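(* If $t\in\mathbb{C}\setminus\{4\cos(\tfrac{j\pi}{l})^2\mid l\in\mathbb{N}_{\ge2},\ j\in\{1,\dots,l-1\}\}$, then $$\phi:\mathbb{N}_0\to\{\text{isomorphism classes of non-zero indecomposable objects in }\underline{\mathrm{Rep}}(S_t^+)\},\quad k\mapsto([k],\mathcal{G}(e_{2k}))$$ is a bijection, where $e_{2k}$ is the Jones--Wenzl idempotent in $\mathrm{End}_{\underline{\mathrm{Rep}}(O_s^+)}([2k])$ for a fixed $s\in\mathbb{C}$ with $s^2=t$, and $\mathcal{G}:\mathrm{End}_{\underline{\mathrm{Rep}}(O_s^+)}([2k])\to\mathrm{End}_{\underline{\mathrm{Rep}}(S_{t}^+)}([k])$ is the (rescaled) fattening map.
   Context: For $k,l\in\mathbb{N}_0$ let $P(k,l)$ be the set of set partitions of $\{1,\dots,k,1',\dots,l'\}$ ($k$ upper points, $l$ lower points). The tensor product $p\otimes q$ is horizontal concatenation; for $p\in P(k,l)$, $q\in P(l,m)$, stack $p$ above $q$, identifying the lower points of $p$ with the upper points of $q$; $q\cdot p\in P(k,m)$ is the induced partition of the outer points by connected components, and $\ell(q,p)$ is the number of connected components containing only middle points. $NC$ denotes the non-crossing partitions (with points ordered $1,\dots,k,l',\dots,1'$ there are no $a<b<c<d$ with $a,c$ in one block and $b,d$ in a different block), $NC_2$ those with all blocks of size two. For $\mathcal{C}\in\{NC,NC_2\}$ and $t\in\mathbb{C}$, $\underline{\mathrm{Rep}}_0(\mathcal{C},t)$ is the $\mathbb{C}$-linear category with objects $[k]$,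 $k\in\mathbb{N}_0$, $\mathrm{Hom}([k],[l])=\mathbb{C}\,\mathcal{C}(k,l)$, and composition extending $qp:=t^{\ell(q,p)}\,q\cdot p$; $\underline{\mathrm{Rep}}(\mathcal{C},t)$ is its Karoubi envelope (idempotent completion of the additive completion). Put $\underline{\mathrm{Rep}}(S_t^+):=\underline{\mathrm{Rep}}(NC,t)$, $\underline{\mathrm{Rep}}(O_s^+):=\underline{\mathrm{Rep}}(NC_2,s)$. For an idempotent $e\in\mathrm{End}([k])$, $([k],e)$ denotes its image. The trace of a partition $p\in\mathcal{C}(k,k)$ in $\underline{\mathrm{Rep}}(\mathcal{C},t)$ is $t^c$, where $c$ is the number of connected components obtained from $p$ by identifying $i$ with $i'$ for all $i$. Jones--Wenzl idempotents: for $s\in\mathbb{C}$ not of the form $2\cos(j\pi/l)$ with $l\in\mathbb{N}_{\ge2}$, $1\le j\le l-1$, define $e_k\in\mathrm{End}_{\underline{\mathrm{Rep}}(O_s^+)}([k])$ by $e_0=\mathrm{id}_0$, $e_1=\mathrm{id}_1$ and, for $k\ge2$, $$e_k=e_{k-1}\otimes\mathrm{id}_1-a_k\,(e_{k-1}\otimes\mathrm{id}_1)\,(\mathrm{id}_{k-2}\otimes u)\,(e_{k-1}\otimes\mathrm{id}_1),$$ where $u=\{\{1,2\},\{1',2'\}\}\in P(2,2)$, $a_1=0$ and $a_k=(s-a_{k-1})^{-1}$. (For $t$ as in the claim and $s^2=t$, $s$ is not of the excluded form, and $s\ne0$.) Fattening: for $p\in NC_2(2k,2k)$ define $\widehat p\in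 NC(k,k)$ as follows. Insert a new upper point $x_i$ between $2i-1$ and $2i$ and a new lower point $y_i$ between $(2i-1)'$ and $(2i)'$ ($1\le i\le k$), and order all points linearly as $1,x_1,2,3,x_2,4,\dots,2k-1,x_k,2k,(2k)',y_k,(2k-1)',\dots,2',y_1,1'$. Two new points are declared equivalent if no block of $p$ contains both an old point lying between them in this order and an old point not lying between them. $\widehat p$ is the partition into equivalence classes, with $x_i$ identified with the upper point $i$ and $y_i$ with the lower point $i'$. The map $\mathcal{G}$ is the linear extension of $p\mapsto\frac{\mathrm{tr}(p)}{\mathrm{tr}_2(\widehat p)}\,\widehat p$, where $\mathrm{tr}$ is the trace in $\underline{\mathrm{Rep}}(O_s^+)$ and $\mathrm{tr}_2$ the trace in $\underline{\mathrm{Rep}}(S_{s^2}^+)=\underline{\mathrm{Rep}}(S_t^+)$. *)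

theory Defs
  imports Complex_Main "HOL-Library.Poly_Mapping" "HOL-Library.Disjoint_Sets"
begin

section \<open>Set partitions of upper and lower points\<close>

text \<open>\<open>Upper i\<close> and \<open>Lower j\<close> stand for \<open>i\<close> and \<open>j'\<close>; indices start at 1.\<close>

datatype point = Upper nat | Lower nat

type_synonym diagram = "point set set"

definition points :: "nat \<Rightarrow> nat \<Rightarrow> point set" where
  "points k l = Upper ` {1..k} \<union> Lower ` {1..l}"

definition Part :: "nat \<Rightarrow> nat \<Rightarrow> diagram set" where
  "Part k l = {p. partition_on (points k l) p}"

text \<open>The order \<open>1, 2, \<dots>, k, l', \<dots>, 2', 1'\<close>; it does not depend on \<open>k\<close> and \<open>l\<close>.\<close>

fun before :: "point \<Rightarrow> point \<Rightarrow> bool" where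
  "before (Upper i) (Upper j) \<longleftrightarrow> i < j"
| "before (Upper i) (Lower j) \<longleftrightarrow> True"
| "before (Lower i) (Upper j) \<longleftrightarrow> False"
| "before (Lower i) (Lower j) \<longleftrightarrow> j < i"

definition noncrossing :: "diagram \<Rightarrow> bool" where
  "noncrossing p \<longleftrightarrow>
     \<not> (\<exists>B\<in>p. \<exists>B'\<in>p. B \<noteq> B' \<and>
          (\<exists>a\<in>B. \<exists>b\<in>B'. \<exists>c\<in>B. \<exists>d\<in>B'. before a b \<and> before b c \<and> before c d))"

definition NC :: "nat \<Rightarrow> nat \<Rightarrow> diagram set" where
  "NC k l = {p \<in> Part k l. noncrossing p}"

definition NC2 :: "nat \<Rightarrow> nat \<Rightarrow> diagram set" where
  "NC2 k l = {p \<in> NC k l. \<forall>B\<in>p. card B = 2}"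


section \<open>Operations on partitions\<close>

text \<open>The connected components of a hypergraph given by its edges, every vertex being
  assumed to lie on some edge.\<close>

definition components :: "'a set set \<Rightarrow> 'a set set" where
  "components H = \<Union>H // (\<Union>B\<in>H. B \<times> B)\<^sup>*"

text \<open>The first two arguments are the numbers of upper and lower points of \<open>p\<close>.\<close>

definition tensor :: "nat \<Rightarrow> nat \<Rightarrow> diagram \<Rightarrow> diagram \<Rightarrow> diagram" where
  "tensor k l p q =
     p \<union> (`) (case_point (\<lambda>i. Upper (k + i)) (\<lambda>j. Lower (l + j))) ` q"

datatype row_point = Top nat | Mid nat | Bot nat

text \<open>Stacking \<open>p\<close> above \<open>q\<close>; as in function composition, the diagram applied first is the
  second argument.\<close>

definition stack :: "diagram \<Rightarrow> diagram \<Rightarrow> row_point set set" where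
  "stack q p = components ((`) (case_point Top Mid) ` p \<union> (`) (case_point Mid Bot) ` q)"

definition composite :: "diagram \<Rightarrow> diagram \<Rightarrow> diagram" where
  "composite q p = (\<lambda>C. case_point Top Bot -` C) ` stack q p - {{}}"

definition loops :: "diagram \<Rightarrow> diagram \<Rightarrow> nat" where
  "loops q p = card {C \<in> stack q p. C \<subseteq> range Mid}"

definition id_diagram :: "nat \<Rightarrow> diagram" where
  "id_diagram k = (\<lambda>i. {Upper i, Lower i}) ` {1..k}"

definition cup_cap :: diagram where
  "cup_cap = {{Upper 1, Upper 2}, {Lower 1, Lower 2}}"

definition trace :: "complex \<Rightarrow> diagram \<Rightarrow> complex" where
  "trace t p = t ^ card (components ((`) (case_point id id) ` p))"


section \<open>The linear category\<close>

type_synonym lin = "diagram \<Rightarrow>\<^sub>0 complex"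

definition smult :: "complex \<Rightarrow> lin \<Rightarrow> lin" where
  "smult c f = Poly_Mapping.map ((*) c) f"

definition basis :: "diagram \<Rightarrow> lin" where
  "basis p = Poly_Mapping.single p 1"

definition lin_extend :: "(diagram \<Rightarrow> lin) \<Rightarrow> lin \<Rightarrow> lin" where
  "lin_extend \<phi> f = (\<Sum>p\<in>Poly_Mapping.keys f. smult (Poly_Mapping.lookup f p) (\<phi> p))"

definition bilin_extend :: "(diagram \<Rightarrow> diagram \<Rightarrow> lin) \<Rightarrow> lin \<Rightarrow> lin \<Rightarrow> lin" where
  "bilin_extend \<beta> f g = lin_extend (\<lambda>p. lin_extend (\<beta> p) g) f"

definition Hom0 :: "(nat \<Rightarrow> nat \<Rightarrow> diagram set) \<Rightarrow> nat \<Rightarrow> nat \<Rightarrow> lin set" where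
  "Hom0 C k l = {f. Poly_Mapping.keys f \<subseteq> C k l}"

definition comp0 :: "complex \<Rightarrow> lin \<Rightarrow> lin \<Rightarrow> lin" where
  "comp0 t = bilin_extend (\<lambda>q p. smult (t ^ loops q p) (basis (composite q p)))"

definition tensor0 :: "nat \<Rightarrow> nat \<Rightarrow> lin \<Rightarrow> lin \<Rightarrow> lin" where
  "tensor0 k l = bilin_extend (\<lambda>p q. basis (tensor k l p q))"

definition id0 :: "nat \<Rightarrow> lin" where
  "id0 k = basis (id_diagram k)"


section \<open>The Karoubi envelope\<close>

text \<open>An object of the additive completion is a formal direct sum \<open>[k\<^sub>0] \<oplus> \<dots> \<oplus> [k\<^sub>n\<^sub>-\<^sub>1]\<close>, given as
  a list. A morphism from \<open>ks\<close> to \<open>ls\<close> is a matrix whose entry \<open>M j i\<close> is a morphism from \<open>ks ! i\<close>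
  to \<open>ls ! j\<close>; entries outside the index range are 0, so that equality of morphisms is equality
  of functions.\<close>

type_synonym mat = "nat \<Rightarrow> nat \<Rightarrow> lin"

definition mat_Hom :: "(nat \<Rightarrow> nat \<Rightarrow> diagram set) \<Rightarrow> nat list \<Rightarrow> nat list \<Rightarrow> mat set" where
  "mat_Hom C ks ls =
     {M. \<forall>j i. if j < length ls \<and> i < length ks then M j i \<in> Hom0 C (ks ! i) (ls ! j)
               else M j i = 0}"

text \<open>The second argument is the intermediate object.\<close>

definition mat_comp :: "complex \<Rightarrow> nat list \<Rightarrow> mat \<Rightarrow> mat \<Rightarrow> mat" where
  "mat_comp t ls N M = (\<lambda>a c. \<Sum>b<length ls. comp0 t (N a b) (M b c))"

definition mat_zero :: mat where
  "mat_zero = (\<lambda>_ _. 0)"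

definition mat_add :: "mat \<Rightarrow> mat \<Rightarrow> mat" where
  "mat_add M N = (\<lambda>a b. M a b + N a b)"

type_synonym obj = "nat list \<times> mat"

definition Obj :: "(nat \<Rightarrow> nat \<Rightarrow> diagram set) \<Rightarrow> complex \<Rightarrow> obj set" where
  "Obj C t = {(ks, E). E \<in> mat_Hom C ks ks \<and> mat_comp t ks E E = E}"

definition Hom :: "(nat \<Rightarrow> nat \<Rightarrow> diagram set) \<Rightarrow> complex \<Rightarrow> obj \<Rightarrow> obj \<Rightarrow> mat set" where
  "Hom C t X Y =
     (\<lambda>M. mat_comp t (fst Y) (snd Y) (mat_comp t (fst X) M (snd X))) ` mat_Hom C (fst X) (fst Y)"

text \<open>Composition of \<open>f : X \<rightarrow> Y\<close> and \<open>g : Y \<rightarrow> Z\<close>, the object argument being \<open>Y\<close>. The identity of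
  \<open>(ks, E)\<close> is \<open>E\<close>.\<close>

definition comp_mor :: "complex \<Rightarrow> obj \<Rightarrow> mat \<Rightarrow> mat \<Rightarrow> mat" where
  "comp_mor t Y g f = mat_comp t (fst Y) g f"

definition ident :: "obj \<Rightarrow> mat" where
  "ident X = snd X"

definition iso_rel :: "(nat \<Rightarrow> nat \<Rightarrow> diagram set) \<Rightarrow> complex \<Rightarrow> obj rel" where
  "iso_rel C t =
     {(X, Y). X \<in> Obj C t \<and> Y \<in> Obj C t \<and>
        (\<exists>f\<in>Hom C t X Y. \<exists>g\<in>Hom C t Y X. comp_mor t Y g f = ident X \<and> comp_mor t X f g = ident Y)}"

definition zero_object :: "(nat \<Rightarrow> nat \<Rightarrow> diagram set) \<Rightarrow> complex \<Rightarrow> obj \<Rightarrow> bool" where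
  "zero_object C t X \<longleftrightarrow>
     X \<in> Obj C t \<and> (\<forall>Y\<in>Obj C t. Hom C t X Y = {mat_zero} \<and> Hom C t Y X = {mat_zero})"

text \<open>\<open>X\<close> is a direct sum (biproduct) of \<open>Y\<close> and \<open>Z\<close>.\<close>

definition direct_sum :: "(nat \<Rightarrow> nat \<Rightarrow> diagram set) \<Rightarrow> complex \<Rightarrow> obj \<Rightarrow> obj \<Rightarrow> obj \<Rightarrow> bool" where
  "direct_sum C t X Y Z \<longleftrightarrow>
     X \<in> Obj C t \<and> Y \<in> Obj C t \<and> Z \<in> Obj C t \<and>
     (\<exists>i\<in>Hom C t Y X. \<exists>j\<in>Hom C t Z X. \<exists>p\<in>Hom C t X Y. \<exists>q\<in>Hom C t X Z.
        comp_mor t X p i = ident Y \<and> comp_mor t X q j = ident Z \<and>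
        comp_mor t X p j = mat_zero \<and> comp_mor t X q i = mat_zero \<and>
        mat_add (comp_mor t Y i p) (comp_mor t Z j q) = ident X)"

definition indecomposable :: "(nat \<Rightarrow> nat \<Rightarrow> diagram set) \<Rightarrow> complex \<Rightarrow> obj \<Rightarrow> bool" where
  "indecomposable C t X \<longleftrightarrow>
     X \<in> Obj C t \<and>
     (\<forall>Y Z. direct_sum C t X Y Z \<longrightarrow> zero_object C t Y \<or> zero_object C t Z)"

definition iso_class :: "(nat \<Rightarrow> nat \<Rightarrow> diagram set) \<Rightarrow> complex \<Rightarrow> obj \<Rightarrow> obj set" where
  "iso_class C t X = iso_rel C t `` {X}"

definition indec_classes :: "(nat \<Rightarrow> nat \<Rightarrow> diagram set) \<Rightarrow> complex \<Rightarrow> obj set set" where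
  "indec_classes C t =
     iso_class C t ` {X \<in> Obj C t. \<not> zero_object C t X \<and> indecomposable C t X}"

definition image_obj :: "nat \<Rightarrow> lin \<Rightarrow> obj" where
  "image_obj k e = ([k], \<lambda>j i. if j = 0 \<and> i = 0 then e else 0)"


section \<open>Jones--Wenzl idempotents and fattening\<close>

text \<open>\<open>jones_wenzl s k\<close> is an endomorphism of \<open>[k]\<close> in the category of \<open>NC2\<close> with parameter \<open>s\<close>, that
  is, an element of \<open>Hom0 NC2 k k\<close>. The value \<open>jw_coeff s 0\<close> is never used. The denominators do not vanish when \<open>s\<close> is not of the form
  \<open>2 cos (j\<pi>/l)\<close>.\<close>

fun jw_coeff :: "complex \<Rightarrow> nat \<Rightarrow> complex" where
  "jw_coeff s 0 = 0"
| "jw_coeff s (Suc 0) = 0"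
| "jw_coeff s (Suc (Suc k)) = inverse (s - jw_coeff s (Suc k))"

fun jones_wenzl :: "complex \<Rightarrow> nat \<Rightarrow> lin" where
  "jones_wenzl s 0 = id0 0"
| "jones_wenzl s (Suc 0) = id0 1"
| "jones_wenzl s (Suc (Suc k)) =
     (let f = tensor0 (k + 1) (k + 1) (jones_wenzl s (Suc k)) (id0 1)
      in f - smult (jw_coeff s (k + 2))
               (comp0 s f (comp0 s (tensor0 k k (id0 k) (basis cup_cap)) f)))"

text \<open>For fattening, the old points are placed at the even positions of their row and the new
  points at odd ones: \<open>x\<^sub>i\<close>, at position \<open>4i - 1\<close>, is between the old points \<open>2i - 1\<close> and \<open>2i\<close>, at
  positions \<open>4i - 2\<close> and \<open>4i\<close>. Similarly for \<open>y\<^sub>i\<close> in the lower row.\<close>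

definition old_point :: "point \<Rightarrow> point" where
  "old_point = case_point (\<lambda>i. Upper (2 * i)) (\<lambda>i. Lower (2 * i))"

definition new_point :: "point \<Rightarrow> point" where
  "new_point = case_point (\<lambda>i. Upper (4 * i - 1)) (\<lambda>i. Lower (4 * i - 1))"

definition between :: "point \<Rightarrow> point \<Rightarrow> point \<Rightarrow> bool" where
  "between x y z \<longleftrightarrow> (before x z \<and> before z y) \<or> (before y z \<and> before z x)"

definition fatten_rel :: "nat \<Rightarrow> diagram \<Rightarrow> point rel" where
  "fatten_rel k p =
     {(x, y). x \<in> points k k \<and> y \<in> points k k \<and>
        \<not> (\<exists>B\<in>p. (\<exists>u\<in>B. between (new_point x) (new_point y) (old_point u)) \<and>
                  (\<exists>v\<in>B. \<not> between (new_point x) (new_point y) (old_point v)))}"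

definition fatten :: "nat \<Rightarrow> diagram \<Rightarrow> diagram" where
  "fatten k p = points k k // fatten_rel k p"

definition fattening_map :: "complex \<Rightarrow> nat \<Rightarrow> lin \<Rightarrow> lin" where
  "fattening_map s k =
     lin_extend (\<lambda>p. smult (trace s p / trace (s\<^sup>2) (fatten k p)) (basis (fatten k p)))"

end

(* The fattening map turns composition with the Temperley-Lieb generators into composition with the
   diagrams that cut off a point (odd generators) or merge two neighbouring points (even ones), up to
   the factor s^(+-1); the factors match because, by Euler's formula for the regions cut out by the
   closure of a pair partition d of 2k + 2k points,
     loops of d + blocks of the fattening = k + 2 * loops of the closed fattening.
   A non-crossing partition with at most k upper and exactly k lower points, other than the identity,
   has a lower singleton or two neighbouring lower points in one block, so it absorbs such a diagram.
   Hence E_k := G(e_2k) is annihilated by everything except multiples of the identity, whose coefficient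
   in E_k is 1. So the E_k are idempotents with End = C and no morphisms between different ones, and
   by induction on k the identity of [k] is a sum of morphisms factoring through the E_j, j <= k.
   A non-zero indecomposable object therefore has a non-zero pairing with some E_j and splits it off.

   The Jones-Wenzl coefficients are quotients of Chebyshev polynomials in s, whose zeros are exactly
   the excluded parameters. *)

theory Submission
  imports Defs
begin

text \<open>Planarity is handled mod 2. Non-crossing is used in the form that two points of one
  block lie on the same side of the chord joining two points of another block
  (\<open>nc_sep\<close>). Such indicators can be added along a path, and this gives non-crossing
  composites and non-crossing reconnected pairings. In the same spirit a point of the fattening is
  described by the set of strands that pass over it (\<open>kap\<close>). Every new point has an odd
  number of old points after it, hence an odd number of strands over it, as in a checkerboard
  colouring of the regions; this parity settles the last strand once all others are known.

  Composing with a Temperley-Lieb generator reconnects the partners of two neighbouring points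
  (\<open>rejoin\<close>). The same move drives Euler's formula: reconnecting in the last column
  keeps the balance of the counts until that column is a separate loop, which is then removed. The
  exponents +1 and -1 of \<open>s\<close> record that a merge costs a block of the fattening while
  an isolation creates one.\<close>

section \<open>Connected components of hypergraphs\<close>

definition conn :: "'a set set \<Rightarrow> 'a rel" where
  "conn H = (\<Union>B\<in>H. B \<times> B)\<^sup>*"

lemma conn_refl [simp]: "(x, x) \<in> conn H"
  by (simp add: conn_def)

lemma conn_block: "B \<in> H \<Longrightarrow> x \<in> B \<Longrightarrow> y \<in> B \<Longrightarrow> (x, y) \<in> conn H"
  unfolding conn_def by (rule r_into_rtrancl) auto

lemma conn_trans: "(x, y) \<in> conn H \<Longrightarrow> (y, z) \<in> conn H \<Longrightarrow> (x, z) \<in> conn H"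
  unfolding conn_def by (rule rtrancl_trans)

lemma conn_sym: "(x, y) \<in> conn H \<Longrightarrow> (y, x) \<in> conn H"
proof -
  have "sym (\<Union>B\<in>H. B \<times> B)" by (auto simp: sym_def)
  then have "sym ((\<Union>B\<in>H. B \<times> B)\<^sup>*)" by (rule sym_rtrancl)
  then show "(x, y) \<in> conn H \<Longrightarrow> (y, x) \<in> conn H" unfolding conn_def by (rule symD)
qed

lemma conn_induct [consumes 1, case_names refl step]:
  assumes "(x, y) \<in> conn H" "P x"
    and "\<And>y z B. (x, y) \<in> conn H \<Longrightarrow> P y \<Longrightarrow> B \<in> H \<Longrightarrow> y \<in> B \<Longrightarrow> z \<in> B \<Longrightarrow> P z"
  shows "P y"
  using assms(1) unfolding conn_def
  by (induction rule: rtrancl_induct) (use assms(2,3) in \<open>auto simp: conn_def\<close>)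

text \<open>Invariance argument: labels that every hyperedge keeps constant are used to show that
  two vertices are not connected.\<close>

lemma conn_label:
  assumes "(x, y) \<in> conn H" "\<And>B u v. B \<in> H \<Longrightarrow> u \<in> B \<Longrightarrow> v \<in> B \<Longrightarrow> f u = f v"
  shows "f x = f y"
  using assms(1) by (induction rule: conn_induct) (use assms(2) in \<open>metis+\<close>)

lemma conn_sub:
  assumes "(x, y) \<in> conn H" "\<And>B u v. B \<in> H \<Longrightarrow> u \<in> B \<Longrightarrow> v \<in> B \<Longrightarrow> (u, v) \<in> conn H'"
  shows "(x, y) \<in> conn H'"
  using assms(1) by (induction rule: conn_induct) (use assms(2) in \<open>auto intro: conn_trans[OF _ assms(2)]\<close>)

lemma conn_mono: "(x, y) \<in> conn H \<Longrightarrow> H \<subseteq> H' \<Longrightarrow> (x, y) \<in> conn H'"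
  by (erule conn_sub) (auto intro: conn_block)

lemma conn_image: "(x, y) \<in> conn H \<Longrightarrow> (g x, g y) \<in> conn ((`) g ` H)"
  by (induction rule: conn_induct) (auto intro: conn_trans[OF _ conn_block])

lemma conn_Union: "(x, y) \<in> conn H \<Longrightarrow> x = y \<or> x \<in> \<Union>H \<and> y \<in> \<Union>H"
  by (induction rule: conn_induct) auto

lemma conn_image_inj:
  assumes "inj g" shows "(g x, g y) \<in> conn ((`) g ` H) \<longleftrightarrow> (x, y) \<in> conn H"
proof
  have "(x, inv g y') \<in> conn H" if "(g x, y') \<in> conn ((`) g ` H)" for y'
    using that by (induction rule: conn_induct) (use assms in \<open>auto intro: conn_trans[OF _ conn_block]\<close>)
  from this[of "g y"] show "(g x, g y) \<in> conn ((`) g ` H) \<Longrightarrow> (x, y) \<in> conn H" using assms by simp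
qed (rule conn_image)

text \<open>The partition of \<open>A\<close> into the fibres of \<open>f\<close>. The explicit
  diagrams below are given in this form, so that an equality of diagrams becomes a comparison of
  labellings (\<open>kerp_cong\<close>) and counting blocks becomes counting labels
  (\<open>card_kerp\<close>).\<close>

definition kerp :: "'a set \<Rightarrow> ('a \<Rightarrow> 'b) \<Rightarrow> 'a set set" where
  "kerp A f = (\<lambda>x. {y\<in>A. f y = f x}) ` A"

lemma partition_on_kerp: "partition_on A (kerp A f)"
  unfolding partition_on_def disjoint_def kerp_def by auto

lemma kerp_cong:
  assumes "\<And>x y. x \<in> A \<Longrightarrow> y \<in> A \<Longrightarrow> f x = f y \<longleftrightarrow> g x = g y"
  shows "kerp A f = kerp A g"
  unfolding kerp_def by (rule image_cong) (use assms in auto)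

lemma card_kerp: "card (kerp A f) = card (f ` A)"
proof -
  have "kerp A f = (\<lambda>c. {y\<in>A. f y = c}) ` f ` A" by (simp add: kerp_def image_image)
  moreover have "inj_on (\<lambda>c. {y\<in>A. f y = c}) (f ` A)" by (rule inj_onI) blast
  ultimately show ?thesis by (simp add: card_image)
qed

lemma conn_class_eq: "conn H `` {x} = conn H `` {y} \<longleftrightarrow> (x, y) \<in> conn H"
proof
  assume "conn H `` {x} = conn H `` {y}"
  then have "y \<in> conn H `` {x}" by auto
  then show "(x, y) \<in> conn H" by auto
next
  assume xy: "(x, y) \<in> conn H"
  show "conn H `` {x} = conn H `` {y}"
    using conn_trans[OF xy] conn_trans[OF conn_sym[OF xy]] by auto
qed

lemma components_alt: "components H = (\<lambda>x. conn H `` {x}) ` \<Union>H"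
  unfolding components_def quotient_def conn_def by auto

lemma components_kerp: "components H = kerp (\<Union>H) (\<lambda>x. conn H `` {x})"
proof -
  have "conn H `` {x} = {y\<in>\<Union>H. conn H `` {y} = conn H `` {x}}" if "x \<in> \<Union>H" for x
    unfolding conn_class_eq using that conn_Union[of x _ H] conn_sym[of x _ H] conn_sym[of _ x H] by auto
  then show ?thesis
    unfolding components_alt kerp_def by auto
qed

text \<open>A labelling that is constant on hyperedges and separates components determines the
  components. This turns the computation of a composite into the search for a label
  function.\<close>

lemma components_eq_kerp:
  assumes "\<And>B u v. B \<in> H \<Longrightarrow> u \<in> B \<Longrightarrow> v \<in> B \<Longrightarrow> f u = f v"
    and "\<And>u v. u \<in> \<Union>H \<Longrightarrow> v \<in> \<Union>H \<Longrightarrow> f u = f v \<Longrightarrow> (u, v) \<in> conn H"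
  shows "components H = kerp (\<Union>H) f"
  unfolding components_kerp
proof (rule kerp_cong)
  fix x y assume xy: "x \<in> \<Union>H" "y \<in> \<Union>H"
  have "(x, y) \<in> conn H \<Longrightarrow> f x = f y" by (erule conn_label) (rule assms(1))
  then show "conn H `` {x} = conn H `` {y} \<longleftrightarrow> f x = f y"
    unfolding conn_class_eq using assms(2)[of x y] xy by blast
qed

lemma components_image_inj:
  assumes "inj g" shows "components ((`) g ` H) = (`) g ` components H"
proof -
  have *: "conn ((`) g ` H) `` {g x} = g ` (conn H `` {x})" if "x \<in> \<Union>H" for x
  proof (intro set_eqI iffI)
    fix z assume "z \<in> conn ((`) g ` H) `` {g x}"
    then have z: "(g x, z) \<in> conn ((`) g ` H)" by simp
    then obtain y where "z = g y" using conn_Union[OF z] by auto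
    then show "z \<in> g ` (conn H `` {x})" using z conn_image_inj[OF assms] by auto
  qed (use conn_image in fastforce)
  have U: "\<Union>((`) g ` H) = g ` \<Union>H" by auto
  show ?thesis unfolding components_alt U image_image using * by (intro image_cong) auto
qed

text \<open>Contracting the hyperedges \<open>H1\<close> to \<open>H1'\<close>, where the vertices in \<open>W\<close> disappear.\<close>

context
  fixes H1 H2 H1' :: "'a set set" and W :: "'a set"
  assumes W: "W \<inter> \<Union>H2 = {}" and W': "\<Union>H1' = \<Union>H1 - W"
    and sub: "\<And>x y. x \<notin> W \<Longrightarrow> y \<notin> W \<Longrightarrow> (x, y) \<in> conn H1' \<longleftrightarrow> (x, y) \<in> conn H1"
begin

lemma conn_contract:
  assumes "x \<notin> W" "y \<notin> W"
  shows "(x, y) \<in> conn (H1' \<union> H2) \<longleftrightarrow> (x, y) \<in> conn (H1 \<union> H2)"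
proof
  assume "(x, y) \<in> conn (H1' \<union> H2)"
  then show "(x, y) \<in> conn (H1 \<union> H2)"
  proof (rule conn_sub)
    fix B u v assume B: "B \<in> H1' \<union> H2" "u \<in> B" "v \<in> B"
    show "(u, v) \<in> conn (H1 \<union> H2)"
    proof (cases "B \<in> H2")
      case False
      then have "(u, v) \<in> conn H1" using B W' sub[of u v] conn_block[of B H1'] by blast
      then show ?thesis by (rule conn_mono) auto
    qed (use B in \<open>auto intro: conn_block\<close>)
  qed
next
  assume "(x, y) \<in> conn (H1 \<union> H2)"
  \<comment> \<open>Invariant along a path from \<open>x\<close>: \<open>w\<close> is the last
    vertex outside \<open>W\<close>, reached already in the contracted hypergraph. The rest of the
    path uses \<open>H1\<close> only, because \<open>W\<close> meets no edge of
    \<open>H2\<close>.\<close>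
  then have "\<exists>w. w \<notin> W \<and> (x, w) \<in> conn (H1' \<union> H2) \<and> (w, y) \<in> conn H1 \<and> (y \<notin> W \<longrightarrow> w = y)"
  proof (induction rule: conn_induct)
    case refl
    then show ?case using assms by auto
  next
    case (step y z B)
    then obtain w where w: "w \<notin> W" "(x, w) \<in> conn (H1' \<union> H2)" "(w, y) \<in> conn H1" "y \<notin> W \<longrightarrow> w = y" by auto
    show ?case
    proof (cases "B \<in> H2")
      case True
      then have "y \<notin> W" "z \<notin> W" using W step by auto
      moreover have "(y, z) \<in> conn (H1' \<union> H2)" using True step by (auto intro: conn_block)
      ultimately show ?thesis using w by (auto intro!: exI[of _ z] intro: conn_trans)
    next
      case False
      then have "(w, z) \<in> conn H1" using w step by (meson UnE conn_block conn_trans)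
      moreover have "(w, z) \<in> conn (H1' \<union> H2)" if "z \<notin> W"
        by (rule conn_mono[of _ _ H1']) (use sub that w \<open>(w, z) \<in> conn H1\<close> in auto)
      ultimately show ?thesis using w by (cases "z \<in> W") (auto intro: conn_trans)
    qed
  qed
  then show "(x, y) \<in> conn (H1' \<union> H2)" using assms by auto
qed

text \<open>Vertices of \<open>W\<close> lie on no edge of \<open>H2\<close>, so a component
  contained in \<open>W\<close> is built from \<open>H1\<close> alone.\<close>

lemma components_contract_inside:
  "{K \<in> components (H1 \<union> H2). K \<subseteq> W} = {K \<in> components H1. K \<subseteq> W}"
proof -
  have *: "conn (H1 \<union> H2) `` {x} = conn H1 `` {x}" if x: "conn H1 `` {x} \<subseteq> W" for x
  proof -
    have "(x, y) \<in> conn H1" if "(x, y) \<in> conn (H1 \<union> H2)" for y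
      using that
    proof (induction rule: conn_induct)
      case (step y z B)
      then have "y \<in> W" using x by auto
      then have "B \<in> H1" using step W by auto
      then show ?case using step by (meson conn_block conn_trans)
    qed simp
    then show ?thesis using conn_mono[of x _ H1 "H1 \<union> H2"] by auto
  qed
  have **: "conn H1 `` {x} \<subseteq> conn (H1 \<union> H2) `` {x}" for x using conn_mono[of x _ H1 "H1 \<union> H2"] by auto
  show ?thesis
  proof (intro set_eqI iffI)
    fix K assume "K \<in> {K \<in> components (H1 \<union> H2). K \<subseteq> W}"
    then obtain x where x: "x \<in> \<Union>(H1 \<union> H2)" "K = conn (H1 \<union> H2) `` {x}" "K \<subseteq> W"
      by (auto simp: components_alt)
    then have "conn H1 `` {x} \<subseteq> W" using ** by blast
    moreover have "x \<in> W" using x by auto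
    ultimately show "K \<in> {K \<in> components H1. K \<subseteq> W}" using x * W by (auto simp: components_alt)
  next
    fix K assume "K \<in> {K \<in> components H1. K \<subseteq> W}"
    then obtain x where "x \<in> \<Union>H1" "K = conn H1 `` {x}" "K \<subseteq> W" by (auto simp: components_alt)
    then show "K \<in> {K \<in> components (H1 \<union> H2). K \<subseteq> W}" using * by (auto simp: components_alt)
  qed
qed

text \<open>Deleting the vertices of \<open>W\<close> is a bijection from the components not
  contained in \<open>W\<close> onto the components after contraction. The bound \<open>Z\<close>
  lets them be counted inside prescribed rows.\<close>

lemma components_contract_outside:
  assumes "W \<subseteq> Z"
  shows "card {K \<in> components (H1' \<union> H2). K \<subseteq> Z} = card {K \<in> components (H1 \<union> H2). K \<subseteq> Z \<and> \<not> K \<subseteq> W}"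
proof (rule bij_betw_same_card[symmetric], rule bij_betw_imageI)
  have V: "\<Union>(H1' \<union> H2) = \<Union>(H1 \<union> H2) - W" using W W' by auto
  have c: "conn (H1 \<union> H2) `` {x} - W = conn (H1' \<union> H2) `` {x}" if "x \<in> \<Union>(H1 \<union> H2) - W" for x
  proof -
    have "y \<notin> W" if "(x, y) \<in> conn (H1' \<union> H2)" for y
      using conn_Union[OF that] V \<open>x \<in> _\<close> by auto
    then show ?thesis using conn_contract[of x] that by auto
  qed
  have rep: "\<exists>x \<in> \<Union>(H1 \<union> H2) - W. K = conn (H1 \<union> H2) `` {x}"
    if K: "K \<in> components (H1 \<union> H2)" "\<not> K \<subseteq> W" for K
  proof -
    obtain x where x: "x \<in> \<Union>(H1 \<union> H2)" "K = conn (H1 \<union> H2) `` {x}"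
      using K(1) unfolding components_alt by (rule imageE) simp
    obtain y where y: "y \<in> K" "y \<notin> W" using K by auto
    then have "(x, y) \<in> conn (H1 \<union> H2)" using x by auto
    then have "K = conn (H1 \<union> H2) `` {y}" "y \<in> \<Union>(H1 \<union> H2)"
      using x conn_class_eq[of "H1 \<union> H2" x y] conn_Union[of x y "H1 \<union> H2"] by (auto simp del: Union_iff)
    then show ?thesis using y by auto
  qed
  show "inj_on (\<lambda>K. K - W) {K \<in> components (H1 \<union> H2). K \<subseteq> Z \<and> \<not> K \<subseteq> W}"
  proof (rule inj_onI)
    fix K L assume K: "K \<in> {K \<in> components (H1 \<union> H2). K \<subseteq> Z \<and> \<not> K \<subseteq> W}"
      and L: "L \<in> {K \<in> components (H1 \<union> H2). K \<subseteq> Z \<and> \<not> K \<subseteq> W}" and eq: "K - W = L - W"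
    have "\<exists>x \<in> \<Union>(H1 \<union> H2) - W. K = conn (H1 \<union> H2) `` {x}" using K by (intro rep) simp_all
    then obtain x where x: "x \<in> \<Union>(H1 \<union> H2) - W" "K = conn (H1 \<union> H2) `` {x}" by (rule bexE)
    have "\<exists>y \<in> \<Union>(H1 \<union> H2) - W. L = conn (H1 \<union> H2) `` {y}" using L by (intro rep) simp_all
    then obtain y where y: "y \<in> \<Union>(H1 \<union> H2) - W" "L = conn (H1 \<union> H2) `` {y}" by (rule bexE)
    from x have "x \<in> K - W" by simp
    then have "x \<in> L" using eq by simp
    then have "(y, x) \<in> conn (H1 \<union> H2)" using y by simp
    then show "K = L" using x y conn_class_eq[of "H1 \<union> H2" y x] by simp
  qed
  show "(\<lambda>K. K - W) ` {K \<in> components (H1 \<union> H2). K \<subseteq> Z \<and> \<not> K \<subseteq> W} = {K \<in> components (H1' \<union> H2). K \<subseteq> Z}"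
  proof (intro set_eqI iffI)
    fix L assume "L \<in> (\<lambda>K. K - W) ` {K \<in> components (H1 \<union> H2). K \<subseteq> Z \<and> \<not> K \<subseteq> W}"
    then obtain K where K: "L = K - W" "K \<in> components (H1 \<union> H2)" "K \<subseteq> Z" "\<not> K \<subseteq> W" by auto
    have "\<exists>x \<in> \<Union>(H1 \<union> H2) - W. K = conn (H1 \<union> H2) `` {x}" using K by (intro rep) simp_all
    then obtain x where x: "x \<in> \<Union>(H1 \<union> H2) - W" "K = conn (H1 \<union> H2) `` {x}" by (rule bexE)
    then have "L = conn (H1' \<union> H2) `` {x}" using c K by simp
    moreover have "L \<subseteq> Z" using K by auto
    ultimately show "L \<in> {K \<in> components (H1' \<union> H2). K \<subseteq> Z}"
      using x(1) unfolding components_alt V by (simp del: Union_iff)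
  next
    fix L assume "L \<in> {K \<in> components (H1' \<union> H2). K \<subseteq> Z}"
    then obtain x where x: "x \<in> \<Union>(H1 \<union> H2) - W" "L = conn (H1' \<union> H2) `` {x}" "L \<subseteq> Z"
      unfolding components_alt V by (auto simp del: Union_iff)
    let ?K = "conn (H1 \<union> H2) `` {x}"
    have "?K \<in> components (H1 \<union> H2)" using x by (auto simp: components_alt)
    moreover have "?K - W = L" using x c by auto
    moreover have "x \<in> ?K" "x \<notin> W" using x by auto
    ultimately show "L \<in> (\<lambda>K. K - W) ` {K \<in> components (H1 \<union> H2). K \<subseteq> Z \<and> \<not> K \<subseteq> W}"
      using x assms by (intro image_eqI[of _ _ ?K]) (simp, blast)
  qed
qed

end

lemma finite_components: "finite (\<Union>H) \<Longrightarrow> finite (components H)"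
  by (simp add: components_alt)

text \<open>\<open>H'\<close> generates the same connectivity as \<open>H\<close> with the extra
  edge \<open>{x, y}\<close>, and an edge between two different components lowers their number by
  one. The two are compared up to connectivity because reconnecting strands replaces edges instead
  of adding one.\<close>

lemma card_components_join:
  assumes fin: "finite (\<Union>H)" and xy: "x \<in> \<Union>H" "y \<in> \<Union>H" "(x, y) \<notin> conn H"
    and U: "\<Union>H' = \<Union>H"
    and sub: "\<And>B u v. B \<in> H \<Longrightarrow> u \<in> B \<Longrightarrow> v \<in> B \<Longrightarrow> (u, v) \<in> conn H'"
    and e: "(x, y) \<in> conn H'"
    and sup: "\<And>B u v. B \<in> H' \<Longrightarrow> u \<in> B \<Longrightarrow> v \<in> B \<Longrightarrow> (u, v) \<in> conn (insert {x, y} H)"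
  shows "card (components H) = Suc (card (components H'))"
proof -
  \<comment> \<open>\<open>?h\<close> renames the class of \<open>y\<close> to the class of
    \<open>x\<close>, so \<open>?h (?f v)\<close> labels the joined components.\<close>
  let ?f = "\<lambda>v. conn H `` {v}" and ?h = "\<lambda>C. if C = conn H `` {y} then conn H `` {x} else C"
  have Hs: "conn H \<subseteq> conn H'" using conn_sub[of _ _ H H'] sub by auto
  have eq: "conn H' = conn (insert {x, y} H)"
  proof (intro subset_antisym subrelI)
    fix u v assume "(u, v) \<in> conn (insert {x, y} H)"
    then show "(u, v) \<in> conn H'"
      by (rule conn_sub) (use sub e conn_sym in auto)
  qed (erule conn_sub, use sup in blast)
  have "components H' = kerp (\<Union>H') (\<lambda>v. ?h (?f v))"
  proof (rule components_eq_kerp)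
    fix B u v assume "B \<in> H'" "u \<in> B" "v \<in> B"
    then have "(u, v) \<in> conn (insert {x, y} H)" using sup by auto
    then show "?h (?f u) = ?h (?f v)"
    proof (rule conn_label)
      fix B u v assume B: "B \<in> insert {x, y} H" "u \<in> B" "v \<in> B"
      show "?h (?f u) = ?h (?f v)"
      proof (cases "B = {x, y}")
        case False
        then have "?f u = ?f v" using B by (simp add: conn_class_eq conn_block)
        then show ?thesis by simp
      qed (use B in auto)
    qed
  next
    fix u v assume "?h (?f u) = ?h (?f v)"
    then have "(u, v) \<in> conn H \<or> (u, y) \<in> conn H \<and> (x, v) \<in> conn H \<or> (u, x) \<in> conn H \<and> (y, v) \<in> conn H"
      unfolding conn_class_eq
      by (cases "(u, y) \<in> conn H"; cases "(v, y) \<in> conn H")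
        (auto simp: conn_class_eq intro: conn_sym conn_trans[OF _ conn_sym[of v y H]])
    then show "(u, v) \<in> conn H'" using Hs e by (meson conn_sym conn_trans subsetD)
  qed
  then have "card (components H') = card (?h ` ?f ` \<Union>H)" by (simp only: card_kerp image_image U)
  also have "?h ` ?f ` \<Union>H = ?f ` \<Union>H - {?f y}"
    using xy by (auto simp: conn_class_eq)
  also have "card \<dots> = card (?f ` \<Union>H) - 1" using xy fin by (subst card_Diff_singleton) auto
  finally have "card (components H') = card (?f ` \<Union>H) - 1" .
  moreover have "card (?f ` \<Union>H) > 0" using xy fin by (auto simp: card_gt_0_iff)
  ultimately show ?thesis unfolding components_alt by simp
qed

lemma components_cong:
  assumes "\<Union>H' = \<Union>H"
    and "\<And>B u v. B \<in> H \<Longrightarrow> u \<in> B \<Longrightarrow> v \<in> B \<Longrightarrow> (u, v) \<in> conn H'"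
    and "\<And>B u v. B \<in> H' \<Longrightarrow> u \<in> B \<Longrightarrow> v \<in> B \<Longrightarrow> (u, v) \<in> conn H"
  shows "components H' = components H"
proof -
  have "conn H' = conn H"
    by (intro subset_antisym subrelI; erule conn_sub; use assms in blast)
  then show ?thesis using assms(1) by (simp add: components_alt)
qed

lemma components_disjoint_Un:
  assumes "\<Union>H \<inter> \<Union>H' = {}"
  shows "components (H \<union> H') = components H \<union> components H'" "components H \<inter> components H' = {}"
proof -
  have 1: "conn (H \<union> H') `` {x} = conn H `` {x}" if "x \<in> \<Union>H" "\<Union>H \<inter> \<Union>H' = {}" for H H' :: "'a set set" and x
  proof -
    have "(x, y) \<in> conn H \<and> y \<in> \<Union>H" if "(x, y) \<in> conn (H \<union> H')" for y
      using that by (induction rule: conn_induct)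
       (use \<open>x \<in> \<Union>H\<close> \<open>\<Union>H \<inter> \<Union>H' = {}\<close> in \<open>auto intro: conn_trans[OF _ conn_block]\<close>)
    then show ?thesis using conn_mono[of x _ H "H \<union> H'"] by auto
  qed
  have a: "conn (H \<union> H') `` {x} = conn H `` {x}" if "x \<in> \<Union>H" for x using 1 that assms by blast
  have b: "conn (H \<union> H') `` {x} = conn H' `` {x}" if "x \<in> \<Union>H'" for x
    using 1[of x H' H] that assms by (simp add: Un_commute Int_commute)
  show "components (H \<union> H') = components H \<union> components H'"
    unfolding components_alt Union_Un_distrib image_Un using a b
    by (intro arg_cong2[of _ _ _ _ "(\<union>)"] image_cong) auto
  show "components H \<inter> components H' = {}"
  proof -
    have "conn H `` {x} \<noteq> conn H' `` {y}" if "x \<in> \<Union>H" "y \<in> \<Union>H'" for x y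
    proof
      assume "conn H `` {x} = conn H' `` {y}"
      then have "x \<in> conn H' `` {y}" using conn_refl[of x H] by auto
      then have "(y, x) \<in> conn H'" by simp
      then have "x \<in> \<Union>H'" using conn_Union[of y x H'] that by metis
      then show False using that assms by auto
    qed
    then show ?thesis unfolding components_alt by (auto simp del: Union_iff)
  qed
qed

section \<open>Partitions as equivalence relations\<close>

definition same :: "'a set set \<Rightarrow> 'a \<Rightarrow> 'a \<Rightarrow> bool" where
  "same p x y \<longleftrightarrow> (\<exists>B\<in>p. x \<in> B \<and> y \<in> B)"

lemma same_sym: "same p x y \<Longrightarrow> same p y x"
  by (auto simp: same_def)

lemma sameI: "B \<in> p \<Longrightarrow> x \<in> B \<Longrightarrow> y \<in> B \<Longrightarrow> same p x y"
  by (auto simp: same_def)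

lemma same_kerp [simp]: "same (kerp A f) x y \<longleftrightarrow> x \<in> A \<and> y \<in> A \<and> f x = f y"
  by (auto simp: same_def kerp_def)

context
  fixes A :: "'a set" and p :: "'a set set"
  assumes p: "partition_on A p"
begin

lemma partition_unique: "B \<in> p \<Longrightarrow> B' \<in> p \<Longrightarrow> x \<in> B \<Longrightarrow> x \<in> B' \<Longrightarrow> B = B'"
  using p by (auto simp: partition_on_def disjoint_def)

lemma same_in: "same p x y \<Longrightarrow> x \<in> A \<and> y \<in> A"
  using p by (auto simp: same_def partition_on_def)

lemma same_refl: "x \<in> A \<Longrightarrow> same p x x"
  using p by (auto simp: same_def partition_on_def)

lemma same_trans: "same p x y \<Longrightarrow> same p y z \<Longrightarrow> same p x z"
  unfolding same_def using partition_unique by blast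

lemma same_block: "B \<in> p \<Longrightarrow> x \<in> B \<Longrightarrow> B = {y. same p x y}"
  unfolding same_def using partition_unique by blast

lemma block_in: "x \<in> A \<Longrightarrow> {y. same p x y} \<in> p"
  using same_refl[of x] same_block by (auto simp: same_def)

lemma same_class_eq: "x \<in> A \<Longrightarrow> {z. same p x z} = {z. same p y z} \<longleftrightarrow> same p x y"
  using same_refl same_trans same_sym[of p] by blast

lemma kerp_same: "p = kerp A (\<lambda>x. {y. same p x y})"
proof -
  have "{y\<in>A. {z. same p y z} = {z. same p x z}} = {y. same p x y}" if "x \<in> A" for x
    using that same_class_eq[of _ x] same_in same_sym[of p] by blast
  then have "kerp A (\<lambda>x. {y. same p x y}) = (\<lambda>x. {y. same p x y}) ` A" by (simp add: kerp_def)
  also have "\<dots> = p"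
  proof (intro subset_antisym subsetI)
    fix B assume B: "B \<in> p"
    then have "B \<noteq> {}" using p by (auto simp: partition_on_def)
    then obtain x where "x \<in> B" by auto
    moreover from this have "x \<in> A" using B p by (auto simp: partition_on_def)
    ultimately show "B \<in> (\<lambda>x. {y. same p x y}) ` A" using same_block[OF B] by blast
  qed (auto intro: block_in)
  finally show ?thesis by simp
qed

lemma conn_partition: "(x, y) \<in> conn p \<longleftrightarrow> x = y \<or> same p x y"
proof
  assume "(x, y) \<in> conn p"
  then show "x = y \<or> same p x y"
    by (induction rule: conn_induct) (auto intro: sameI same_trans[OF _ sameI])
qed (auto simp: same_def intro: conn_block)

end

lemma partition_eqI:
  assumes "partition_on A p" "partition_on A q"
    and "\<And>x y. x \<in> A \<Longrightarrow> y \<in> A \<Longrightarrow> same p x y \<longleftrightarrow> same q x y"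
  shows "p = q"
proof -
  have "kerp A (\<lambda>x. {y. same p x y}) = kerp A (\<lambda>x. {y. same q x y})"
    using assms by (intro kerp_cong) (simp add: same_class_eq)
  then show ?thesis using kerp_same[OF assms(1)] kerp_same[OF assms(2)] by simp
qed

lemma same_image_inj:
  assumes "inj g" shows "same ((`) g ` p) (g x) (g y) \<longleftrightarrow> same p x y"
  using assms by (auto simp: same_def inj_image_mem_iff)

lemma partition_on_image_inj:
  assumes "inj g" "partition_on A p" shows "partition_on (g ` A) ((`) g ` p)"
  using assms unfolding partition_on_def disjoint_def
  by (auto simp: image_Int[symmetric] inj_image_eq_iff)

section \<open>Diagrams, the order of their points, and forms of the non-crossing condition\<close>

lemma Part_partition: "p \<in> Part k l \<Longrightarrow> partition_on (points k l) p"
  by (simp add: Part_def)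

lemma NC_Part: "p \<in> NC k l \<Longrightarrow> p \<in> Part k l" by (simp add: NC_def)
lemma NC2_NC: "p \<in> NC2 k l \<Longrightarrow> p \<in> NC k l" by (simp add: NC2_def)

lemma Part_Union: "p \<in> Part k l \<Longrightarrow> \<Union>p = points k l"
  by (auto simp: Part_def partition_on_def)

lemma kerp_Part [simp]: "kerp (points k l) f \<in> Part k l"
  by (simp add: Part_def partition_on_kerp)

lemma finite_points [simp]: "finite (points k l)"
  by (simp add: points_def)

lemma in_points [simp]: "Upper i \<in> points k l \<longleftrightarrow> 1 \<le> i \<and> i \<le> k" "Lower i \<in> points k l \<longleftrightarrow> 1 \<le> i \<and> i \<le> l"
  by (auto simp: points_def)

text \<open>With \<open>before\<close> as the strict order of a type class, the non-crossing
  arguments can use the automation for linear orders.\<close>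

instantiation point :: linorder
begin
definition less_point where "less_point = before"
definition less_eq_point where "x \<le> (y::point) \<longleftrightarrow> x = y \<or> x < y"
instance
proof
  fix x y z :: point
  show "x < y \<longleftrightarrow> x \<le> y \<and> \<not> y \<le> x"
    by (cases x; cases y) (auto simp: less_point_def less_eq_point_def)
  show "x \<le> x" by (simp add: less_eq_point_def)
  show "x \<le> y \<Longrightarrow> y \<le> z \<Longrightarrow> x \<le> z"
    by (cases x; cases y; cases z) (auto simp: less_point_def less_eq_point_def)
  show "x \<le> y \<Longrightarrow> y \<le> x \<Longrightarrow> x = y"
    by (cases x; cases y) (auto simp: less_point_def less_eq_point_def)
  show "x \<le> y \<or> y \<le> x"
    by (cases x; cases y) (auto simp: less_point_def less_eq_point_def)
qed
end

lemma less_point_simps [simp]: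
  "Upper i < Upper j \<longleftrightarrow> i < j" "Upper i < Lower j" "\<not> Lower i < Upper j" "Lower i < Lower j \<longleftrightarrow> j < i"
  by (simp_all add: less_point_def)

lemma noncrossingD:
  assumes "noncrossing p" "B \<in> p" "B' \<in> p" "a \<in> B" "b \<in> B'" "c \<in> B" "d \<in> B'" "a < b" "b < c" "c < d"
  shows "B = B'"
  using assms unfolding noncrossing_def less_point_def by metis

text \<open>The crossing patterns are exactly the cases in which the chord \<open>y y'\<close> has
  \<open>x\<close> and \<open>x'\<close> on different sides. In this mod 2 form the four points come
  in any order, and the indicators can be added along a path of blocks.\<close>

lemma nc_sep:
  assumes "noncrossing p" "B \<in> p" "B' \<in> p" "B \<inter> B' = {}" "x \<in> B" "x' \<in> B" "y \<in> B'" "y' \<in> B'"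
  shows "((x < y) = (x < y')) = ((x' < y) = (x' < y'))"
proof -
  have n: "\<not> (a < b \<and> b < c \<and> c < d)" "\<not> (b < a \<and> a < d \<and> d < c)"
    if "a \<in> B" "c \<in> B" "b \<in> B'" "d \<in> B'" for a b c d
  proof -
    have "B \<noteq> B'" using assms that by auto
    then show "\<not> (a < b \<and> b < c \<and> c < d)" "\<not> (b < a \<and> a < d \<and> d < c)"
      using noncrossingD[of p B B' a b c d] noncrossingD[of p B' B b a d c] assms(1-3) that by auto
  qed
  have d: "x \<noteq> y" "x \<noteq> y'" "x' \<noteq> y" "x' \<noteq> y'" using assms by auto
  show ?thesis
    using n[of x x' y y'] n[of x' x y y'] n[of x x' y' y] n[of x' x y' y] assms(5-8) d
    by (meson linorder_less_linear less_asym less_trans)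
qed

lemma nc_same:
  assumes "p \<in> NC k l" "same p a c" "same p b d" "a < b" "b < c" "c < d"
  shows "same p a b"
proof -
  obtain B B' where B: "B \<in> p" "a \<in> B" "c \<in> B" "B' \<in> p" "b \<in> B'" "d \<in> B'"
    using assms(2,3) by (auto simp: same_def)
  then have "B = B'" using noncrossingD[of p B B' a b c d] assms by (simp add: NC_def)
  then show ?thesis using B by (auto intro: sameI)
qed

lemma NC_I:
  assumes "p \<in> Part k l"
    and "\<And>a b c d. same p a c \<Longrightarrow> same p b d \<Longrightarrow> a < b \<Longrightarrow> b < c \<Longrightarrow> c < d \<Longrightarrow> same p a b"
  shows "p \<in> NC k l"
proof -
  have "B = B'" if "B \<in> p" "B' \<in> p" "a \<in> B" "b \<in> B'" "c \<in> B" "d \<in> B'" "before a b" "before b c" "before c d"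
    for B B' a b c d
  proof -
    have "same p a b"
      by (rule assms(2)[of a c b d]) (use that in \<open>auto simp: less_point_def intro: sameI\<close>)
    then obtain C where C: "C \<in> p" "a \<in> C" "b \<in> C" by (auto simp: same_def)
    then have "C = B" "C = B'" using partition_unique[OF Part_partition[OF assms(1)]] that by auto
    then show ?thesis by simp
  qed
  then have "noncrossing p" unfolding noncrossing_def by metis
  then show ?thesis using assms(1) by (simp add: NC_def)
qed

subsection \<open>Composition\<close>

text \<open>Points are placed into rows of a larger diagram; the row is the first component.\<close>

definition emb :: "nat \<Rightarrow> nat \<Rightarrow> point \<Rightarrow> nat \<times> nat" where
  "emb a b = case_point (Pair a) (Pair b)"

lemma emb_simps [simp]: "emb a b (Upper i) = (a, i)" "emb a b (Lower i) = (b, i)"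
  by (simp_all add: emb_def)

lemma inj_emb: "a \<noteq> b \<Longrightarrow> inj (emb a b)"
  unfolding inj_def emb_def by (auto split: point.splits)

lemma emb_image_points: "emb a b ` points k l = {a} \<times> {1..k} \<union> {b} \<times> {1..l}"
  by (auto simp: points_def image_Un image_image)

text \<open>The rows carry arbitrary names, so that the composites in an associativity law embed
  into one stack with rows 0 to 3, and a reflected stack is the same hypergraph read
  upwards.\<close>

definition stackH :: "nat \<Rightarrow> nat \<Rightarrow> nat \<Rightarrow> diagram \<Rightarrow> diagram \<Rightarrow> (nat \<times> nat) set set" where
  "stackH a b c q p = (`) (emb a b) ` p \<union> (`) (emb b c) ` q"

lemma Union_emb: "p \<in> Part k l \<Longrightarrow> \<Union>((`) (emb a b) ` p) = {a} \<times> {1..k} \<union> {b} \<times> {1..l}"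
  by (simp only: emb_image_points[symmetric] image_Union[symmetric] Part_Union)

lemma Union_stackH:
  "p \<in> Part k l \<Longrightarrow> q \<in> Part l m \<Longrightarrow>
    \<Union>(stackH a b c q p) = {a} \<times> {1..k} \<union> {b} \<times> {1..l} \<union> {c} \<times> {1..m}"
  by (simp add: stackH_def Union_Un_distrib Union_emb) blast

context
  fixes a b c k l m :: nat and p q :: diagram
  assumes abc: "a \<noteq> b" "b \<noteq> c" "a \<noteq> c" and p: "p \<in> Part k l" and q: "q \<in> Part l m"
begin

lemma stack_emb: "(`) (case_row_point (Pair a) (Pair b) (Pair c)) ` stack q p = components (stackH a b c q p)"
  and inj_rows: "inj (case_row_point (Pair a) (Pair b) (Pair c))"
proof -
  let ?g = "case_row_point (Pair a) (Pair b) (Pair c)"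
  show g: "inj ?g" unfolding inj_def using abc by (auto split: row_point.splits)
  have c: "?g (case_point Top Mid x) = emb a b x" "?g (case_point Mid Bot x) = emb b c x" for x
    by (cases x; simp)+
  have "(`) ?g ` ((`) (case_point Top Mid) ` p \<union> (`) (case_point Mid Bot) ` q) = stackH a b c q p"
    unfolding stackH_def image_Un image_image c ..
  then show "(`) ?g ` stack q p = components (stackH a b c q p)"
    unfolding stack_def components_image_inj[OF g, symmetric] by simp
qed

lemma composite_emb: "composite q p = (\<lambda>C. emb a c -` C) ` components (stackH a b c q p) - {{}}"
proof -
  let ?g = "case_row_point (Pair a) (Pair b) (Pair c)"
  have "?g \<circ> case_point Top Bot = emb a c" by (auto simp: emb_def fun_eq_iff split: point.splits)
  then have "emb a c -` (?g ` C) = case_point Top Bot -` C" for C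
    using inj_vimage_image_eq[OF inj_rows, of C] by (metis vimage_comp)
  then show ?thesis unfolding composite_def stack_emb[symmetric] image_image by simp
qed

lemma composite_kerp: "composite q p = kerp (points k m) (\<lambda>x. conn (stackH a b c q p) `` {emb a c x})"
proof -
  let ?H = "stackH a b c q p"
  have U: "emb a c x \<in> \<Union>?H \<longleftrightarrow> x \<in> points k m" for x
    unfolding Union_stackH[OF p q] using abc by (cases x) auto
  have *: "{y \<in> points k m. conn ?H `` {emb a c y} = conn ?H `` {emb a c x}} = emb a c -` (conn ?H `` {emb a c x})"
    if "x \<in> points k m" for x
    unfolding conn_class_eq
  proof (intro set_eqI iffI)
    fix y assume "y \<in> emb a c -` (conn ?H `` {emb a c x})"
    then have y: "(emb a c x, emb a c y) \<in> conn ?H" by simp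
    then have "emb a c x = emb a c y \<or> emb a c y \<in> \<Union>?H" using conn_Union[OF y] by argo
    then have "y \<in> points k m" using U that inj_emb[of a c] abc by (auto simp: inj_def)
    then show "y \<in> {y \<in> points k m. (emb a c y, emb a c x) \<in> conn ?H}" using y by (simp add: conn_sym)
  qed (auto intro: conn_sym)
  have "composite q p = (\<lambda>x. emb a c -` (conn ?H `` {emb a c x})) ` points k m"
  proof (intro subset_antisym subsetI)
    fix B assume "B \<in> composite q p"
    then obtain v where v: "v \<in> \<Union>?H" "B = emb a c -` (conn ?H `` {v})" "B \<noteq> {}"
      unfolding composite_emb components_alt by (auto simp del: Union_iff)
    from v(3) obtain x where "x \<in> B" by (auto simp only: ex_in_conv[symmetric])
    then have x: "(v, emb a c x) \<in> conn ?H" using v(2) by simp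
    then have "emb a c x \<in> \<Union>?H" using v conn_Union[OF x] by (auto simp del: Union_iff)
    then have "x \<in> points k m" using U by simp
    moreover have "conn ?H `` {v} = conn ?H `` {emb a c x}" using x conn_class_eq by metis
    ultimately show "B \<in> (\<lambda>x. emb a c -` (conn ?H `` {emb a c x})) ` points k m" using v by auto
  next
    fix B assume "B \<in> (\<lambda>x. emb a c -` (conn ?H `` {emb a c x})) ` points k m"
    then obtain x where x: "x \<in> points k m" "B = emb a c -` (conn ?H `` {emb a c x})" by auto
    then have "x \<in> B" by simp
    then have "B \<noteq> {}" by auto
    then show "B \<in> composite q p"
      using x U[of x] unfolding composite_emb components_alt by (auto simp del: Union_iff intro!: image_eqI)
  qed
  then show ?thesis unfolding kerp_def using * by simp
qed

lemma composite_Part: "composite q p \<in> Part k m"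
  unfolding composite_kerp by simp

lemma same_composite:
  "same (composite q p) x y \<longleftrightarrow>
    x \<in> points k m \<and> y \<in> points k m \<and> (emb a c x, emb a c y) \<in> conn (stackH a b c q p)"
  unfolding composite_kerp same_kerp conn_class_eq by simp

lemma loops_emb: "loops q p = card {K \<in> components (stackH a b c q p). K \<subseteq> {b} \<times> UNIV}"
proof -
  let ?g = "case_row_point (Pair a) (Pair b) (Pair c)"
  have "?g ` C \<subseteq> {b} \<times> UNIV \<longleftrightarrow> C \<subseteq> range Mid" for C
  proof -
    have "?g v \<in> {b} \<times> UNIV \<longleftrightarrow> v \<in> range Mid" for v using abc by (cases v) auto
    then show ?thesis by blast
  qed
  then have "(`) ?g ` {C \<in> stack q p. C \<subseteq> range Mid} = {K \<in> components (stackH a b c q p). K \<subseteq> {b} \<times> UNIV}"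
    unfolding stack_emb[symmetric] by blast
  moreover have "card ((`) ?g ` {C \<in> stack q p. C \<subseteq> range Mid}) = card {C \<in> stack q p. C \<subseteq> range Mid}"
    using inj_image_eq_iff[OF inj_rows] by (intro card_image) (auto simp: inj_on_def)
  ultimately show ?thesis by (simp only: loops_def)
qed

text \<open>The working tool for computing composites: labels that describe the components of the
  stack give the composite on the outer rows, and a loop is a label that occurs in the middle row
  only.\<close>

lemma composite_label:
  assumes lp: "\<And>x y. same p x y \<Longrightarrow> f (emb a b x) = f (emb a b y)"
    and lq: "\<And>x y. same q x y \<Longrightarrow> f (emb b c x) = f (emb b c y)"
    and con: "\<And>u v. u \<in> {a} \<times> {1..k} \<union> {b} \<times> {1..l} \<union> {c} \<times> {1..m} \<Longrightarrow>
        v \<in> {a} \<times> {1..k} \<union> {b} \<times> {1..l} \<union> {c} \<times> {1..m} \<Longrightarrow> f u = f v \<Longrightarrow> (u, v) \<in> conn (stackH a b c q p)"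
  shows "composite q p = kerp (points k m) (\<lambda>x. f (emb a c x))"
    and "loops q p = card (f ` ({b} \<times> {1..l}) - f ` ({a} \<times> {1..k} \<union> {c} \<times> {1..m}))"
proof -
  let ?H = "stackH a b c q p" and ?V = "{a} \<times> {1..k} \<union> {b} \<times> {1..l} \<union> {c} \<times> {1..m}"
  have f: "f u = f v" if B: "B \<in> ?H" "u \<in> B" "v \<in> B" for B u v
  proof -
    from B(1) consider B' where "B' \<in> p" "B = emb a b ` B'" | B' where "B' \<in> q" "B = emb b c ` B'"
      unfolding stackH_def by auto
    then show ?thesis
    proof cases
      case 1
      obtain x y where "u = emb a b x" "v = emb a b y" "x \<in> B'" "y \<in> B'" using B(2,3) unfolding 1(2) by blast
      then show ?thesis using lp[of x y] 1 by (simp add: sameI)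
    next
      case 2
      obtain x y where "u = emb b c x" "v = emb b c y" "x \<in> B'" "y \<in> B'" using B(2,3) unfolding 2(2) by blast
      then show ?thesis using lq[of x y] 2 by (simp add: sameI)
    qed
  qed
  have *: "components ?H = kerp ?V f"
    using components_eq_kerp[of ?H f] f con unfolding Union_stackH[OF p q] by blast
  have "conn ?H `` {u} = conn ?H `` {v} \<longleftrightarrow> f u = f v" if "u \<in> ?V" "v \<in> ?V" for u v
    unfolding conn_class_eq using con that conn_label[of u v ?H f] f by blast
  moreover have "emb a c x \<in> ?V" if "x \<in> points k m" for x using that by (cases x) auto
  ultimately show "composite q p = kerp (points k m) (\<lambda>x. f (emb a c x))"
    unfolding composite_kerp by (intro kerp_cong) auto
  have "{K \<in> components ?H. K \<subseteq> {b} \<times> UNIV} =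
      (\<lambda>c. {y\<in>?V. f y = c}) ` (f ` ({b} \<times> {1..l}) - f ` ({a} \<times> {1..k} \<union> {c} \<times> {1..m}))" (is "?L = ?R")
  proof (intro subset_antisym subsetI)
    fix K assume "K \<in> ?L"
    then obtain x where x: "x \<in> ?V" "K = {y\<in>?V. f y = f x}" and Kb: "K \<subseteq> {b} \<times> UNIV"
      unfolding * kerp_def by auto
    then have "x \<in> K" by simp
    then have "x \<in> {b} \<times> {1..l}" using x Kb abc by auto
    moreover have "f x \<notin> f ` ({a} \<times> {1..k} \<union> {c} \<times> {1..m})"
    proof
      assume "f x \<in> f ` ({a} \<times> {1..k} \<union> {c} \<times> {1..m})"
      then obtain y where y: "y \<in> {a} \<times> {1..k} \<union> {c} \<times> {1..m}" "f x = f y" by (rule imageE) auto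
      then have "y \<in> K" using x by auto
      then show False using Kb y abc by auto
    qed
    ultimately show "K \<in> ?R" using x by blast
  next
    fix K assume "K \<in> ?R"
    then obtain x where x: "x \<in> {b} \<times> {1..l}" "f x \<notin> f ` ({a} \<times> {1..k} \<union> {c} \<times> {1..m})"
      "K = {y\<in>?V. f y = f x}" by (auto simp del: mem_Times_iff)
    have "K \<subseteq> {b} \<times> UNIV"
    proof
      fix y assume y: "y \<in> K"
      then have "y \<in> ?V" "f x = f y" using x by auto
      then have "y \<in> {b} \<times> {1..l}" using x(2) by blast
      then show "y \<in> {b} \<times> UNIV" by auto
    qed
    moreover have "K \<in> components ?H" unfolding * kerp_def using x by (intro image_eqI[of _ _ x]) auto
    ultimately show "K \<in> ?L" by auto
  qed
  moreover have "inj_on (\<lambda>c. {y\<in>?V. f y = c}) (f ` ({b} \<times> {1..l}) - f ` ({a} \<times> {1..k} \<union> {c} \<times> {1..m}))"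
  proof (rule inj_onI)
    fix x y assume "x \<in> f ` ({b} \<times> {1..l}) - f ` ({a} \<times> {1..k} \<union> {c} \<times> {1..m})"
      and e: "{v\<in>?V. f v = x} = {v\<in>?V. f v = y}"
    then obtain u where "u \<in> {b} \<times> {1..l}" "x = f u" by auto
    then have "u \<in> {v\<in>?V. f v = x}" by auto
    then show "x = y" unfolding e using \<open>x = f u\<close> by simp
  qed
  ultimately show "loops q p = card (f ` ({b} \<times> {1..l}) - f ` ({a} \<times> {1..k} \<union> {c} \<times> {1..m}))"
    unfolding loops_emb by (simp add: card_image)
qed

end

text \<open>This is the third hypothesis of the contraction lemmas: replacing \<open>p\<close> and
  \<open>q\<close> by their composite contracts the stack along its middle row.\<close>

lemma contract_sub:
  assumes "a \<noteq> b" "b \<noteq> c" "a \<noteq> c" and p: "p \<in> Part k l" and q: "q \<in> Part l m"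
    and u: "u \<notin> {b} \<times> UNIV" "v \<notin> {b} \<times> UNIV"
  shows "(u, v) \<in> conn ((`) (emb a c) ` composite q p) \<longleftrightarrow> (u, v) \<in> conn (stackH a b c q p)"
proof (cases "u \<in> range (emb a c) \<and> v \<in> range (emb a c)")
  case True
  then obtain x y where xy: "u = emb a c x" "v = emb a c y" by auto
  have 1: "composite q p \<in> Part k m" using composite_Part assms by blast
  have 2: "(emb a c x, emb a c y) \<in> conn (stackH a b c q p) \<Longrightarrow> x = y \<or> x \<in> points k m \<and> y \<in> points k m"
  proof -
    assume "(emb a c x, emb a c y) \<in> conn (stackH a b c q p)"
    then have "emb a c x = emb a c y \<or> emb a c x \<in> \<Union>(stackH a b c q p) \<and> emb a c y \<in> \<Union>(stackH a b c q p)"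
      by (rule conn_Union)
    then show ?thesis unfolding Union_stackH[OF p q] using assms(1-3) by (cases x; cases y) auto
  qed
  show ?thesis
    unfolding xy conn_image_inj[OF inj_emb[OF assms(3)]] conn_partition[OF Part_partition[OF 1]]
      same_composite[OF assms(1-5)] using 2 by auto
next
  case False
  have r: "x \<in> range (emb a c) \<longleftrightarrow> fst x = a \<or> fst x = c" for x
  proof
    assume "fst x = a \<or> fst x = c"
    then have "x = emb a c (Upper (snd x)) \<or> x = emb a c (Lower (snd x))" by (cases x) auto
    then show "x \<in> range (emb a c)" by (metis rangeI)
  qed (auto simp: emb_def split: point.splits)
  have "(u, v) \<in> conn ((`) (emb a c) ` composite q p) \<longleftrightarrow> u = v"
    using False conn_Union[of u v "(`) (emb a c) ` composite q p"] by auto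
  moreover have "(u, v) \<in> conn (stackH a b c q p) \<longleftrightarrow> u = v"
    using False conn_Union[of u v "stackH a b c q p"] u unfolding Union_stackH[OF p q] r by auto
  ultimately show ?thesis by simp
qed

context
  fixes k l m n :: nat and p q r :: diagram
  assumes p: "p \<in> Part k l" and q: "q \<in> Part l m" and r: "r \<in> Part m n"
begin

private abbreviation "HP \<equiv> (`) (emb 0 1) ` p"
private abbreviation "HQ \<equiv> (`) (emb 1 2) ` q"
private abbreviation "HR \<equiv> (`) (emb 2 3) ` r"

private lemma qp: "composite q p \<in> Part k m"
  by (rule composite_Part[of 0 1 2, OF _ _ _ p q]) auto

private lemma rq: "composite r q \<in> Part l n"
  by (rule composite_Part[of 0 1 2, OF _ _ _ q r]) auto

private lemma left_contract:
  "({1::nat} \<times> UNIV) \<inter> \<Union>HR = {}"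
  "\<Union>((`) (emb 0 2) ` composite q p) = \<Union>(HP \<union> HQ) - {1} \<times> UNIV"
  "\<And>u v. u \<notin> {1} \<times> UNIV \<Longrightarrow> v \<notin> {1} \<times> UNIV \<Longrightarrow>
     (u, v) \<in> conn ((`) (emb 0 2) ` composite q p) \<longleftrightarrow> (u, v) \<in> conn (HP \<union> HQ)"
proof -
  show "({1::nat} \<times> UNIV) \<inter> \<Union>HR = {}" unfolding Union_emb[OF r] by auto
  show "\<Union>((`) (emb 0 2) ` composite q p) = \<Union>(HP \<union> HQ) - {1} \<times> UNIV"
    unfolding Union_Un_distrib Union_emb[OF p] Union_emb[OF q] Union_emb[OF qp] by auto
  show "(u, v) \<in> conn ((`) (emb 0 2) ` composite q p) \<longleftrightarrow> (u, v) \<in> conn (HP \<union> HQ)"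
    if "u \<notin> {1} \<times> UNIV" "v \<notin> {1} \<times> UNIV" for u v
    using contract_sub[of 0 1 2, OF _ _ _ p q that] by (simp add: stackH_def)
qed

private lemma right_contract:
  "({2::nat} \<times> UNIV) \<inter> \<Union>HP = {}"
  "\<Union>((`) (emb 1 3) ` composite r q) = \<Union>(HQ \<union> HR) - {2} \<times> UNIV"
  "\<And>u v. u \<notin> {2} \<times> UNIV \<Longrightarrow> v \<notin> {2} \<times> UNIV \<Longrightarrow>
     (u, v) \<in> conn ((`) (emb 1 3) ` composite r q) \<longleftrightarrow> (u, v) \<in> conn (HQ \<union> HR)"
proof -
  show "({2::nat} \<times> UNIV) \<inter> \<Union>HP = {}" unfolding Union_emb[OF p] by auto
  show "\<Union>((`) (emb 1 3) ` composite r q) = \<Union>(HQ \<union> HR) - {2} \<times> UNIV"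
    unfolding Union_Un_distrib Union_emb[OF q] Union_emb[OF r] Union_emb[OF rq] by auto
  show "(u, v) \<in> conn ((`) (emb 1 3) ` composite r q) \<longleftrightarrow> (u, v) \<in> conn (HQ \<union> HR)"
    if "u \<notin> {2} \<times> UNIV" "v \<notin> {2} \<times> UNIV" for u v
    using contract_sub[of 1 2 3, OF _ _ _ q r that] by (simp add: stackH_def)
qed

private lemma left_eq: "stackH 0 2 3 r (composite q p) = (`) (emb 0 2) ` composite q p \<union> HR"
  by (simp add: stackH_def)

private lemma right_eq: "stackH 0 1 3 (composite r q) p = (`) (emb 1 3) ` composite r q \<union> HP"
  by (simp add: stackH_def Un_commute)

text \<open>Both sides are what remains of the stack of \<open>p\<close>, \<open>q\<close>,
  \<open>r\<close> when the two inner rows are contracted, in either order.\<close>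

lemma composite_assoc: "composite r (composite q p) = composite (composite r q) p"
proof (rule partition_eqI)
  show "partition_on (points k n) (composite r (composite q p))"
    by (rule Part_partition, rule composite_Part[of 0 2 3, OF _ _ _ qp r]) auto
  show "partition_on (points k n) (composite (composite r q) p)"
    by (rule Part_partition, rule composite_Part[of 0 2 3, OF _ _ _ p rq]) auto
  fix x y
  have a: "emb 0 3 z \<notin> {1} \<times> UNIV" "emb 0 3 z \<notin> {2} \<times> UNIV" for z by (cases z; simp)+
  have "(emb 0 3 x, emb 0 3 y) \<in> conn (stackH 0 2 3 r (composite q p)) \<longleftrightarrow>
      (emb 0 3 x, emb 0 3 y) \<in> conn ((HP \<union> HQ) \<union> HR)"
    unfolding left_eq by (rule conn_contract[OF left_contract a(1) a(1)])
  moreover have "(emb 0 3 x, emb 0 3 y) \<in> conn (stackH 0 1 3 (composite r q) p) \<longleftrightarrow>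
      (emb 0 3 x, emb 0 3 y) \<in> conn ((HQ \<union> HR) \<union> HP)"
    unfolding right_eq by (rule conn_contract[OF right_contract a(2) a(2)])
  moreover have "(HQ \<union> HR) \<union> HP = (HP \<union> HQ) \<union> HR" by auto
  ultimately show "same (composite r (composite q p)) x y \<longleftrightarrow> same (composite (composite r q) p) x y"
    using same_composite[of 0 2 3, OF _ _ _ qp r] same_composite[of 0 1 3, OF _ _ _ p rq] by simp
qed

text \<open>Both sides count the components of the triple stack that are contained in the two inner
  rows; the two ways of composing differ only in when such a component is noticed.\<close>

lemma loops_assoc: "loops r (composite q p) + loops q p = loops (composite r q) p + loops r q"
proof -
  let ?H = "HP \<union> HQ \<union> HR" and ?Z = "{1::nat, 2} \<times> (UNIV :: nat set)"
  have e: "(HQ \<union> HR) \<union> HP = ?H" by auto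
  have fin: "finite (components ?H)"
    by (rule finite_components) (simp add: Union_Un_distrib Union_emb[OF p] Union_emb[OF q] Union_emb[OF r])
  \<comment> \<open>After the contraction no vertex of row 1 is left, so lying in row 2 and lying in
    \<open>?Z\<close> coincide.\<close>
  have i: "K \<inter> {1} \<times> UNIV = {}" if "K \<in> components (stackH 0 2 3 r (composite q p))" for K
  proof -
    obtain v where v: "v \<in> \<Union>(stackH 0 2 3 r (composite q p))" "K = conn (stackH 0 2 3 r (composite q p)) `` {v}"
      using \<open>K \<in> _\<close> unfolding components_alt by (rule imageE) simp
    then have "K \<subseteq> \<Union>(stackH 0 2 3 r (composite q p))" using conn_Union by fastforce
    then show ?thesis unfolding Union_stackH[OF qp r] by auto
  qed
  have j: "K \<inter> {2} \<times> UNIV = {}" if "K \<in> components (stackH 0 1 3 (composite r q) p)" for K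
  proof -
    obtain v where v: "v \<in> \<Union>(stackH 0 1 3 (composite r q) p)" "K = conn (stackH 0 1 3 (composite r q) p) `` {v}"
      using \<open>K \<in> _\<close> unfolding components_alt by (rule imageE) simp
    then have "K \<subseteq> \<Union>(stackH 0 1 3 (composite r q) p)" using conn_Union by fastforce
    then show ?thesis unfolding Union_stackH[OF p rq] by auto
  qed
  have "loops r (composite q p) = card {K \<in> components (stackH 0 2 3 r (composite q p)). K \<subseteq> {2} \<times> UNIV}"
    by (rule loops_emb[OF _ _ _ qp r]) auto
  also have "\<dots> = card {K \<in> components (stackH 0 2 3 r (composite q p)). K \<subseteq> ?Z}"
    by (intro arg_cong[of _ _ card] Collect_cong conj_cong refl) (use i in blast)
  also have "\<dots> = card {K \<in> components ?H. K \<subseteq> ?Z \<and> \<not> K \<subseteq> {1} \<times> UNIV}"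
    unfolding left_eq by (rule components_contract_outside[OF left_contract]) auto
  finally have 1: "loops r (composite q p) = \<dots>" .
  have "loops q p = card {K \<in> components (HP \<union> HQ). K \<subseteq> {1} \<times> UNIV}"
    using loops_emb[of 0 1 2, OF _ _ _ p q] by (simp add: stackH_def)
  also have "\<dots> = card {K \<in> components ?H. K \<subseteq> {1} \<times> UNIV}"
    using components_contract_inside[OF left_contract] by simp
  finally have "loops r (composite q p) + loops q p =
     card ({K \<in> components ?H. K \<subseteq> ?Z \<and> \<not> K \<subseteq> {1} \<times> UNIV} \<union> {K \<in> components ?H. K \<subseteq> {1} \<times> UNIV})"
    unfolding 1 using fin by (subst card_Un_disjoint) auto
  also have "{K \<in> components ?H. K \<subseteq> ?Z \<and> \<not> K \<subseteq> {1} \<times> UNIV} \<union> {K \<in> components ?H. K \<subseteq> {1} \<times> UNIV}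
     = {K \<in> components ?H. K \<subseteq> ?Z}" by blast
  finally have L: "loops r (composite q p) + loops q p = card {K \<in> components ?H. K \<subseteq> ?Z}" .
  have "loops (composite r q) p = card {K \<in> components (stackH 0 1 3 (composite r q) p). K \<subseteq> {1} \<times> UNIV}"
    by (rule loops_emb[OF _ _ _ p rq]) auto
  also have "\<dots> = card {K \<in> components (stackH 0 1 3 (composite r q) p). K \<subseteq> ?Z}"
    by (intro arg_cong[of _ _ card] Collect_cong conj_cong refl) (use j in blast)
  also have "\<dots> = card {K \<in> components ?H. K \<subseteq> ?Z \<and> \<not> K \<subseteq> {2} \<times> UNIV}"
    unfolding right_eq e[symmetric] by (rule components_contract_outside[OF right_contract]) auto
  finally have 2: "loops (composite r q) p = \<dots>" .
  have "loops r q = card {K \<in> components (HQ \<union> HR). K \<subseteq> {2} \<times> UNIV}"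
    using loops_emb[of 1 2 3, OF _ _ _ q r] by (simp add: stackH_def)
  also have "\<dots> = card {K \<in> components ?H. K \<subseteq> {2} \<times> UNIV}"
    using components_contract_inside[OF right_contract] e by simp
  finally have "loops (composite r q) p + loops r q =
     card ({K \<in> components ?H. K \<subseteq> ?Z \<and> \<not> K \<subseteq> {2} \<times> UNIV} \<union> {K \<in> components ?H. K \<subseteq> {2} \<times> UNIV})"
    unfolding 2 using fin by (subst card_Un_disjoint) auto
  also have "{K \<in> components ?H. K \<subseteq> ?Z \<and> \<not> K \<subseteq> {2} \<times> UNIV} \<union> {K \<in> components ?H. K \<subseteq> {2} \<times> UNIV}
     = {K \<in> components ?H. K \<subseteq> ?Z}" by blast
  finally show ?thesis using L by simp
qed

end

declare One_nat_def [simp del]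

subsection \<open>Planarity of composites\<close>

text \<open>For \<open>u\<close> in row 0 and \<open>v\<close> in row 2 this is the circular order of the outer points; for \<open>u\<close> in row 1
  the signs are chosen such that the indicator sums below telescope along a path.\<close>

fun xord :: "nat \<times> nat \<Rightarrow> nat \<times> nat \<Rightarrow> bool" where
  "xord (r, i) (r', j) \<longleftrightarrow> (if r = 0 then r' \<noteq> 0 \<or> i < j else r' = r \<and> j < i)"

text \<open>Let \<open>K\<close> be the component of \<open>b\<close> and \<open>d\<close> in the
  stack. Adding mod 2 the chords of the steps of a path from \<open>b\<close> to \<open>d\<close>
  gives functions \<open>P\<close> and \<open>Q\<close> on the points of \<open>p\<close> and
  \<open>q\<close>. They are constant on all blocks outside \<open>K\<close> by
  \<open>nc_sep\<close>, and outside \<open>K\<close> they agree on the middle row. Glued together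
  they are constant on every other component, while on the outer points they tell whether a point
  lies between \<open>b\<close> and \<open>d\<close>. Hence \<open>a\<close> and \<open>c\<close>
  lie both between them or both not, which contradicts \<open>a < b < c < d\<close>.\<close>

lemma composite_NC:
  assumes p: "p \<in> NC k l" and q: "q \<in> NC l m"
  shows "composite q p \<in> NC k m"
proof (rule NC_I)
  note pq = NC_Part[OF p] NC_Part[OF q]
  note pp = Part_partition[OF pq(1)] and qq = Part_partition[OF pq(2)]
  show "composite q p \<in> Part k m" by (rule composite_Part[of 0 1 2, OF _ _ _ pq]) auto
  let ?H = "stackH 0 1 2 q p"
  fix a b c d assume ac: "same (composite q p) a c" and bd: "same (composite q p) b d"
    and ord: "a < b" "b < c" "c < d"
  note sc = same_composite[of 0 1 2, OF _ _ _ pq, simplified]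
  define \<beta> where "\<beta> = emb 0 2 b"
  define K where "K = conn ?H `` {\<beta>}"
  have nK: "u \<notin> K" if "(u, v) \<in> conn ?H" "v \<notin> K" for u v
    using that unfolding K_def by (auto intro: conn_trans)
  \<comment> \<open>\<open>P\<close> and \<open>Q\<close> collect the chords traversed so far on the
    path from \<open>\<beta>\<close> to \<open>v\<close>. On the outer rows the sum telescopes to
    its two ends; on the middle row \<open>P\<close> and \<open>Q\<close> differ by such a
    telescoped term.\<close>
  define J where "J = (\<lambda>P Q v.
      (\<forall>B\<in>p. \<forall>x\<in>B. \<forall>y\<in>B. emb 0 1 x \<notin> K \<longrightarrow> P x = P y) \<and>
      (\<forall>B\<in>q. \<forall>x\<in>B. \<forall>y\<in>B. emb 1 2 x \<notin> K \<longrightarrow> Q x = Q y) \<and>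
      (\<forall>i. P (Upper i) = (xord (0, i) \<beta> \<noteq> xord (0, i) v)) \<and>
      (\<forall>i. Q (Lower i) = (xord (2, i) \<beta> \<noteq> xord (2, i) v)) \<and>
      (\<forall>i. (1, i) \<notin> K \<longrightarrow> (P (Lower i) \<noteq> Q (Upper i)) = (xord (1, i) \<beta> \<noteq> xord (1, i) v)))"
  define I where "I v = (\<exists>P Q. J P Q v)" for v
  have x1: "x < y \<longleftrightarrow> xord (emb 0 1 x) (emb 0 1 y)" for x y by (cases x; cases y) auto
  have x2: "Lower i < y \<longleftrightarrow> xord (2, i) (emb 1 2 y)" for i y by (cases y) auto
  have x3: "Upper i < y \<longleftrightarrow> \<not> xord (1, i) (emb 1 2 y)" if "(1, i) \<noteq> emb 1 2 y" for i y
    using that by (cases y) auto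
  have x4: "xord (0, i) (emb 1 2 y)" "\<not> xord (2, i) (emb 0 1 y)" for i y by (cases y; simp)+
  have main: "I v" if "(\<beta>, v) \<in> conn ?H" for v
    using that
  proof (induction rule: conn_induct)
    case refl
    show ?case unfolding I_def J_def by (rule exI[of _ "\<lambda>_. False"], rule exI[of _ "\<lambda>_. False"]) auto
  next
    case (step v w B)
    from step.IH obtain P Q where PQ: "J P Q v" unfolding I_def by blast
note PQ' = PQ[unfolded J_def]
    note P = PQ'[THEN conjunct1, rule_format]
      and Q = PQ'[THEN conjunct2, THEN conjunct1, rule_format]
      and t = PQ'[THEN conjunct2, THEN conjunct2, THEN conjunct1, rule_format]
      and l = PQ'[THEN conjunct2, THEN conjunct2, THEN conjunct2, THEN conjunct1, rule_format]
      and mid = PQ'[THEN conjunct2, THEN conjunct2, THEN conjunct2, THEN conjunct2, rule_format]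
    have vK: "v \<in> K" "w \<in> K" using step conn_trans[OF step(1) conn_block[OF step(2-4)]] by (auto simp: K_def)
    from step(2) consider C where "C \<in> p" "B = emb 0 1 ` C" | C where "C \<in> q" "B = emb 1 2 ` C"
      unfolding stackH_def by auto
    then show ?case
    proof cases
      case 1
      then obtain y y' where y: "v = emb 0 1 y" "w = emb 0 1 y'" "y \<in> C" "y' \<in> C" using step by auto
      \<comment> \<open>Stepping from \<open>y\<close> to \<open>y'\<close> inside a block of
        \<open>p\<close> adds the indicator of the chord \<open>y y'\<close> mod 2.\<close>
      define P' where "P' x = (P x \<noteq> ((x < y) \<noteq> (x < y')))" for x
      have c1: "P' x = P' x'" if "D \<in> p" "x \<in> D" "x' \<in> D" "emb 0 1 x \<notin> K" for D x x'
      proof -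
        have "D \<noteq> C"
        proof
          assume "D = C"
          then have "(emb 0 1 x, v) \<in> conn ?H" using y that(1,2)
            by (auto simp: stackH_def intro!: conn_block[of "emb 0 1 ` C"])
          then show False using nK[OF conn_sym, of "emb 0 1 x" v] vK that by blast
        qed
        then have "D \<inter> C = {}" using partition_unique[OF pp that(1) 1(1)] by auto
        then have "((x < y) = (x < y')) = ((x' < y) = (x' < y'))"
          using nc_sep[of p D C x x' y y'] p that 1 y by (simp add: NC_def)
        then show ?thesis using P[OF that] unfolding P'_def by auto
      qed
      have c2: "P' (Upper i) = (xord (0, i) \<beta> \<noteq> xord (0, i) w)" for i
        unfolding P'_def t y x1 by auto
      have c3: "Q (Lower i) = (xord (2, i) \<beta> \<noteq> xord (2, i) w)" for i
        unfolding l y using x4 by auto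
      have c4: "(P' (Lower i) \<noteq> Q (Upper i)) = (xord (1, i) \<beta> \<noteq> xord (1, i) w)" if "(1, i) \<notin> K" for i
        using mid[OF that] unfolding P'_def y x1 by auto
      have "J P' Q w" unfolding J_def
        by (intro conjI ballI allI impI) (rule c1 Q c2 c3 c4; assumption)+
      then show ?thesis unfolding I_def by blast
    next
      case 2
      then obtain y y' where y: "v = emb 1 2 y" "w = emb 1 2 y'" "y \<in> C" "y' \<in> C" using step by auto
      define Q' where "Q' x = (Q x \<noteq> ((x < y) \<noteq> (x < y')))" for x
      have c1: "Q' x = Q' x'" if "D \<in> q" "x \<in> D" "x' \<in> D" "emb 1 2 x \<notin> K" for D x x'
      proof -
        have "D \<noteq> C"
        proof
          assume "D = C"
          then have "(emb 1 2 x, v) \<in> conn ?H" using y that(1,2)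
            by (auto simp: stackH_def intro!: conn_block[of "emb 1 2 ` C"])
          then show False using nK[OF conn_sym, of "emb 1 2 x" v] vK that by blast
        qed
        then have "D \<inter> C = {}" using partition_unique[OF qq that(1) 2(1)] by auto
        then have "((x < y) = (x < y')) = ((x' < y) = (x' < y'))"
          using nc_sep[of q D C x x' y y'] q that 2 y by (simp add: NC_def)
        then show ?thesis using Q[OF that] unfolding Q'_def by auto
      qed
      have c2: "P (Upper i) = (xord (0, i) \<beta> \<noteq> xord (0, i) w)" for i
        unfolding t y using x4 by auto
      have c3: "Q' (Lower i) = (xord (2, i) \<beta> \<noteq> xord (2, i) w)" for i
        unfolding Q'_def l y x2 by auto
      have c4: "(P (Lower i) \<noteq> Q' (Upper i)) = (xord (1, i) \<beta> \<noteq> xord (1, i) w)" if "(1, i) \<notin> K" for i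
      proof -
        have "(1, i) \<noteq> emb 1 2 y" "(1, i) \<noteq> emb 1 2 y'" using that vK y by auto
        then show ?thesis using mid[OF that] unfolding Q'_def y by (simp add: x3) blast
      qed
      have "J P Q' w" unfolding J_def
        by (intro conjI ballI allI impI) (rule c1 P c2 c3 c4; assumption)+
      then show ?thesis unfolding I_def by blast
    qed
  qed
  have "I (emb 0 2 d)" using main bd unfolding sc \<beta>_def by simp
    then obtain P Q where PQ: "J P Q (emb 0 2 d)" unfolding I_def by blast
  note PQ' = PQ[unfolded J_def]
    note P = PQ'[THEN conjunct1, rule_format]
      and Q = PQ'[THEN conjunct2, THEN conjunct1, rule_format]
      and t = PQ'[THEN conjunct2, THEN conjunct2, THEN conjunct1, rule_format]
      and l = PQ'[THEN conjunct2, THEN conjunct2, THEN conjunct2, THEN conjunct1, rule_format]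
      and mid = PQ'[THEN conjunct2, THEN conjunct2, THEN conjunct2, THEN conjunct2, rule_format]
  \<comment> \<open>\<open>\<beta>\<close> and the end of the path lie in outer rows, where
    \<open>xord (1, i)\<close> is false. So the correction term vanishes and \<open>P\<close> and
    \<open>Q\<close> can be glued.\<close>
  have mid': "P (Lower i) = Q (Upper i)" if "(1, i) \<notin> K" for i
    using mid[OF that] unfolding \<beta>_def by (cases b; cases d) auto
  have xo: "xord (emb 0 2 x) (emb 0 2 y) = (x < y)" for x y by (cases x; cases y) auto
  show "same (composite q p) a b"
  proof (rule ccontr)
    assume nab: "\<not> same (composite q p) a b"
    have aK: "emb 0 2 a \<notin> K"
      using nab ac bd unfolding K_def \<beta>_def sc by (auto intro: conn_sym)
    define F where "F = (\<lambda>x. (x < b) \<noteq> (x < d))"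
    define L where "L = (\<lambda>w. w \<notin> K \<and> (\<forall>i. (w = (0, i) \<longrightarrow> P (Upper i) = F a) \<and>
        (w = (1, i) \<longrightarrow> P (Lower i) = F a \<and> Q (Upper i) = F a) \<and> (w = (2, i) \<longrightarrow> Q (Lower i) = F a)))"
    have Jp: "L (emb 0 1 x) \<longleftrightarrow> emb 0 1 x \<notin> K \<and> P x = F a" for x
      unfolding L_def using mid' by (cases x) auto
    have Jq: "L (emb 1 2 x) \<longleftrightarrow> emb 1 2 x \<notin> K \<and> Q x = F a" for x
      unfolding L_def using mid' by (cases x) auto
    have Jo: "L (emb 0 2 x) \<longleftrightarrow> emb 0 2 x \<notin> K \<and> F x = F a" for x
      unfolding L_def F_def using t l xo[of x b] xo[of x d] by (cases x) (auto simp: \<beta>_def)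
    have "(emb 0 2 a, emb 0 2 c) \<in> conn ?H" using ac unfolding sc by simp
    then have "L (emb 0 2 c)"
    proof (induction rule: conn_induct)
      case refl
      show ?case unfolding Jo using aK by simp
    next
      case (step v w B)
      have wK: "w \<notin> K" using step nK[of w v] conn_sym[OF conn_block[OF step(2-4)]] by (auto simp: L_def)
      from step(2) consider C where "C \<in> p" "B = emb 0 1 ` C" | C where "C \<in> q" "B = emb 1 2 ` C"
        unfolding stackH_def by auto
      then show ?case
      proof cases
        case 1
        then obtain y y' where y: "v = emb 0 1 y" "w = emb 0 1 y'" "y \<in> C" "y' \<in> C" using step by auto
        then show ?thesis using step.IH wK P[OF 1(1) y(3,4)] by (auto simp: Jp)
      next
        case 2
        then obtain y y' where y: "v = emb 1 2 y" "w = emb 1 2 y'" "y \<in> C" "y' \<in> C" using step by auto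
        then show ?thesis using step.IH wK Q[OF 2(1) y(3,4)] by (auto simp: Jq)
      qed
    qed
    then have "F c = F a" by (simp add: Jo)
    then show False using ord unfolding F_def by auto
  qed
qed

subsection \<open>Reflection\<close>

definition flip :: "point \<Rightarrow> point" where "flip = case_point Lower Upper"

lemma flip_simps [simp]: "flip (Upper i) = Lower i" "flip (Lower i) = Upper i"
  by (simp_all add: flip_def)

lemma flip_flip [simp]: "flip (flip x) = x" by (cases x) auto

lemma inj_flip: "inj flip" by (metis flip_flip injI)

lemma flip_less [simp]: "flip x < flip y \<longleftrightarrow> y < x" by (cases x; cases y) auto

lemma flip_points [simp]: "flip x \<in> points k l \<longleftrightarrow> x \<in> points l k" by (cases x) auto

lemma flip_image_points: "flip ` points k l = points l k"
  by (auto simp: points_def image_Un image_image)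

definition flipd :: "diagram \<Rightarrow> diagram" where "flipd p = (`) flip ` p"

lemma flipd_flipd [simp]: "flipd (flipd p) = p"
  by (simp add: flipd_def image_image)

lemma same_flipd: "same (flipd p) x y \<longleftrightarrow> same p (flip x) (flip y)"
  using same_image_inj[OF inj_flip, of p "flip x" "flip y"] by (simp add: flipd_def)

lemma flipd_Part: "p \<in> Part k l \<Longrightarrow> flipd p \<in> Part l k"
  using partition_on_image_inj[OF inj_flip, of "points k l" p]
  by (simp add: Part_def flipd_def flip_image_points)

lemma flipd_NC:
  assumes p: "p \<in> NC k l" shows "flipd p \<in> NC l k"
proof (rule NC_I)
  note P = Part_partition[OF NC_Part[OF p]]
  show "flipd p \<in> Part l k" using flipd_Part NC_Part p by blast
  fix a b c d assume s: "same (flipd p) a c" "same (flipd p) b d" and l: "a < b" "b < c" "c < d"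
  have "same p (flip d) (flip c)"
    by (rule nc_same[OF p, of _ "flip b" _ "flip a"])
      (use s l same_sym[of p] in \<open>auto simp: same_flipd\<close>)
  then have "same p (flip a) (flip d)" using s same_trans[OF P] same_sym[of p] by (metis same_flipd)
  then show "same (flipd p) a b" using s same_trans[OF P] same_sym[of p] by (metis same_flipd)
qed

lemma flipd_NC2: "p \<in> NC2 k l \<Longrightarrow> flipd p \<in> NC2 l k"
  unfolding NC2_def using flipd_NC card_image[OF inj_on_subset[OF inj_flip]]
  by (auto simp: flipd_def)

text \<open>A stack and its reflection are literally the same hypergraph with the rows read in
  opposite order, so the facts about reflected composites need no new component argument.\<close>

lemma stackH_flip: "stackH 2 1 0 (flipd p) (flipd q) = stackH 0 1 2 q p"
proof -
  have "emb a b (flip x) = emb b a x" for a b x by (cases x) auto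
  then have "(\<lambda>B. emb a b ` flip ` B) = (`) (emb b a)" for a b by (simp add: image_image)
  then show ?thesis by (auto simp: stackH_def flipd_def image_image)
qed

lemma composite_flipd:
  assumes p: "p \<in> Part k l" and q: "q \<in> Part l m"
  shows "composite (flipd p) (flipd q) = flipd (composite q p)" and "loops (flipd p) (flipd q) = loops q p"
proof -
  note p' = flipd_Part[OF p] and q' = flipd_Part[OF q]
  have C: "composite q p \<in> Part k m" by (rule composite_Part[of 0 1 2, OF _ _ _ p q]) auto
  have C': "composite (flipd p) (flipd q) \<in> Part m k" by (rule composite_Part[of 0 1 2, OF _ _ _ q' p']) auto
  have e: "emb 2 0 x = emb 0 2 (flip x)" for x by (cases x) auto
  show "composite (flipd p) (flipd q) = flipd (composite q p)"
  proof (rule partition_eqI[OF Part_partition[OF C'] Part_partition[OF flipd_Part[OF C]]])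
    fix x y
    have "same (composite (flipd p) (flipd q)) x y \<longleftrightarrow>
      x \<in> points m k \<and> y \<in> points m k \<and> (emb 2 0 x, emb 2 0 y) \<in> conn (stackH 2 1 0 (flipd p) (flipd q))"
      by (rule same_composite[OF _ _ _ q' p']) auto
    also have "\<dots> \<longleftrightarrow> same (flipd (composite q p)) x y"
      unfolding stackH_flip same_flipd e using same_composite[of 0 1 2, OF _ _ _ p q] by simp
    finally show "same (composite (flipd p) (flipd q)) x y = same (flipd (composite q p)) x y" .
  qed
  have "loops (flipd p) (flipd q) = card {K \<in> components (stackH 2 1 0 (flipd p) (flipd q)). K \<subseteq> {1} \<times> UNIV}"
    by (rule loops_emb[OF _ _ _ q' p']) auto
  also have "\<dots> = loops q p"
    unfolding stackH_flip by (rule loops_emb[OF _ _ _ p q, symmetric]) auto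
  finally show "loops (flipd p) (flipd q) = loops q p" .
qed

subsection \<open>Elementary diagrams\<close>

text \<open>Composition with an elementary \<open>q\<close> below: \<open>F\<close> is the class map
  of \<open>p\<close>, coarsened by the joins that \<open>q\<close> makes among the lower points,
  and \<open>\<beta>\<close> labels the new bottom row. A bottom point either hangs on an upper
  point of \<open>q\<close> and inherits its label, or carries a label that does not occur in
  \<open>p\<close>.\<close>

lemma composite_below:
  assumes p: "p \<in> Part j k" and q: "q \<in> Part k m"
    and F: "\<And>x y. same p x y \<Longrightarrow> F x = F y"
    and Q: "\<And>x y. same q x y \<Longrightarrow> case_point (\<lambda>i. F (Lower i)) \<beta> x = case_point (\<lambda>i. F (Lower i)) \<beta> y"
    and con: "\<And>x y. x \<in> points j k \<Longrightarrow> y \<in> points j k \<Longrightarrow> F x = F y \<Longrightarrow>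
        (emb 0 1 x, emb 0 1 y) \<in> conn (stackH 0 1 2 q p)"
    and bot: "\<And>i. i \<in> {1..m} \<Longrightarrow> (\<exists>i'. same q (Lower i) (Upper i')) \<or>
        \<beta> i \<notin> F ` points j k \<and> (\<forall>i'\<in>{1..m}. \<beta> i' = \<beta> i \<longrightarrow> same q (Lower i) (Lower i'))"
  shows "composite q p = kerp (points j m) (case_point (\<lambda>i. F (Upper i)) \<beta>)"
    and "loops q p = card ((\<lambda>i. F (Lower i)) ` {1..k} - ((\<lambda>i. F (Upper i)) ` {1..j} \<union> \<beta> ` {1..m}))"
proof -
  let ?H = "stackH 0 1 2 q p"
  let ?V = "{0::nat} \<times> {1..j} \<union> {1} \<times> {1..k} \<union> {2} \<times> {1..m}"
  define f where "f v = (if fst v = 0 then F (Upper (snd v)) else if fst v = 1 then F (Lower (snd v)) else \<beta> (snd v))"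
    for v :: "nat \<times> nat"
  have f1: "f (emb 0 1 x) = F x" for x by (cases x) (auto simp: f_def)
  have f2: "f (emb 1 2 x) = case_point (\<lambda>i. F (Lower i)) \<beta> x" for x by (cases x) (auto simp: f_def)
  have f3: "f (emb 0 2 x) = case_point (\<lambda>i. F (Upper i)) \<beta> x" for x by (cases x) (auto simp: f_def)
  have qH: "(emb 1 2 x, emb 1 2 y) \<in> conn ?H" if s: "same q x y" for x y
  proof -
    obtain B where "B \<in> q" "x \<in> B" "y \<in> B" using s by (auto simp: same_def)
    then show ?thesis by (intro conn_block[of "emb 1 2 ` B"]) (auto simp: stackH_def)
  qed
  have fc: "f u = f v" if "(u, v) \<in> conn ?H" for u v
    using that
  proof (rule conn_label)
    fix B u v assume B: "B \<in> ?H" "u \<in> B" "v \<in> B"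
    then consider C where "C \<in> p" "B = emb 0 1 ` C" | C where "C \<in> q" "B = emb 1 2 ` C"
      unfolding stackH_def by auto
    then show "f u = f v"
    proof cases
      case 1
      obtain x y where "u = emb 0 1 x" "v = emb 0 1 y" "x \<in> C" "y \<in> C" using B(2,3) unfolding 1(2) by blast
      then show ?thesis using F[of x y] 1 by (simp add: sameI f1)
    next
      case 2
      obtain x y where "u = emb 1 2 x" "v = emb 1 2 y" "x \<in> C" "y \<in> C" using B(2,3) unfolding 2(2) by blast
      then show ?thesis using Q[of x y] 2 by (simp add: sameI f2)
    qed
  qed
  have top: "\<exists>x\<in>points j k. u = emb 0 1 x" if "u \<in> {0} \<times> {1..j} \<union> {1} \<times> {1..k}" for u
    using that emb_image_points[of 0 1 j k] by (metis imageE)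
  have rep: "(\<exists>x\<in>points j k. (u, emb 0 1 x) \<in> conn ?H) \<or> f u \<notin> F ` points j k" if "u \<in> ?V" for u
  proof (cases "u \<in> {2} \<times> {1..m}")
    case True
    then obtain i where i: "u = (2, i)" "i \<in> {1..m}" by auto
    from bot[OF i(2)] show ?thesis
    proof
      assume "\<exists>i'. same q (Lower i) (Upper i')"
      then obtain i' where s: "same q (Lower i) (Upper i')" by auto
      then have "Lower i' \<in> points j k" using same_in[OF Part_partition[OF q] s] by auto
      moreover have "(u, emb 0 1 (Lower i')) \<in> conn ?H" using qH[OF s] i by simp
      ultimately show ?thesis by blast
    qed (use i in \<open>auto simp: f_def\<close>)
  next
    case False
    then have "u \<in> {0} \<times> {1..j} \<union> {1} \<times> {1..k}" using that by blast
    then obtain x where "x \<in> points j k" "u = emb 0 1 x" using top by blast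
    then show ?thesis using conn_refl[of u ?H] by blast
  qed
  have con': "(u, v) \<in> conn ?H" if uv: "u \<in> ?V" "v \<in> ?V" "f u = f v" for u v
  proof (cases "f u \<in> F ` points j k")
    case True
    obtain x y where xy: "x \<in> points j k" "(u, emb 0 1 x) \<in> conn ?H" "y \<in> points j k" "(v, emb 0 1 y) \<in> conn ?H"
      using rep[OF uv(1)] rep[OF uv(2)] True uv(3) by auto
    then have "F x = F y" using fc[OF xy(2)] fc[OF xy(4)] uv(3) by (simp add: f1)
    then show ?thesis using con[OF xy(1,3)] xy by (meson conn_sym conn_trans)
  next
    case False
    have "\<exists>i\<in>{1..m}. w = (2, i)" if "w \<in> ?V" "f w \<notin> F ` points j k" for w
    proof (cases "w \<in> {2} \<times> {1..m}")
      case False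
      then have "w \<in> {0} \<times> {1..j} \<union> {1} \<times> {1..k}" using that(1) by blast
      then obtain x where "x \<in> points j k" "w = emb 0 1 x" using top by blast
      then show ?thesis using that(2) by (simp add: f1)
    qed auto
    then obtain i i' where i: "i \<in> {1..m}" "u = (2, i)" "i' \<in> {1..m}" "v = (2, i')"
      using uv False by metis
    have "\<not> (\<exists>i'. same q (Lower i) (Upper i'))"
    proof
      assume "\<exists>i'. same q (Lower i) (Upper i')"
      then obtain i' where s: "same q (Lower i) (Upper i')" by auto
      then have "Lower i' \<in> points j k" using same_in[OF Part_partition[OF q] s] by auto
      moreover have "f u = F (Lower i')" using fc[OF qH[OF s]] i by (simp add: f_def)
      ultimately show False using False by auto
    qed
    then have "same q (Lower i) (Lower i')" using bot[OF i(1)] i uv(3) by (auto simp: f_def)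
    then show ?thesis using qH[of "Lower i" "Lower i'"] i by simp
  qed
  have l1: "\<And>x y. same p x y \<Longrightarrow> f (emb 0 1 x) = f (emb 0 1 y)" unfolding f1 by (rule F)
  have l2: "\<And>x y. same q x y \<Longrightarrow> f (emb 1 2 x) = f (emb 1 2 y)" unfolding f2 by (rule Q)
  have "composite q p = kerp (points j m) (\<lambda>x. f (emb 0 2 x))"
    by (rule composite_label(1)[OF _ _ _ p q l1 l2 con']) simp_all
  then show "composite q p = kerp (points j m) (case_point (\<lambda>i. F (Upper i)) \<beta>)" by (simp add: f3)
  have "loops q p = card (f ` ({1} \<times> {1..k}) - f ` ({0} \<times> {1..j} \<union> {2} \<times> {1..m}))"
    by (rule composite_label(2)[OF _ _ _ p q l1 l2 con']) simp_all
  moreover have img: "f ` ({r} \<times> A) = (\<lambda>i. f (r, i)) ` A" for r A by auto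
  then have "f ` ({1} \<times> {1..k}) = (\<lambda>i. F (Lower i)) ` {1..k}" "f ` ({0} \<times> {1..j}) = (\<lambda>i. F (Upper i)) ` {1..j}"
    "f ` ({2} \<times> {1..m}) = \<beta> ` {1..m}" by (simp_all add: img f_def)
  ultimately show "loops q p = card ((\<lambda>i. F (Lower i)) ` {1..k} - ((\<lambda>i. F (Upper i)) ` {1..j} \<union> \<beta> ` {1..m}))"
    by (simp only: image_Un)
qed

definition cls :: "'a set set \<Rightarrow> 'a \<Rightarrow> 'a set" where "cls p x = {z. same p x z}"

lemma cls_eq:
  assumes "partition_on A p" "same p x y" shows "cls p x = cls p y"
  using assms same_trans[OF assms(1)] same_sym[of p] unfolding cls_def by blast

lemma cls_eq_iff:
  assumes "partition_on A p" "x \<in> A" shows "cls p x = cls p y \<longleftrightarrow> same p x y"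
  using same_class_eq[OF assms] by (simp add: cls_def)

lemma kerp_cls: "p \<in> Part k l \<Longrightarrow> kerp (points k l) (cls p) = p"
  using kerp_same[OF Part_partition, of p k l] unfolding cls_def by simp

text \<open>For counting loops below an elementary diagram: every middle label, with at most one
  exception, reappears in an outer row, so there is at most one loop.\<close>

lemma image_Diff_eq:
  assumes "i \<in> A" "\<And>x. x \<in> A \<Longrightarrow> f x \<in> Y \<or> f x = f i"
  shows "f ` A - Y = (if f i \<in> Y then {} else {f i})"
proof (cases "f i \<in> Y")
  case True
  then have "f ` A \<subseteq> Y" using assms(2) by fastforce
  then show ?thesis using True by auto
next
  case False
  have "f ` A - Y \<subseteq> {f i}" using assms(2) by fastforce
  then show ?thesis using False assms(1) by auto
qed

lemma case_point_eta: "case_point (\<lambda>i. f (Upper i)) (\<lambda>i. f (Lower i)) = f"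
  by (auto simp: fun_eq_iff split: point.splits)

lemma same_above: "same p x y \<Longrightarrow> (emb a b x, emb a b y) \<in> conn (stackH a b c q p)"
proof -
  assume "same p x y"
  then obtain B where "B \<in> p" "x \<in> B" "y \<in> B" unfolding same_def by blast
  then show ?thesis by (intro conn_block[of "emb a b ` B"]) (auto simp: stackH_def)
qed

lemma same_below: "same q x y \<Longrightarrow> (emb b c x, emb b c y) \<in> conn (stackH a b c q p)"
proof -
  assume "same q x y"
  then obtain B where "B \<in> q" "x \<in> B" "y \<in> B" unfolding same_def by blast
  then show ?thesis by (intro conn_block[of "emb b c ` B"]) (auto simp: stackH_def)
qed

lemma id_diagram_kerp: "id_diagram n = kerp (points n n) (case_point id id)"
proof -
  have *: "{y \<in> points n n. case_point id id y = i} = {Upper i, Lower i}" if "i \<in> {1..n}" for i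
  proof (intro set_eqI)
    fix y show "y \<in> {y \<in> points n n. case_point id id y = i} \<longleftrightarrow> y \<in> {Upper i, Lower i}"
      using that by (cases y) auto
  qed
  show ?thesis
    unfolding kerp_def id_diagram_def points_def image_Un image_image
    using * by (auto simp: points_def image_iff)
qed

lemma kerp_NC_I:
  assumes "\<And>a b c d. a \<in> points k l \<Longrightarrow> b \<in> points k l \<Longrightarrow> c \<in> points k l \<Longrightarrow> d \<in> points k l \<Longrightarrow>
     f a = f c \<Longrightarrow> f b = f d \<Longrightarrow> a < b \<Longrightarrow> b < c \<Longrightarrow> c < d \<Longrightarrow> f a = f b"
  shows "kerp (points k l) f \<in> NC k l"
  by (rule NC_I) (use assms in \<open>auto simp del: in_points\<close>)

lemma id_diagram_NC: "id_diagram n \<in> NC n n"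
  unfolding id_diagram_kerp
proof (rule kerp_NC_I, goal_cases)
  case (1 a b c d) then show ?case by (cases a; cases b; cases c; cases d) auto
qed

lemma flipd_kerp: "flipd (kerp (points k l) f) = kerp (points l k) (f \<circ> flip)"
proof (rule partition_eqI)
  show "partition_on (points l k) (flipd (kerp (points k l) f))"
    by (rule Part_partition[OF flipd_Part]) simp
qed (auto simp: same_flipd partition_on_kerp)

lemma flipd_id [simp]: "flipd (id_diagram n) = id_diagram n"
proof -
  have "case_point id id \<circ> flip = case_point id id" by (auto simp: fun_eq_iff flip_def split: point.splits)
  then show ?thesis by (simp add: id_diagram_kerp flipd_kerp)
qed

lemma composite_id_left:
  assumes p: "p \<in> Part j k" shows "composite (id_diagram k) p = p" and "loops (id_diagram k) p = 0"
proof -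
  note P = Part_partition[OF p]
  have I: "id_diagram k \<in> Part k k" using id_diagram_NC NC_Part by blast
  note C = composite_below[OF p I, of "cls p" "\<lambda>i. cls p (Lower i)"]
  have "composite (id_diagram k) p = kerp (points j k) (case_point (\<lambda>i. cls p (Upper i)) (\<lambda>i. cls p (Lower i)))
    \<and> loops (id_diagram k) p = card ((\<lambda>i. cls p (Lower i)) ` {1..k} - ((\<lambda>i. cls p (Upper i)) ` {1..j} \<union> (\<lambda>i. cls p (Lower i)) ` {1..k}))"
  \<comment> \<open>Both conclusions of \<open>composite_below\<close> are proved at once, so each
    of its premises comes up twice and is shown twice.\<close>
  proof (rule conjI; rule C)
    fix x y
    show "same p x y \<Longrightarrow> cls p x = cls p y" by (rule cls_eq[OF P])
    show "same p x y \<Longrightarrow> cls p x = cls p y" by (rule cls_eq[OF P])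
    assume "same (id_diagram k) x y"
    then show "case_point (\<lambda>i. cls p (Lower i)) (\<lambda>i. cls p (Lower i)) x = case_point (\<lambda>i. cls p (Lower i)) (\<lambda>i. cls p (Lower i)) y"
      by (cases x; cases y) (auto simp: id_diagram_kerp)
    then show "case_point (\<lambda>i. cls p (Lower i)) (\<lambda>i. cls p (Lower i)) x = case_point (\<lambda>i. cls p (Lower i)) (\<lambda>i. cls p (Lower i)) y" .
  next
    fix x y assume "x \<in> points j k" "cls p x = cls p y"
    then have "same p x y" using cls_eq_iff[OF P] by blast
    then show "(emb 0 1 x, emb 0 1 y) \<in> conn (stackH 0 1 2 (id_diagram k) p)"
      by (rule same_above)
    then show "(emb 0 1 x, emb 0 1 y) \<in> conn (stackH 0 1 2 (id_diagram k) p)" .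
  next
    fix i assume i: "i \<in> {1..k}"
    have "same (id_diagram k) (Lower i) (Upper i)" using i by (auto simp: id_diagram_kerp)
    then show "(\<exists>i'. same (id_diagram k) (Lower i) (Upper i')) \<or> cls p (Lower i) \<notin> cls p ` points j k \<and>
        (\<forall>i'\<in>{1..k}. cls p (Lower i') = cls p (Lower i) \<longrightarrow> same (id_diagram k) (Lower i) (Lower i'))" by blast
    then show "(\<exists>i'. same (id_diagram k) (Lower i) (Upper i')) \<or> cls p (Lower i) \<notin> cls p ` points j k \<and>
        (\<forall>i'\<in>{1..k}. cls p (Lower i') = cls p (Lower i) \<longrightarrow> same (id_diagram k) (Lower i) (Lower i'))" .
  qed
  then show "composite (id_diagram k) p = p" "loops (id_diagram k) p = 0"
    using kerp_cls[OF p] by (simp_all add: case_point_eta)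
qed

lemma composite_id_right:
  assumes p: "p \<in> Part k l" shows "composite p (id_diagram k) = p" and "loops p (id_diagram k) = 0"
proof -
  have I: "id_diagram k \<in> Part k k" using id_diagram_NC NC_Part by blast
  have e: "flipd (composite p (id_diagram k)) = flipd p" "loops p (id_diagram k) = 0"
    using composite_id_left[OF flipd_Part[OF p]] composite_flipd[OF I p] by simp_all
  then show "composite p (id_diagram k) = p" by (metis flipd_flipd)
  show "loops p (id_diagram k) = 0" by fact
qed

text \<open>Apart from vertical strands, \<open>sdiag n i\<close> has the blocks \<open>{i}\<close>, \<open>{i'}\<close>, \<open>mdiag n i\<close> the block
  \<open>{i, i + 1, i', (i + 1)'}\<close>, and \<open>udiag n i\<close> the blocks \<open>{i, i + 1}\<close>, \<open>{i', (i + 1)'}\<close>.\<close>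

definition sdiag :: "nat \<Rightarrow> nat \<Rightarrow> diagram" where
  "sdiag n i = kerp (points n n)
     (case_point (\<lambda>j. if j = i then (1::nat, 0) else (0, j)) (\<lambda>j. if j = i then (2, 0) else (0, j)))"

definition mdiag :: "nat \<Rightarrow> nat \<Rightarrow> diagram" where
  "mdiag n i = kerp (points n n)
     (case_point (\<lambda>j. if j \<le> i then j else j - 1) (\<lambda>j. if j \<le> i then j else j - 1))"

definition udiag :: "nat \<Rightarrow> nat \<Rightarrow> diagram" where
  "udiag n i = kerp (points n n)
     (case_point (\<lambda>j. if j = i \<or> j = i + 1 then (1::nat, 0) else (0, j))
        (\<lambda>j. if j = i \<or> j = i + 1 then (2, 0) else (0, j)))"

lemma sdiag_NC: "sdiag n i \<in> NC n n"
  unfolding sdiag_def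
proof (rule kerp_NC_I, goal_cases)
  case (1 a b c d) then show ?case by (cases a; cases b; cases c; cases d) (auto split: if_splits)
qed

lemma mdiag_NC: "mdiag n i \<in> NC n n"
  unfolding mdiag_def
proof (rule kerp_NC_I, goal_cases)
  case (1 a b c d) then show ?case by (cases a; cases b; cases c; cases d) (auto split: if_splits)
qed

lemma udiag_NC: "udiag n i \<in> NC n n"
  unfolding udiag_def
proof (rule kerp_NC_I, goal_cases)
  case (1 a b c d) then show ?case by (cases a; cases b; cases c; cases d) (auto split: if_splits)
qed

lemma flipd_sdiag [simp]: "flipd (sdiag n i) = sdiag n i"
  unfolding sdiag_def flipd_kerp
proof (rule kerp_cong, goal_cases)
  case (1 x y) then show ?case by (cases x; cases y) (auto split: if_splits)
qed

lemma flipd_mdiag [simp]: "flipd (mdiag n i) = mdiag n i"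
  unfolding mdiag_def flipd_kerp
proof (rule kerp_cong, goal_cases)
  case (1 x y) then show ?case by (cases x; cases y) (auto split: if_splits)
qed

lemma flipd_udiag [simp]: "flipd (udiag n i) = udiag n i"
  unfolding udiag_def flipd_kerp
proof (rule kerp_cong, goal_cases)
  case (1 x y) then show ?case by (cases x; cases y) (auto split: if_splits)
qed

context
  fixes j k i :: nat and p :: diagram
  assumes p: "p \<in> Part j k" and i: "1 \<le> i" "i \<le> k"
begin

private lemma P: "partition_on (points j k) p" by (rule Part_partition[OF p])

text \<open>The lower point \<open>i'\<close> becomes isolated and receives the fresh label
  \<open>None\<close>.\<close>

private lemma comp_S:
  defines "\<beta> \<equiv> \<lambda>i'. if i' = i then None else Some (cls p (Lower i'))"
  shows "composite (sdiag k i) p = kerp (points j k) (case_point (\<lambda>i. Some (cls p (Upper i))) \<beta>)"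
    and "loops (sdiag k i) p = card ((\<lambda>i. Some (cls p (Lower i))) ` {1..k} - ((\<lambda>i. Some (cls p (Upper i))) ` {1..j} \<union> \<beta> ` {1..k}))"
proof -
  have 1: "Some (cls p x) = Some (cls p y)" if "same p x y" for x y
    using cls_eq[OF P that] by simp
  have 2: "case_point (\<lambda>i. Some (cls p (Lower i))) \<beta> x = case_point (\<lambda>i. Some (cls p (Lower i))) \<beta> y"
    if "same (sdiag k i) x y" for x y
    using that by (cases x; cases y) (auto simp: sdiag_def \<beta>_def split: if_splits)
  have 3: "(emb 0 1 x, emb 0 1 y) \<in> conn (stackH 0 1 2 (sdiag k i) p)"
    if "x \<in> points j k" "y \<in> points j k" "Some (cls p x) = Some (cls p y)" for x y
    using that cls_eq_iff[OF P, of x y] by (intro same_above) simp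
  have 4: "(\<exists>i''. same (sdiag k i) (Lower i') (Upper i'')) \<or> \<beta> i' \<notin> (\<lambda>x. Some (cls p x)) ` points j k \<and>
     (\<forall>i''\<in>{1..k}. \<beta> i'' = \<beta> i' \<longrightarrow> same (sdiag k i) (Lower i') (Lower i''))" if "i' \<in> {1..k}" for i'
  proof (cases "i' = i")
    case False
    then have "same (sdiag k i) (Lower i') (Upper i')" using that by (auto simp: sdiag_def)
    then show ?thesis by blast
  qed (use i in \<open>auto simp: \<beta>_def sdiag_def\<close>)
  show "composite (sdiag k i) p = kerp (points j k) (case_point (\<lambda>i. Some (cls p (Upper i))) \<beta>)"
    by (rule composite_below(1)[OF p NC_Part[OF sdiag_NC] 1 2 3 4])
  show "loops (sdiag k i) p = card ((\<lambda>i. Some (cls p (Lower i))) ` {1..k} - ((\<lambda>i. Some (cls p (Upper i))) ` {1..j} \<union> \<beta> ` {1..k}))"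
    by (rule composite_below(2)[OF p NC_Part[OF sdiag_NC] 1 2 3 4])
qed

lemma same_composite_S:
  "same (composite (sdiag k i) p) x y \<longleftrightarrow> x \<in> points j k \<and> y \<in> points j k \<and>
    (x = Lower i \<and> y = Lower i \<or> x \<noteq> Lower i \<and> y \<noteq> Lower i \<and> same p x y)"
proof -
  have "x \<in> points j k \<Longrightarrow> y \<in> points j k \<Longrightarrow>
     case_point (\<lambda>i. Some (cls p (Upper i))) (\<lambda>i'. if i' = i then None else Some (cls p (Lower i'))) x =
     case_point (\<lambda>i. Some (cls p (Upper i))) (\<lambda>i'. if i' = i then None else Some (cls p (Lower i'))) y
    \<longleftrightarrow> (x = Lower i \<and> y = Lower i \<or> x \<noteq> Lower i \<and> y \<noteq> Lower i \<and> cls p x = cls p y)"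
    by (cases x; cases y) auto
  then show ?thesis
    unfolding comp_S same_kerp using cls_eq_iff[OF P, of x y] by blast
qed

lemma loops_S: "loops (sdiag k i) p = (if \<exists>x. x \<noteq> Lower i \<and> same p x (Lower i) then 0 else 1)"
proof -
  let ?f = "\<lambda>i. Some (cls p (Lower i))"
  let ?\<beta> = "\<lambda>i'. if i' = i then None else ?f i'"
  let ?Y = "(\<lambda>i. Some (cls p (Upper i))) ` {1..j} \<union> ?\<beta> ` {1..k}"
  have a: "i \<in> {1..k}" using i by simp
  have b: "?f x \<in> ?Y \<or> ?f x = ?f i" if "x \<in> {1..k}" for x
  proof (cases "x = i")
    case False
    then show ?thesis using that by (intro disjI1 UnI2 image_eqI[of _ _ x]) auto
  qed (rule disjI2, simp only:)
  have X: "?f ` {1..k} - ?Y = (if ?f i \<in> ?Y then {} else {?f i})"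
    by (rule image_Diff_eq[of i "{1..k}" ?f ?Y]) (rule a, rule b)
  have "?f i \<in> ?Y \<longleftrightarrow> (\<exists>x. x \<noteq> Lower i \<and> same p x (Lower i))"
  proof
    assume "?f i \<in> ?Y"
    then obtain x where "x \<in> points j k" "x \<noteq> Lower i" "cls p x = cls p (Lower i)"
    proof (rule UnE)
      assume "?f i \<in> (\<lambda>i. Some (cls p (Upper i))) ` {1..j}"
      then show ?thesis using that[of "Upper _"] by auto
    next
      assume "?f i \<in> ?\<beta> ` {1..k}"
      then show ?thesis using that[of "Lower _"] by (auto split: if_splits)
    qed
    then show "\<exists>x. x \<noteq> Lower i \<and> same p x (Lower i)" using cls_eq_iff[OF P] by blast
  next
    assume "\<exists>x. x \<noteq> Lower i \<and> same p x (Lower i)"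
    then obtain x where x: "x \<noteq> Lower i" "same p x (Lower i)" by blast
    then have "cls p x = cls p (Lower i)" "x \<in> points j k" using cls_eq[OF P] same_in[OF P] by auto
    then show "?f i \<in> ?Y" using x(1) by (cases x) (auto simp: image_iff)
  qed
  then show ?thesis unfolding comp_S(2) by (subst X) (simp only: card.empty card_1_singleton_iff split: if_split, simp)
qed

end

context
  fixes j k i :: nat and p :: diagram
  assumes p: "p \<in> Part j k" and i: "1 \<le> i" "i < k"
begin

private lemma P': "partition_on (points j k) p" by (rule Part_partition[OF p])

text \<open>Both \<open>mdiag\<close> and \<open>udiag\<close> connect their upper points
  \<open>i\<close> and \<open>i + 1\<close>. \<open>G\<close> is the class map of \<open>p\<close>
  after this join and serves for both composites; \<open>merged\<close> is the resulting equivalence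
  relation.\<close>

private definition "G x = (if same p x (Lower (i + 1)) then cls p (Lower i) else cls p x)"

private definition "merged x y \<longleftrightarrow> same p x y \<or> same p x (Lower i) \<and> same p (Lower (i + 1)) y \<or>
    same p x (Lower (i + 1)) \<and> same p (Lower i) y"

private lemma G_eq: "x \<in> points j k \<Longrightarrow> y \<in> points j k \<Longrightarrow> G x = G y \<longleftrightarrow> merged x y"
proof -
  have l: "Lower i \<in> points j k" "Lower (i + 1) \<in> points j k" using i by auto
  have *: "cls p x = cls p y \<longleftrightarrow> same p x y" if "x \<in> points j k" for x y using cls_eq_iff[OF P' that] .
  note t = same_trans[OF P'] same_sym[of p]
  show "x \<in> points j k \<Longrightarrow> y \<in> points j k \<Longrightarrow> ?thesis"
    unfolding G_def merged_def using l * t by (smt (verit))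
qed

private lemma G_same: "same p x y \<Longrightarrow> G x = G y"
  using same_in[OF P', of x y] by (simp add: G_eq merged_def)

private lemma merged_conn:
  assumes "merged x y" and e: "((1, i), (1, i + 1)) \<in> conn (stackH 0 1 2 q p)"
  shows "(emb 0 1 x, emb 0 1 y) \<in> conn (stackH 0 1 2 q p)"
proof -
  have s: "(emb 0 1 x, emb 0 1 y) \<in> conn (stackH 0 1 2 q p)" if "same p x y" for x y
    by (rule same_above[OF that])
  have "same p x y \<Longrightarrow> ?thesis" by (rule s)
  moreover have "same p x (Lower i) \<Longrightarrow> same p (Lower (i + 1)) y \<Longrightarrow> ?thesis"
    using s[of x "Lower i"] s[of "Lower (i + 1)" y] conn_trans[OF conn_trans[OF _ e]] by simp
  moreover have "same p x (Lower (i + 1)) \<Longrightarrow> same p (Lower i) y \<Longrightarrow> ?thesis"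
    using s[of x "Lower (i + 1)"] s[of "Lower i" y] conn_trans[OF conn_trans[OF _ conn_sym[OF e]]] by simp
  ultimately show ?thesis using assms(1) unfolding merged_def by blast
qed

private lemma comp_M:
  shows "composite (mdiag k i) p = kerp (points j k) (case_point (\<lambda>i. G (Upper i)) (\<lambda>i. G (Lower i)))"
    and "loops (mdiag k i) p = card ((\<lambda>i. G (Lower i)) ` {1..k} - ((\<lambda>i. G (Upper i)) ` {1..j} \<union> (\<lambda>i. G (Lower i)) ` {1..k}))"
proof -
  have l: "Lower i \<in> points j k" "Lower (i + 1) \<in> points j k" using i by auto
  have gg: "G (Lower i) = G (Lower (i + 1))"
    using G_eq[OF l] same_refl[OF P'] l by (auto simp: merged_def)
  have 2: "case_point (\<lambda>i. G (Lower i)) (\<lambda>i. G (Lower i)) x = case_point (\<lambda>i. G (Lower i)) (\<lambda>i. G (Lower i)) y"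
    if xy: "same (mdiag k i) x y" for x y
  proof -
    have *: "G (Lower a) = G (Lower b)" if "(if a \<le> i then a else a - 1) = (if b \<le> i then b else b - 1)" "1 \<le> a" "1 \<le> b" for a b
    proof -
      have "a = b \<or> a = i \<and> b = i + 1 \<or> a = i + 1 \<and> b = i" using that by (auto split: if_splits)
      then show ?thesis using gg by auto
    qed
    have c: "case_point (\<lambda>i. G (Lower i)) (\<lambda>i. G (Lower i)) z = G (Lower (case_point id id z))" for z
      by (cases z) simp_all
    have l: "case_point (\<lambda>j. if j \<le> i then j else j - 1) (\<lambda>j. if j \<le> i then j else j - 1) z =
       (if case_point id id z \<le> i then case_point id id z else case_point id id z - 1)" for z
      by (cases z) simp_all
    have xy': "x \<in> points k k" "y \<in> points k k"
      "(if case_point id id x \<le> i then case_point id id x else case_point id id x - 1) =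
       (if case_point id id y \<le> i then case_point id id y else case_point id id y - 1)"
      using xy unfolding mdiag_def same_kerp l by blast+
    have "1 \<le> case_point id id z" if "z \<in> points k k" for z using that by (cases z) auto
    then show ?thesis unfolding c using *[OF xy'(3)] xy'(1,2) by blast
  qed
  have e: "((1, i), (1, i + 1)) \<in> conn (stackH 0 1 2 (mdiag k i) p)"
    using same_below[of "mdiag k i" "Upper i" "Upper (i + 1)" 1 2 0 p] i by (auto simp: mdiag_def)
  have 3: "(emb 0 1 x, emb 0 1 y) \<in> conn (stackH 0 1 2 (mdiag k i) p)"
    if "x \<in> points j k" "y \<in> points j k" "G x = G y" for x y
    using merged_conn[OF _ e] that G_eq by blast
  have 4: "(\<exists>i''. same (mdiag k i) (Lower i') (Upper i'')) \<or> G (Lower i') \<notin> G ` points j k \<and>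
     (\<forall>i''\<in>{1..k}. G (Lower i'') = G (Lower i') \<longrightarrow> same (mdiag k i) (Lower i') (Lower i''))" if "i' \<in> {1..k}" for i'
  proof -
    have "same (mdiag k i) (Lower i') (Upper i')" using that by (auto simp: mdiag_def)
    then show ?thesis by blast
  qed
  show "composite (mdiag k i) p = kerp (points j k) (case_point (\<lambda>i. G (Upper i)) (\<lambda>i. G (Lower i)))"
    by (rule composite_below(1)[OF p NC_Part[OF mdiag_NC] G_same 2 3 4])
  show "loops (mdiag k i) p = card ((\<lambda>i. G (Lower i)) ` {1..k} - ((\<lambda>i. G (Upper i)) ` {1..j} \<union> (\<lambda>i. G (Lower i)) ` {1..k}))"
    by (rule composite_below(2)[OF p NC_Part[OF mdiag_NC] G_same 2 3 4])
qed

lemma same_composite_M: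
  "same (composite (mdiag k i) p) x y \<longleftrightarrow> x \<in> points j k \<and> y \<in> points j k \<and>
    (same p x y \<or> same p x (Lower i) \<and> same p (Lower (i + 1)) y \<or>
    same p x (Lower (i + 1)) \<and> same p (Lower i) y)"
  unfolding comp_M case_point_eta same_kerp using G_eq unfolding merged_def by blast

lemma loops_M: "loops (mdiag k i) p = 0"
  unfolding comp_M by simp

private lemma comp_U:
  defines "F \<equiv> \<lambda>x. Some (G x)"
  defines "\<beta> \<equiv> \<lambda>i'. if i' = i \<or> i' = i + 1 then None else F (Lower i')"
  shows "composite (udiag k i) p = kerp (points j k) (case_point (\<lambda>i. F (Upper i)) \<beta>)"
    and "loops (udiag k i) p = card ((\<lambda>i. F (Lower i)) ` {1..k} - ((\<lambda>i. F (Upper i)) ` {1..j} \<union> \<beta> ` {1..k}))"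
proof -
  have l: "Lower i \<in> points j k" "Lower (i + 1) \<in> points j k" using i by auto
  have gg: "G (Lower i) = G (Lower (i + 1))"
    using G_eq[OF l] same_refl[OF P'] l by (auto simp: merged_def)
  have 1: "F x = F y" if "same p x y" for x y using G_same[OF that] by (simp add: F_def)
  have 2: "case_point (\<lambda>i. F (Lower i)) \<beta> x = case_point (\<lambda>i. F (Lower i)) \<beta> y" if "same (udiag k i) x y" for x y
    using that gg by (cases x; cases y) (auto simp: udiag_def F_def \<beta>_def split: if_splits)
  have e: "((1, i), (1, i + 1)) \<in> conn (stackH 0 1 2 (udiag k i) p)"
    using same_below[of "udiag k i" "Upper i" "Upper (i + 1)" 1 2 0 p] i by (auto simp: udiag_def)
  have 3: "(emb 0 1 x, emb 0 1 y) \<in> conn (stackH 0 1 2 (udiag k i) p)"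
    if "x \<in> points j k" "y \<in> points j k" "F x = F y" for x y
    using merged_conn[OF _ e] that G_eq unfolding F_def by blast
  have 4: "(\<exists>i''. same (udiag k i) (Lower i') (Upper i'')) \<or> \<beta> i' \<notin> F ` points j k \<and>
     (\<forall>i''\<in>{1..k}. \<beta> i'' = \<beta> i' \<longrightarrow> same (udiag k i) (Lower i') (Lower i''))" if "i' \<in> {1..k}" for i'
  proof (cases "i' = i \<or> i' = i + 1")
    case False
    then have "same (udiag k i) (Lower i') (Upper i')" using that by (auto simp: udiag_def)
    then show ?thesis by blast
  qed (use i in \<open>auto simp: \<beta>_def udiag_def F_def\<close>)
  show "composite (udiag k i) p = kerp (points j k) (case_point (\<lambda>i. F (Upper i)) \<beta>)"
    by (rule composite_below(1)[OF p NC_Part[OF udiag_NC] 1 2 3 4])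
  show "loops (udiag k i) p = card ((\<lambda>i. F (Lower i)) ` {1..k} - ((\<lambda>i. F (Upper i)) ` {1..j} \<union> \<beta> ` {1..k}))"
    by (rule composite_below(2)[OF p NC_Part[OF udiag_NC] 1 2 3 4])
qed

lemma same_composite_U:
  "same (composite (udiag k i) p) x y \<longleftrightarrow> x \<in> points j k \<and> y \<in> points j k \<and>
    (x \<in> {Lower i, Lower (i + 1)} \<and> y \<in> {Lower i, Lower (i + 1)} \<or>
     x \<notin> {Lower i, Lower (i + 1)} \<and> y \<notin> {Lower i, Lower (i + 1)} \<and>
    (same p x y \<or> same p x (Lower i) \<and> same p (Lower (i + 1)) y \<or>
    same p x (Lower (i + 1)) \<and> same p (Lower i) y))"
proof -
  have "x \<in> points j k \<Longrightarrow> y \<in> points j k \<Longrightarrow>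
     case_point (\<lambda>i. Some (G (Upper i))) (\<lambda>i'. if i' = i \<or> i' = i + 1 then None else Some (G (Lower i'))) x =
     case_point (\<lambda>i. Some (G (Upper i))) (\<lambda>i'. if i' = i \<or> i' = i + 1 then None else Some (G (Lower i'))) y
    \<longleftrightarrow> (x \<in> {Lower i, Lower (i + 1)} \<and> y \<in> {Lower i, Lower (i + 1)} \<or>
     x \<notin> {Lower i, Lower (i + 1)} \<and> y \<notin> {Lower i, Lower (i + 1)} \<and> G x = G y)"
    by (cases x; cases y) auto
  then show ?thesis
    unfolding comp_U same_kerp using G_eq[of x y] unfolding merged_def by blast
qed

lemma loops_U:
  "loops (udiag k i) p = (if \<exists>x. x \<notin> {Lower i, Lower (i + 1)} \<and> (same p x (Lower i) \<or> same p x (Lower (i + 1)))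
     then 0 else 1)"
proof -
  have l: "Lower i \<in> points j k" "Lower (i + 1) \<in> points j k" using i by auto
  have gg: "G (Lower i) = G (Lower (i + 1))"
    using G_eq[OF l] same_refl[OF P'] l by (auto simp: merged_def)
  let ?f = "\<lambda>i. Some (G (Lower i))"
  let ?\<beta> = "\<lambda>i'. if i' = i \<or> i' = i + 1 then None else ?f i'"
  let ?Y = "(\<lambda>i. Some (G (Upper i))) ` {1..j} \<union> ?\<beta> ` {1..k}"
  have a: "i \<in> {1..k}" using i by simp
  have b: "?f x \<in> ?Y \<or> ?f x = ?f i" if "x \<in> {1..k}" for x
  proof (cases "x = i \<or> x = i + 1")
    case False
    then show ?thesis using that by (intro disjI1 UnI2 image_eqI[of _ _ x]) auto
  next
    case True
    then have "G (Lower x) = G (Lower i)" using gg by (elim disjE) (simp_all only:)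
    then show ?thesis by (intro disjI2) (simp only:)
  qed
  have X: "?f ` {1..k} - ?Y = (if ?f i \<in> ?Y then {} else {?f i})"
    by (rule image_Diff_eq[of i "{1..k}" ?f ?Y]) (rule a, rule b)
  have m: "G x = G (Lower i) \<longleftrightarrow> same p x (Lower i) \<or> same p x (Lower (i + 1))" if "x \<in> points j k" for x
    using G_eq[OF that l(1)] same_refl[OF P'] l same_trans[OF P'] same_sym[of p] unfolding merged_def by blast
  have "?f i \<in> ?Y \<longleftrightarrow> (\<exists>x. x \<notin> {Lower i, Lower (i + 1)} \<and> (same p x (Lower i) \<or> same p x (Lower (i + 1))))"
  proof
    assume "?f i \<in> ?Y"
    then obtain x where "x \<in> points j k" "x \<notin> {Lower i, Lower (i + 1)}" "G x = G (Lower i)"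
    proof (rule UnE)
      assume "?f i \<in> (\<lambda>i. Some (G (Upper i))) ` {1..j}"
      then show ?thesis using that[of "Upper _"] by auto
    next
      assume "?f i \<in> ?\<beta> ` {1..k}"
      then show ?thesis using that[of "Lower _"] by (auto split: if_splits)
    qed
    then show "\<exists>x. x \<notin> {Lower i, Lower (i + 1)} \<and> (same p x (Lower i) \<or> same p x (Lower (i + 1)))"
      using m by blast
  next
    assume "\<exists>x. x \<notin> {Lower i, Lower (i + 1)} \<and> (same p x (Lower i) \<or> same p x (Lower (i + 1)))"
    then obtain x where x: "x \<notin> {Lower i, Lower (i + 1)}" "same p x (Lower i) \<or> same p x (Lower (i + 1))" by blast
    then have "x \<in> points j k" using same_in[OF P'] by blast
    then show "?f i \<in> ?Y" using x m[of x] by (cases x) (auto simp: image_iff)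
  qed
  then show ?thesis unfolding comp_U(2) by (subst X) (simp only: card.empty card_1_singleton_iff split: if_split, simp)
qed

end

lemma composite_S_absorb:
  assumes p: "p \<in> Part j k" and i: "1 \<le> i" "i \<le> k" and s: "\<And>x. same p x (Lower i) \<Longrightarrow> x = Lower i"
  shows "composite (sdiag k i) p = p" "loops (sdiag k i) p = 1"
proof -
  note P = Part_partition[OF p]
  have C: "composite (sdiag k i) p \<in> Part j k"
    by (rule composite_Part[of 0 1 2, OF _ _ _ p NC_Part[OF sdiag_NC]]) auto
  show "composite (sdiag k i) p = p"
    by (rule partition_eqI[OF Part_partition[OF C] P])
      (use s same_sym[of p] same_refl[OF P] in \<open>auto simp: same_composite_S[OF p i]\<close>)
  show "loops (sdiag k i) p = 1" using s by (auto simp: loops_S[OF p i])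
qed

lemma composite_M_absorb:
  assumes p: "p \<in> Part j k" and i: "1 \<le> i" "i < k" and s: "same p (Lower i) (Lower (i + 1))"
  shows "composite (mdiag k i) p = p"
proof -
  note P = Part_partition[OF p]
  have C: "composite (mdiag k i) p \<in> Part j k"
    by (rule composite_Part[of 0 1 2, OF _ _ _ p NC_Part[OF mdiag_NC]]) auto
  show ?thesis
    by (rule partition_eqI[OF Part_partition[OF C] P], unfold same_composite_M[OF p i])
      (use s same_sym[OF s] same_trans[OF P] in blast)
qed

text \<open>\<open>gdiag\<close> inserts the singleton \<open>{i'}\<close>, and \<open>hdiag\<close> splits strand \<open>i\<close> into a block with two lower points.\<close>

definition gdiag :: "nat \<Rightarrow> nat \<Rightarrow> diagram" where
  "gdiag n i = kerp (points n (n + 1)) (case_point (\<lambda>j. if j < i then j else j + 1) id)"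

definition hdiag :: "nat \<Rightarrow> nat \<Rightarrow> diagram" where
  "hdiag n i = kerp (points n (n + 1)) (case_point id (\<lambda>j. if j \<le> i then j else j - 1))"

lemma gdiag_NC: "gdiag n i \<in> NC n (n + 1)"
  unfolding gdiag_def
proof (rule kerp_NC_I, goal_cases)
  case (1 a b c d) then show ?case by (cases a; cases b; cases c; cases d) (auto split: if_splits)
qed

lemma hdiag_NC: "hdiag n i \<in> NC n (n + 1)"
  unfolding hdiag_def
proof (rule kerp_NC_I, goal_cases)
  case (1 a b c d) then show ?case by (cases a; cases b; cases c; cases d) (auto split: if_splits)
qed

text \<open>The induction that writes identities through the fattened idempotents needs the absorbed
  diagrams to factor over a smaller object. Here the point \<open>i\<close> is forgotten and then
  reinserted; in \<open>mdiag_factor\<close> two strands are merged and split again.\<close>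

lemma sdiag_factor:
  assumes "1 \<le> i" "i \<le> n + 1"
  shows "sdiag (n + 1) i = composite (gdiag n i) (flipd (gdiag n i))" "loops (gdiag n i) (flipd (gdiag n i)) = 0"
proof -
  let ?H = "stackH 0 1 2 (gdiag n i) (flipd (gdiag n i))"
  \<comment> \<open>Surviving strands are labelled by their position in the outer rows;
    \<open>(1, 0)\<close> and \<open>(2, 0)\<close> stand for the two singletons.\<close>
  define f :: "nat \<times> nat \<Rightarrow> nat \<times> nat" where
    "f = (\<lambda>(r, j). if r = 1 then (0, if j < i then j else j + 1)
        else if j = i then (if r = 0 then (1, 0) else (2, 0)) else (0, j))"
  note g = NC_Part[OF gdiag_NC[of n i]]
  note fg = flipd_Part[OF g]
  have 1: "f (emb 0 1 x) = f (emb 0 1 y)" if "same (flipd (gdiag n i)) x y" for x y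
    using that by (cases x; cases y) (auto simp: same_flipd gdiag_def f_def split: if_splits)
  have 2: "f (emb 1 2 x) = f (emb 1 2 y)" if "same (gdiag n i) x y" for x y
    using that by (cases x; cases y) (auto simp: gdiag_def f_def split: if_splits)
  let ?V = "{0::nat} \<times> {1..n + 1} \<union> {1} \<times> {1..n} \<union> {2} \<times> {1..n + 1}"
  have rep: "(u, (1, if c < i then c else c - 1)) \<in> conn ?H" if u: "u \<in> ?V" "f u = (0, c)" for u c
  proof -
    obtain r j where rj: "u = (r, j)" by (cases u)
    consider "r = 0" "j = c" "j \<noteq> i" | "r = 1" "c = (if j < i then j else j + 1)" | "r = 2" "j = c" "j \<noteq> i"
      using u unfolding rj f_def by (auto split: if_splits)
    then show ?thesis
    proof cases
      case 1
      then have "same (flipd (gdiag n i)) (Upper j) (Lower (if c < i then c else c - 1))"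
        using u assms unfolding rj by (auto simp: same_flipd gdiag_def)
      from same_above[OF this, of 0 1 2 "gdiag n i"] show ?thesis using 1 rj by simp
    next
      case 2
      then have "u = (1, if c < i then c else c - 1)" using rj by auto
      then show ?thesis by simp
    next
      case 3
      then have "same (gdiag n i) (Lower j) (Upper (if c < i then c else c - 1))"
        using u assms unfolding rj by (auto simp: gdiag_def)
      from same_below[OF this, of 1 2 0 "flipd (gdiag n i)"] show ?thesis using 3 rj by simp
    qed
  qed
  have 3: "(u, v) \<in> conn ?H" if uv: "u \<in> ?V" "v \<in> ?V" "f u = f v" for u v
  proof (cases "fst (f u) = 0")
    case True
    then obtain c where c: "f u = (0, c)" by (cases "f u") auto
    then show ?thesis using rep[OF uv(1) c] rep[OF uv(2), of c] uv(3) by (auto intro: conn_sym conn_trans[OF _ conn_sym])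
  next
    case False
    then have "u = v" using uv(3) by (cases u; cases v) (use uv in \<open>auto simp: f_def split: if_splits\<close>)
    then show ?thesis by simp
  qed
  have "composite (gdiag n i) (flipd (gdiag n i)) = kerp (points (n + 1) (n + 1)) (\<lambda>x. f (emb 0 2 x))"
    by (rule composite_label(1)[OF _ _ _ fg g 1 2 3]) simp_all
  also have "\<dots> = sdiag (n + 1) i"
    unfolding sdiag_def
  proof (rule kerp_cong, goal_cases)
    case (1 x y) then show ?case by (cases x; cases y) (auto simp: f_def)
  qed
  finally show "sdiag (n + 1) i = composite (gdiag n i) (flipd (gdiag n i))" by simp
  have "loops (gdiag n i) (flipd (gdiag n i)) =
    card (f ` ({1} \<times> {1..n}) - f ` ({0} \<times> {1..n + 1} \<union> {2} \<times> {1..n + 1}))"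
    by (rule composite_label(2)[OF _ _ _ fg g 1 2 3]) simp_all
  also have "f ` ({1} \<times> {1..n}) - f ` ({0} \<times> {1..n + 1} \<union> {2} \<times> {1..n + 1}) = {}"
  proof -
    have "f (1, j) = f (0, if j < i then j else j + 1)" for j by (auto simp: f_def)
    moreover have "(0, if j < i then j else j + 1) \<in> {0} \<times> {1..n + 1}" if "j \<in> {1..n}" for j using that by auto
    ultimately show ?thesis by blast
  qed
  finally show "loops (gdiag n i) (flipd (gdiag n i)) = 0" by simp
qed

lemma mdiag_factor:
  assumes "1 \<le> i" "i \<le> n"
  shows "mdiag (n + 1) i = composite (hdiag n i) (flipd (hdiag n i))" "loops (hdiag n i) (flipd (hdiag n i)) = 0"
proof -
  let ?H = "stackH 0 1 2 (hdiag n i) (flipd (hdiag n i))"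
  define f :: "nat \<times> nat \<Rightarrow> nat" where
    "f = (\<lambda>(r, j). if r = 1 \<or> j \<le> i then j else j - 1)"
  note g = NC_Part[OF hdiag_NC[of n i]]
  note fg = flipd_Part[OF g]
  have 1: "f (emb 0 1 x) = f (emb 0 1 y)" if "same (flipd (hdiag n i)) x y" for x y
    using that by (cases x; cases y) (auto simp: same_flipd hdiag_def f_def split: if_splits)
  have 2: "f (emb 1 2 x) = f (emb 1 2 y)" if "same (hdiag n i) x y" for x y
    using that by (cases x; cases y) (auto simp: hdiag_def f_def split: if_splits)
  let ?V = "{0::nat} \<times> {1..n + 1} \<union> {1} \<times> {1..n} \<union> {2} \<times> {1..n + 1}"
  have rep: "(u, (1, f u)) \<in> conn ?H" if u: "u \<in> ?V" for u
  proof -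
    obtain r j where rj: "u = (r, j)" by (cases u)
    consider "r = 0" | "r = 1" | "r = 2" using u rj by auto
    then show ?thesis
    proof cases
      case 1
      then have "same (flipd (hdiag n i)) (Upper j) (Lower (f u))"
        using u assms unfolding rj by (auto simp: same_flipd hdiag_def f_def)
      from same_above[OF this, of 0 1 2 "hdiag n i"] show ?thesis using 1 rj by simp
    next
      case 2
      then show ?thesis using rj by (simp add: f_def)
    next
      case 3
      then have "same (hdiag n i) (Lower j) (Upper (f u))"
        using u assms unfolding rj by (auto simp: hdiag_def f_def)
      from same_below[OF this, of 1 2 0 "flipd (hdiag n i)"] show ?thesis using 3 rj by simp
    qed
  qed
  have 3: "(u, v) \<in> conn ?H" if uv: "u \<in> ?V" "v \<in> ?V" "f u = f v" for u v
    using rep[OF uv(1)] rep[OF uv(2)] uv(3) by (auto intro: conn_trans[OF _ conn_sym])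
  have "composite (hdiag n i) (flipd (hdiag n i)) = kerp (points (n + 1) (n + 1)) (\<lambda>x. f (emb 0 2 x))"
    by (rule composite_label(1)[OF _ _ _ fg g 1 2 3]) simp_all
  also have "\<dots> = mdiag (n + 1) i"
    unfolding mdiag_def
  proof (rule kerp_cong, goal_cases)
    case (1 x y) then show ?case by (cases x; cases y) (auto simp: f_def)
  qed
  finally show "mdiag (n + 1) i = composite (hdiag n i) (flipd (hdiag n i))" by simp
  have "loops (hdiag n i) (flipd (hdiag n i)) =
    card (f ` ({1} \<times> {1..n}) - f ` ({0} \<times> {1..n + 1} \<union> {2} \<times> {1..n + 1}))"
    by (rule composite_label(2)[OF _ _ _ fg g 1 2 3]) simp_all
  also have "f ` ({1} \<times> {1..n}) - f ` ({0} \<times> {1..n + 1} \<union> {2} \<times> {1..n + 1}) = {}"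
  proof -
    have "f (1, j) = f (0, if j \<le> i then j else j + 1)" for j by (auto simp: f_def)
    moreover have "(0, if j \<le> i then j else j + 1) \<in> {0} \<times> {1..n + 1}" if "j \<in> {1..n}" for j using that by auto
    ultimately show ?thesis by blast
  qed
  finally show "loops (hdiag n i) (flipd (hdiag n i)) = 0" by simp
qed

subsection \<open>Reducible diagrams\<close>

text \<open>These are the two situations in which \<open>composite_S_absorb\<close> and
  \<open>composite_M_absorb\<close> apply. The condition looks at lower points; upper points are
  reached by reflection.\<close>

definition reducible :: "nat \<Rightarrow> diagram \<Rightarrow> bool" where
  "reducible k p \<longleftrightarrow> (\<exists>i. 1 \<le> i \<and> i \<le> k \<and> (\<forall>x. same p x (Lower i) \<longrightarrow> x = Lower i)) \<or>
     (\<exists>i. 1 \<le> i \<and> i < k \<and> same p (Lower i) (Lower (i + 1)))"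

lemma reducibleI:
  "1 \<le> i \<Longrightarrow> i \<le> k \<Longrightarrow> (\<And>x. same p x (Lower i) \<Longrightarrow> x = Lower i) \<Longrightarrow> reducible k p"
  "1 \<le> i \<Longrightarrow> i < k \<Longrightarrow> same p (Lower i) (Lower (i + 1)) \<Longrightarrow> reducible k p"
  by (auto simp: reducible_def)

text \<open>Innermost pair argument: \<open>i'\<close> and \<open>m'\<close> are not neighbours, and
  \<open>(i + 1)'\<close> is no singleton, so it has a partner. Non-crossing keeps this partner
  strictly between \<open>i'\<close> and \<open>m'\<close>, which gives a closer pair of the same
  kind.\<close>

lemma irreducible_lower_distinct:
  assumes p: "p \<in> NC j k" and n: "\<not> reducible k p" and "same p (Lower i) (Lower m)" "i < m"
  shows False
  using assms(3,4)
proof (induction "m - i" arbitrary: i m rule: less_induct)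
  case less
  note P = Part_partition[OF NC_Part[OF p]]
  have im: "1 \<le> i" "m \<le> k" using same_in[OF P less.prems(1)] by auto
  have ne: "m \<noteq> i + 1" using less.prems im n by (auto simp: reducible_def)
  then have lt: "i + 1 < m" using less.prems by simp
  obtain x where x: "same p x (Lower (i + 1))" "x \<noteq> Lower (i + 1)"
    using n reducibleI(1)[of "i + 1" k p] im lt by auto
  have d: "\<not> same p (Lower i) (Lower (i + 1))" using n im lt by (auto simp: reducible_def)
  \<comment> \<open>Any crossing of the pair \<open>i'\<close>, \<open>m'\<close> with the pair of
    \<open>(i + 1)'\<close> would put \<open>(i + 1)'\<close> into the block of
    \<open>i'\<close>.\<close>
  have nc: False if "same p a c" "same p b d'" "a < b" "b < c" "c < d'" "{a, c} = {Lower i, Lower m} \<or> {b, d'} = {Lower i, Lower m}"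
    "a = Lower (i + 1) \<or> b = Lower (i + 1) \<or> c = Lower (i + 1) \<or> d' = Lower (i + 1)" for a b c d'
  proof -
    have "same p a b" by (rule nc_same[OF p that(1-5)])
    then have "same p (Lower i) (Lower (i + 1))"
      using that(1,2,6,7) same_trans[OF P] same_sym[of p] by (smt (verit) doubleton_eq_iff)
    then show False using d by simp
  qed
  have s: "same p (Lower m) (Lower i)" using less.prems(1) by (rule same_sym)
  have s': "same p (Lower (i + 1)) x" using x(1) by (rule same_sym)
  have "x \<noteq> Lower i" using x d same_sym[of p] by auto
  moreover have "x \<noteq> Lower m" using x d s same_trans[OF P] same_sym[of p] by blast
  moreover have "\<not> x < Lower m"
    using nc[OF x(1) s, of] lt by auto
  moreover have "\<not> Lower i < x"
    using nc[OF s s'] lt by auto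
  ultimately have "Lower m < x" "x < Lower i" by auto
  then obtain q where q: "x = Lower q" "i < q" "q < m" by (cases x) auto
  then have "i + 1 < q" using x by (cases "q = i + 1") auto
  then have "q - (i + 1) < m - i" using q by linarith
  then show False by (rule less.hyps) (use q s' \<open>i + 1 < q\<close> in simp_all)
qed

text \<open>Every lower point is attached to some upper point \<open>u i\<close>, different lower
  points lie in different blocks, and non-crossing makes \<open>u\<close> strictly increasing from
  \<open>{1..k}\<close> into \<open>{1..j}\<close>. With \<open>j \<le> k\<close> only the identity
  is left.\<close>

lemma irreducible_id:
  assumes p: "p \<in> NC j k" and n: "\<not> reducible k p" and jk: "j \<le> k"
  shows "j = k \<and> p = id_diagram k"
proof -
  note P = Part_partition[OF NC_Part[OF p]]
  have "\<exists>u. same p (Lower i) (Upper u)" if i: "i \<in> {1..k}" for i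
  proof -
    have "1 \<le> i" "i \<le> k" using i by auto
    then obtain x where x: "same p x (Lower i)" "x \<noteq> Lower i"
      using n reducibleI(1)[of i k p] by blast
    show ?thesis
    proof (cases x)
      case (Upper u) then show ?thesis using same_sym[OF x(1)] by auto
    next
      case (Lower l)
      then have "l < i \<or> i < l" using x by auto
      then have False
        using irreducible_lower_distinct[OF p n] x same_sym[of p] Lower by blast
      then show ?thesis ..
    qed
  qed
  then obtain u where u: "\<And>i. i \<in> {1..k} \<Longrightarrow> same p (Lower i) (Upper (u i))" by metis
  have ur: "u i \<in> {1..j}" if "i \<in> {1..k}" for i using same_in[OF P u[OF that]] by auto
  have d: "\<not> same p (Lower i) (Lower m)" if "i < m" for i m using irreducible_lower_distinct[OF p n _ that] by blast
  have mono: "u i < u m" if im: "i \<in> {1..k}" "m \<in> {1..k}" "i < m" for i m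
  proof (rule ccontr)
    assume "\<not> u i < u m"
    then consider "u i = u m" | "u m < u i" by linarith
    then show False
    proof cases
      case 1
      then have "same p (Lower i) (Lower m)" using u[OF im(1)] u[OF im(2)] same_trans[OF P] same_sym[of p] by metis
      then show False using d im by blast
    next
      case 2
      have "same p (Upper (u m)) (Upper (u i))"
        by (rule nc_same[OF p same_sym[OF u[OF im(2)]] same_sym[OF u[OF im(1)]]]) (use 2 im in auto)
      then have "same p (Lower i) (Lower m)" using u[OF im(1)] u[OF im(2)] same_trans[OF P] same_sym[of p] by metis
      then show False using d im by blast
    qed
  qed
  have ge: "i \<le> u i" if "i \<in> {1..k}" for i
    using that
  proof (induction i)
    case (Suc i)
    then show ?case using mono[of i "Suc i"] ur[of "Suc i"] by (cases "i = 0") auto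
  qed simp
  \<comment> \<open>The same count from the right end; together with \<open>ge\<close> and
    \<open>j \<le> k\<close> it squeezes \<open>u i\<close> to \<open>i\<close>.\<close>
  have up: "u i + (k - i) \<le> j" if "i \<in> {1..k}" for i
    using that
  proof (induction "k - i" arbitrary: i)
    case 0
    then show ?case using ur[of i] by auto
  next
    case (Suc d)
    then have "u (Suc i) + (k - Suc i) \<le> j" by (intro Suc.hyps) auto
    moreover have "u i < u (Suc i)" using Suc by (intro mono) auto
    ultimately show ?case using Suc.hyps(2) by linarith
  qed
  have ui: "u i = i" if "i \<in> {1..k}" for i using ge[OF that] up[OF that] jk that by auto
  have jk': "j = k" using ge[of k] ur[of k] jk by (cases "k = 0") auto
  have "p = id_diagram k"
  proof (rule partition_eqI[OF P])
    show "partition_on (points j k) (id_diagram k)" using id_diagram_NC[of k] jk' by (simp add: NC_Part Part_partition)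
    fix x y assume xy: "x \<in> points j k" "y \<in> points j k"
    have r: "same p x (Lower (case_point id id x))" if "x \<in> points j k" for x
      using that u ui jk' same_refl[OF P] same_sym[of p] by (cases x) auto
    have dd: "same p (Lower a) (Lower b) \<longleftrightarrow> a = b" if "a \<in> {1..k}" for a b
      using d[of a b] d[of b a] same_sym[of p "Lower a" "Lower b"] same_refl[OF P, of "Lower a"] that by (cases a b rule: linorder_cases) auto
    have ran: "case_point id id x \<in> {1..k}" using xy jk' by (cases x) auto
    have "same p x y \<longleftrightarrow> same p (Lower (case_point id id x)) (Lower (case_point id id y))"
      using r[OF xy(1)] r[OF xy(2)] same_trans[OF P] same_sym[of p] by metis
    also have "\<dots> \<longleftrightarrow> case_point id id x = (case_point id id y :: nat)" using dd[OF ran] .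
    finally show "same p x y \<longleftrightarrow> same (id_diagram k) x y"
      using xy jk' by (simp add: id_diagram_kerp del: in_points)
  qed
  then show ?thesis using jk' by simp
qed

subsection \<open>Linear extension\<close>

lemma lookup_smult [simp]: "Poly_Mapping.lookup (smult c f) p = c * Poly_Mapping.lookup f p"
  by (simp add: smult_def Poly_Mapping.map.rep_eq when_def)

interpretation lin: vector_space smult
  by unfold_locales (auto intro!: poly_mapping_eqI simp: lookup_add algebra_simps)

lemma keys_smult: "Poly_Mapping.keys (smult c f) \<subseteq> Poly_Mapping.keys f"
  by (auto simp: in_keys_iff)

lemma lin_extend_superset:
  assumes "finite S" "Poly_Mapping.keys f \<subseteq> S"
  shows "lin_extend \<phi> f = (\<Sum>p\<in>S. smult (Poly_Mapping.lookup f p) (\<phi> p))"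
  unfolding lin_extend_def by (rule sum.mono_neutral_left[OF assms]) (auto simp: in_keys_iff)

lemma lin_extend_add: "lin_extend \<phi> (f + g) = lin_extend \<phi> f + lin_extend \<phi> g"
proof -
  let ?S = "Poly_Mapping.keys f \<union> Poly_Mapping.keys g"
  have "Poly_Mapping.keys (f + g) \<subseteq> ?S" by (rule Poly_Mapping.keys_add)
  then show ?thesis
    using lin_extend_superset[of ?S f] lin_extend_superset[of ?S g] lin_extend_superset[of ?S "f + g"]
    by (simp add: lookup_add lin.scale_left_distrib sum.distrib)
qed

lemma lin_extend_smult: "lin_extend \<phi> (smult c f) = smult c (lin_extend \<phi> f)"
  using lin_extend_superset[of "Poly_Mapping.keys f" "smult c f"] keys_smult[of c f]
  by (simp add: lin_extend_def lin.scale_sum_right)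

lemma lin_extend_basis [simp]: "lin_extend \<phi> (basis p) = \<phi> p"
  by (simp add: lin_extend_def basis_def)

lemma lin_extend_zero [simp]: "lin_extend \<phi> 0 = 0"
  by (simp add: lin_extend_def)

lemma lin_extend_fun_add: "lin_extend (\<lambda>p. \<phi> p + \<psi> p) f = lin_extend \<phi> f + lin_extend \<psi> f"
  by (simp add: lin_extend_def lin.scale_right_distrib sum.distrib)

lemma lin_extend_fun_smult: "lin_extend (\<lambda>p. smult c (\<phi> p)) f = smult c (lin_extend \<phi> f)"
  by (simp add: lin_extend_def lin.scale_sum_right mult.commute)

lemma comp0_add_left: "comp0 t (x + y) z = comp0 t x z + comp0 t y z"
  and comp0_smult_left: "comp0 t (smult c x) z = smult c (comp0 t x z)"
  and comp0_add_right: "comp0 t z (x + y) = comp0 t z x + comp0 t z y"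
  and comp0_smult_right: "comp0 t z (smult c x) = smult c (comp0 t z x)"
  and comp0_basis: "comp0 t (basis q) (basis p) = smult (t ^ loops q p) (basis (composite q p))"
  and comp0_zero_left [simp]: "comp0 t 0 z = 0"
  by (simp_all add: comp0_def bilin_extend_def lin_extend_add lin_extend_smult lin_extend_fun_add lin_extend_fun_smult)

lemma comp0_zero_right [simp]: "comp0 t z 0 = 0"
  using comp0_smult_right[of t z 0 0] by simp

lemma comp0_diff_left: "comp0 t (x - y) z = comp0 t x z - comp0 t y z"
  using comp0_add_left[of t "x - y" y z] by (simp add: algebra_simps)

lemma comp0_diff_right: "comp0 t z (x - y) = comp0 t z x - comp0 t z y"
  using comp0_add_right[of t z "x - y" y] by (simp add: algebra_simps)

lemma comp0_sum_left: "comp0 t (\<Sum>i\<in>I. f i) z = (\<Sum>i\<in>I. comp0 t (f i) z)"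
  by (induction I rule: infinite_finite_induct) (simp_all add: comp0_add_left)

lemma comp0_sum_right: "comp0 t z (\<Sum>i\<in>I. f i) = (\<Sum>i\<in>I. comp0 t z (f i))"
  by (induction I rule: infinite_finite_induct) (simp_all add: comp0_add_right)

lemma Hom0_zero [simp]: "0 \<in> Hom0 C k l" by (simp add: Hom0_def)

lemma Hom0_add: "x \<in> Hom0 C k l \<Longrightarrow> y \<in> Hom0 C k l \<Longrightarrow> x + y \<in> Hom0 C k l"
  using Poly_Mapping.keys_add[of x y] by (auto simp: Hom0_def)

lemma Hom0_smult: "x \<in> Hom0 C k l \<Longrightarrow> smult c x \<in> Hom0 C k l"
  using keys_smult[of c x] by (auto simp: Hom0_def)

lemma Hom0_diff: "x \<in> Hom0 C k l \<Longrightarrow> y \<in> Hom0 C k l \<Longrightarrow> x - y \<in> Hom0 C k l"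
  using Hom0_add[OF _ Hom0_smult[of y C k l "-1"], of x] by (simp add: lin.scale_minus_left)

lemma Hom0_sum: "(\<And>i. i \<in> I \<Longrightarrow> f i \<in> Hom0 C k l) \<Longrightarrow> (\<Sum>i\<in>I. f i) \<in> Hom0 C k l"
  by (induction I rule: infinite_finite_induct) (simp_all add: Hom0_add)

lemma keys_basis [simp]: "Poly_Mapping.keys (basis p) = {p}" by (simp add: basis_def)

lemma basis_Hom0 [simp]: "basis p \<in> Hom0 C k l \<longleftrightarrow> p \<in> C k l" by (simp add: Hom0_def)

lemma lookup_basis: "Poly_Mapping.lookup (basis p) q = (if p = q then 1 else 0)"
  by (simp add: basis_def lookup_single when_def)

lemma lin_expand: "x = (\<Sum>p\<in>Poly_Mapping.keys x. smult (Poly_Mapping.lookup x p) (basis p))"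
proof (rule poly_mapping_eqI)
  fix q
  have "Poly_Mapping.lookup (\<Sum>p\<in>Poly_Mapping.keys x. smult (Poly_Mapping.lookup x p) (basis p)) q
     = (\<Sum>p\<in>Poly_Mapping.keys x. if p = q then Poly_Mapping.lookup x p else 0)"
    by (simp add: lookup_sum lookup_basis if_distrib cong: if_cong)
  also have "\<dots> = Poly_Mapping.lookup x q" by (simp add: sum.delta' in_keys_iff)
  finally show "Poly_Mapping.lookup x q = Poly_Mapping.lookup (\<Sum>p\<in>Poly_Mapping.keys x. smult (Poly_Mapping.lookup x p) (basis p)) q" ..
qed

text \<open>Reduces linear identities to basis diagrams; multilinear ones are obtained by nesting
  it.\<close>

lemma Hom0_induct [consumes 1, case_names zero basis add smult]:
  assumes x: "x \<in> Hom0 C k l"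
    and "P 0" "\<And>p. p \<in> C k l \<Longrightarrow> P (basis p)" "\<And>x y. P x \<Longrightarrow> P y \<Longrightarrow> P (x + y)" "\<And>c x. P x \<Longrightarrow> P (smult c x)"
  shows "P x"
proof -
  have "P (\<Sum>p\<in>S. smult (Poly_Mapping.lookup x p) (basis p))" if "finite S" "S \<subseteq> C k l" for S
    using that by (induction S) (use assms in auto)
  from this[of "Poly_Mapping.keys x"] show ?thesis
    using x lin_expand[of x] by (simp add: Hom0_def)
qed

lemma NC2_sub: "x \<in> Hom0 NC2 k l \<Longrightarrow> x \<in> Hom0 NC k l"
  using NC2_NC by (auto simp: Hom0_def)

lemma comp0_NC: "g \<in> Hom0 NC l m \<Longrightarrow> f \<in> Hom0 NC k l \<Longrightarrow> comp0 t g f \<in> Hom0 NC k m"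
proof (induction rule: Hom0_induct)
  case (basis q)
  note q = \<open>q \<in> _\<close>
  from \<open>f \<in> _\<close> show ?case
  proof (induction rule: Hom0_induct)
    case (basis p)
    show ?case unfolding comp0_basis by (rule Hom0_smult) (simp add: composite_NC[OF basis q])
  qed (auto simp: comp0_add_right comp0_smult_right intro: Hom0_add Hom0_smult)
qed (auto simp: comp0_add_left comp0_smult_left intro: Hom0_add Hom0_smult)

lemma comp0_assoc:
  assumes "h \<in> Hom0 NC m n" "g \<in> Hom0 NC l m" "f \<in> Hom0 NC k l"
  shows "comp0 t (comp0 t h g) f = comp0 t h (comp0 t g f)"
  using assms(1)
proof (induction rule: Hom0_induct)
  case (basis r)
  show ?case
    using assms(2)
  proof (induction rule: Hom0_induct)
    case (basis q)
    show ?case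
      using assms(3)
    proof (induction rule: Hom0_induct)
      case (basis p)
      note P = NC_Part[OF \<open>p \<in> _\<close>] NC_Part[OF \<open>q \<in> _\<close>] NC_Part[OF \<open>r \<in> _\<close>]
      show ?case
        using loops_assoc[OF P] composite_assoc[OF P]
        by (simp add: comp0_basis comp0_smult_left comp0_smult_right power_add[symmetric] add.commute)
    qed (simp_all add: comp0_add_right comp0_smult_right)
  qed (simp_all add: comp0_add_right comp0_smult_right comp0_add_left comp0_smult_left)
qed (simp_all add: comp0_add_left comp0_smult_left)

lemma id0_NC: "id0 k \<in> Hom0 NC k k" by (simp add: id0_def id_diagram_NC)

lemma comp0_id_left: "x \<in> Hom0 NC k l \<Longrightarrow> comp0 t (id0 l) x = x"
  by (induction rule: Hom0_induct)
    (simp_all add: id0_def comp0_basis comp0_add_right comp0_smult_right composite_id_left[OF NC_Part])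

lemma comp0_id_right: "x \<in> Hom0 NC k l \<Longrightarrow> comp0 t x (id0 k) = x"
  by (induction rule: Hom0_induct)
    (simp_all add: id0_def comp0_basis comp0_add_left comp0_smult_left composite_id_right[OF NC_Part])

definition flip0 :: "lin \<Rightarrow> lin" where "flip0 = lin_extend (\<lambda>p. basis (flipd p))"

lemma flip0_simps [simp]:
  "flip0 (x + y) = flip0 x + flip0 y" "flip0 (smult c x) = smult c (flip0 x)" "flip0 (basis p) = basis (flipd p)" "flip0 0 = 0"
  by (simp_all add: flip0_def lin_extend_add lin_extend_smult)

lemma flip0_NC: "x \<in> Hom0 NC k l \<Longrightarrow> flip0 x \<in> Hom0 NC l k"
  by (induction rule: Hom0_induct) (auto intro: Hom0_add Hom0_smult flipd_NC)

lemma flip0_NC2: "x \<in> Hom0 NC2 k l \<Longrightarrow> flip0 x \<in> Hom0 NC2 l k"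
  by (induction rule: Hom0_induct) (auto intro: Hom0_add Hom0_smult flipd_NC2)

lemma flip0_flip0 [simp]: "flip0 (flip0 x) = x"
proof -
  \<comment> \<open>The family of all diagrams makes \<open>Hom0_induct\<close> available for an
    arbitrary \<open>x\<close>.\<close>
  have "x \<in> Hom0 (\<lambda>_ _. UNIV) 0 0" by (simp add: Hom0_def)
  then show ?thesis by (induction rule: Hom0_induct) simp_all
qed

lemma flip0_comp0:
  assumes "g \<in> Hom0 NC l m" "f \<in> Hom0 NC k l"
  shows "flip0 (comp0 t g f) = comp0 t (flip0 f) (flip0 g)"
  using assms(1)
proof (induction rule: Hom0_induct)
  case (basis q)
  show ?case
    using assms(2)
  proof (induction rule: Hom0_induct)
    case (basis p)
    then show ?case
      using composite_flipd[OF NC_Part[OF \<open>p \<in> _\<close>] NC_Part[OF \<open>q \<in> _\<close>]] by (simp add: comp0_basis)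
  qed (simp_all add: comp0_add_right comp0_smult_right comp0_add_left comp0_smult_left)
qed (simp_all add: comp0_add_left comp0_smult_left comp0_add_right comp0_smult_right)

subsection \<open>Perfect matchings\<close>

definition matching :: "'a set \<Rightarrow> 'a set set \<Rightarrow> bool" where
  "matching A d \<longleftrightarrow> partition_on A d \<and> (\<forall>B\<in>d. card B = 2)"

definition mate :: "'a set set \<Rightarrow> 'a \<Rightarrow> 'a" where
  "mate d x = (THE y. y \<noteq> x \<and> same d x y)"

lemma matchingI:
  assumes "partition_on A d" "\<And>x. x \<in> A \<Longrightarrow> \<exists>y. y \<noteq> x \<and> (\<forall>z. same d x z \<longleftrightarrow> z = x \<or> z = y)"
  shows "matching A d"
  unfolding matching_def
proof (intro conjI ballI)
  fix B assume B: "B \<in> d"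
  then have "B \<noteq> {}" using assms(1) by (auto simp: partition_on_def)
  then obtain x where x: "x \<in> B" by auto
  then have "x \<in> A" using B assms(1) by (auto simp: partition_on_def)
  then obtain y where y: "y \<noteq> x" "\<And>z. same d x z \<longleftrightarrow> z = x \<or> z = y" using assms(2) by metis
  have "B = {z. same d x z}" by (rule same_block[OF assms(1) B x])
  also have "\<dots> = {x, y}" using y(2) by auto
  finally show "card B = 2" using y(1) by simp
qed (rule assms)

context
  fixes A :: "'a set" and d
  assumes d: "matching A d"
begin

lemma matching_partition: "partition_on A d" using d by (simp add: matching_def)

lemma same_mate: "x \<in> A \<Longrightarrow> same d x y \<longleftrightarrow> y = x \<or> y = mate d x"
  and mate_ne: "x \<in> A \<Longrightarrow> mate d x \<noteq> x"
proof -
  assume x: "x \<in> A"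
  have "{y. same d x y} \<in> d" "x \<in> {y. same d x y}"
    using block_in[OF matching_partition x] same_refl[OF matching_partition x] by auto
  then have "card {y. same d x y} = 2" using d by (simp add: matching_def)
  then obtain u v where "{y. same d x y} = {u, v}" "u \<noteq> v" by (auto simp: card_2_iff)
  then obtain y where y: "y \<noteq> x" "{y. same d x y} = {x, y}" using \<open>x \<in> {y. same d x y}\<close>
    by (metis insertE insert_commute singletonD)
  then have "mate d x = y" unfolding mate_def by (intro the_equality) auto
  then show "mate d x \<noteq> x" "same d x y \<longleftrightarrow> y = x \<or> y = mate d x" for y using y by auto
qed

lemma mate_in: "x \<in> A \<Longrightarrow> mate d x \<in> A"
  using same_mate[of x "mate d x"] same_in[OF matching_partition] by blast

lemma mate_mate: "x \<in> A \<Longrightarrow> mate d (mate d x) = x"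
  using same_mate[of x "mate d x"] same_mate[of "mate d x" x] same_sym[of d x "mate d x"] mate_in[of x] mate_ne[of x]
  by auto

lemma mate_eq_iff: "x \<in> A \<Longrightarrow> y \<in> A \<Longrightarrow> mate d x = y \<longleftrightarrow> x = mate d y"
  using mate_mate by auto

end

lemma mate_eqI: "matching A d \<Longrightarrow> same d x y \<Longrightarrow> y \<noteq> x \<Longrightarrow> mate d x = y"
  using same_mate[of A d x y] same_in[OF matching_partition, of A d x y] by auto

lemma matching_eqI:
  assumes "matching A d" "matching A d'" "\<And>x. x \<in> A \<Longrightarrow> mate d x = mate d' x" shows "d = d'"
  by (rule partition_eqI[OF matching_partition[OF assms(1)] matching_partition[OF assms(2)]])
    (simp add: same_mate[OF assms(1)] same_mate[OF assms(2)] assms(3))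

lemma NC2_matching: "p \<in> NC2 k l \<Longrightarrow> matching (points k l) p"
  by (simp add: matching_def NC2_def NC_def Part_def)

lemma NC2_I: "p \<in> NC k l \<Longrightarrow> matching (points k l) p \<Longrightarrow> p \<in> NC2 k l"
  by (simp add: matching_def NC2_def)

text \<open>The blocks of \<open>a\<close> and \<open>b\<close>, with \<open>a\<close> and \<open>b\<close> removed, are joined, and \<open>{a, b}\<close> becomes a block.\<close>

definition rejoin :: "'a \<Rightarrow> 'a \<Rightarrow> 'a set set \<Rightarrow> 'a set set" where
  "rejoin a b p = kerp (\<Union>p) (\<lambda>x. if x = a \<or> x = b then None else Some (if same p x b then cls p a else cls p x))"

lemma same_rejoin:
  assumes p: "partition_on A p" and ab: "a \<in> A" "b \<in> A"
  shows "same (rejoin a b p) x y \<longleftrightarrow> x \<in> A \<and> y \<in> A \<and>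
    (x \<in> {a, b} \<and> y \<in> {a, b} \<or> x \<notin> {a, b} \<and> y \<notin> {a, b} \<and>
      (same p x y \<or> same p x a \<and> same p b y \<or> same p x b \<and> same p a y))"
proof -
  have "\<Union>p = A" using p by (auto simp: partition_on_def)
  moreover have "(if same p x b then cls p a else cls p x) = (if same p y b then cls p a else cls p y) \<longleftrightarrow>
     (same p x y \<or> same p x a \<and> same p b y \<or> same p x b \<and> same p a y)" if "x \<in> A" "y \<in> A"
    using cls_eq_iff[OF p that(1)] cls_eq_iff[OF p ab(1)] same_trans[OF p] same_sym[of p] by (smt (verit))
  ultimately show ?thesis unfolding rejoin_def same_kerp
    by (cases "x \<in> {a, b}"; cases "y \<in> {a, b}") (simp_all split del: if_split cong: conj_cong)
qed

lemma rejoin_partition: "partition_on A p \<Longrightarrow> partition_on A (rejoin a b p)"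
  using partition_on_kerp[of "\<Union>p"] unfolding rejoin_def partition_on_def by metis

context
  fixes A :: "'a set" and d and a b :: 'a
  assumes d: "matching A d" and ab: "a \<in> A" "b \<in> A" "a \<noteq> b"
begin

private lemma mA: "x \<in> A \<Longrightarrow> mate d x \<in> A" "x \<in> A \<Longrightarrow> mate d x \<noteq> x" "x \<in> A \<Longrightarrow> mate d (mate d x) = x"
  using mate_in[OF d] mate_ne[OF d] mate_mate[OF d] by auto

private definition "m' x = (if mate d a = b then mate d x else if x = a then b else if x = b then a
    else if x = mate d a then mate d b else if x = mate d b then mate d a else mate d x)"

private lemma m'_ne: "x \<in> A \<Longrightarrow> m' x \<noteq> x"
  unfolding m'_def using mA ab by (smt (verit))

private lemma same_rejoin_mate:
  assumes x: "x \<in> A" shows "same (rejoin a b d) x y \<longleftrightarrow> y = x \<or> y = m' x"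
proof -
  have 1: "same d u v \<longleftrightarrow> v = u \<or> v = mate d u" if "u \<in> A" for u v using same_mate[OF d that] .
  have "y \<in> A" if "y = x \<or> y = m' x" using that x mA ab by (auto simp: m'_def)
  then show ?thesis
    unfolding same_rejoin[OF matching_partition[OF d] ab(1,2)] m'_def
    using 1[OF x] 1[OF ab(1)] 1[OF ab(2)] mA[OF x] mA[OF ab(1)] mA[OF ab(2)] ab x by (smt (verit) insert_iff singleton_iff)
qed

lemma matching_rejoin: "matching A (rejoin a b d)"
  by (rule matchingI[OF rejoin_partition[OF matching_partition[OF d]]])
    (use same_rejoin_mate m'_ne in metis)

lemma mate_rejoin: "x \<in> A \<Longrightarrow> mate (rejoin a b d) x = (if mate d a = b then mate d x else if x = a then b else if x = b then a
    else if x = mate d a then mate d b else if x = mate d b then mate d a else mate d x)"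
  using mate_eqI[OF matching_rejoin, of x "m' x"] same_rejoin_mate[of x "m' x"] m'_ne[of x] by (simp add: m'_def)

lemma rejoin_id: "mate d a = b \<Longrightarrow> rejoin a b d = d"
  by (rule matching_eqI[OF matching_rejoin d]) (simp add: mate_rejoin)

end

text \<open>The relation \<open>u_i u_(i+1) u_i = u_i\<close> on the level of pairings: pairing
  \<open>b\<close> with \<open>c\<close> sends the old partner \<open>a\<close> of \<open>b\<close>
  to the partner of \<open>c\<close>, and pairing \<open>a\<close> with \<open>b\<close> again
  undoes this.\<close>

lemma rejoin_rejoin:
  assumes d: "matching A d" and abc: "a \<in> A" "b \<in> A" "c \<in> A" "a \<noteq> b" "b \<noteq> c" "a \<noteq> c" and m: "mate d a = b"
  shows "rejoin a b (rejoin b c d) = d"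
proof -
  note m1 = matching_rejoin[OF d abc(2,3,5)]
  note m2 = matching_rejoin[OF m1 abc(1,2,4)]
  have mb: "mate d b = a" using mate_mate[OF d abc(1)] m by simp
  note mc = mate_in[OF d abc(3)] mate_ne[OF d abc(3)] mate_mate[OF d abc(3)]
  have mcn: "mate d c \<noteq> a" "mate d c \<noteq> b" using mc m mb abc by auto
  show ?thesis
    by (rule matching_eqI[OF m2 d])
      (use abc m mb mc mcn in \<open>auto simp: mate_rejoin[OF m1 abc(1,2,4)] mate_rejoin[OF d abc(2,3,5)]\<close>)
qed

text \<open>\<open>a\<close> and \<open>b\<close> are neighbours, so every other point sees them on
  the same side. The new chord between their partners is therefore the sum mod 2 of the chords at
  \<open>a\<close> and at \<open>b\<close>, and inherits from them that it separates no other pair.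
  The chord \<open>a b\<close> itself separates nothing.\<close>

lemma rejoin_NC:
  assumes p: "p \<in> NC2 k l" and ab: "a \<in> points k l" "b \<in> points k l" "a < b"
    and adj: "\<And>z. z \<in> points k l \<Longrightarrow> \<not> (a < z \<and> z < b)"
  shows "rejoin a b p \<in> NC2 k l"
proof (cases "mate p a = b")
  case True
  then show ?thesis using rejoin_id[OF NC2_matching[OF p] ab(1,2)] ab p by simp
next
  case False
  note d = NC2_matching[OF p]
  have ne: "a \<noteq> b" using ab by simp
  note m = matching_rejoin[OF d ab(1,2) ne]
  note P = matching_partition[OF d]
  have "rejoin a b p \<in> NC k l"
  proof (rule NC_I)
    show "rejoin a b p \<in> Part k l" using matching_partition[OF m] by (simp add: Part_def)
    fix x y x' y' assume s: "same (rejoin a b p) x x'" "same (rejoin a b p) y y'" and o: "x < y" "y < x'" "x' < y'"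
    note sr = same_rejoin[OF P ab(1,2)]
    \<comment> \<open>Mod 2 form of non-crossing: \<open>w\<close> and \<open>z\<close> lie on the
      same side of the chord \<open>u v\<close>.\<close>
    define sep where "sep = (\<lambda>u v w z. ((w::point) < u) = (w < v) \<longleftrightarrow> (z < u) = (z < v))"
    have nc: "sep u v w z" if uvwz: "same p u v" "same p w z" "\<not> same p u w" for u v w z
    proof -
      obtain B B' where B: "B \<in> p" "u \<in> B" "v \<in> B" "B' \<in> p" "w \<in> B'" "z \<in> B'"
        using uvwz(1,2) by (auto simp: same_def)
      then have "B \<noteq> B'" using uvwz(3) by (auto intro: sameI)
      then have "B' \<inter> B = {}" using partition_unique[OF P] B by blast
      then show ?thesis unfolding sep_def using nc_sep[of p B' B w z u v] p B by (auto simp: NC2_def NC_def)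
    qed
    have pts: "x \<in> points k l" "x' \<in> points k l" "y \<in> points k l" "y' \<in> points k l"
      using s unfolding sr by blast+
    show "same (rejoin a b p) x y"
    proof (rule ccontr)
      assume nxy: "\<not> same (rejoin a b p) x y"
      \<comment> \<open>a block of the rejoined matching is a block of \<open>p\<close>, the pair \<open>a b\<close>, or consists of mates of \<open>a\<close> and \<open>b\<close>;
          in the last case we compare with the blocks of \<open>a\<close> and \<open>b\<close>\<close>
      have ab': "(z < a) = (z < b)" if "z \<in> points k l" "z \<notin> {a, b}" for z
        using adj[OF that(1)] that(2) ab(3) by (metis insertI1 insertI2 less_trans linorder_less_linear singletonI)
      have ba': "(a < z) = (b < z)" if "z \<in> points k l" "z \<notin> {a, b}" for z
        using adj[OF that(1)] that(2) ab(3) by (metis insertI1 insertI2 less_trans linorder_less_linear singletonI)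
      have st: "same p u v \<Longrightarrow> same p v w \<Longrightarrow> same p u w" "same p u v \<Longrightarrow> same p v u" for u v w
        using same_trans[OF P] same_sym[of p] by blast+
      have key: "sep u v w z" if uvwz: "same (rejoin a b p) u v" "same (rejoin a b p) w z" "\<not> same (rejoin a b p) u w" for u v w z
      proof -
        have pts: "u \<in> points k l" "v \<in> points k l" "w \<in> points k l" "z \<in> points k l"
          using uvwz unfolding sr by blast+
        have tr: "(u < w) = (\<not> w < u)" "(u < z) = (\<not> z < u)" "(v < w) = (\<not> w < v)" "(v < z) = (\<not> z < v)"
        proof -
          note mp = matching_partition[OF m]
          have "u \<noteq> w" "u \<noteq> z" "v \<noteq> w" "v \<noteq> z"
            using that same_refl[OF mp pts(1)] same_sym[of "rejoin a b p"] same_trans[OF mp] by metis+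
          then show "(u < w) = (\<not> w < u)" "(u < z) = (\<not> z < u)" "(v < w) = (\<not> w < v)" "(v < z) = (\<not> z < v)"
            by auto
        qed
        have flat: "sep u v w z" if "u \<in> {a, b}" "v \<in> {a, b}" "w \<notin> {a, b}" "z \<notin> {a, b}"
          using that ab'[OF pts(3)] ab'[OF pts(4)] by (auto simp: sep_def)
        have flat': "sep u v w z" if "w \<in> {a, b}" "z \<in> {a, b}" "u \<notin> {a, b}" "v \<notin> {a, b}"
          using that ba'[OF pts(1)] ba'[OF pts(2)] tr by (auto simp: sep_def)
        consider "u \<in> {a, b}" "v \<in> {a, b}" "w \<notin> {a, b}" "z \<notin> {a, b}"
          | "w \<in> {a, b}" "z \<in> {a, b}" "u \<notin> {a, b}" "v \<notin> {a, b}"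
          | "u \<notin> {a, b}" "v \<notin> {a, b}" "w \<notin> {a, b}" "z \<notin> {a, b}"
          using uvwz unfolding sr by blast
        then show ?thesis
        proof cases
          case 3
          have r1: "same p u v \<or> same p u a \<and> same p b v \<or> same p u b \<and> same p a v"
            and r2: "same p w z \<or> same p w a \<and> same p b z \<or> same p w b \<and> same p a z"
            and r3: "\<not> (same p u w \<or> same p u a \<and> same p b w \<or> same p u b \<and> same p a w)"
            using uvwz 3 pts unfolding sr by blast+
          have nab: "\<not> same p a b" using False same_mate[OF d ab(1)] ne by auto
          \<comment> \<open>The chord \<open>a b\<close> separates no other pair, and no chord
            between other points separates \<open>a\<close> from \<open>b\<close>
            (\<open>A2\<close>). These facts close up the sums of two chords.\<close>
          have A1: "sep a b w z" using ab'[OF pts(3)] ab'[OF pts(4)] 3 by (auto simp: sep_def)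
          have A2: "sep u v a b" using ba'[OF pts(1)] ba'[OF pts(2)] 3 by (auto simp: sep_def less_le_not_le linorder_not_less)
          have c1: ?thesis if "same p u v" "same p w z"
            using nc[OF that] r3 by blast
          have c2: ?thesis if "same p u a" "same p b v" "same p w z"
          proof -
            have "sep u a w z" using nc that(1,3) r3 by blast
            moreover have "sep b v w z"
            proof (rule nc[OF that(2,3)])
              show "\<not> same p b w"
                using r3 that by blast
            qed
            ultimately show ?thesis using A1 unfolding sep_def by blast
          qed
          have c3: ?thesis if "same p u b" "same p a v" "same p w z"
          proof -
            have "sep u b w z" using nc that(1,3) r3 by blast
            moreover have "sep a v w z" using nc[OF that(2,3)] r3 that by blast
            ultimately show ?thesis using A1 unfolding sep_def by blast
          qed
          have c4: ?thesis if "same p u v" "same p w a" "same p b z"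
          proof -
            have "sep u v w a" using nc[OF that(1,2)] r3 by blast
            moreover have "sep u v b z"
            proof (rule nc[OF that(1,3)])
              show "\<not> same p u b" using r3 that st by blast
            qed
            ultimately show ?thesis using A2 unfolding sep_def by blast
          qed
          have c5: ?thesis if "same p u v" "same p w b" "same p a z"
          proof -
            have "sep u v w b" using nc[OF that(1,2)] r3 by blast
            moreover have "sep u v a z"
            proof (rule nc[OF that(1,3)])
              show "\<not> same p u a" using r3 that st by blast
            qed
            ultimately show ?thesis using A2 unfolding sep_def by blast
          qed
          \<comment> \<open>If both chords came from the new block, they would lie in one block of
            the rejoined pairing, against \<open>r3\<close>.\<close>
          have "\<not> same p u v \<Longrightarrow> \<not> same p w z \<Longrightarrow> False" using r1 r2 r3 st by blast
          then show ?thesis using c1 c2 c3 c4 c5 r1 r2 by blast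
        qed (use flat flat' in blast)+
      qed
      have "sep x x' y y'" using key s nxy by blast
      then show False using o unfolding sep_def by (auto dest: less_asym less_trans)
    qed
  qed
  then show ?thesis using m by (rule NC2_I)
qed

subsection \<open>Temperley--Lieb generators\<close>

text \<open>The upper pair of the generator connects the partners of \<open>i'\<close> and
  \<open>(i + 1)'\<close>, its lower pair becomes a new block, and a loop closes exactly when the
  two points were paired before. This turns the Temperley-Lieb relations into statements about
  \<open>mate\<close>.\<close>

lemma composite_U:
  assumes p: "p \<in> NC2 j k" and i: "1 \<le> i" "i < k"
  shows "composite (udiag k i) p = rejoin (Lower i) (Lower (i + 1)) p"
    and "loops (udiag k i) p = (if mate p (Lower i) = Lower (i + 1) then 1 else 0)"
proof -
  note P = NC_Part[OF NC2_NC[OF p]] and d = NC2_matching[OF p]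
  have l: "Lower i \<in> points j k" "Lower (i + 1) \<in> points j k" using i by auto
  show "composite (udiag k i) p = rejoin (Lower i) (Lower (i + 1)) p"
  proof (rule partition_eqI[OF _ rejoin_partition[OF Part_partition[OF P]]])
    show "partition_on (points j k) (composite (udiag k i) p)"
      by (rule Part_partition, rule composite_Part[of 0 1 2, OF _ _ _ P NC_Part[OF udiag_NC]]) auto
  qed (simp only: same_composite_U[OF P i] same_rejoin[OF Part_partition[OF P] l])
  have "(\<exists>x. x \<notin> {Lower i, Lower (i + 1)} \<and> (same p x (Lower i) \<or> same p x (Lower (i + 1)))) \<longleftrightarrow>
    mate p (Lower i) \<noteq> Lower (i + 1)"
  proof
    assume "mate p (Lower i) \<noteq> Lower (i + 1)"
    then show "\<exists>x. x \<notin> {Lower i, Lower (i + 1)} \<and> (same p x (Lower i) \<or> same p x (Lower (i + 1)))"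
      using same_mate[OF d l(1), of "mate p (Lower i)"] mate_ne[OF d l(1)] same_sym[of p "Lower i"]
      by (intro exI[of _ "mate p (Lower i)"]) auto
  next
    assume "\<exists>x. x \<notin> {Lower i, Lower (i + 1)} \<and> (same p x (Lower i) \<or> same p x (Lower (i + 1)))"
    then obtain x where x: "x \<notin> {Lower i, Lower (i + 1)}" "same p (Lower i) x \<or> same p (Lower (i + 1)) x"
      using same_sym[of p] by blast
    show "mate p (Lower i) \<noteq> Lower (i + 1)"
    proof
      assume m: "mate p (Lower i) = Lower (i + 1)"
      then have "mate p (Lower (i + 1)) = Lower i" using mate_mate[OF d l(1)] by simp
      then show False using x m same_mate[OF d l(1), of x] same_mate[OF d l(2), of x] by auto
    qed
  qed
  then show "loops (udiag k i) p = (if mate p (Lower i) = Lower (i + 1) then 1 else 0)"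
    unfolding loops_U[OF P i] by simp
qed

lemma composite_U_NC2:
  assumes p: "p \<in> NC2 j k" and i: "1 \<le> i" "i < k"
  shows "composite (udiag k i) p \<in> NC2 j k"
proof (rule NC2_I)
  show "composite (udiag k i) p \<in> NC j k" by (rule composite_NC[OF NC2_NC[OF p] udiag_NC])
  show "matching (points j k) (composite (udiag k i) p)"
    unfolding composite_U[OF p i] by (rule matching_rejoin[OF NC2_matching[OF p]]) (use i in auto)
qed

definition umate :: "nat \<Rightarrow> point \<Rightarrow> point" where
  "umate i x = (if x = Upper i then Upper (i + 1) else if x = Upper (i + 1) then Upper i else
     if x = Lower i then Lower (i + 1) else if x = Lower (i + 1) then Lower i else flip x)"

lemma same_udiag:
  assumes i: "1 \<le> i" "i < n" and x: "x \<in> points n n"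
  shows "same (udiag n i) x y \<longleftrightarrow> y = x \<or> y = umate i x"
  unfolding udiag_def same_kerp using x i by (cases x; cases y) (auto simp: umate_def)

lemma udiag_matching: "1 \<le> i \<Longrightarrow> i < n \<Longrightarrow> matching (points n n) (udiag n i)"
proof (rule matchingI, goal_cases)
  case 1 then show ?case by (simp add: udiag_def partition_on_kerp)
next
  case (2 x)
  then show ?case using same_udiag[of i n x] by (intro exI[of _ "umate i x"]) (cases x; auto simp: umate_def)
qed

lemma udiag_NC2: "1 \<le> i \<Longrightarrow> i < n \<Longrightarrow> udiag n i \<in> NC2 n n"
  by (rule NC2_I[OF udiag_NC udiag_matching])

lemma mate_udiag: "1 \<le> i \<Longrightarrow> i < n \<Longrightarrow> x \<in> points n n \<Longrightarrow> mate (udiag n i) x = umate i x"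
  using mate_eqI[OF udiag_matching, of i n x "umate i x"] same_udiag[of i n x "umate i x"]
  by (cases x) (auto simp: umate_def)

lemma id_matching: "matching (points n n) (id_diagram n)"
proof (rule matchingI, goal_cases)
  case 1 then show ?case by (simp add: id_diagram_kerp partition_on_kerp)
next
  case (2 x)
  have "same (id_diagram n) x z \<longleftrightarrow> z = x \<or> z = flip x" for z
    unfolding id_diagram_kerp same_kerp using 2 by (cases x; cases z) auto
  then show ?case by (intro exI[of _ "flip x"]) (cases x; auto)
qed

lemma id_NC2: "id_diagram n \<in> NC2 n n" by (rule NC2_I[OF id_diagram_NC id_matching])

subsection \<open>Adding a strand\<close>

lemma same_insert: "same (insert B p) x y \<longleftrightarrow> x \<in> B \<and> y \<in> B \<or> same p x y"
  by (auto simp: same_def)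

lemma partition_insert:
  assumes "partition_on A p" "B \<noteq> {}" "B \<inter> A = {}"
  shows "partition_on (B \<union> A) (insert B p)"
proof -
  have "B \<inter> C = {}" if "C \<in> p" for C using assms that by (auto simp: partition_on_def)
  then show ?thesis using assms unfolding partition_on_def disjoint_def by (auto simp: Int_commute)
qed

definition strand :: "nat \<Rightarrow> diagram \<Rightarrow> diagram" where
  "strand n d = insert {Upper (n + 1), Lower (n + 1)} d"

lemma points_Suc: "points (n + 1) (n + 1) = {Upper (n + 1), Lower (n + 1)} \<union> points n n"
proof (intro set_eqI)
  fix x show "x \<in> points (n + 1) (n + 1) \<longleftrightarrow> x \<in> {Upper (n + 1), Lower (n + 1)} \<union> points n n"
    by (cases x) auto
qed

lemma same_strand:
  "same (strand n d) x y \<longleftrightarrow> x \<in> {Upper (n + 1), Lower (n + 1)} \<and> y \<in> {Upper (n + 1), Lower (n + 1)} \<or> same d x y"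
  by (simp add: strand_def same_insert)

lemma strand_Part: "d \<in> Part n n \<Longrightarrow> strand n d \<in> Part (n + 1) (n + 1)"
  unfolding Part_def strand_def points_Suc mem_Collect_eq by (rule partition_insert) auto

text \<open>The two ends of the new strand are neighbours in the order, so no old point can lie
  between them.\<close>

lemma strand_NC:
  assumes d: "d \<in> NC n n" shows "strand n d \<in> NC (n + 1) (n + 1)"
proof (rule NC_I[OF strand_Part[OF NC_Part[OF d]]])
  fix a b c e assume s: "same (strand n d) a c" "same (strand n d) b e" and o: "a < b" "b < c" "c < e"
  have i: "x \<in> points n n \<and> y \<in> points n n" if "same d x y" for x y
    using same_in[OF Part_partition[OF NC_Part[OF d]] that] .
  have m: "\<not> (Upper (n + 1) < z \<and> z < Lower (n + 1))" if "z \<in> points n n" for z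
    using that by (cases z) auto
  show "same (strand n d) a b"
  proof (cases "same d a c \<and> same d b e")
    case True then show ?thesis using nc_same[OF d _ _ o] by (auto simp: same_strand)
  next
    case False
    then consider "a \<in> {Upper (n + 1), Lower (n + 1)}" "c \<in> {Upper (n + 1), Lower (n + 1)}"
      | "b \<in> {Upper (n + 1), Lower (n + 1)}" "e \<in> {Upper (n + 1), Lower (n + 1)}"
      using s unfolding same_strand by blast
    then show ?thesis
    proof cases
      case 1
      then have "a = Upper (n + 1)" "c = Lower (n + 1)" using less_trans[OF o(1,2)] by auto
      then have "b \<notin> points n n" using m[of b] o by auto
      then have "b \<in> {Upper (n + 1), Lower (n + 1)}" using s(2) i[of b e] unfolding same_strand by blast
      then show ?thesis using 1 unfolding same_strand by blast
    next
      case 2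
      then have "b = Upper (n + 1)" "e = Lower (n + 1)" using less_trans[OF o(2,3)] by auto
      then have "c \<notin> points n n" using m[of c] o by auto
      then have "a \<in> {Upper (n + 1), Lower (n + 1)}" using s(1) i[of a c] unfolding same_strand by blast
      then show ?thesis using 2 unfolding same_strand by blast
    qed
  qed
qed

lemma strand_matching:
  assumes d: "matching (points n n) d" shows "matching (points (n + 1) (n + 1)) (strand n d)"
proof -
  have "partition_on (points (n + 1) (n + 1)) (strand n d)"
    using strand_Part[of d n] matching_partition[OF d] by (simp add: Part_def)
  moreover have "\<forall>B\<in>strand n d. card B = 2"
    using d by (auto simp: strand_def matching_def)
  ultimately show ?thesis by (simp add: matching_def)
qed

lemma strand_NC2: "d \<in> NC2 n n \<Longrightarrow> strand n d \<in> NC2 (n + 1) (n + 1)"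
  by (rule NC2_I[OF strand_NC[OF NC2_NC] strand_matching[OF NC2_matching]])

lemma mate_strand:
  assumes d: "matching (points n n) d" and x: "x \<in> points (n + 1) (n + 1)"
  shows "mate (strand n d) x = (if x \<in> points n n then mate d x else flip x)"
proof (cases "x \<in> points n n")
  case True
  have "same (strand n d) x (mate d x)" using same_mate[OF d True, of "mate d x"] by (simp add: same_strand)
  then show ?thesis using mate_eqI[OF strand_matching[OF d]] mate_ne[OF d True] True by auto
next
  case False
  then have "x \<in> {Upper (n + 1), Lower (n + 1)}" using x unfolding points_Suc by auto
  then have "same (strand n d) x (flip x)" "flip x \<noteq> x" by (auto simp: same_strand)
  then show ?thesis using mate_eqI[OF strand_matching[OF d]] False by auto
qed

lemma strand_flipd: "flipd (strand n d) = strand n (flipd d)"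
  by (auto simp: flipd_def strand_def)

lemma strand_composite:
  assumes p: "p \<in> Part n n" and q: "q \<in> Part n n"
  shows "composite (strand n q) (strand n p) = strand n (composite q p)"
    and "loops (strand n q) (strand n p) = loops q p"
proof -
  let ?H = "stackH 0 1 2 q p" and ?H' = "stackH 0 1 2 (strand n q) (strand n p)"
  define C where "C v = conn ?H `` {v}" for v
  \<comment> \<open>\<open>None\<close> labels the new strand, which runs through all three rows and
    hence never counts as a loop.\<close>
  define f where "f v = (if snd v = n + 1 then None else Some (C v))" for v :: "nat \<times> nat"
  let ?V = "\<lambda>n. {0::nat} \<times> {1..n} \<union> {1} \<times> {1..n} \<union> {2} \<times> {1..n}"
  note p' = strand_Part[OF p] and q' = strand_Part[OF q]
  have idx: "snd (emb a b x) \<noteq> n + 1" if "x \<in> points n n" for a b x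
    using that by (cases x) auto
  have l0: "f (emb a b x) = f (emb a b y)" if "x \<in> {Upper (n + 1), Lower (n + 1)}" "y \<in> {Upper (n + 1), Lower (n + 1)}" for a b x y
    using that by (auto simp: f_def)
  have c1: "C (emb 0 1 x) = C (emb 0 1 y)" if "same p x y" for x y
    unfolding C_def conn_class_eq by (rule same_above[OF that])
  have c2: "C (emb 1 2 x) = C (emb 1 2 y)" if "same q x y" for x y
    unfolding C_def conn_class_eq by (rule same_below[OF that])
  have l1: "f (emb 0 1 x) = f (emb 0 1 y)" if s: "same (strand n p) x y" for x y
    using s[unfolded same_strand]
  proof
    assume "same p x y"
    then show ?thesis using c1[of x y] same_in[OF Part_partition[OF p], of x y] idx by (simp add: f_def)
  qed (use l0 in blast)
  have l2: "f (emb 1 2 x) = f (emb 1 2 y)" if s: "same (strand n q) x y" for x y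
    using s[unfolded same_strand]
  proof
    assume "same q x y"
    then show ?thesis using c2[of x y] same_in[OF Part_partition[OF q], of x y] idx by (simp add: f_def)
  qed (use l0 in blast)
  have sub: "(u, v) \<in> conn ?H'" if "(u, v) \<in> conn ?H" for u v
    by (rule conn_mono[OF that]) (auto simp: stackH_def strand_def)
  have e1: "((0, n + 1), (1, n + 1)) \<in> conn ?H'"
    using same_above[of "strand n p" "Upper (n + 1)" "Lower (n + 1)" 0 1 2] by (simp add: same_strand)
  have e2: "((1, n + 1), (2, n + 1)) \<in> conn ?H'"
    using same_below[of "strand n q" "Upper (n + 1)" "Lower (n + 1)" 1 2 0] by (simp add: same_strand)
  have e: "((1, n + 1), u) \<in> conn ?H'" if u: "u \<in> ?V (n + 1)" "snd u = n + 1" for u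
  proof -
    have "u = (0, n + 1) \<or> u = (1, n + 1) \<or> u = (2, n + 1)" using u by (cases u) auto
    then show ?thesis using conn_sym[OF e1] e2 by auto
  qed
  have con: "(u, v) \<in> conn ?H'" if uv: "u \<in> ?V (n + 1)" "v \<in> ?V (n + 1)" "f u = f v" for u v
  proof (cases "snd u = n + 1")
    case True
    then have "snd v = n + 1" using uv(3) by (auto simp: f_def split: if_splits)
    then show ?thesis using conn_trans[OF conn_sym[OF e[OF uv(1) True]] e[OF uv(2)]] by simp
  next
    case False
    then have "C u = C v" using uv(3) by (auto simp: f_def split: if_splits)
    then show ?thesis unfolding C_def conn_class_eq by (rule sub)
  qed
  have c: "composite (strand n q) (strand n p) = kerp (points (n + 1) (n + 1)) (\<lambda>x. f (emb 0 2 x))"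
    by (rule composite_label(1)[OF _ _ _ p' q' l1 l2 con]) simp_all
  note qp = composite_Part[of 0 1 2, OF _ _ _ p q, simplified]
  show "composite (strand n q) (strand n p) = strand n (composite q p)"
    unfolding c
  proof (rule partition_eqI[OF partition_on_kerp Part_partition[OF strand_Part[OF qp]]])
    fix x y assume xy: "x \<in> points (n + 1) (n + 1)" "y \<in> points (n + 1) (n + 1)"
    have o: "snd (emb 0 2 z) = n + 1 \<longleftrightarrow> z \<in> {Upper (n + 1), Lower (n + 1)}" for z by (cases z) auto
    have o': "z \<notin> {Upper (n + 1), Lower (n + 1)} \<longleftrightarrow> z \<in> points n n" if "z \<in> points (n + 1) (n + 1)" for z
      using that by (cases z) auto
    show "same (kerp (points (n + 1) (n + 1)) (\<lambda>x. f (emb 0 2 x))) x y = same (strand n (composite q p)) x y"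
      unfolding same_kerp same_strand same_composite[of 0 1 2, OF _ _ _ p q, simplified] f_def o
      using xy o'[OF xy(1)] o'[OF xy(2)] by (auto simp: C_def conn_class_eq simp del: in_points insert_iff)
  qed
  have "loops (strand n q) (strand n p) =
     card (f ` ({1} \<times> {1..n + 1}) - f ` ({0} \<times> {1..n + 1} \<union> {2} \<times> {1..n + 1}))"
    by (rule composite_label(2)[OF _ _ _ p' q' l1 l2 con]) simp_all
  also have "f ` ({1} \<times> {1..n + 1}) - f ` ({0} \<times> {1..n + 1} \<union> {2} \<times> {1..n + 1}) =
     Some ` (C ` ({1} \<times> {1..n}) - C ` ({0} \<times> {1..n} \<union> {2} \<times> {1..n}))"
  proof -
    have "f ` ({r} \<times> {1..n + 1}) = insert None (Some ` C ` ({r} \<times> {1..n}))" for r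
    proof -
      have "{r} \<times> {1..n + 1} = insert (r, n + 1) ({r} \<times> {1..n})" by auto
      moreover have "f ` ({r} \<times> {1..n}) = Some ` C ` ({r} \<times> {1..n})"
        unfolding image_image by (rule image_cong) (auto simp: f_def)
      ultimately show ?thesis by (simp add: f_def)
    qed
    then show ?thesis unfolding image_Un by auto
  qed
  also have "card \<dots> = card (C ` ({1} \<times> {1..n}) - C ` ({0} \<times> {1..n} \<union> {2} \<times> {1..n}))"
    by (rule card_image) simp
  also have "\<dots> = loops q p"
  proof (rule composite_label(2)[OF _ _ _ p q c1 c2, symmetric])
    fix u v assume "C u = C v"
    then show "(u, v) \<in> conn ?H" unfolding C_def conn_class_eq .
  qed simp_all
  finally show "loops (strand n q) (strand n p) = loops q p" .
qed

lemma tensor_strand: "tensor n n d (id_diagram 1) = strand n d"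
proof -
  have "id_diagram 1 = {{Upper 1, Lower 1}}" by (simp add: id_diagram_def)
  then show ?thesis by (simp add: tensor_def strand_def)
qed

lemma tensor_cup_cap: "tensor k k (id_diagram k) cup_cap = udiag (k + 2) (k + 1)"
proof (rule partition_eqI)
  have t: "tensor k k (id_diagram k) cup_cap =
    insert {Upper (k + 1), Upper (k + 2)} (insert {Lower (k + 1), Lower (k + 2)} (id_diagram k))"
    by (simp add: tensor_def cup_cap_def)
  have A: "points (k + 2) (k + 2) = {Upper (k + 1), Upper (k + 2)} \<union> ({Lower (k + 1), Lower (k + 2)} \<union> points k k)"
  proof (intro set_eqI)
    fix x show "x \<in> points (k + 2) (k + 2) \<longleftrightarrow>
      x \<in> {Upper (k + 1), Upper (k + 2)} \<union> ({Lower (k + 1), Lower (k + 2)} \<union> points k k)" by (cases x) auto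
  qed
  show "partition_on (points (k + 2) (k + 2)) (tensor k k (id_diagram k) cup_cap)"
    unfolding t A by (intro partition_insert Part_partition[OF NC_Part[OF id_diagram_NC]]) auto
  show "partition_on (points (k + 2) (k + 2)) (udiag (k + 2) (k + 1))"
    by (simp add: udiag_def partition_on_kerp)
  fix x y :: point
  show "same (tensor k k (id_diagram k) cup_cap) x y \<longleftrightarrow> same (udiag (k + 2) (k + 1)) x y"
    unfolding t same_insert unfolding id_diagram_kerp udiag_def same_kerp
    by (cases x; cases y) auto
qed

definition strand0 :: "nat \<Rightarrow> lin \<Rightarrow> lin" where
  "strand0 n = lin_extend (\<lambda>d. basis (strand n d))"

lemma strand0_simps [simp]:
  "strand0 n (x + y) = strand0 n x + strand0 n y" "strand0 n (smult c x) = smult c (strand0 n x)"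
  "strand0 n (basis p) = basis (strand n p)" "strand0 n 0 = 0"
  by (simp_all add: strand0_def lin_extend_add lin_extend_smult)

lemma strand0_diff [simp]: "strand0 n (x - y) = strand0 n x - strand0 n y"
  using strand0_simps(1)[of n "x - y" y] by (simp add: algebra_simps)

lemma tensor0_strand: "tensor0 n n x (id0 1) = strand0 n x"
  by (simp add: tensor0_def bilin_extend_def strand0_def id0_def tensor_strand)

lemma strand0_comp0:
  assumes "y \<in> Hom0 NC n n" "x \<in> Hom0 NC n n"
  shows "strand0 n (comp0 s y x) = comp0 s (strand0 n y) (strand0 n x)"
  using assms(1)
proof (induction rule: Hom0_induct)
  case (basis q)
  show ?case
    using assms(2)
  proof (induction rule: Hom0_induct)
    case (basis p)
    then show ?case
      using strand_composite[OF NC_Part[OF \<open>p \<in> _\<close>] NC_Part[OF \<open>q \<in> _\<close>]] by (simp add: comp0_basis)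
  qed (simp_all add: comp0_add_right comp0_smult_right)
qed (simp_all add: comp0_add_left comp0_smult_left)

lemma strand_id [simp]: "strand n (id_diagram n) = id_diagram (n + 1)"
proof (rule partition_eqI[OF Part_partition[OF strand_Part] Part_partition])
  show "id_diagram n \<in> Part n n" "id_diagram (n + 1) \<in> Part (n + 1) (n + 1)" using id_diagram_NC NC_Part by blast+
  fix x y :: point
  show "same (strand n (id_diagram n)) x y \<longleftrightarrow> same (id_diagram (n + 1)) x y"
    unfolding same_strand id_diagram_kerp same_kerp by (cases x; cases y) auto
qed

lemma strand_udiag:
  assumes "i < n" shows "strand n (udiag n i) = udiag (n + 1) i"
proof (rule partition_eqI[OF Part_partition[OF strand_Part] Part_partition])
  show "udiag n i \<in> Part n n" "udiag (n + 1) i \<in> Part (n + 1) (n + 1)" using udiag_NC NC_Part by blast+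
  fix x y :: point
  show "same (strand n (udiag n i)) x y \<longleftrightarrow> same (udiag (n + 1) i) x y"
    unfolding same_strand udiag_def same_kerp using assms by (cases x; cases y) auto
qed

subsection \<open>Temperley--Lieb relations\<close>

definition ulin :: "nat \<Rightarrow> nat \<Rightarrow> lin" where "ulin n i = basis (udiag n i)"

lemma ulin_NC: "ulin n i \<in> Hom0 NC n n" by (simp add: ulin_def udiag_NC)

lemma rejoin_commute:
  assumes "partition_on A p" "a \<in> A" "b \<in> A" shows "rejoin a b p = rejoin b a p"
proof (rule partition_eqI[OF rejoin_partition[OF assms(1)] rejoin_partition[OF assms(1)]])
  fix x y
  show "same (rejoin a b p) x y \<longleftrightarrow> same (rejoin b a p) x y"
    unfolding same_rejoin[OF assms] same_rejoin[OF assms(1,3,2)] by blast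
qed

lemma ulin_square:
  assumes i: "1 \<le> i" "i < n" shows "comp0 s (ulin n i) (ulin n i) = smult s (ulin n i)"
proof -
  have m: "mate (udiag n i) (Lower i) = Lower (i + 1)" using mate_udiag[OF i, of "Lower i"] i by (simp add: umate_def)
  have "rejoin (Lower i) (Lower (i + 1)) (udiag n i) = udiag n i"
    by (rule rejoin_id[OF udiag_matching[OF i]]) (use i m in auto)
  then show ?thesis using composite_U[OF udiag_NC2[OF i] i] m by (simp add: ulin_def comp0_basis)
qed

lemma ulin_braid:
  assumes i: "1 \<le> i" "i + 1 < n"
  shows "comp0 s (ulin n (i + 1)) (comp0 s (ulin n i) (ulin n (i + 1))) = ulin n (i + 1)"
proof -
  let ?d = "udiag n (i + 1)"
  have j: "1 \<le> i + 1" "i < n" using i by auto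
  note d = udiag_NC2[OF j(1) i(2)] and m = udiag_matching[OF j(1) i(2)]
  note mm = mate_udiag[OF j(1) i(2)]
  note d1 = composite_U_NC2[OF d i(1) j(2)]
  have l: "Lower i \<in> points n n" "Lower (i + 1) \<in> points n n" "Lower (i + 1 + 1) \<in> points n n" using i by auto
  have ms: "mate ?d (Lower i) = Upper i" "mate ?d (Lower (i + 1)) = Lower (i + 1 + 1)" "mate ?d (Lower (i + 1 + 1)) = Lower (i + 1)"
    using mm[OF l(1)] mm[OF l(2)] mm[OF l(3)] by (auto simp: umate_def)
  have c1: "composite (udiag n i) ?d = rejoin (Lower i) (Lower (i + 1)) ?d" "loops (udiag n i) ?d = 0"
    using composite_U[OF d i(1) j(2)] ms by auto
  have mr: "mate (rejoin (Lower i) (Lower (i + 1)) ?d) (Lower (i + 1)) = Lower i"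
    using mate_rejoin[OF m l(1,2), of "Lower (i + 1)"] ms l by simp
  have c2: "loops (udiag n (i + 1)) (composite (udiag n i) ?d) = 0"
    using composite_U(2)[OF d1 j(1) i(2)] mr c1 by simp
  have "composite (udiag n (i + 1)) (composite (udiag n i) ?d) =
     rejoin (Lower (i + 1)) (Lower (i + 1 + 1)) (rejoin (Lower i) (Lower (i + 1)) ?d)"
    using composite_U(1)[OF d1 j(1) i(2)] c1 by simp
  also have "\<dots> = rejoin (Lower (i + 1 + 1)) (Lower (i + 1)) (rejoin (Lower (i + 1)) (Lower i) ?d)"
    using rejoin_commute[OF matching_partition[OF m] l(1,2)]
      rejoin_commute[OF rejoin_partition[OF matching_partition[OF m]] l(2,3)] by simp
  also have "\<dots> = ?d" by (rule rejoin_rejoin[OF m l(3,2,1) _ _ _ ms(3)]) simp_all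
  finally have c3: "composite (udiag n (i + 1)) (composite (udiag n i) ?d) = ?d" .
  show ?thesis using c1(2) c2 c3 by (simp add: ulin_def comp0_basis comp0_smult_right)
qed

text \<open>On mates both products look the same: \<open>d\<close> on the first \<open>n\<close>
  strands and \<open>u_(n+1)\<close> on the last two. \<open>composite_U\<close> computes the
  product with the generator below; the other order is obtained from it by reflection.\<close>

lemma ulin_commute:
  assumes x: "x \<in> Hom0 NC2 n n"
  shows "comp0 s (ulin (n + 2) (n + 1)) (strand0 (n + 1) (strand0 n x)) =
    comp0 s (strand0 (n + 1) (strand0 n x)) (ulin (n + 2) (n + 1))"
  using x
proof (induction rule: Hom0_induct)
  case (basis d)
  let ?u = "udiag (n + 2) (n + 1)" and ?A = "points (n + 2) (n + 2)"
  let ?T = "\<lambda>d. strand (n + 1) (strand n d)"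
  have i: "1 \<le> n + 1" "n + 1 < n + 2" by auto
  have l: "Lower (n + 1) \<in> ?A" "Lower (n + 1 + 1) \<in> ?A" "Lower (n + 1) \<noteq> Lower (n + 1 + 1)" by auto
  have T: "?T d \<in> NC2 (n + 2) (n + 2)" if "d \<in> NC2 n n" for d
    using strand_NC2[OF strand_NC2[OF that]] by (simp add: numeral_2_eq_2 One_nat_def)
  have mT: "mate (?T d) x = (if x \<in> points n n then mate d x else flip x)" if "d \<in> NC2 n n" "x \<in> ?A" for d x
  proof -
    note m0 = NC2_matching[OF that(1)]
    have "x \<in> points (n + 1 + 1) (n + 1 + 1)" using that(2) by (simp add: numeral_2_eq_2 One_nat_def)
    note m1 = mate_strand[OF strand_matching[OF m0] this]
    show ?thesis
    proof (cases "x \<in> points (n + 1) (n + 1)")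
      case True then show ?thesis using m1 mate_strand[OF m0 True] by simp
    next
      case False
      then have "x \<notin> points n n" by (cases x) auto
      then show ?thesis using m1 False by simp
    qed
  qed
  have loop: "loops ?u (?T d) = 0" if d: "d \<in> NC2 n n" for d
    using composite_U(2)[OF T[OF d] i] mT[OF d l(1)] by simp
  have Z: "composite ?u (?T d) \<in> NC2 (n + 2) (n + 2)" if "d \<in> NC2 n n" for d
    by (rule composite_U_NC2[OF T[OF that] i])
  have mZ: "mate (composite ?u (?T d)) x = (if x \<in> points n n then mate d x else umate (n + 1) x)"
    if d: "d \<in> NC2 n n" and x: "x \<in> ?A" for d x
  proof -
    have r: "mate (composite ?u (?T d)) x = mate (rejoin (Lower (n + 1)) (Lower (n + 1 + 1)) (?T d)) x"
      using composite_U(1)[OF T[OF d] i] by simp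
    have ne: "mate d x \<in> points n n" if "x \<in> points n n" using mate_in[OF NC2_matching[OF d] that] .
    show ?thesis
      unfolding r mate_rejoin[OF NC2_matching[OF T[OF d]] l x] mT[OF d x] mT[OF d l(1)] mT[OF d l(2)]
      using x by (cases x) (auto simp: umate_def)
  qed
  have fl: "flipd (?T d) = ?T (flipd d)" for d by (simp add: strand_flipd)
  have e: "composite (?T d) ?u = composite ?u (?T d)" "loops (?T d) ?u = 0"
  proof -
    note fd = flipd_NC2[OF basis]
    have cf: "composite (?T d) ?u = flipd (composite ?u (?T (flipd d)))" "loops (?T d) ?u = loops ?u (?T (flipd d))"
      using composite_flipd[OF NC_Part[OF NC2_NC[OF T[OF fd]]] NC_Part[OF udiag_NC], of "n + 1"] by (simp_all add: fl)
    show "loops (?T d) ?u = 0" using cf(2) loop[OF fd] by simp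
    note m1 = NC2_matching[OF Z[OF fd]]
    note mf = NC2_matching[OF flipd_NC2[OF Z[OF fd]]]
    have mate_flip: "mate (flipd p) x = flip (mate p (flip x))" if "matching (points k k) p" "x \<in> points k k" for p k x
    proof -
      have fx: "flip x \<in> points k k" using that by simp
      have "matching (points k k) (flipd p)"
        using that(1) flipd_Part[of p k k] card_image[OF inj_on_subset[OF inj_flip]]
        by (auto simp: matching_def Part_def flipd_def)
      moreover have "same (flipd p) x (flip (mate p (flip x)))"
        using same_mate[OF that(1) fx, of "mate p (flip x)"] by (simp add: same_flipd)
      moreover have "flip (mate p (flip x)) \<noteq> x" using mate_ne[OF that(1) fx] by (metis flip_flip)
      ultimately show ?thesis by (rule mate_eqI)
    qed
    show "composite (?T d) ?u = composite ?u (?T d)"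
      unfolding cf(1)
    proof (rule matching_eqI[OF mf NC2_matching[OF Z[OF basis]]])
      fix x assume x: "x \<in> ?A"
      then have fx: "flip x \<in> ?A" by simp
      have "mate (flipd (composite ?u (?T (flipd d)))) x = flip (mate (composite ?u (?T (flipd d))) (flip x))"
        by (rule mate_flip[OF m1 x])
      also have "\<dots> = (if x \<in> points n n then mate d x else umate (n + 1) x)"
      proof (cases "x \<in> points n n")
        case True
        then show ?thesis using mZ[OF fd fx] mate_flip[OF NC2_matching[OF basis], of "flip x"] by simp
      next
        case False
        then show ?thesis using mZ[OF fd fx] by (cases x) (auto simp: umate_def)
      qed
      also have "\<dots> = mate (composite ?u (?T d)) x" using mZ[OF basis x] by simp
      finally show "mate (flipd (composite ?u (?T (flipd d)))) x = mate (composite ?u (?T d)) x" .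
    qed
  qed
  show ?case using e loop[OF basis] by (simp add: ulin_def comp0_basis)
qed (simp_all add: comp0_add_right comp0_smult_right comp0_add_left comp0_smult_left)

subsection \<open>Jones--Wenzl idempotents\<close>

text \<open>The algebra generated by the \<open>u_i\<close>. Each generator maps pairings to
  pairings (\<open>ulin_comp_NC2\<close>), so the whole algebra consists of combinations of
  pairings, and the Jones-Wenzl elements stay inside it.\<close>

inductive_set words :: "complex \<Rightarrow> nat \<Rightarrow> lin set" for s n where
  one: "id0 n \<in> words s n"
| gen: "x \<in> words s n \<Longrightarrow> 1 \<le> i \<Longrightarrow> i < n \<Longrightarrow> comp0 s (ulin n i) x \<in> words s n"
| add: "x \<in> words s n \<Longrightarrow> y \<in> words s n \<Longrightarrow> x + y \<in> words s n"
| smult: "x \<in> words s n \<Longrightarrow> smult c x \<in> words s n"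

lemma ulin_comp_NC2:
  assumes i: "1 \<le> i" "i < n" and x: "x \<in> Hom0 NC2 j n"
  shows "comp0 s (ulin n i) x \<in> Hom0 NC2 j n"
  using x
proof (induction rule: Hom0_induct)
  case (basis d)
  show ?case unfolding ulin_def comp0_basis by (rule Hom0_smult) (simp add: composite_U_NC2[OF basis i])
qed (auto simp: comp0_add_right comp0_smult_right intro: Hom0_add Hom0_smult)

lemma words_NC2: "x \<in> words s n \<Longrightarrow> x \<in> Hom0 NC2 n n"
  by (induction rule: words.induct) (auto simp: id0_def id_NC2 intro: Hom0_add Hom0_smult ulin_comp_NC2)

lemma words_mult:
  assumes "x \<in> words s n" and y: "y \<in> words s n" shows "comp0 s x y \<in> words s n"
  using assms(1)
proof (induction rule: words.induct)
  case one
  then show ?case using y comp0_id_left[OF NC2_sub[OF words_NC2[OF y]]] by simp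
next
  case (gen x i)
  then show ?case
    using comp0_assoc[OF ulin_NC[of n i] NC2_sub[OF words_NC2[OF gen.hyps(1)]] NC2_sub[OF words_NC2[OF y]], of s]
      words.gen by simp
qed (simp_all add: comp0_add_left comp0_smult_left words.add words.smult)

lemma words_diff: "x \<in> words s n \<Longrightarrow> y \<in> words s n \<Longrightarrow> x - y \<in> words s n"
  using words.add[OF _ words.smult[of y s n "-1"], of x] by (simp add: lin.scale_minus_left)

lemma strand0_ulin: "i < n \<Longrightarrow> strand0 n (ulin n i) = ulin (n + 1) i"
  by (simp add: ulin_def strand_udiag)

lemma strand0_id [simp]: "strand0 n (id0 n) = id0 (n + 1)" by (simp add: id0_def)

lemma strand0_words: "x \<in> words s n \<Longrightarrow> strand0 n x \<in> words s (n + 1)"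
proof (induction rule: words.induct)
  case (gen x i)
  then show ?case
    using strand0_comp0[OF ulin_NC[of n i] NC2_sub[OF words_NC2[OF gen.hyps(1)]], of s] words.gen[of "strand0 n x" s "n + 1" i]
    by (simp add: strand0_ulin)
qed (auto intro: words.intros)

lemma ulin_words: "1 \<le> i \<Longrightarrow> i < n \<Longrightarrow> ulin n i \<in> words s n"
  using words.gen[OF words.one, of i n s] comp0_id_right[OF ulin_NC, of s n i] by simp

lemma jones_wenzl_Suc:
  assumes "1 \<le> k"
  shows "jones_wenzl s (k + 1) = (let f = strand0 k (jones_wenzl s k) in
     f - smult (jw_coeff s (k + 1)) (comp0 s f (comp0 s (ulin (k + 1) k) f)))"
proof -
  obtain m where m: "k = Suc m" using assms by (cases k) (auto simp: One_nat_def)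
  have u: "tensor0 m m (id0 m) (basis cup_cap) = ulin (m + 2) (m + 1)"
    by (simp add: tensor0_def bilin_extend_def id0_def tensor_cup_cap ulin_def)
  show ?thesis unfolding m
    using tensor0_strand[of "m + 1"] u by (simp add: Let_def One_nat_def numeral_2_eq_2)
qed

lemma jones_wenzl_1: "jones_wenzl s 1 = id0 1" by (simp add: One_nat_def)

text \<open>Wenzl's induction. The last clause, \<open>u_k (e_k \<otimes> 1) u_k = (s - a_k)
  (e_(k-1) \<otimes> 1 \<otimes> 1) u_k\<close>, explains the coefficients: \<open>a_(k+1)\<close>
  is the inverse of \<open>s - a_k\<close>, and this makes \<open>u_k\<close> kill
  \<open>e_(k+1)\<close>. The clauses about \<open>e_(k-1)\<close> serve to absorb the factor on the
  right.\<close>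

lemma jones_wenzl_props:
  assumes h: "\<And>k. 1 \<le> k \<Longrightarrow> s - jw_coeff s k \<noteq> 0" and k: "1 \<le> k"
  defines "e \<equiv> jones_wenzl s"
  shows "e k \<in> words s k \<and> comp0 s (e k) (e k) = e k \<and>
    (\<forall>i. 1 \<le> i \<longrightarrow> i < k \<longrightarrow> comp0 s (ulin k i) (e k) = 0 \<and> comp0 s (e k) (ulin k i) = 0) \<and>
    e (k - 1) \<in> words s (k - 1) \<and>
    comp0 s (strand0 (k - 1) (e (k - 1))) (e k) = e k \<and> comp0 s (e k) (strand0 (k - 1) (e (k - 1))) = e k \<and>
    comp0 s (ulin (k + 1) k) (comp0 s (strand0 k (e k)) (ulin (k + 1) k)) =
      smult (s - jw_coeff s k) (comp0 s (strand0 k (strand0 (k - 1) (e (k - 1)))) (ulin (k + 1) k))"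
  using k
proof (induction k rule: nat_induct_at_least)
  case base
  have "comp0 s (id0 2) (ulin 2 1) = ulin 2 1" by (rule comp0_id_left[OF ulin_NC])
  moreover have "id0 (1 + 1) = id0 2" "strand0 0 (id0 0) = id0 1" using strand0_id[of 0] by simp_all
  ultimately show ?case
    using comp0_id_left[OF id0_NC] ulin_square[of 1 2 s] strand0_id[of 1]
    by (simp add: e_def jones_wenzl_1 words.one) (simp add: One_nat_def)
next
  case (Suc k)
  note IH = Suc.IH
  let ?c = "comp0 s" and ?n = "k + 1"
  define f where "f = strand0 k (e k)"
  define u where "u = ulin (k + 1) k"
  define a where "a = jw_coeff s (k + 1)"
  define g where "g = strand0 k (strand0 (k - 1) (e (k - 1)))"
  have ek: "e k \<in> words s k" "?c (e k) (e k) = e k"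
    and ke: "\<And>i. 1 \<le> i \<Longrightarrow> i < k \<Longrightarrow> ?c (ulin k i) (e k) = 0 \<and> ?c (e k) (ulin k i) = 0"
    and e': "e (k - 1) \<in> words s (k - 1)"
    and ee: "?c (strand0 (k - 1) (e (k - 1))) (e k) = e k" "?c (e k) (strand0 (k - 1) (e (k - 1))) = e k"
    and uu: "?c u (?c f u) = smult (s - jw_coeff s k) (?c g u)"
    using IH unfolding u_def f_def g_def by blast+
  have k1: "1 \<le> k" by fact
  have hk: "e k \<in> Hom0 NC k k" using ek words_NC2 NC2_sub by blast
  have fW: "f \<in> words s ?n" unfolding f_def by (rule strand0_words[OF ek(1)])
  have uW: "u \<in> words s ?n" unfolding u_def by (rule ulin_words) (use k1 in auto)
  have sW: "strand0 (k - 1) (e (k - 1)) \<in> words s k" using strand0_words[OF e'] k1 by simp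
  have gW: "g \<in> words s ?n" unfolding g_def by (rule strand0_words[OF sW])
  have fuf: "?c f (?c u f) \<in> words s ?n" using fW uW words_mult by blast
  have H: "x \<in> Hom0 NC ?n ?n" if "x \<in> words s ?n" for x using that words_NC2 NC2_sub by blast
  have as: "?c (?c x y) z = ?c x (?c y z)" if "x \<in> words s ?n" "y \<in> words s ?n" "z \<in> words s ?n" for x y z
    using comp0_assoc[of x ?n ?n y ?n z ?n] H that by blast
  have rec: "e ?n = f - smult a (?c f (?c u f))"
    unfolding e_def f_def u_def a_def using jones_wenzl_Suc[OF k1] by (simp add: Let_def)
  have eW: "e ?n \<in> words s ?n" unfolding rec by (intro words_diff words.smult fW fuf)
  have ff: "?c f f = f" unfolding f_def using strand0_comp0[OF hk hk, of s] ek(2) by simp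
  have sH: "strand0 (k - 1) (e (k - 1)) \<in> Hom0 NC k k" using sW words_NC2 NC2_sub by blast
  have gf: "?c g f = f" "?c f g = f" unfolding f_def g_def
    using strand0_comp0[OF sH hk, of s] strand0_comp0[OF hk sH, of s] ee by simp_all
  have ug: "?c u g = ?c g u"
  proof -
    have "k - 1 + 2 = k + 1" "k - 1 + 1 = k" using k1 by linarith+
    then show ?thesis using ulin_commute[OF words_NC2[OF e'], of s] unfolding g_def u_def by (simp only:)
  qed
  have ab: "a * (s - jw_coeff s k) = 1"
  proof -
    obtain m where "k = Suc m" using k1 by (cases k) (auto simp: One_nat_def)
    then have "a = inverse (s - jw_coeff s k)" by (simp add: a_def One_nat_def)
    then show ?thesis using h[OF k1] by simp
  qed
  \<comment> \<open>\<open>u f u f = (s - a_k) g u f = (s - a_k) u f\<close>, because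
    \<open>g\<close> commutes with \<open>u\<close> and is absorbed by \<open>f\<close>.\<close>
  have ufu: "?c u (?c f (?c u f)) = smult (s - jw_coeff s k) (?c u f)"
  proof -
    have "?c u (?c f (?c u f)) = ?c (?c u (?c f u)) f"
      using as[OF uW words_mult[OF fW uW] fW] as[OF fW uW fW] by simp
    also have "\<dots> = smult (s - jw_coeff s k) (?c (?c u g) f)" unfolding uu ug by (simp add: comp0_smult_left)
    also have "?c (?c u g) f = ?c u f" using as[OF uW gW fW] gf by simp
    finally show ?thesis .
  qed
  have fufu: "?c f (?c u (?c f u)) = smult (s - jw_coeff s k) (?c f u)"
  proof -
    have "?c f (?c g u) = ?c f u" using as[OF fW gW uW] gf by simp
    then show ?thesis unfolding uu by (simp add: comp0_smult_right)
  qed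
  have ue: "?c u (e ?n) = 0"
    unfolding rec comp0_diff_right comp0_smult_right ufu using ab by simp
  have eu: "?c (e ?n) u = 0"
  proof -
    have "?c (?c f (?c u f)) u = ?c f (?c u (?c f u))"
      using as[OF fW words_mult[OF uW fW] uW] as[OF uW fW uW] by simp
    then show ?thesis unfolding rec comp0_diff_left comp0_smult_left using fufu ab by simp
  qed
  have fe: "?c f (e ?n) = e ?n"
    unfolding rec comp0_diff_right comp0_smult_right using as[OF fW fW words_mult[OF uW fW]] ff by simp
  have ef: "?c (e ?n) f = e ?n"
  proof -
    have "?c (?c f (?c u f)) f = ?c f (?c u f)"
      using as[OF fW words_mult[OF uW fW] fW] as[OF uW fW fW] ff by simp
    then show ?thesis unfolding rec comp0_diff_left comp0_smult_left using ff by simp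
  qed
  have ee': "?c (e ?n) (e ?n) = e ?n"
  proof -
    have "?c (e ?n) (?c f (?c u f)) = 0"
      using as[OF eW fW words_mult[OF uW fW]] as[OF eW uW fW] ef eu by simp
    then have "?c (e ?n) (f - smult a (?c f (?c u f))) = e ?n"
      unfolding comp0_diff_right comp0_smult_right using ef by simp
    then show ?thesis using rec by simp
  qed
  \<comment> \<open>For \<open>i < k\<close> the generator already kills \<open>f\<close>, and
    \<open>f\<close> can be inserted next to \<open>e_(k+1)\<close> by \<open>fe\<close> and
    \<open>ef\<close>.\<close>
  have ann: "?c (ulin ?n i) (e ?n) = 0 \<and> ?c (e ?n) (ulin ?n i) = 0" if i: "1 \<le> i" "i < ?n" for i
  proof (cases "i = k")
    case False
    then have ik: "i < k" using i by simp
    have uf: "?c (ulin ?n i) f = 0" "?c f (ulin ?n i) = 0"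
      using strand0_comp0[OF ulin_NC[of k i] hk, of s] strand0_comp0[OF hk ulin_NC[of k i], of s] ke[OF i(1) ik] strand0_ulin[OF ik]
      by (simp_all add: f_def)
    have uiW: "ulin ?n i \<in> words s ?n" by (rule ulin_words[OF i])
    have "?c (ulin ?n i) (e ?n) = ?c (?c (ulin ?n i) f) (e ?n)" using as[OF uiW fW eW] fe by simp
    moreover have "?c (e ?n) (ulin ?n i) = ?c (e ?n) (?c f (ulin ?n i))" using as[OF eW fW uiW] ef by simp
    ultimately show ?thesis using uf by simp
  qed (use ue eu u_def in simp)
  let ?m = "k + 2"
  define F where "F = strand0 ?n f"
  define u' where "u' = ulin ?m ?n"
  define v where "v = ulin ?m k"
  have n2: "?n + 1 = ?m" by simp
  have FW: "F \<in> words s ?m" unfolding F_def using strand0_words[OF fW] by (simp only: n2)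
  have u'W: "u' \<in> words s ?m" unfolding u'_def by (rule ulin_words) auto
  have vW: "v \<in> words s ?m" unfolding v_def by (rule ulin_words) (use k1 in auto)
  have Tu: "strand0 ?n u = v" unfolding u_def v_def using strand0_ulin[of k ?n] by (simp only: n2)
  have TT: "strand0 ?n (?c x y) = ?c (strand0 ?n x) (strand0 ?n y)" if "x \<in> words s ?n" "y \<in> words s ?n" for x y
    by (rule strand0_comp0[OF H[OF that(1)] H[OF that(2)]])
  have FF: "?c F F = F" using TT[OF fW fW] ff by (simp add: F_def)
  have uF: "?c u' F = ?c F u'"
    unfolding u'_def F_def f_def by (rule ulin_commute[OF words_NC2[OF ek(1)]])
  have H': "x \<in> Hom0 NC ?m ?m" if "x \<in> words s ?m" for x using that words_NC2 NC2_sub by blast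
  have as': "?c (?c x y) z = ?c x (?c y z)" if "x \<in> words s ?m" "y \<in> words s ?m" "z \<in> words s ?m" for x y z
    using comp0_assoc[of x ?m ?m y ?m z ?m] H' that by blast
  have Te: "strand0 ?n (e ?n) = F - smult a (?c F (?c v F))"
    unfolding rec using TT[OF fW words_mult[OF uW fW]] TT[OF uW fW] Tu by (simp add: F_def)
  have sq: "?c u' u' = smult s u'" unfolding u'_def by (rule ulin_square) auto
  have br: "?c u' (?c v u') = u'" unfolding u'_def v_def by (rule ulin_braid) (use k1 in auto)
  \<comment> \<open>The two terms of \<open>e_(k+1) = f - a f u f\<close> are put between two copies
    of \<open>u'\<close>. The first gives the factor \<open>s\<close> by \<open>u'^2 = s u'\<close>,
    the second gives 1 by \<open>u' v u' = u'\<close>, hence the new factor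
    \<open>s - a\<close>.\<close>
  have 1: "?c u' (?c F u') = smult s (?c F u')"
    using as'[OF u'W FW u'W] as'[OF FW u'W u'W] uF sq by (simp add: comp0_smult_right)
  have 2: "?c u' (?c (?c F (?c v F)) u') = ?c F u'"
  proof -
    have "?c (?c F (?c v F)) u' = ?c F (?c v (?c F u'))"
      using as'[OF FW words_mult[OF vW FW] u'W] as'[OF vW FW u'W] by simp
    also have "\<dots> = ?c F (?c (?c v u') F)" using as'[OF vW u'W FW] uF by simp
    finally have "?c u' (?c (?c F (?c v F)) u') = ?c (?c u' F) (?c (?c v u') F)"
      using as'[OF u'W FW words_mult[OF words_mult[OF vW u'W] FW]] by simp
    also have "\<dots> = ?c F (?c u' (?c (?c v u') F))"
      unfolding uF by (rule as'[OF FW u'W words_mult[OF words_mult[OF vW u'W] FW]])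
    also have "?c u' (?c (?c v u') F) = ?c u' F" using as'[OF u'W words_mult[OF vW u'W] FW] br by simp
    also have "?c F (?c u' F) = ?c F u'" using as'[OF FW FW u'W] uF FF by simp
    finally show ?thesis .
  qed
  have last: "?c u' (?c (strand0 ?n (e ?n)) u') = smult (s - a) (?c F u')"
    unfolding Te comp0_diff_left comp0_smult_left comp0_diff_right comp0_smult_right 1 2
    by (simp add: lin.scale_left_diff_distrib)
  have sk: "Suc k = ?n" "?n - 1 = k" "Suc k - 1 = k" "Suc k + 1 = ?m" by simp_all
  show ?case
    unfolding sk unfolding n2 unfolding f_def[symmetric] unfolding F_def[symmetric] u'_def[symmetric] a_def[symmetric]
  proof (intro conjI allI impI)
    fix i assume "1 \<le> i" "i < ?n"
    then show "?c (ulin ?n i) (e ?n) = 0" "?c (e ?n) (ulin ?n i) = 0" using ann by simp_all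
  qed (fact eW ee' ek(1) fe ef last)+
qed

text \<open>A non-identity pairing has two neighbouring upper points in one block, by
  \<open>irreducible_id\<close> for its reflection, as pairings have no singletons. This block
  survives any composition below, so the identity cannot arise.\<close>

lemma lookup_comp0_non_id:
  assumes x: "x \<in> Hom0 NC n n" and y: "y \<in> Hom0 NC2 n n" "Poly_Mapping.lookup y (id_diagram n) = 0"
  shows "Poly_Mapping.lookup (comp0 s x y) (id_diagram n) = 0"
proof -
  have *: "Poly_Mapping.lookup (comp0 s x (basis p)) (id_diagram n) = 0" if p: "p \<in> NC2 n n" "p \<noteq> id_diagram n" for p
    using x
  proof (induction rule: Hom0_induct)
    case (basis q)
    note fp = flipd_NC2[OF p(1)]
    note m = NC2_matching[OF fp]
    have "flipd p \<noteq> id_diagram n" using p(2) by (metis flipd_flipd flipd_id)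
    then have "reducible n (flipd p)" using irreducible_id[OF NC2_NC[OF fp]] by auto
    moreover have "\<not> (\<forall>x. same (flipd p) x (Lower i) \<longrightarrow> x = Lower i)" if "1 \<le> i" "i \<le> n" for i
    proof -
      have l: "Lower i \<in> points n n" using that by simp
      have "same (flipd p) (mate (flipd p) (Lower i)) (Lower i)"
        using same_mate[OF m l, of "mate (flipd p) (Lower i)"] by (simp add: same_sym)
      then show ?thesis using mate_ne[OF m l] by blast
    qed
    ultimately obtain i where i: "1 \<le> i" "i < n" "same (flipd p) (Lower i) (Lower (i + 1))"
      unfolding reducible_def by blast
    then have "same p (Upper i) (Upper (i + 1))" by (simp add: same_flipd)
    from same_above[OF this, of 0 1 2 q]
    have "same (composite q p) (Upper i) (Upper (i + 1))"
      using i unfolding same_composite[of 0 1 2, OF _ _ _ NC_Part[OF NC2_NC[OF p(1)]] NC_Part[OF basis], simplified] by simp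
    then have "composite q p \<noteq> id_diagram n" by (auto simp: id_diagram_kerp)
    then show ?case by (simp add: comp0_basis lookup_basis)
  qed (simp_all add: comp0_add_left comp0_smult_left lookup_add)
  have "comp0 s x y = (\<Sum>p\<in>Poly_Mapping.keys y. smult (Poly_Mapping.lookup y p) (comp0 s x (basis p)))"
    by (subst lin_expand[of y]) (simp add: comp0_sum_right comp0_smult_right)
  moreover have "p \<in> NC2 n n \<and> p \<noteq> id_diagram n" if "p \<in> Poly_Mapping.keys y" for p
    using y that by (auto simp: Hom0_def in_keys_iff)
  ultimately show ?thesis using * by (simp add: lookup_sum)
qed

lemma lookup_ulin_comp:
  assumes i: "1 \<le> i" "i < n" and y: "y \<in> Hom0 NC n n"
  shows "Poly_Mapping.lookup (comp0 s (ulin n i) y) (id_diagram n) = 0"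
  using y
proof (induction rule: Hom0_induct)
  case (basis p)
  have "same (composite (udiag n i) p) (Lower i) (Lower (i + 1))"
    unfolding same_composite_U[OF NC_Part[OF basis] i] using i by simp
  then have "composite (udiag n i) p \<noteq> id_diagram n" by (auto simp: id_diagram_kerp)
  then show ?case by (simp add: ulin_def comp0_basis lookup_basis)
qed (simp_all add: comp0_add_right comp0_smult_right lookup_add)

lemma lookup_strand0:
  assumes "x \<in> Hom0 NC n n"
  shows "Poly_Mapping.lookup (strand0 n x) (id_diagram (n + 1)) = Poly_Mapping.lookup x (id_diagram n)"
  using assms
proof (induction rule: Hom0_induct)
  case (basis p)
  have "strand n p = id_diagram (n + 1) \<longleftrightarrow> p = id_diagram n"
  proof
    assume e: "strand n p = id_diagram (n + 1)"
    show "p = id_diagram n"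
    proof (rule partition_eqI[OF Part_partition[OF NC_Part[OF basis]] Part_partition[OF NC_Part[OF id_diagram_NC]]])
      fix x y assume xy: "x \<in> points n n" "y \<in> points n n"
      have "same p x y \<longleftrightarrow> same (strand n p) x y" using xy by (auto simp: same_strand)
      also have "\<dots> \<longleftrightarrow> same (id_diagram n) x y"
        unfolding e strand_id[symmetric] using xy by (auto simp: same_strand simp del: strand_id)
      finally show "same p x y \<longleftrightarrow> same (id_diagram n) x y" .
    qed
  qed simp
  then show ?case by (simp add: lookup_basis)
qed (simp_all add: lookup_add)

text \<open>The correction term of the recursion contains a factor \<open>u\<close> and so has no
  identity component; the main term only gains a strand.\<close>

lemma lookup_jones_wenzl:
  assumes h: "\<And>k. 1 \<le> k \<Longrightarrow> s - jw_coeff s k \<noteq> 0"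
  shows "Poly_Mapping.lookup (jones_wenzl s k) (id_diagram k) = 1"
proof (cases "k = 0")
  case False
  then have "1 \<le> k" by simp
  then show ?thesis
  proof (induction k rule: nat_induct_at_least)
    case base
    show ?case by (simp add: jones_wenzl_1 id0_def lookup_basis)
  next
    case (Suc k)
    let ?f = "strand0 k (jones_wenzl s k)"
    have W: "jones_wenzl s k \<in> words s k" using jones_wenzl_props[OF h Suc.hyps] by blast
    have f: "?f \<in> Hom0 NC2 (k + 1) (k + 1)" by (rule words_NC2[OF strand0_words[OF W]])
    have i: "1 \<le> k" "k < k + 1" using Suc.hyps by auto
    have "Poly_Mapping.lookup (comp0 s ?f (comp0 s (ulin (k + 1) k) ?f)) (id_diagram (k + 1)) = 0"
      by (intro lookup_comp0_non_id NC2_sub[OF f] ulin_comp_NC2[OF i f] lookup_ulin_comp[OF i])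
    moreover have "Poly_Mapping.lookup ?f (id_diagram (k + 1)) = 1"
      using lookup_strand0[OF NC2_sub[OF words_NC2[OF W]]] Suc.IH by simp
    ultimately show ?case
      unfolding Suc_eq_plus1 using jones_wenzl_Suc[OF Suc.hyps, of s] by (simp add: Let_def lookup_minus)
  qed
qed (simp add: id0_def lookup_basis)

lemma jones_wenzl_NC2:
  assumes h: "\<And>k. 1 \<le> k \<Longrightarrow> s - jw_coeff s k \<noteq> 0"
  shows "jones_wenzl s k \<in> Hom0 NC2 k k"
proof (cases "k = 0")
  case True
  then show ?thesis using words_NC2[OF words.one, of 0] by simp
next
  case False
  then have "1 \<le> k" by simp
  then show ?thesis using jones_wenzl_props[OF h, of k] words_NC2 by blast
qed

lemma jones_wenzl_ulin:
  assumes h: "\<And>k. 1 \<le> k \<Longrightarrow> s - jw_coeff s k \<noteq> 0" and i: "1 \<le> i" "i < k"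
  shows "comp0 s (ulin k i) (jones_wenzl s k) = 0" "comp0 s (jones_wenzl s k) (ulin k i) = 0"
proof -
  have "1 \<le> k" using i by simp
  then show "comp0 s (ulin k i) (jones_wenzl s k) = 0" "comp0 s (jones_wenzl s k) (ulin k i) = 0"
    using jones_wenzl_props[OF h, of k] i by blast+
qed

subsection \<open>Fattening\<close>

definition side :: "point \<Rightarrow> point \<Rightarrow> bool" where
  "side x u \<longleftrightarrow> new_point x < old_point u"

text \<open>Geometrically, the strand from \<open>u\<close> to \<open>v\<close> passes over the new
  point \<open>x\<close>.\<close>

definition cr :: "point \<Rightarrow> point \<Rightarrow> point \<Rightarrow> bool" where
  "cr x u v \<longleftrightarrow> side x u \<noteq> side x v"

text \<open>The strands of \<open>d\<close> (with orientations) separating \<open>x\<close> from the point at infinity. Two new points are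
  equivalent iff they are separated from infinity by the same strands.\<close>

definition kap :: "diagram \<Rightarrow> point \<Rightarrow> (point \<times> point) set" where
  "kap d x = {(u, v). same d u v \<and> cr x u v}"

lemma new_point_simps [simp]: "new_point (Upper i) = Upper (4 * i - 1)" "new_point (Lower i) = Lower (4 * i - 1)"
  by (simp_all add: new_point_def)

lemma old_point_simps [simp]: "old_point (Upper i) = Upper (2 * i)" "old_point (Lower i) = Lower (2 * i)"
  by (simp_all add: old_point_def)

lemma old_point_less [simp]: "old_point u < old_point v \<longleftrightarrow> u < v"
  by (cases u; cases v) auto

lemma new_point_less: "x < y \<Longrightarrow> new_point x < new_point y"
  by (cases x; cases y) auto

lemma new_ne_old: "x \<in> points k l \<Longrightarrow> new_point x \<noteq> old_point u"
  by (cases x; cases u) (auto, presburger+)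

lemma side_mono: "x < y \<Longrightarrow> side y u \<Longrightarrow> side x u"
  unfolding side_def using new_point_less less_trans by blast

lemma kap_eq_iff: "kap d x = kap d y \<longleftrightarrow> (\<forall>u v. same d u v \<longrightarrow> cr x u v = cr y u v)"
  unfolding kap_def by (auto simp: set_eq_iff)

lemma not_separated_iff:
  "(\<not> (\<exists>B\<in>d. (\<exists>u\<in>B. s u \<noteq> t u) \<and> (\<exists>v\<in>B. \<not> (s v \<noteq> t v)))) \<longleftrightarrow>
    (\<forall>u v. same d u v \<longrightarrow> (s u \<noteq> s v) = (t u \<noteq> (t v :: bool)))" (is "?L \<longleftrightarrow> ?R")
proof
  assume L: ?L
  show ?R
  proof (intro allI impI)
    fix u v assume "same d u v"
    then obtain B where "B \<in> d" "u \<in> B" "v \<in> B" by (auto simp: same_def)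
    then have "(s u \<noteq> t u) = (s v \<noteq> t v)" using L by blast
    then show "(s u \<noteq> s v) = (t u \<noteq> t v)" by auto
  qed
next
  assume R: ?R
  show ?L
  proof
    assume "\<exists>B\<in>d. (\<exists>u\<in>B. s u \<noteq> t u) \<and> (\<exists>v\<in>B. \<not> (s v \<noteq> t v))"
    then obtain B u v where "B \<in> d" "u \<in> B" "v \<in> B" "s u \<noteq> t u" "s v = t v" by auto
    moreover from this have "(s u \<noteq> s v) = (t u \<noteq> t v)" using R sameI[of B d u v] by blast
    ultimately show False by auto
  qed
qed

text \<open>An old point lies between \<open>x\<close> and \<open>y\<close> iff they see it on
  different sides. So a block separates \<open>x\<close> from \<open>y\<close> iff for some pair of
  its points the strand passes over exactly one of them, and equivalence of new points becomes
  equality of the sets \<open>kap\<close>.\<close>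

lemma fatten_rel_iff:
  "(x, y) \<in> fatten_rel k d \<longleftrightarrow> x \<in> points k k \<and> y \<in> points k k \<and> kap d x = kap d y"
proof -
  have b: "between (new_point x) (new_point y) (old_point u) \<longleftrightarrow> side x u \<noteq> side y u"
    if "x \<in> points k k" "y \<in> points k k" for u
    unfolding between_def side_def less_point_def[symmetric]
    using new_ne_old[OF that(1), of u] new_ne_old[OF that(2), of u] by auto
  show ?thesis
    unfolding fatten_rel_def kap_eq_iff cr_def mem_Collect_eq case_prod_conv
    by (intro conj_cong refl) (simp only: b not_separated_iff)
qed

lemma fatten_kerp: "fatten k d = kerp (points k k) (kap d)"
proof -
  have "fatten_rel k d `` {x} = {y \<in> points k k. kap d y = kap d x}" if "x \<in> points k k" for x
    using that by (auto simp: fatten_rel_iff)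
  then show ?thesis unfolding fatten_def quotient_def kerp_def by auto
qed

lemma same_fatten: "same (fatten k d) x y \<longleftrightarrow> x \<in> points k k \<and> y \<in> points k k \<and> kap d x = kap d y"
  unfolding fatten_kerp by simp

lemma fatten_Part: "fatten k d \<in> Part k k"
  unfolding fatten_kerp by simp

text \<open>\<open>side\<close> is monotone in the new point, so a strand over \<open>x\<close> and
  over \<open>z\<close> also passes over everything between them. For \<open>a < b < c < e\<close>
  as in a crossing this gives inclusions both ways.\<close>

lemma kap_between: "x < y \<Longrightarrow> y < z \<Longrightarrow> kap d x = kap d z \<Longrightarrow> kap d x \<subseteq> kap d y"
proof
  fix uv assume o: "x < y" "y < z" and e: "kap d x = kap d z" and m: "uv \<in> kap d x"
  obtain u v where uv: "uv = (u, v)" by (cases uv)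
  have "same d u v" "cr x u v" "cr z u v" using m e unfolding uv kap_def by auto
  then show "uv \<in> kap d y"
    using side_mono[OF o(1), of u] side_mono[OF o(1), of v] side_mono[OF o(2), of u] side_mono[OF o(2), of v]
    unfolding uv kap_def cr_def by auto
qed

lemma fatten_NC: "fatten k d \<in> NC k k"
  unfolding fatten_kerp
proof (rule kerp_NC_I)
  fix a b c e assume "kap d a = kap d c" "kap d b = kap d e" "a < b" "b < c" "c < e"
  then show "kap d a = kap d b" using kap_between[of a b c d] kap_between[of b c e d] by blast
qed

lemma flip_new [simp]: "new_point (flip x) = flip (new_point x)" by (cases x) auto
lemma flip_old [simp]: "old_point (flip x) = flip (old_point x)" by (cases x) auto

lemma side_flip: "x \<in> points k k \<Longrightarrow> side (flip x) u \<longleftrightarrow> \<not> side x (flip u)"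
  using new_ne_old[of x k k "flip u"] unfolding side_def
  by (metis flip_flip flip_less flip_new flip_old linorder_less_linear not_less_iff_gr_or_eq)

lemma fatten_flipd: "fatten k (flipd d) = flipd (fatten k d)"
proof -
  have "kap (flipd d) x = kap (flipd d) y \<longleftrightarrow> kap d (flip x) = kap d (flip y)"
    if "x \<in> points k k" "y \<in> points k k" for x y
  proof -
    have f: "flip x \<in> points k k" "flip y \<in> points k k" using that by simp_all
    have "cr x (flip u) (flip v) = cr (flip x) u v" "cr y (flip u) (flip v) = cr (flip y) u v" for u v
      unfolding cr_def using side_flip[OF that(1)] side_flip[OF that(2)] by auto
    then show ?thesis unfolding kap_eq_iff same_flipd by (metis flip_flip)
  qed
  then have "kerp (points k k) (kap (flipd d)) = kerp (points k k) (kap d \<circ> flip)"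
    by (intro kerp_cong) simp
  then show ?thesis unfolding fatten_kerp flipd_kerp .
qed

text \<open>The new point adjacent to an old point.\<close>

definition nb :: "point \<Rightarrow> point" where
  "nb = case_point (\<lambda>j. Upper ((j + 1) div 2)) (\<lambda>j. Lower ((j + 1) div 2))"

lemma nb_simps [simp]: "nb (Upper j) = Upper ((j + 1) div 2)" "nb (Lower j) = Lower ((j + 1) div 2)"
  by (simp_all add: nb_def)

lemma nb_in: "u \<in> points (2 * k) (2 * k) \<Longrightarrow> nb u \<in> points k k"
  by (cases u) auto

text \<open>No old point other than \<open>u\<close> itself lies between \<open>u\<close> and
  \<open>nb u\<close>.\<close>

lemma side_nb: "u \<in> points (2 * k) (2 * k) \<Longrightarrow> w \<noteq> u \<Longrightarrow> side (nb u) w \<longleftrightarrow> u < w"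
proof -
  have 1: "4 * ((j + 1) div 2) - 1 < 2 * j' \<longleftrightarrow> j < j'" if "1 \<le> j" "j' \<noteq> j" for j j' :: nat using that by presburger
  have 2: "2 * j' < 4 * ((j + 1) div 2) - 1 \<longleftrightarrow> j' < j" if "1 \<le> j" "j' \<noteq> j" for j j' :: nat using that by presburger
  show "u \<in> points (2 * k) (2 * k) \<Longrightarrow> w \<noteq> u \<Longrightarrow> ?thesis"
    unfolding side_def by (cases u; cases w) (simp_all add: 1 2)
qed

lemma cr_nb: "u \<in> points (2 * k) (2 * k) \<Longrightarrow> v \<noteq> u \<Longrightarrow> w \<noteq> u \<Longrightarrow> cr (nb u) v w \<longleftrightarrow> (u < v) \<noteq> (u < w)"
  unfolding cr_def using side_nb by blast

lemma cr_self [simp]: "\<not> cr x u u" by (simp add: cr_def)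

lemma cr_sym: "cr x u v \<longleftrightarrow> cr x v u" by (auto simp: cr_def)

text \<open>An order embedding of the points into the reals, upper points negative and lower points
  positive in reverse order. It makes \<open>separation\<close> a fact about six real
  numbers.\<close>

definition pos :: "point \<Rightarrow> real" where
  "pos = case_point (\<lambda>i. - 1 / (real i + 1)) (\<lambda>i. 1 / (real i + 1))"

lemma pos_less: "x < y \<longleftrightarrow> pos x < pos y"
proof -
  have p: "0 < 1 / (real i + 1)" for i by simp
  have "- (1 / (real i + 1)) < 1 / (real j + 1)" for i j using p[of i] p[of j] by linarith
  moreover have "\<not> 1 / (real i + 1) < - (1 / (real j + 1))" for i j using p[of i] p[of j] by linarith
  ultimately show ?thesis by (cases x; cases y) (auto simp: pos_def field_simps)
qed

lemma separation_real:
  fixes X Y U V A A' :: real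
  assumes "X \<notin> {U, V, A, A'}" "Y \<notin> {U, V, A, A'}" "A \<notin> {U, V}"
    and "A' \<in> {U, V} \<or> ((A < U) \<noteq> (A < V)) = ((A' < U) \<noteq> (A' < V)) \<and> A' \<notin> {U, V}"
    and "((X < A) \<noteq> (X < A')) \<noteq> ((Y < A) \<noteq> (Y < A'))"
    and "((X < U) \<noteq> (X < V)) = ((Y < U) \<noteq> (Y < V))"
  shows "((X < U) \<noteq> (X < V)) = ((A < U) \<noteq> (A < V))"
  using assms by (smt (verit) insertCI insertE singletonD)

text \<open>The strands \<open>u v\<close> and \<open>a a'\<close> do not cross, and
  \<open>a a'\<close> separates \<open>x\<close> from \<open>y\<close> whereas \<open>u v\<close>
  does not. So one of \<open>x\<close>, \<open>y\<close> lies on the side of \<open>a a'\<close>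
  away from \<open>u v\<close>. From there \<open>a\<close> is reached without crossing
  \<open>u v\<close>, hence \<open>x\<close> and \<open>y\<close> lie on the same side of
  \<open>u v\<close> as \<open>a\<close>.\<close>

lemma separation:
  assumes xy: "x \<in> points k k" "y \<in> points k k" and a: "a \<noteq> u" "a \<noteq> v"
    and nc: "a' = u \<or> a' = v \<or> ((a < u) = (a < v)) = ((a' < u) = (a' < v))"
    and sep: "cr x a a' \<noteq> cr y a a'" and eq: "cr x u v = cr y u v"
  shows "cr x u v \<longleftrightarrow> (a < u) \<noteq> (a < v)"
proof -
  let ?o = "\<lambda>z. pos (old_point z)" and ?n = "\<lambda>z. pos (new_point z)"
  have inj: "?o z = ?o w \<longleftrightarrow> z = w" for z w
    using pos_less[of "old_point z" "old_point w"] pos_less[of "old_point w" "old_point z"]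
    by (metis linorder_less_linear old_point_less less_irrefl)
  have ne: "?n z \<noteq> ?o w" if "z \<in> points k k" for z w
    using pos_less[of "new_point z" "old_point w"] pos_less[of "old_point w" "new_point z"] new_ne_old[OF that, of w]
    by (metis linorder_less_linear less_irrefl)
  have l: "z < w \<longleftrightarrow> ?o z < ?o w" for z w using pos_less[of "old_point z" "old_point w"] by simp
  have s: "side z w \<longleftrightarrow> ?n z < ?o w" for z w unfolding side_def pos_less ..
  show ?thesis
    unfolding cr_def s l
  proof (rule separation_real[where A' = "?o a'"])
    show "?n x \<notin> {?o u, ?o v, ?o a, ?o a'}" "?n y \<notin> {?o u, ?o v, ?o a, ?o a'}" "?o a \<notin> {?o u, ?o v}"
      using ne[OF xy(1)] ne[OF xy(2)] a inj by auto
    show "?o a' \<in> {?o u, ?o v} \<or> ((?o a < ?o u) \<noteq> (?o a < ?o v)) = ((?o a' < ?o u) \<noteq> (?o a' < ?o v)) \<and> ?o a' \<notin> {?o u, ?o v}"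
      using nc inj unfolding l by auto
    show "((?n x < ?o a) \<noteq> (?n x < ?o a')) \<noteq> ((?n y < ?o a) \<noteq> (?n y < ?o a'))" using sep unfolding cr_def s .
    show "((?n x < ?o u) \<noteq> (?n x < ?o v)) = ((?n y < ?o u) \<noteq> (?n y < ?o v))" using eq unfolding cr_def s .
  qed
qed

section \<open>Parity of the number of strands over a new point\<close>

lemma odd_card_side:
  assumes x: "x \<in> points k k" shows "odd (card {u \<in> points (2 * k) (2 * k). side x u})"
proof (cases x)
  case (Upper i)
  then have i: "1 \<le> i" "i \<le> k" using x by auto
  have s: "side (Upper i) (Upper j) \<longleftrightarrow> 2 * i \<le> j" "side (Upper i) (Lower j)" for j
    unfolding side_def using i by auto
  have "{u \<in> points (2 * k) (2 * k). side x u} = Upper ` {2 * i..2 * k} \<union> Lower ` {1..2 * k}" (is "_ = ?R")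
  proof (intro set_eqI)
    fix u show "u \<in> {u \<in> points (2 * k) (2 * k). side x u} \<longleftrightarrow> u \<in> ?R"
      using i s unfolding Upper by (cases u) auto
  qed
  also have "card ?R = card (Upper ` {2 * i..2 * k}) + card (Lower ` {1..2 * k})" by (rule card_Un_disjoint) auto
  also have "\<dots> = (2 * k + 1 - 2 * i) + 2 * k" by (simp add: card_image inj_on_def)
  finally show ?thesis using i by simp
next
  case (Lower i)
  then have i: "1 \<le> i" "i \<le> k" using x by auto
  have s: "\<not> side (Lower i) (Upper j)" "side (Lower i) (Lower j) \<longleftrightarrow> j < 2 * i" for j
    unfolding side_def using i by auto
  have "{u \<in> points (2 * k) (2 * k). side x u} = Lower ` {1..<2 * i}" (is "_ = ?R")
  proof (intro set_eqI)
    fix u show "u \<in> {u \<in> points (2 * k) (2 * k). side x u} \<longleftrightarrow> u \<in> ?R"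
      using i s unfolding Lower by (cases u) auto
  qed
  also have "card ?R = 2 * i - 1" by (simp add: card_image inj_on_def)
  finally show ?thesis using i by simp
qed

text \<open>The old points after \<open>x\<close> are odd in number. A pair with both ends or no end
  after \<open>x\<close> contributes evenly, so the strands over \<open>x\<close> are odd in
  number.\<close>

lemma odd_card_crossed:
  assumes d: "matching (points (2 * k) (2 * k)) d" and x: "x \<in> points k k"
  shows "odd (card {B \<in> d. \<exists>u\<in>B. \<exists>v\<in>B. cr x u v})"
proof -
  let ?A = "points (2 * k) (2 * k)"
  have U: "\<Union>d = ?A" and dj: "disjoint d" and fin: "finite d"
    using matching_partition[OF d] finite_elements[OF _ matching_partition[OF d]] by (auto simp: partition_on_def)
  have "{u \<in> ?A. side x u} = (\<Union>B\<in>d. {u \<in> B. side x u})" using U by auto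
  also have "card \<dots> = (\<Sum>B\<in>d. card {u \<in> B. side x u})"
  proof (rule card_UN_disjoint[OF fin])
    show "\<forall>B\<in>d. finite {u \<in> B. side x u}" using U by (intro ballI finite_subset[OF _ finite_points[of "2 * k" "2 * k"]]) auto
    show "\<forall>B\<in>d. \<forall>C\<in>d. B \<noteq> C \<longrightarrow> {u \<in> B. side x u} \<inter> {u \<in> C. side x u} = {}"
      using dj by (auto simp: disjoint_def)
  qed
  finally have "odd (\<Sum>B\<in>d. card {u \<in> B. side x u})" using odd_card_side[OF x] by simp
  then have "odd (card {B \<in> d. odd (card {u \<in> B. side x u})})" unfolding even_sum_iff[OF fin] .
  moreover have "odd (card {u \<in> B. side x u}) \<longleftrightarrow> (\<exists>u\<in>B. \<exists>v\<in>B. cr x u v)" if "B \<in> d" for B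
  proof -
    obtain u v where uv: "B = {u, v}" "u \<noteq> v" using d \<open>B \<in> d\<close> by (auto simp: matching_def card_2_iff)
    have "{w \<in> B. side x w} = (if side x u then {u} else {}) \<union> (if side x v then {v} else {})" using uv by auto
    then show ?thesis using uv by (auto simp: cr_def)
  qed
  then have "{B \<in> d. odd (card {u \<in> B. side x u})} = {B \<in> d. \<exists>u\<in>B. \<exists>v\<in>B. cr x u v}" by blast
  ultimately show ?thesis by simp
qed

text \<open>Both numbers of strands are odd, so agreement on all strands but one forces agreement on
  the last.\<close>

lemma parity_last:
  assumes d: "matching (points (2 * k) (2 * k)) d" and xy: "x \<in> points k k" "y \<in> points k k"
    and u0: "u0 \<in> points (2 * k) (2 * k)"
    and eq: "\<And>u. u \<in> points (2 * k) (2 * k) \<Longrightarrow> u \<noteq> u0 \<Longrightarrow> u \<noteq> mate d u0 \<Longrightarrow> cr x u (mate d u) = cr y u (mate d u)"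
  shows "cr x u0 (mate d u0) = cr y u0 (mate d u0)"
proof -
  let ?A = "points (2 * k) (2 * k)"
  define c where "c z B \<longleftrightarrow> (\<exists>u\<in>B. \<exists>v\<in>B. cr z u v)" for z and B :: "point set"
  note P = matching_partition[OF d]
  have blk: "B = {u, mate d u}" if "B \<in> d" "u \<in> B" for B u
  proof -
    have "u \<in> ?A" using that P by (auto simp: partition_on_def)
    then show ?thesis using same_block[OF P that] same_mate[OF d] by auto
  qed
  have c_eq: "c z {u, mate d u} \<longleftrightarrow> cr z u (mate d u)" for z u unfolding c_def using cr_sym by auto
  let ?B = "{u0, mate d u0}"
  have "{y. same d u0 y} = ?B" using same_mate[OF d u0] by auto
  then have B0: "?B \<in> d" using block_in[OF P u0] by simp
  have ceq: "c x B = c y B" if B: "B \<in> d" "B \<noteq> ?B" for B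
  proof -
    have "B \<noteq> {}" using B P by (auto simp: partition_on_def)
    then obtain u where u: "u \<in> B" by auto
    have "u \<in> ?A" using u B P by (auto simp: partition_on_def)
    moreover have "u \<notin> ?B" using partition_unique[OF P B(1) B0 u] B(2) by blast
    ultimately show ?thesis using eq[of u] unfolding blk[OF B(1) u] c_eq by auto
  qed
  have fin: "finite d" using finite_elements[OF _ P] by simp
  have o: "odd (card {B \<in> d. c z B})" if "z \<in> points k k" for z
    unfolding c_def by (rule odd_card_crossed[OF d that])
  have split: "{B \<in> d. c z B} = (if c z ?B then insert ?B {B \<in> d - {?B}. c z B} else {B \<in> d - {?B}. c z B})" for z
    using B0 by auto
  have "card {B \<in> d. c z B} = (if c z ?B then 1 else 0) + card {B \<in> d - {?B}. c z B}" for z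
    by (subst split) (use fin in auto)
  moreover have "{B \<in> d - {?B}. c x B} = {B \<in> d - {?B}. c y B}" using ceq by blast
  ultimately have "c x ?B = c y ?B" using o[OF xy(1)] o[OF xy(2)] by (auto split: if_splits)
  then show ?thesis unfolding c_eq .
qed

lemma kap_eq_mate:
  assumes d: "matching (points (2 * k) (2 * k)) d"
  shows "kap d x = kap d y \<longleftrightarrow> (\<forall>u\<in>points (2 * k) (2 * k). cr x u (mate d u) = cr y u (mate d u))"
proof -
  have "same d u v \<longleftrightarrow> u \<in> points (2 * k) (2 * k) \<and> (v = u \<or> v = mate d u)" for u v
    using same_mate[OF d, of u v] same_in[OF matching_partition[OF d], of u v] by blast
  then show ?thesis unfolding kap_eq_iff by auto
qed

lemma mate_nc:
  assumes d: "d \<in> NC2 n n" and u: "u \<in> points n n" and v: "v \<in> points n n" "v \<noteq> u" "v \<noteq> mate d u"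
  shows "((u < v) = (u < mate d v)) = ((mate d u < v) = (mate d u < mate d v))"
proof -
  note m = NC2_matching[OF d]
  note P = matching_partition[OF m]
  obtain B C where BC: "B \<in> d" "u \<in> B" "mate d u \<in> B" "C \<in> d" "v \<in> C" "mate d v \<in> C"
    using same_mate[OF m u, of "mate d u"] same_mate[OF m v(1), of "mate d v"] by (auto simp: same_def)
  have "\<not> same d u v" using same_mate[OF m u] v by simp
  then have "B \<noteq> C" using BC by (auto intro: sameI)
  then have "B \<inter> C = {}" using partition_unique[OF P] BC by blast
  then show ?thesis using nc_sep[of d B C u "mate d u" v "mate d v"] d BC by (simp add: NC2_def NC_def)
qed

text \<open>Following the strand from \<open>u\<close> to its partner crosses no other strand, so
  the new points next to its ends agree on all other strands. \<open>parity_last\<close> puts them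
  on the same side of this one.\<close>

lemma kap_nb_mate:
  assumes d: "d \<in> NC2 (2 * k) (2 * k)" and u: "u \<in> points (2 * k) (2 * k)"
  shows "kap d (nb u) = kap d (nb (mate d u))"
proof -
  note m = NC2_matching[OF d]
  have mu: "mate d u \<in> points (2 * k) (2 * k)" by (rule mate_in[OF m u])
  have *: "cr (nb u) w (mate d w) = cr (nb (mate d u)) w (mate d w)"
    if w: "w \<in> points (2 * k) (2 * k)" "w \<noteq> u" "w \<noteq> mate d u" for w
  proof -
    have "mate d w \<noteq> u" "mate d w \<noteq> mate d u"
      using w mate_mate[OF m w(1)] mate_mate[OF m u] by auto
    then show ?thesis using cr_nb[OF u w(2)] cr_nb[OF mu w(3)] mate_nc[OF d u w] by blast
  qed
  moreover have l: "cr (nb u) u (mate d u) = cr (nb (mate d u)) u (mate d u)"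
    by (rule parity_last[OF m nb_in[OF u] nb_in[OF mu] u *])
  moreover have "cr (nb u) (mate d u) (mate d (mate d u)) = cr (nb (mate d u)) (mate d u) (mate d (mate d u))"
    using l mate_mate[OF m u] cr_sym by metis
  ultimately show ?thesis unfolding kap_eq_mate[OF m] by blast
qed

subsection \<open>Rejoining adjacent strands\<close>

context
  fixes k :: nat and d :: diagram and a b :: point
  assumes d: "d \<in> NC2 (2 * k) (2 * k)" and ab: "a \<in> points (2 * k) (2 * k)" "b \<in> points (2 * k) (2 * k)" "a < b"
    and adj: "\<And>w. w \<in> points (2 * k) (2 * k) \<Longrightarrow> w \<noteq> a \<Longrightarrow> w \<noteq> b \<Longrightarrow> (a < w) = (b < w)"
    and nm: "mate d a \<noteq> b"
begin

private abbreviation "O2 \<equiv> points (2 * k) (2 * k)"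
private lemma m: "matching O2 d" by (rule NC2_matching[OF d])
private lemma ne: "a \<noteq> b" using ab by simp
private lemma m': "matching O2 (rejoin a b d)" by (rule matching_rejoin[OF m ab(1,2) ne])

private lemma mate': "x \<in> O2 \<Longrightarrow> mate (rejoin a b d) x = (if x = a then b else if x = b then a
    else if x = mate d a then mate d b else if x = mate d b then mate d a else mate d x)"
  using mate_rejoin[OF m ab(1,2) ne] nm by simp

private lemma nm': "mate d b \<noteq> a" "mate d a \<noteq> a" "mate d b \<noteq> b" "mate d a \<noteq> mate d b" "mate d a \<in> O2" "mate d b \<in> O2"
    "mate d (mate d a) = a" "mate d (mate d b) = b"
  using nm ne mate_mate[OF m ab(1)] mate_mate[OF m ab(2)] mate_ne[OF m ab(1)] mate_ne[OF m ab(2)]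
    mate_in[OF m ab(1)] mate_in[OF m ab(2)] by metis+

private definition "agree x y \<longleftrightarrow> (\<forall>u\<in>O2. u \<noteq> a \<longrightarrow> u \<noteq> b \<longrightarrow> cr x u (mate (rejoin a b d) u) = cr y u (mate (rejoin a b d) u))"

private lemma kap_agree: "kap (rejoin a b d) x = kap (rejoin a b d) y \<longleftrightarrow> agree x y \<and> cr x a b = cr y a b"
proof -
  have e: "cr z b (mate (rejoin a b d) b) = cr z a b" "cr z a (mate (rejoin a b d) a) = cr z a b" for z
    using mate'[OF ab(1)] mate'[OF ab(2)] ne cr_sym[of z a b] by simp_all
  define P where "P u \<longleftrightarrow> cr x u (mate (rejoin a b d) u) = cr y u (mate (rejoin a b d) u)" for u
  have "P a \<longleftrightarrow> cr x a b = cr y a b" "P b \<longleftrightarrow> cr x a b = cr y a b" unfolding P_def e by (rule refl)+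
  then show ?thesis unfolding kap_eq_mate[OF m'] agree_def P_def[symmetric] using ab(1,2) by metis
qed

text \<open>For points not between \<open>a\<close> and \<open>b\<close> the strand joining the two
  partners is the sum mod 2 of the strands at \<open>a\<close> and at \<open>b\<close>. So equality
  of \<open>kap d\<close> refines \<open>agree\<close> by one bit, the side of the strand at
  \<open>a\<close>.\<close>

private lemma agree_kap:
  assumes s: "side x a = side x b" "side y a = side y b"
  shows "agree x y \<and> cr x a (mate d a) = cr y a (mate d a) \<longleftrightarrow> kap d x = kap d y"
proof -
  let ?e = "\<lambda>u v. cr x u v = cr y u v"
  have 1: "?e (mate d a) (mate d b) \<longleftrightarrow> (?e a (mate d a) = ?e b (mate d b))"
    unfolding cr_def using s by auto
  have sym: "?e u v = ?e v u" for u v using cr_sym by metis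
  have mm: "mate (rejoin a b d) (mate d a) = mate d b" "mate (rejoin a b d) (mate d b) = mate d a"
    using mate' nm' nm by auto
  have mo: "mate (rejoin a b d) u = mate d u" if "u \<in> O2" "u \<notin> {a, b, mate d a, mate d b}" for u
    using mate'[OF that(1)] that(2) by auto
  let ?rest = "\<forall>u\<in>O2. u \<notin> {a, b, mate d a, mate d b} \<longrightarrow> ?e u (mate d u)"
  have A: "agree x y \<longleftrightarrow> ?rest \<and> ?e (mate d a) (mate d b)"
  proof
    assume ag: "agree x y"
    have "?e u (mate d u)" if "u \<in> O2" "u \<notin> {a, b, mate d a, mate d b}" for u
      using ag that mo[OF that] unfolding agree_def by auto
    moreover have "?e (mate d a) (mate d b)" using ag nm' nm mm unfolding agree_def by metis
    ultimately show "?rest \<and> ?e (mate d a) (mate d b)" by blast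
  next
    assume r: "?rest \<and> ?e (mate d a) (mate d b)"
    show "agree x y" unfolding agree_def
    proof (intro ballI impI)
      fix u assume u: "u \<in> O2" "u \<noteq> a" "u \<noteq> b"
      consider "u = mate d a" | "u = mate d b" | "u \<notin> {a, b, mate d a, mate d b}" using u by auto
      then show "?e u (mate (rejoin a b d) u)"
      proof cases
        case 1 then show ?thesis using r mm by simp
      next
        case 2 then show ?thesis using r mm sym[of "mate d a" "mate d b"] by simp
      next
        case 3 then show ?thesis using r mo[OF u(1) 3] u by simp
      qed
    qed
  qed
  have K: "kap d x = kap d y \<longleftrightarrow> ?rest \<and> ?e a (mate d a) \<and> ?e b (mate d b)"
  proof
    assume "kap d x = kap d y"
    then show "?rest \<and> ?e a (mate d a) \<and> ?e b (mate d b)" unfolding kap_eq_mate[OF m] using ab by blast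
  next
    assume r: "?rest \<and> ?e a (mate d a) \<and> ?e b (mate d b)"
    show "kap d x = kap d y" unfolding kap_eq_mate[OF m]
    proof
      fix u assume u: "u \<in> O2"
      consider "u = a" | "u = b" | "u = mate d a" | "u = mate d b" | "u \<notin> {a, b, mate d a, mate d b}" by blast
      then show "?e u (mate d u)"
      proof cases
        case 3 then show ?thesis using r sym[of a "mate d a"] nm' by simp
      next
        case 4 then show ?thesis using r sym[of b "mate d b"] nm' by simp
      qed (use r u in auto)
    qed
  qed
  show ?thesis unfolding A K using 1 by blast
qed

text \<open>The strand at \<open>a\<close> separates \<open>x\<close> from \<open>y\<close>, while
  no strand of the rejoined pairing other than \<open>{a, b}\<close> does. By
  \<open>separation\<close>, \<open>x\<close> then lies on the same side of each such strand as
  \<open>a\<close>, and so does \<open>nb a\<close>.\<close>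

private lemma separated_agree:
  assumes xy: "x \<in> points k k" "y \<in> points k k" and ag: "agree x y" and s: "cr x a (mate d a) \<noteq> cr y a (mate d a)"
  shows "agree x (nb a)"
  unfolding agree_def
proof (intro ballI impI)
  fix u assume u: "u \<in> O2" "u \<noteq> a" "u \<noteq> b"
  let ?v = "mate (rejoin a b d) u"
  have v: "?v \<noteq> a" "?v \<noteq> b"
    using u mate'[OF ab(1)] mate'[OF ab(2)] mate_mate[OF m' u(1)] ne by auto
  have "cr x u ?v \<longleftrightarrow> (a < u) \<noteq> (a < ?v)"
  proof (rule separation[OF xy _ _ _ s])
    show "a \<noteq> u" "a \<noteq> ?v" using u v by auto
    show "cr x u ?v = cr y u ?v" using ag u unfolding agree_def by blast
    show "mate d a = u \<or> mate d a = ?v \<or> ((a < u) = (a < ?v)) = ((mate d a < u) = (mate d a < ?v))"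
    proof (cases "u = mate d a \<or> u = mate d b")
      case True
      then have "mate d a = u \<or> mate d a = ?v" using mate'[OF u(1)] u nm' nm by auto
      then show ?thesis by blast
    next
      case False
      then have "?v = mate d u" using mate'[OF u(1)] u by auto
      then show ?thesis using mate_nc[OF d ab(1) u(1)] u False by simp
    qed
  qed
  also have "\<dots> \<longleftrightarrow> cr (nb a) u ?v" using cr_nb[OF ab(1) u(2) v(1)] by simp
  finally show "cr x u ?v = cr (nb a) u ?v" .
qed

private lemma agree_sym: "agree x y \<Longrightarrow> agree y x" and agree_trans: "agree x y \<Longrightarrow> agree y z \<Longrightarrow> agree x z"
  unfolding agree_def by auto

text \<open>Reconnecting opens a passage from \<open>nb a\<close> to \<open>nb b\<close>, which lay
  on different sides of the strand at \<open>a\<close>. If \<open>x\<close> and \<open>y\<close>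
  agree afterwards but were separated by this strand, both agree with these two points, so one of
  them was with \<open>nb a\<close> and the other with \<open>nb b\<close>.\<close>

lemma kap_merge:
  assumes new: "\<And>x. x \<in> points k k \<Longrightarrow> side x a = side x b"
    and xy: "x \<in> points k k" "y \<in> points k k"
  shows "kap (rejoin a b d) x = kap (rejoin a b d) y \<longleftrightarrow>
    kap d x = kap d y \<or> kap d x = kap d (nb a) \<and> kap d (nb b) = kap d y \<or>
    kap d x = kap d (nb b) \<and> kap d (nb a) = kap d y"
    and "kap d (nb a) \<noteq> kap d (nb b)"
proof -
  let ?X = "nb a" and ?Y = "nb b"
  have X: "?X \<in> points k k" "?Y \<in> points k k" using nb_in ab by auto
  have cab: "\<not> cr z a b" if "z \<in> points k k" for z using new[OF that] by (simp add: cr_def)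
  have ka: "kap (rejoin a b d) z = kap (rejoin a b d) w \<longleftrightarrow> agree z w" if "z \<in> points k k" "w \<in> points k k" for z w
    using kap_agree cab that by auto
  have kd: "agree z w \<and> cr z a (mate d a) = cr w a (mate d a) \<longleftrightarrow> kap d z = kap d w" if "z \<in> points k k" "w \<in> points k k" for z w
    by (rule agree_kap[OF new[OF that(1)] new[OF that(2)]])
  have XY: "agree ?X ?Y"
    unfolding agree_def
  proof (intro ballI impI)
    fix u assume u: "u \<in> O2" "u \<noteq> a" "u \<noteq> b"
    let ?v = "mate (rejoin a b d) u"
    have v: "?v \<noteq> a" "?v \<noteq> b"
      using u mate'[OF ab(1)] mate'[OF ab(2)] mate_mate[OF m' u(1)] ne by auto
    have "?v \<in> O2" by (rule mate_in[OF m' u(1)])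
    then show "cr ?X u ?v = cr ?Y u ?v"
      using cr_nb[OF ab(1) u(2) v(1)] cr_nb[OF ab(2) u(3) v(2)] adj[OF u] adj[of ?v] v by auto
  qed
  \<comment> \<open>\<open>a\<close> lies between \<open>nb a\<close> and \<open>nb b\<close>, and
    the partner of \<open>a\<close> does not.\<close>
  have ns: "cr ?X a (mate d a) \<noteq> cr ?Y a (mate d a)"
  proof -
    have "side ?X a" using new[OF X(1)] side_nb[OF ab(1), of b] ne ab(3) by simp
    moreover have "\<not> side ?Y a" using side_nb[OF ab(2), of a] ne ab(3) by auto
    moreover have "side ?X (mate d a) = side ?Y (mate d a)"
      using side_nb[OF ab(1), of "mate d a"] side_nb[OF ab(2), of "mate d a"] adj[of "mate d a"] nm nm' by auto
    ultimately show ?thesis by (auto simp: cr_def)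
  qed
  then show "kap d ?X \<noteq> kap d ?Y" using kd[OF X] by blast
  have fwd: "kap d x = kap d y \<or> kap d x = kap d ?X \<and> kap d ?Y = kap d y \<or> kap d x = kap d ?Y \<and> kap d ?X = kap d y"
    if ag: "agree x y"
  proof (cases "cr x a (mate d a) = cr y a (mate d a)")
    case True then show ?thesis using kd[OF xy] ag by blast
  next
    case False
    have xX: "agree x ?X" by (rule separated_agree[OF xy ag False])
    have xY: "agree x ?Y" by (rule agree_trans[OF xX XY])
    have yX: "agree y ?X" by (rule agree_trans[OF agree_sym[OF ag] xX])
    have yY: "agree y ?Y" by (rule agree_trans[OF yX XY])
    show ?thesis
      using kd[OF xy(1) X(1)] kd[OF xy(1) X(2)] kd[OF xy(2) X(1)] kd[OF xy(2) X(2)] xX xY yX yY False ns by metis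
  qed
  have kag: "agree z w" if "kap d z = kap d w" "z \<in> points k k" "w \<in> points k k" for z w
    using kd[OF that(2,3)] that(1) by blast
  have bwd: "agree x y"
    if "kap d x = kap d y \<or> kap d x = kap d ?X \<and> kap d ?Y = kap d y \<or> kap d x = kap d ?Y \<and> kap d ?X = kap d y"
    using that
  proof (elim disjE conjE)
    assume "kap d x = kap d y" then show ?thesis by (rule kag[OF _ xy])
  next
    assume "kap d x = kap d ?X" "kap d ?Y = kap d y"
    then show ?thesis using kag[OF _ xy(1) X(1)] kag[OF _ X(2) xy(2)] XY agree_trans by blast
  next
    assume "kap d x = kap d ?Y" "kap d ?X = kap d y"
    then show ?thesis using kag[OF _ xy(1) X(2)] kag[OF _ X(1) xy(2)] agree_sym[OF XY] agree_trans by blast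
  qed
  show "kap (rejoin a b d) x = kap (rejoin a b d) y \<longleftrightarrow>
    kap d x = kap d y \<or> kap d x = kap d (nb a) \<and> kap d (nb b) = kap d y \<or>
    kap d x = kap d (nb b) \<and> kap d (nb a) = kap d y"
    unfolding ka[OF xy] using fwd bwd by blast
qed

text \<open>The new strand \<open>{a, b}\<close> passes over \<open>nb a\<close> and over no other
  new point. If the strand at \<open>a\<close> had separated two other points that agree afterwards,
  these would agree with \<open>nb a\<close> on all strands except \<open>{a, b}\<close>, hence by
  parity on that one too, which is impossible.\<close>

lemma kap_isolate:
  assumes nb: "nb a = nb b"
    and new: "\<And>x. x \<in> points k k \<Longrightarrow> x \<noteq> nb a \<Longrightarrow> side x a = side x b" and newX: "side (nb a) a \<noteq> side (nb a) b"
    and xy: "x \<in> points k k" "y \<in> points k k"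
  shows "kap (rejoin a b d) x = kap (rejoin a b d) y \<longleftrightarrow>
    x = nb a \<and> y = nb a \<or> x \<noteq> nb a \<and> y \<noteq> nb a \<and> kap d x = kap d y"
proof -
  let ?X = "nb a"
  have X: "?X \<in> points k k" using nb_in ab by auto
  have cX: "cr ?X a b" using newX by (simp add: cr_def)
  have cz: "\<not> cr z a b" if "z \<in> points k k" "z \<noteq> ?X" for z using new[OF that] by (simp add: cr_def)
  have main: "kap (rejoin a b d) x = kap (rejoin a b d) y \<longleftrightarrow> kap d x = kap d y" if "x \<noteq> ?X" "y \<noteq> ?X"
  proof -
    have kd: "agree x y \<and> cr x a (mate d a) = cr y a (mate d a) \<longleftrightarrow> kap d x = kap d y"
      by (rule agree_kap[OF new[OF xy(1) that(1)] new[OF xy(2) that(2)]])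
    have "cr x a (mate d a) = cr y a (mate d a)" if ag: "agree x y"
    proof (rule ccontr)
      assume s: "cr x a (mate d a) \<noteq> cr y a (mate d a)"
      have xX: "agree x ?X" by (rule separated_agree[OF xy ag s])
      have ma: "mate (rejoin a b d) a = b" using mate'[OF ab(1)] by simp
      have "cr x a (mate (rejoin a b d) a) = cr ?X a (mate (rejoin a b d) a)"
        by (rule parity_last[OF m' xy(1) X ab(1)]) (use xX ma in \<open>auto simp: agree_def\<close>)
      then show False using cX cz[OF xy(1) \<open>x \<noteq> ?X\<close>] ma by simp
    qed
    then show ?thesis using kd kap_agree[of x y] cz[OF xy(1) that(1)] cz[OF xy(2) that(2)] by blast
  qed
  show ?thesis
  proof (cases "x = ?X \<or> y = ?X")
    case True
    then show ?thesis using kap_agree[of x y] cX cz xy by metis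
  next
    case False then show ?thesis using main by blast
  qed
qed

end

lemma same_mate_self: "matching A d \<Longrightarrow> x \<in> A \<Longrightarrow> same d x (mate d x)"
  by (simp add: same_mate)

text \<open>Neighbouring old points without a new point between them; reconnecting them merges two
  blocks of the fattening unless they are already paired.\<close>

definition merge_pair :: "nat \<Rightarrow> point \<Rightarrow> point \<Rightarrow> bool" where
  "merge_pair k a b \<longleftrightarrow> a \<in> points (2 * k) (2 * k) \<and> b \<in> points (2 * k) (2 * k) \<and> a < b \<and>
     (\<forall>w. w \<in> points (2 * k) (2 * k) \<longrightarrow> w \<noteq> a \<longrightarrow> w \<noteq> b \<longrightarrow> (a < w) = (b < w)) \<and>
     (\<forall>x. x \<in> points k k \<longrightarrow> side x a = side x b)"

text \<open>Neighbouring old points with one new point between them; reconnecting them makes this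
  point a singleton of the fattening.\<close>

definition isolate_pair :: "nat \<Rightarrow> point \<Rightarrow> point \<Rightarrow> bool" where
  "isolate_pair k a b \<longleftrightarrow> a \<in> points (2 * k) (2 * k) \<and> b \<in> points (2 * k) (2 * k) \<and> a < b \<and>
     (\<forall>w. w \<in> points (2 * k) (2 * k) \<longrightarrow> w \<noteq> a \<longrightarrow> w \<noteq> b \<longrightarrow> (a < w) = (b < w)) \<and>
     nb a = nb b \<and> (\<forall>w. nb w = nb a \<longrightarrow> w = a \<or> w = b \<or> w \<notin> points (2 * k) (2 * k)) \<and>
     (\<forall>x. x \<in> points k k \<longrightarrow> x \<noteq> nb a \<longrightarrow> side x a = side x b) \<and> side (nb a) a \<noteq> side (nb a) b"

text \<open>The right-hand side has the shape of \<open>same_composite_M\<close>, so for neighbours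
  in the lower row reconnecting fattens to composition with \<open>mdiag\<close>.\<close>

lemma fatten_merge:
  assumes d: "d \<in> NC2 (2 * k) (2 * k)" and mp: "merge_pair k a b"
  shows "same (fatten k (rejoin a b d)) x y \<longleftrightarrow> x \<in> points k k \<and> y \<in> points k k \<and>
     (same (fatten k d) x y \<or> same (fatten k d) x (nb a) \<and> same (fatten k d) (nb b) y \<or>
      same (fatten k d) x (nb b) \<and> same (fatten k d) (nb a) y)"
    and "same (fatten k d) (nb a) (nb b) \<longleftrightarrow> mate d a = b"
proof -
  have ab: "a \<in> points (2 * k) (2 * k)" "b \<in> points (2 * k) (2 * k)" "a < b"
    and adj: "\<And>w. w \<in> points (2 * k) (2 * k) \<Longrightarrow> w \<noteq> a \<Longrightarrow> w \<noteq> b \<Longrightarrow> (a < w) = (b < w)"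
    and new: "\<And>x. x \<in> points k k \<Longrightarrow> side x a = side x b"
    using mp by (simp_all add: merge_pair_def del: in_points)
  have X: "nb a \<in> points k k" "nb b \<in> points k k" using nb_in ab by auto
  have e: "mate d a = b \<Longrightarrow> kap d (nb a) = kap d (nb b)" using kap_nb_mate[OF d ab(1)] by simp
  have r: "mate d a = b \<Longrightarrow> rejoin a b d = d" using rejoin_id[OF NC2_matching[OF d] ab(1,2)] ab(3) by simp
  show "same (fatten k d) (nb a) (nb b) \<longleftrightarrow> mate d a = b"
    unfolding same_fatten using e X kap_merge(2)[OF d ab adj _ new X] by blast
  show "same (fatten k (rejoin a b d)) x y \<longleftrightarrow> x \<in> points k k \<and> y \<in> points k k \<and>
     (same (fatten k d) x y \<or> same (fatten k d) x (nb a) \<and> same (fatten k d) (nb b) y \<or>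
      same (fatten k d) x (nb b) \<and> same (fatten k d) (nb a) y)"
  proof (cases "mate d a = b")
    case True
    then show ?thesis unfolding r[OF True] same_fatten using e[OF True] X by auto
  next
    case False
    show ?thesis
    proof (cases "x \<in> points k k \<and> y \<in> points k k")
      case True
      then show ?thesis
        unfolding same_fatten using kap_merge(1)[OF d ab adj False new, of x y] X by blast
    qed (auto simp: same_fatten)
  qed
qed

text \<open>The shape is that of \<open>same_composite_S\<close>, which for neighbours in the lower
  row links reconnecting with \<open>sdiag\<close>; the second part decides whether that composition
  closes a loop.\<close>

lemma fatten_isolate:
  assumes d: "d \<in> NC2 (2 * k) (2 * k)" and ip: "isolate_pair k a b"
  shows "same (fatten k (rejoin a b d)) x y \<longleftrightarrow> x \<in> points k k \<and> y \<in> points k k \<and>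
     (x = nb a \<and> y = nb a \<or> x \<noteq> nb a \<and> y \<noteq> nb a \<and> same (fatten k d) x y)"
    and "(\<exists>z. z \<noteq> nb a \<and> same (fatten k d) z (nb a)) \<longleftrightarrow> mate d a \<noteq> b"
proof -
  note m = NC2_matching[OF d]
  have ab: "a \<in> points (2 * k) (2 * k)" "b \<in> points (2 * k) (2 * k)" "a < b"
    and adj: "\<And>w. w \<in> points (2 * k) (2 * k) \<Longrightarrow> w \<noteq> a \<Longrightarrow> w \<noteq> b \<Longrightarrow> (a < w) = (b < w)"
    and nb: "nb a = nb b" "\<And>w. nb w = nb a \<Longrightarrow> w = a \<or> w = b \<or> w \<notin> points (2 * k) (2 * k)"
    and new: "\<And>x. x \<in> points k k \<Longrightarrow> x \<noteq> nb a \<Longrightarrow> side x a = side x b" and newX: "side (nb a) a \<noteq> side (nb a) b"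
    using ip unfolding isolate_pair_def by (blast, blast, blast, blast, blast, blast, blast, blast)
  have X: "nb a \<in> points k k" using nb_in ab by auto
  have r: "mate d a = b \<Longrightarrow> rejoin a b d = d" using rejoin_id[OF m ab(1,2)] ab(3) by simp
  have single: "z = nb a" if "mate d a = b" "z \<in> points k k" "kap d z = kap d (nb a)" for z
  proof (rule ccontr)
    assume "z \<noteq> nb a"
    then have "\<not> cr z a b" "cr (nb a) a b" using new[OF that(2)] newX by (auto simp: cr_def)
    moreover have "same d a b" using same_mate[OF m ab(1)] that(1) by simp
    ultimately show False using that(3) unfolding kap_eq_iff by blast
  qed
  show "(\<exists>z. z \<noteq> nb a \<and> same (fatten k d) z (nb a)) \<longleftrightarrow> mate d a \<noteq> b"
  proof
    assume "\<exists>z. z \<noteq> nb a \<and> same (fatten k d) z (nb a)"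
    then show "mate d a \<noteq> b" using single unfolding same_fatten by blast
  next
    assume ne: "mate d a \<noteq> b"
    have ma: "mate d a \<in> points (2 * k) (2 * k)" "mate d a \<noteq> a" using mate_in[OF m ab(1)] mate_ne[OF m ab(1)] by auto
    then have "nb (mate d a) \<noteq> nb a" using nb(2)[of "mate d a"] ne by auto
    moreover have "same (fatten k d) (nb (mate d a)) (nb a)"
      unfolding same_fatten using nb_in[OF ma(1)] X kap_nb_mate[OF d ab(1)] by simp
    ultimately show "\<exists>z. z \<noteq> nb a \<and> same (fatten k d) z (nb a)" by blast
  qed
  show "same (fatten k (rejoin a b d)) x y \<longleftrightarrow> x \<in> points k k \<and> y \<in> points k k \<and>
     (x = nb a \<and> y = nb a \<or> x \<noteq> nb a \<and> y \<noteq> nb a \<and> same (fatten k d) x y)"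
  proof (cases "mate d a = b")
    case True
    then show ?thesis unfolding r[OF True] same_fatten using single[OF True] X by metis
  next
    case False
    show ?thesis
    proof (cases "x \<in> points k k \<and> y \<in> points k k")
      case True
      then show ?thesis
        unfolding same_fatten using kap_isolate[OF d ab adj False nb(1) new newX, of x y] X by blast
    qed (auto simp: same_fatten)
  qed
qed

text \<open>New positions are 3 mod 4: none lies between the old positions \<open>4m\<close> and
  \<open>4m + 2\<close>, and exactly \<open>4(m + 1) - 1\<close> lies between \<open>4m + 2\<close>
  and \<open>4m + 4\<close>.\<close>

lemma new_old_arith:
  fixes i m :: nat
  assumes "1 \<le> i"
  shows "2 * (2 * m + 1) < 4 * i - 1 \<longleftrightarrow> 2 * (2 * m) < 4 * i - 1"
    and "i \<noteq> m + 1 \<Longrightarrow> 2 * (2 * m + 2) < 4 * i - 1 \<longleftrightarrow> 2 * (2 * m + 1) < 4 * i - 1"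
    and "i \<noteq> m + 1 \<Longrightarrow> 4 * i - 1 < 2 * (2 * m + 1) \<longleftrightarrow> 4 * i - 1 < 2 * (2 * m + 2)"
  using assms by presburger+

lemma nb_arith: "(2 * m + 2 + 1) div 2 = m + (1::nat)" "(2 * m + 1 + 1) div 2 = m + (1::nat)"
  by presburger+

text \<open>The lower row is ordered backwards, so the larger index comes first. The pair straddles
  the gap between the cells of the new points \<open>m\<close> and \<open>m + 1\<close>.\<close>

lemma merge_lower:
  assumes m: "1 \<le> m" "m < k" shows "merge_pair k (Lower (2 * m + 1)) (Lower (2 * m))"
  unfolding merge_pair_def
proof (intro conjI allI impI)
  show "(Lower (2 * m + 1) < w) = (Lower (2 * m) < w)"
    if "w \<noteq> Lower (2 * m + 1)" "w \<noteq> Lower (2 * m)" for w using that by (cases w) auto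
  show "side x (Lower (2 * m + 1)) = side x (Lower (2 * m))" if "x \<in> points k k" for x
    using that unfolding side_def
    by (cases x) (simp_all only: new_point_simps old_point_simps less_point_simps new_old_arith in_points)
qed (use m in auto)

lemma merge_middle:
  assumes k: "1 \<le> k" shows "merge_pair k (Upper (2 * k)) (Lower (2 * k))"
  unfolding merge_pair_def
proof (intro conjI allI impI)
  show "(Upper (2 * k) < w) = (Lower (2 * k) < w)"
    if "w \<in> points (2 * k) (2 * k)" "w \<noteq> Upper (2 * k)" "w \<noteq> Lower (2 * k)" for w using that by (cases w) auto
  show "side x (Upper (2 * k)) = side x (Lower (2 * k))" if "x \<in> points k k" for x
    using that unfolding side_def by (cases x) auto
qed (use k in auto)

lemma isolate_lower:
  assumes m: "m < k" shows "isolate_pair k (Lower (2 * m + 2)) (Lower (2 * m + 1))" "nb (Lower (2 * m + 2)) = Lower (m + 1)"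
proof -
  show n: "nb (Lower (2 * m + 2)) = Lower (m + 1)" by (simp_all only: nb_simps nb_arith)
  have n': "nb (Lower (2 * m + 2)) = nb (Lower (2 * m + 1))" by (simp_all only: nb_simps nb_arith)
  show "isolate_pair k (Lower (2 * m + 2)) (Lower (2 * m + 1))"
    unfolding isolate_pair_def
  proof (intro conjI allI impI n')
    show "(Lower (2 * m + 2) < w) = (Lower (2 * m + 1) < w)"
      if "w \<noteq> Lower (2 * m + 2)" "w \<noteq> Lower (2 * m + 1)" for w using that by (cases w) auto
    show "w = Lower (2 * m + 2) \<or> w = Lower (2 * m + 1) \<or> w \<notin> points (2 * k) (2 * k)" if "nb w = nb (Lower (2 * m + 2))" for w
      using that unfolding n by (cases w) auto
    show "side x (Lower (2 * m + 2)) = side x (Lower (2 * m + 1))" if "x \<in> points k k" "x \<noteq> nb (Lower (2 * m + 2))" for x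
      using that unfolding side_def n
      by (cases x) (simp_all only: new_point_simps old_point_simps less_point_simps new_old_arith(2) in_points point.inject simp_thms)
    show "side (nb (Lower (2 * m + 2))) (Lower (2 * m + 2)) \<noteq> side (nb (Lower (2 * m + 2))) (Lower (2 * m + 1))"
      unfolding side_def n by auto
  qed (use m in auto)
qed

lemma isolate_upper:
  assumes m: "m < k" shows "isolate_pair k (Upper (2 * m + 1)) (Upper (2 * m + 2))" "nb (Upper (2 * m + 1)) = Upper (m + 1)"
proof -
  show n: "nb (Upper (2 * m + 1)) = Upper (m + 1)" by (simp_all only: nb_simps nb_arith)
  have n': "nb (Upper (2 * m + 1)) = nb (Upper (2 * m + 2))" by (simp_all only: nb_simps nb_arith)
  show "isolate_pair k (Upper (2 * m + 1)) (Upper (2 * m + 2))"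
    unfolding isolate_pair_def
  proof (intro conjI allI impI n')
    show "(Upper (2 * m + 1) < w) = (Upper (2 * m + 2) < w)"
      if "w \<noteq> Upper (2 * m + 1)" "w \<noteq> Upper (2 * m + 2)" for w using that by (cases w) auto
    show "w = Upper (2 * m + 1) \<or> w = Upper (2 * m + 2) \<or> w \<notin> points (2 * k) (2 * k)" if "nb w = nb (Upper (2 * m + 1))" for w
      using that unfolding n by (cases w) auto
    show "side x (Upper (2 * m + 1)) = side x (Upper (2 * m + 2))" if "x \<in> points k k" "x \<noteq> nb (Upper (2 * m + 1))" for x
      using that unfolding side_def n
      by (cases x) (simp_all only: new_point_simps old_point_simps less_point_simps new_old_arith(3) in_points point.inject simp_thms)
    show "side (nb (Upper (2 * m + 1))) (Upper (2 * m + 1)) \<noteq> side (nb (Upper (2 * m + 1))) (Upper (2 * m + 2))"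
      unfolding side_def n by auto
  qed (use m in auto)
qed

subsection \<open>The number of loops of a closure\<close>

definition closure_comps :: "nat \<Rightarrow> diagram \<Rightarrow> nat" where
  "closure_comps n p = card (components (p \<union> id_diagram n))"

text \<open>Integer valued, so that the moves below can be compared by linear arithmetic;
  \<open>euler_formula\<close> identifies the value as \<open>k\<close>.\<close>

definition euler :: "nat \<Rightarrow> diagram \<Rightarrow> int" where
  "euler k d = int (closure_comps (2 * k) d) + int (card (fatten k d)) - 2 * int (closure_comps k (fatten k d))"

lemma Union_id_diagram: "\<Union>(id_diagram n) = points n n"
  using Part_Union[OF NC_Part[OF id_diagram_NC]] .

lemma conn_id: "u \<in> points n n \<Longrightarrow> (u, flip u) \<in> conn (p \<union> id_diagram n)"
proof -
  assume "u \<in> points n n"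
  then have "same (id_diagram n) u (flip u)" unfolding id_diagram_kerp by (cases u) auto
  then obtain B where "B \<in> id_diagram n" "u \<in> B" "flip u \<in> B" by (auto simp: same_def)
  then show ?thesis by (intro conn_block[of B]) auto
qed

lemma conn_same: "same p u v \<Longrightarrow> (u, v) \<in> conn (p \<union> E)"
  by (auto simp: same_def intro: conn_block)

lemma id_diagram_block: "B \<in> id_diagram n \<Longrightarrow> u \<in> B \<Longrightarrow> v \<in> B \<Longrightarrow> u \<in> points n n \<and> (v = u \<or> v = flip u)"
  by (auto simp: id_diagram_def)

text \<open>Gluing \<open>i\<close> to \<open>i'\<close> and adding the edge \<open>{i, i'}\<close>
  give the same components. The second version keeps the vertex set, so the effect of reconnecting
  strands can be counted by \<open>card_components_join\<close>.\<close>

lemma trace_closure: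
  assumes p: "p \<in> Part n n" shows "trace s p = s ^ closure_comps n p"
proof -
  let ?c = "case_point id id :: point \<Rightarrow> nat"
  let ?C = "(`) ?c ` p" and ?H = "p \<union> id_diagram n"
  define g where "g i = conn ?C `` {i}" for i
  have UC: "\<Union>?C = ?c ` points n n" using Part_Union[OF p] by (metis image_Union)
  have UH: "\<Union>?H = points n n" using Part_Union[OF p] Union_id_diagram by auto
  have lift: "(Upper i, Upper j) \<in> conn ?H" if "(i, j) \<in> conn ?C" for i j
    using that
  proof (induction rule: conn_induct)
    case (step j l B)
    obtain B' where B': "B' \<in> p" "B = ?c ` B'" using step(2) by auto
    obtain x y where xy: "x \<in> B'" "y \<in> B'" "j = ?c x" "l = ?c y" using step(3,4) unfolding B'(2) by blast
    have in_pts: "x \<in> points n n" "y \<in> points n n" using xy B' Part_Union[OF p] by auto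
    have up: "(Upper (?c z), z) \<in> conn ?H" if "z \<in> points n n" for z
      using that conn_id[of "Upper (?c z)" n p] by (cases z) auto
    have "(x, y) \<in> conn ?H" using B' xy by (intro conn_block[of B']) auto
    then have "(Upper j, Upper l) \<in> conn ?H"
      unfolding xy using up[OF in_pts(1)] conn_sym[OF up[OF in_pts(2)]] by (blast intro: conn_trans)
    then show ?case using step.IH by (blast intro: conn_trans)
  qed simp
  have "components ?H = kerp (\<Union>?H) (\<lambda>x. g (?c x))"
  proof (rule components_eq_kerp)
    fix B u v assume B: "B \<in> ?H" "u \<in> B" "v \<in> B"
    show "g (?c u) = g (?c v)"
    proof (cases "B \<in> p")
      case True
      then show ?thesis unfolding g_def conn_class_eq using B by (intro conn_block[of "?c ` B"]) auto
    next
      case False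
      then have "v = u \<or> v = flip u" using B id_diagram_block by blast
      then show ?thesis by (cases u) auto
    qed
  next
    fix u v assume uv: "u \<in> \<Union>?H" "v \<in> \<Union>?H" "g (?c u) = g (?c v)"
    then have "(Upper (?c u), Upper (?c v)) \<in> conn ?H" unfolding g_def conn_class_eq using lift by blast
    moreover have "(Upper (?c z), z) \<in> conn ?H" if "z \<in> points n n" for z
      using that conn_id[of "Upper (?c z)" n p] by (cases z) auto
    ultimately show "(u, v) \<in> conn ?H" using uv(1,2) unfolding UH by (meson conn_sym conn_trans)
  qed
  then have "closure_comps n p = card ((\<lambda>x. g (?c x)) ` points n n)" unfolding closure_comps_def by (simp only: card_kerp UH)
  also have "\<dots> = card (components ?C)"
    unfolding components_kerp card_kerp UC g_def image_image ..
  finally show ?thesis by (simp add: trace_def)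
qed

lemma components_partition: "partition_on A p \<Longrightarrow> components p = p"
proof -
  assume p: "partition_on A p"
  have U: "\<Union>p = A" using p by (auto simp: partition_on_def)
  have "components p = kerp A (\<lambda>x. {y. same p x y})"
    unfolding components_kerp U
    by (rule kerp_cong) (use same_refl[OF p] in \<open>auto simp: conn_class_eq conn_partition[OF p] same_class_eq[OF p]\<close>)
  then show ?thesis using kerp_same[OF p] by simp
qed

text \<open>\<open>card_components_join\<close> for two partitions with common closure edges
  \<open>E\<close>. The set \<open>S\<close>, closed under all edges, certifies that
  \<open>x\<close> and \<open>y\<close> lie in different components.\<close>

lemma join_partition:
  assumes p: "partition_on A p" and q: "partition_on A q" and fin: "finite A" and E: "\<Union>E \<subseteq> A"
    and x: "x \<in> A" "y \<in> A"
    and S: "x \<in> S" "y \<notin> S" "\<And>u v. same p u v \<Longrightarrow> u \<in> S \<Longrightarrow> v \<in> S" "\<And>B u v. B \<in> E \<Longrightarrow> u \<in> B \<Longrightarrow> v \<in> B \<Longrightarrow> u \<in> S \<Longrightarrow> v \<in> S"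
    and sub: "\<And>u v. same p u v \<Longrightarrow> (u, v) \<in> conn (q \<union> E)"
    and e: "(x, y) \<in> conn (q \<union> E)"
    and sup: "\<And>u v. same q u v \<Longrightarrow> (u, v) \<in> conn (insert {x, y} (p \<union> E))"
  shows "card (components (p \<union> E)) = Suc (card (components (q \<union> E)))"
proof (rule card_components_join)
  have U: "\<Union>p = A" "\<Union>q = A" using p q by (auto simp: partition_on_def)
  show "finite (\<Union>(p \<union> E))" "x \<in> \<Union>(p \<union> E)" "y \<in> \<Union>(p \<union> E)" "\<Union>(q \<union> E) = \<Union>(p \<union> E)"
    using U fin E x finite_subset[of "\<Union>E" A] by auto
  show "(x, y) \<notin> conn (p \<union> E)"
  proof
    assume "(x, y) \<in> conn (p \<union> E)"
    then have "(x \<in> S) = (y \<in> S)"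
    proof (rule conn_label)
      fix B u v assume B: "B \<in> p \<union> E" "u \<in> B" "v \<in> B"
      show "(u \<in> S) = (v \<in> S)"
      proof (cases "B \<in> p")
        case True
        then show ?thesis using S(3)[of u v] S(3)[of v u] sameI[of B p u v] sameI[of B p v u] B by blast
      next
        case False
        then show ?thesis using S(4)[of B u v] S(4)[of B v u] B by blast
      qed
    qed
    then show False using S by simp
  qed
  show "(u, v) \<in> conn (q \<union> E)" if "B \<in> p \<union> E" "u \<in> B" "v \<in> B" for B u v
  proof (cases "B \<in> p")
    case True then show ?thesis using sub that by (auto intro: sameI)
  next
    case False then show ?thesis using that by (intro conn_block[of B]) auto
  qed
  show "(u, v) \<in> conn (insert {x, y} (p \<union> E))" if "B \<in> q \<union> E" "u \<in> B" "v \<in> B" for B u v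
  proof (cases "B \<in> q")
    case True then show ?thesis using sup that by (auto intro: sameI)
  next
    case False then show ?thesis using that by (intro conn_block[of B]) auto
  qed
qed (rule e)

lemma conn_merged:
  assumes H: "\<And>u v. same p u v \<Longrightarrow> (u, v) \<in> conn H" "(x, y) \<in> conn H"
    and s: "same p u v \<or> same p u x \<and> same p y v \<or> same p u y \<and> same p x v"
  shows "(u, v) \<in> conn H"
  using s
proof (elim disjE conjE)
  assume "same p u x" "same p y v"
  then show ?thesis using conn_trans[OF conn_trans[OF H(1) H(2)] H(1)] by blast
next
  assume "same p u y" "same p x v"
  then show ?thesis using conn_trans[OF conn_trans[OF H(1) conn_sym[OF H(2)]] H(1)] by blast
qed (rule H(1))

lemma conn_rejoin:
  assumes p: "partition_on A p" and ab: "a \<in> A" "b \<in> A"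
    and H: "\<And>u v. same p u v \<Longrightarrow> (u, v) \<in> conn H" "(a, b) \<in> conn H" and s: "same (rejoin a b p) u v"
  shows "(u, v) \<in> conn H"
proof -
  have ba: "(b, a) \<in> conn H" using H(2) by (rule conn_sym)
  show ?thesis
  proof (cases "u \<in> {a, b} \<and> v \<in> {a, b}")
    case True then show ?thesis using H(2) ba by auto
  next
    case False
    then have D: "same p u v \<or> same p u a \<and> same p b v \<or> same p u b \<and> same p a v"
      using s unfolding same_rejoin[OF p ab] by blast
    show ?thesis by (rule conn_merged[OF H D])
  qed
qed

text \<open>Together with a connection of \<open>a\<close> to its old partner, the pair
  \<open>a b\<close> and the pair of the two partners connect all four ends, so the old pairs are
  recovered.\<close>

lemma conn_rejoin_converse:
  assumes d: "matching A d" and ab: "a \<in> A" "b \<in> A" "a \<noteq> b" and ne: "mate d a \<noteq> b"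
    and H: "\<And>u v. same (rejoin a b d) u v \<Longrightarrow> (u, v) \<in> conn H" "(a, mate d a) \<in> conn H" and s: "same d u v"
  shows "(u, v) \<in> conn H"
proof -
  have u: "u \<in> A" using same_in[OF matching_partition[OF d] s] by simp
  note m = matching_rejoin[OF d ab]
  have mA: "mate d a \<in> A" "mate d b \<in> A" using mate_in[OF d] ab by auto
  have pair: "(x, mate (rejoin a b d) x) \<in> conn H" if "x \<in> A" for x
    by (rule H(1)) (simp add: same_mate[OF m that])
  have 1: "(a, b) \<in> conn H" using pair[OF ab(1)] mate_rejoin[OF d ab ab(1)] ne by simp
  have "mate d a \<noteq> a" using mate_ne[OF d ab(1)] by simp
  then have 2: "(mate d a, mate d b) \<in> conn H"
    using pair[OF mA(1)] mate_rejoin[OF d ab mA(1)] ne by simp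
  have 3: "(b, mate d b) \<in> conn H"
    by (rule conn_trans[OF conn_sym[OF 1] conn_trans[OF H(2) 2]])
  have "v = u \<or> v = mate d u" using same_mate[OF d u] s by simp
  then consider "v = u" | "u = a" "v = mate d a" | "u = b" "v = mate d b" | "u = mate d a" "v = a" | "u = mate d b" "v = b"
    | "u \<notin> {a, b, mate d a, mate d b}" "v = mate d u"
    using mate_mate[OF d ab(1)] mate_mate[OF d ab(2)] by auto
  then show ?thesis
  proof cases
    case 6
    then have "v = mate (rejoin a b d) u" using mate_rejoin[OF d ab u] ne by simp
    then show ?thesis using pair[OF u] by simp
  qed (use H(2) 3 conn_sym[OF H(2)] conn_sym[OF 3] in simp_all)
qed

text \<open>The rest of the former block of \<open>y\<close> is still one block of
  \<open>f'\<close>, so a single edge from \<open>y\<close> to one of its points \<open>z\<close>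
  restores the block.\<close>

lemma conn_isolate:
  assumes f: "partition_on A f"
    and F: "\<And>u v. same f' u v \<longleftrightarrow> u \<in> A \<and> v \<in> A \<and> (u = y \<and> v = y \<or> u \<noteq> y \<and> v \<noteq> y \<and> same f u v)"
    and H: "\<And>u v. same f' u v \<Longrightarrow> (u, v) \<in> conn H" "(y, z) \<in> conn H"
    and z: "same f y z" "z \<noteq> y" and s: "same f u v"
  shows "(u, v) \<in> conn H"
proof -
  have in_A: "u \<in> A" "v \<in> A" "z \<in> A" using same_in[OF f s] same_in[OF f z(1)] by auto
  have y: "(y, w) \<in> conn H" if "same f y w" "w \<noteq> y" for w
  proof -
    have "same f z w" using same_trans[OF f same_sym[OF z(1)] that(1)] .
    then have "same f' z w" using F that z same_in[OF f that(1)] in_A by blast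
    then show ?thesis using conn_trans[OF H(2) H(1)] by blast
  qed
  show ?thesis
  proof (cases "u = y")
    case True
    then show ?thesis using y[of v] s by (cases "v = y") auto
  next
    case uy: False
    show ?thesis
    proof (cases "v = y")
      case True
      then show ?thesis using conn_sym[OF y[of u]] same_sym[OF s] uy by blast
    next
      case False
      then have "same f' u v" using F uy s in_A by blast
      then show ?thesis by (rule H(1))
    qed
  qed
qed

lemma components_singleton:
  assumes "x \<in> \<Union>Q" "\<And>y. y \<in> \<Union>Q \<Longrightarrow> (x, y) \<in> conn Q" shows "card (components Q) = 1"
proof -
  have "conn Q `` {y} = conn Q `` {x}" if "y \<in> \<Union>Q" for y
    unfolding conn_class_eq using assms(2)[OF that] by (rule conn_sym)
  then have "components Q = (\<lambda>_. conn Q `` {x}) ` \<Union>Q" unfolding components_alt by (intro image_cong refl)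
  also have "\<dots> = {conn Q `` {x}}" by (rule image_constant[OF assms(1)])
  finally show ?thesis by simp
qed

lemma partition_remove:
  assumes "partition_on A p" "B \<in> p" shows "partition_on (A - B) (p - {B})"
  using assms unfolding partition_on_def disjoint_def by auto

context
  fixes k :: nat and d :: diagram
  assumes d: "d \<in> NC2 (2 * (k + 1)) (2 * (k + 1))"
begin

private abbreviation "n \<equiv> 2 * (k + 1)"
private abbreviation "up \<equiv> Upper (2 * k + 1)"
private abbreviation "ua \<equiv> Upper (2 * k + 2)"
private abbreviation "lb \<equiv> Lower (2 * k + 2)"
private abbreviation "lq \<equiv> Lower (2 * k + 1)"
private abbreviation "X \<equiv> Upper (k + 1)"
private abbreviation "Y \<equiv> Lower (k + 1)"

private lemma pts: "up \<in> points n n" "ua \<in> points n n" "lb \<in> points n n" "lq \<in> points n n"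
    "X \<in> points (k + 1) (k + 1)" "Y \<in> points (k + 1) (k + 1)"
  by auto

private lemma Id_sub: "\<Union>(id_diagram m) \<subseteq> points m m" by (simp add: Union_id_diagram)

private lemma flip_closed: "B \<in> id_diagram m \<Longrightarrow> u \<in> B \<Longrightarrow> v \<in> B \<Longrightarrow> u \<in> S \<Longrightarrow> flip ` S \<subseteq> S \<Longrightarrow> v \<in> S"
  using id_diagram_block[of B m u v] by auto

private lemma partF: "partition_on (points m m) (fatten m e)" by (rule Part_partition[OF fatten_Part])

text \<open>Closing the innermost strand joins \<open>x\<^sub>K\<close> and \<open>y\<^sub>K\<close>; afterwards both are split off.\<close>

lemma close_step:
  defines "d1 \<equiv> rejoin ua lb d"
  shows "d1 \<in> NC2 n n" "mate d1 ua = lb" "same (fatten (k + 1) d1) X Y"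
    and "euler (k + 1) d = euler (k + 1) d1"
proof -
  note m = NC2_matching[OF d]
  have e: "ua = Upper (2 * (k + 1))" "lb = Lower (2 * (k + 1))" by simp_all
  have mp: "merge_pair (k + 1) ua lb" using merge_middle[of "k + 1"] e by simp
  have lt: "ua < lb" by simp
  have nb: "nb ua = X" "nb lb = Y" by simp_all
  show d1: "d1 \<in> NC2 n n"
    unfolding d1_def
  proof (rule rejoin_NC[OF d pts(2,3) lt])
    fix z assume "z \<in> points n n" then show "\<not> (ua < z \<and> z < lb)" by (cases z) auto
  qed
  have ne: "ua \<noteq> lb" by simp
  show md1: "mate d1 ua = lb" unfolding d1_def using mate_rejoin[OF m pts(2,3) ne pts(2)] by simp
  note F = fatten_merge[OF d mp, folded d1_def, unfolded nb]
  have sF: "same (fatten (k + 1) d1) u v" if "same (fatten (k + 1) d) u v" for u v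
    using that F(1)[of u v] by (simp add: same_fatten)
  have r: "same (fatten (k + 1) e) z z" if "z \<in> points (k + 1) (k + 1)" for e z using that by (simp add: same_fatten)
  show XY: "same (fatten (k + 1) d1) X Y"
    using F(1)[of X Y] r[OF pts(5)] r[OF pts(6)] pts by simp
  show "euler (k + 1) d = euler (k + 1) d1"
  proof (cases "mate d ua = lb")
    case True
    then have "d1 = d" unfolding d1_def by (rule rejoin_id[OF m pts(2,3) ne])
    then show ?thesis by simp
  next
    case False
    \<comment> \<open>Balance of this move: \<open>{ua, lb}\<close> splits off as a loop of the
      closure (+1), the blocks of \<open>X\<close> and \<open>Y\<close> merge (-1), and the closed
      fattening is unchanged because closing joins \<open>X\<close> and \<open>Y\<close>
      anyway.\<close>
    have "closure_comps n d1 = Suc (closure_comps n d)"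
      unfolding closure_comps_def
    proof (rule join_partition[where x = ua and y = "mate d ua" and S = "{ua, lb}"])
      show "partition_on (points n n) d1" "partition_on (points n n) d"
        using matching_partition[OF NC2_matching[OF d1]] matching_partition[OF m] .
      show "mate d ua \<in> points n n" "mate d ua \<notin> {ua, lb}" using mate_in[OF m pts(2)] mate_ne[OF m pts(2)] False by auto
      have c: "(ua, lb) \<in> conn (d \<union> id_diagram n)" using conn_id[OF pts(2), of d] by simp
      show "(u, v) \<in> conn (d \<union> id_diagram n)" if "same d1 u v" for u v
        by (rule conn_rejoin[OF matching_partition[OF m] pts(2,3) conn_same c that[unfolded d1_def]])
      show "(ua, mate d ua) \<in> conn (d \<union> id_diagram n)" by (rule conn_same[OF same_mate_self[OF m pts(2)]])
      show "(u, v) \<in> conn (insert {ua, mate d ua} (d1 \<union> id_diagram n))" if "same d u v" for u v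
      proof (rule conn_rejoin_converse[OF m pts(2,3) ne False _ _ that])
        show "(u, v) \<in> conn (insert {ua, mate d ua} (d1 \<union> id_diagram n))" if "same (rejoin ua lb d) u v" for u v
          using conn_same[OF that, folded d1_def, of "id_diagram n"] by (rule conn_mono) auto
      qed (rule conn_block[of "{ua, mate d ua}"], auto)
      show "v \<in> {ua, lb}" if "same d1 u v" "u \<in> {ua, lb}" for u v
        using that unfolding d1_def same_rejoin[OF matching_partition[OF m] pts(2,3)] by blast
      show "v \<in> {ua, lb}" if "B \<in> id_diagram n" "u \<in> B" "v \<in> B" "u \<in> {ua, lb}" for B u v
        by (rule flip_closed[OF that]) auto
    qed (use pts Id_sub[of n] in simp_all)
    moreover have "card (fatten (k + 1) d) = Suc (card (fatten (k + 1) d1))"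
    proof -
      have nXY: "\<not> same (fatten (k + 1) d) X Y" using F(2) False by simp
      have "card (components (fatten (k + 1) d \<union> {})) = Suc (card (components (fatten (k + 1) d1 \<union> {})))"
      proof (rule join_partition[where x = X and y = Y and S = "{v. same (fatten (k + 1) d) X v}"])
        show "partition_on (points (k + 1) (k + 1)) (fatten (k + 1) d)" "partition_on (points (k + 1) (k + 1)) (fatten (k + 1) d1)"
          by (rule partF)+
        show "v \<in> {v. same (fatten (k + 1) d) X v}" if "same (fatten (k + 1) d) u v" "u \<in> {v. same (fatten (k + 1) d) X v}" for u v
          using that same_trans[OF partF] by blast
        show "(u, v) \<in> conn (fatten (k + 1) d1 \<union> {})" if "same (fatten (k + 1) d) u v" for u v
          by (rule conn_same[OF sF[OF that]])
        show "(X, Y) \<in> conn (fatten (k + 1) d1 \<union> {})" by (rule conn_same[OF XY])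
        let ?H = "insert {X, Y} (fatten (k + 1) d \<union> {})"
        have c: "(u, v) \<in> conn ?H" if "same (fatten (k + 1) d) u v" for u v
          using conn_same[OF that, of "{}"] by (rule conn_mono) auto
        have xy: "(X, Y) \<in> conn ?H" by (rule conn_block[of "{X, Y}"]) auto
        show "(u, v) \<in> conn ?H" if "same (fatten (k + 1) d1) u v" for u v
        proof -
          have "same (fatten (k + 1) d) u v \<or> same (fatten (k + 1) d) u X \<and> same (fatten (k + 1) d) Y v \<or>
            same (fatten (k + 1) d) u Y \<and> same (fatten (k + 1) d) X v" using that unfolding F(1) by blast
          then show ?thesis by (rule conn_merged[OF _ xy, rotated]) (rule c)
        qed
      qed (use pts nXY r[OF pts(5), of d] in simp_all)
      then show ?thesis by (simp add: components_partition[OF partF])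
    qed
    moreover have "closure_comps (k + 1) (fatten (k + 1) d1) = closure_comps (k + 1) (fatten (k + 1) d)"
    proof -
      have "components (fatten (k + 1) d1 \<union> id_diagram (k + 1)) = components (fatten (k + 1) d \<union> id_diagram (k + 1))"
      proof (rule components_cong)
        show "\<Union>(fatten (k + 1) d1 \<union> id_diagram (k + 1)) = \<Union>(fatten (k + 1) d \<union> id_diagram (k + 1))"
          using Part_Union[OF fatten_Part] by (simp add: Union_Un_distrib)
        fix B u v assume B: "B \<in> fatten (k + 1) d \<union> id_diagram (k + 1)" "u \<in> B" "v \<in> B"
        show "(u, v) \<in> conn (fatten (k + 1) d1 \<union> id_diagram (k + 1))"
        proof (cases "B \<in> fatten (k + 1) d")
          case True then show ?thesis using B by (intro conn_same sF) (auto intro: sameI)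
        qed (use B in \<open>auto intro: conn_block\<close>)
      next
        fix B u v assume B: "B \<in> fatten (k + 1) d1 \<union> id_diagram (k + 1)" "u \<in> B" "v \<in> B"
        let ?H = "fatten (k + 1) d \<union> id_diagram (k + 1)"
        have xy: "(X, Y) \<in> conn ?H" using conn_id[OF pts(5)] by simp
        have c: "(u, v) \<in> conn ?H" if "same (fatten (k + 1) d) u v" for u v using conn_same[OF that] .
        show "(u, v) \<in> conn ?H"
        proof (cases "B \<in> fatten (k + 1) d1")
          case True
          then have "same (fatten (k + 1) d1) u v" using B by (auto intro: sameI)
          then have "same (fatten (k + 1) d) u v \<or> same (fatten (k + 1) d) u X \<and> same (fatten (k + 1) d) Y v \<or>
            same (fatten (k + 1) d) u Y \<and> same (fatten (k + 1) d) X v" unfolding F(1) by blast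
          then show ?thesis by (rule conn_merged[OF _ xy, rotated]) (rule c)
        qed (use B in \<open>auto intro: conn_block\<close>)
      qed
      then show ?thesis by (simp add: closure_comps_def)
    qed
    ultimately show ?thesis unfolding euler_def by linarith
  qed
qed

text \<open>Balance: the loop through \<open>ua\<close> and \<open>lb\<close> is joined to the
  component of \<open>up\<close> (-1), \<open>X\<close> is split off its block (+1), and the closed
  fattening is unchanged because closing reattaches \<open>X\<close> to \<open>Y\<close>.\<close>

lemma split_upper:
  assumes md: "mate d ua = lb"
  defines "d2 \<equiv> rejoin up ua d"
  shows "d2 \<in> NC2 n n" "mate d2 up = ua" "euler (k + 1) d = euler (k + 1) d2"
proof -
  note m = NC2_matching[OF d]
  note P = matching_partition[OF m]
  have ip: "isolate_pair (k + 1) up ua" and nb: "nb up = X" using isolate_upper[of k "k + 1"] by simp_all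
  have lt: "up < ua" by simp
  have ne: "up \<noteq> ua" "ua \<noteq> up" by simp_all
  show d2: "d2 \<in> NC2 n n"
    unfolding d2_def
  proof (rule rejoin_NC[OF d pts(1,2) lt])
    fix z assume "z \<in> points n n" then show "\<not> (up < z \<and> z < ua)" by (cases z) auto
  qed
  show md2: "mate d2 up = ua" unfolding d2_def using mate_rejoin[OF m pts(1,2) ne(1) pts(1)] by simp
  have cm: "rejoin ua up d = d2" unfolding d2_def by (rule rejoin_commute[OF P pts(2,1)])
  note F = fatten_isolate(1)[OF d ip, folded d2_def, unfolded nb]
  have XY: "same (fatten (k + 1) d) X Y"
  proof -
    have "nb ua = X" "nb lb = Y" by simp_all
    then show ?thesis unfolding same_fatten using kap_nb_mate[OF d pts(2)] md pts(5,6) by metis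
  qed
  have XYne: "X \<noteq> Y" "Y \<noteq> X" by simp_all
  have sF: "(u, v) \<in> conn (fatten (k + 1) d \<union> E)" if "same (fatten (k + 1) d2) u v" for u v E
  proof -
    have "u = v \<or> same (fatten (k + 1) d) u v" using that unfolding F by blast
    then show ?thesis using conn_same[of "fatten (k + 1) d" u v E] by auto
  qed
  have "closure_comps n d = Suc (closure_comps n d2)"
    unfolding closure_comps_def
  proof (rule join_partition[where x = ua and y = up and S = "{ua, lb}"])
    show "partition_on (points n n) d" "partition_on (points n n) d2"
      using P matching_partition[OF NC2_matching[OF d2]] .
    show "v \<in> {ua, lb}" if "same d u v" "u \<in> {ua, lb}" for u v
    proof -
      have "mate d lb = ua" using mate_mate[OF m pts(2)] md by simp
      then show ?thesis using that same_mate[OF m pts(2), of v] same_mate[OF m pts(3), of v] md by blast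
    qed
    show "v \<in> {ua, lb}" if "B \<in> id_diagram n" "u \<in> B" "v \<in> B" "u \<in> {ua, lb}" for B u v
      by (rule flip_closed[OF that]) auto
    have c: "(ua, mate d ua) \<in> conn (d2 \<union> id_diagram n)" using conn_id[OF pts(2), of d2] md by simp
    have nm: "mate d ua \<noteq> up" using md by simp
    show "(u, v) \<in> conn (d2 \<union> id_diagram n)" if "same d u v" for u v
      by (rule conn_rejoin_converse[OF m pts(2,1) ne(2) nm conn_same c that, unfolded cm])
    have "same d2 ua up" using same_mate[OF NC2_matching[OF d2] pts(1), of ua] md2 by (simp add: same_sym)
    then show "(ua, up) \<in> conn (d2 \<union> id_diagram n)" by (rule conn_same)
    show "(u, v) \<in> conn (insert {ua, up} (d \<union> id_diagram n))" if "same d2 u v" for u v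
    proof (rule conn_rejoin[OF P pts(1,2) _ _ that[unfolded d2_def]])
      show "(u, v) \<in> conn (insert {ua, up} (d \<union> id_diagram n))" if "same d u v" for u v
        using conn_same[OF that, of "id_diagram n"] by (rule conn_mono) auto
    qed (rule conn_block[of "{ua, up}"], auto)
  qed (use pts Id_sub[of n] in simp_all)
  moreover have "card (fatten (k + 1) d2) = Suc (card (fatten (k + 1) d))"
  proof -
    have "card (components (fatten (k + 1) d2 \<union> {})) = Suc (card (components (fatten (k + 1) d \<union> {})))"
    proof (rule join_partition[where x = X and y = Y and S = "{X}"])
      show "partition_on (points (k + 1) (k + 1)) (fatten (k + 1) d2)" "partition_on (points (k + 1) (k + 1)) (fatten (k + 1) d)"
        by (rule partF)+
      show "v \<in> {X}" if "same (fatten (k + 1) d2) u v" "u \<in> {X}" for u v using that unfolding F by blast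
      show "(u, v) \<in> conn (fatten (k + 1) d \<union> {})" if "same (fatten (k + 1) d2) u v" for u v by (rule sF[OF that])
      show "(X, Y) \<in> conn (fatten (k + 1) d \<union> {})" by (rule conn_same[OF XY])
      show "(u, v) \<in> conn (insert {X, Y} (fatten (k + 1) d2 \<union> {}))" if "same (fatten (k + 1) d) u v" for u v
      proof (rule conn_isolate[OF partF F _ _ XY XYne(2) that])
        show "(u, v) \<in> conn (insert {X, Y} (fatten (k + 1) d2 \<union> {}))" if "same (fatten (k + 1) d2) u v" for u v
          using conn_same[OF that, of "{}"] by (rule conn_mono) auto
      qed (rule conn_block[of "{X, Y}"], auto)
    qed (use pts in simp_all)
    then show ?thesis by (simp add: components_partition[OF partF])
  qed
  moreover have "closure_comps (k + 1) (fatten (k + 1) d2) = closure_comps (k + 1) (fatten (k + 1) d)"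
  proof -
    have "components (fatten (k + 1) d2 \<union> id_diagram (k + 1)) = components (fatten (k + 1) d \<union> id_diagram (k + 1))"
    proof (rule components_cong)
      show "\<Union>(fatten (k + 1) d2 \<union> id_diagram (k + 1)) = \<Union>(fatten (k + 1) d \<union> id_diagram (k + 1))"
        using Part_Union[OF fatten_Part] by (simp add: Union_Un_distrib)
      fix B u v assume B: "B \<in> fatten (k + 1) d2 \<union> id_diagram (k + 1)" "u \<in> B" "v \<in> B"
      show "(u, v) \<in> conn (fatten (k + 1) d \<union> id_diagram (k + 1))"
      proof (cases "B \<in> fatten (k + 1) d2")
        case True then show ?thesis using B by (intro sF) (auto intro: sameI)
      qed (use B in \<open>auto intro: conn_block\<close>)
    next
      fix B u v assume B: "B \<in> fatten (k + 1) d \<union> id_diagram (k + 1)" "u \<in> B" "v \<in> B"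
      let ?H = "fatten (k + 1) d2 \<union> id_diagram (k + 1)"
      have xy: "(X, Y) \<in> conn ?H" using conn_id[OF pts(5)] by simp
      show "(u, v) \<in> conn ?H"
      proof (cases "B \<in> fatten (k + 1) d")
        case True
        then have s: "same (fatten (k + 1) d) u v" using B by (auto intro: sameI)
        show ?thesis by (rule conn_isolate[OF partF F conn_same xy XY XYne(2) s])
      qed (use B in \<open>auto intro: conn_block\<close>)
    qed
    then show ?thesis by (simp add: closure_comps_def)
  qed
  ultimately show "euler (k + 1) d = euler (k + 1) d2" unfolding euler_def by linarith
qed

text \<open>Balance, if \<open>lb\<close> and \<open>lq\<close> are not yet paired: a loop through
  \<open>up\<close>, \<open>ua\<close>, \<open>lb\<close>, \<open>lq\<close> splits off (+1),
  \<open>Y\<close> leaves its block (+1), and as \<open>X\<close> is already alone,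
  \<open>{X, Y}\<close> becomes a new component of the closed fattening (-2).\<close>

lemma split_lower:
  assumes md: "mate d up = ua"
  defines "d3 \<equiv> rejoin lb lq d"
  shows "d3 \<in> NC2 n n" "mate d3 up = ua" "mate d3 lb = lq" "euler (k + 1) d = euler (k + 1) d3"
proof -
  note m = NC2_matching[OF d]
  note P = matching_partition[OF m]
  have ip: "isolate_pair (k + 1) lb lq" and nb: "nb lb = Y" using isolate_lower[of k "k + 1"] by simp_all
  have ip': "isolate_pair (k + 1) up ua" and nb': "nb up = X" using isolate_upper[of k "k + 1"] by simp_all
  have lt: "lb < lq" by simp
  have ne: "lb \<noteq> lq" by simp
  show d3: "d3 \<in> NC2 n n"
    unfolding d3_def
  proof (rule rejoin_NC[OF d pts(3,4) lt])
    fix z assume "z \<in> points n n" then show "\<not> (lb < z \<and> z < lq)" by (cases z) auto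
  qed
  note m3 = NC2_matching[OF d3]
  show md3: "mate d3 lb = lq" unfolding d3_def using mate_rejoin[OF m pts(3,4) ne pts(3)] by simp
  have mua: "mate d ua = up" using mate_mate[OF m pts(1)] md by simp
  have diff: "up \<noteq> lb" "up \<noteq> lq" "ua \<noteq> lb" "ua \<noteq> lq" by simp_all
  have mne: "mate d lb \<noteq> up" "mate d lb \<noteq> ua" "mate d lq \<noteq> up" "mate d lq \<noteq> ua"
    using mate_mate[OF m pts(3)] mate_mate[OF m pts(4)] md mua diff by metis+
  show mup: "mate d3 up = ua"
    unfolding d3_def mate_rejoin[OF m pts(3,4) ne pts(1)] 
    using diff mne[symmetric] md by (simp only: simp_thms if_False if_cancel)
  show "euler (k + 1) d = euler (k + 1) d3"
  proof (cases "mate d lb = lq")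
    case True
    then have "d3 = d" unfolding d3_def by (rule rejoin_id[OF m pts(3,4) ne])
    then show ?thesis by simp
  next
    case False
    note F = fatten_isolate(1)[OF d ip, folded d3_def, unfolded nb]
    obtain z where z: "z \<noteq> Y" "same (fatten (k + 1) d) z Y"
      using fatten_isolate(2)[OF d ip, unfolded nb] False by blast
    have zY: "same (fatten (k + 1) d) Y z" by (rule same_sym[OF z(2)])
    have zp: "z \<in> points (k + 1) (k + 1)" using same_in[OF partF z(2)] by blast
    have Xs: "w = X" if "same (fatten (k + 1) d) w X" for w
      using fatten_isolate(2)[OF d ip', unfolded nb'] md that by blast
    have zX: "z \<noteq> X" using Xs[of Y] zY by auto
    have sF: "(u, v) \<in> conn (fatten (k + 1) d \<union> E)" if "same (fatten (k + 1) d3) u v" for u v E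
    proof -
      have "u = v \<or> same (fatten (k + 1) d) u v" using that unfolding F by blast
      then show ?thesis using conn_same[of "fatten (k + 1) d" u v E] by auto
    qed
    have "closure_comps n d3 = Suc (closure_comps n d)"
      unfolding closure_comps_def
    proof (rule join_partition[where x = lb and y = "mate d lb" and S = "{up, ua, lb, lq}"])
      show "partition_on (points n n) d3" "partition_on (points n n) d" using matching_partition[OF m3] P .
      have m3': "mate d3 ua = up" "mate d3 lq = lb" using mate_mate[OF m3 pts(1)] mate_mate[OF m3 pts(3)] mup md3 by simp_all
      show "v \<in> {up, ua, lb, lq}" if "same d3 u v" "u \<in> {up, ua, lb, lq}" for u v
      proof -
        have "u \<in> points n n" using that(2) pts by blast
        then have "v = u \<or> v = mate d3 u" using same_mate[OF m3] that(1) by blast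
        then show ?thesis using that(2) mup md3 m3' by (elim disjE insertE emptyE) simp_all
      qed
      show "v \<in> {up, ua, lb, lq}" if "B \<in> id_diagram n" "u \<in> B" "v \<in> B" "u \<in> {up, ua, lb, lq}" for B u v
        by (rule flip_closed[OF that]) auto
      show "mate d lb \<in> points n n" by (rule mate_in[OF m pts(3)])
      show "mate d lb \<notin> {up, ua, lb, lq}" using mne mate_ne[OF m pts(3)] False by blast
      have c: "(lb, lq) \<in> conn (d \<union> id_diagram n)"
      proof -
        have c1: "(lb, ua) \<in> conn (d \<union> id_diagram n)" using conn_id[OF pts(3), of d] by simp
        have c2: "(ua, up) \<in> conn (d \<union> id_diagram n)" using conn_same[OF same_mate_self[OF m pts(2)]] unfolding mua .
        have c3: "(up, lq) \<in> conn (d \<union> id_diagram n)" using conn_id[OF pts(1), of d] by simp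
        show ?thesis by (rule conn_trans[OF conn_trans[OF c1 c2] c3])
      qed
      show "(u, v) \<in> conn (d \<union> id_diagram n)" if "same d3 u v" for u v
        by (rule conn_rejoin[OF P pts(3,4) conn_same c that[unfolded d3_def]])
      show "(lb, mate d lb) \<in> conn (d \<union> id_diagram n)" by (rule conn_same[OF same_mate_self[OF m pts(3)]])
      show "(u, v) \<in> conn (insert {lb, mate d lb} (d3 \<union> id_diagram n))" if "same d u v" for u v
      proof (rule conn_rejoin_converse[OF m pts(3,4) ne False _ _ that])
        show "(u, v) \<in> conn (insert {lb, mate d lb} (d3 \<union> id_diagram n))" if "same (rejoin lb lq d) u v" for u v
          using conn_same[OF that, folded d3_def, of "id_diagram n"] by (rule conn_mono) auto
      qed (rule conn_block[of "{lb, mate d lb}"], auto)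
    qed (use pts Id_sub[of n] in simp_all)
    moreover have "card (fatten (k + 1) d3) = Suc (card (fatten (k + 1) d))"
    proof -
      have "card (components (fatten (k + 1) d3 \<union> {})) = Suc (card (components (fatten (k + 1) d \<union> {})))"
      proof (rule join_partition[where x = Y and y = z and S = "{Y}"])
        show "partition_on (points (k + 1) (k + 1)) (fatten (k + 1) d3)" "partition_on (points (k + 1) (k + 1)) (fatten (k + 1) d)"
          by (rule partF)+
        show "v \<in> {Y}" if "same (fatten (k + 1) d3) u v" "u \<in> {Y}" for u v using that unfolding F by blast
        show "(u, v) \<in> conn (fatten (k + 1) d \<union> {})" if "same (fatten (k + 1) d3) u v" for u v by (rule sF[OF that])
        show "(Y, z) \<in> conn (fatten (k + 1) d \<union> {})" by (rule conn_same[OF zY])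
        show "(u, v) \<in> conn (insert {Y, z} (fatten (k + 1) d3 \<union> {}))" if "same (fatten (k + 1) d) u v" for u v
        proof (rule conn_isolate[OF partF F _ _ zY z(1) that])
          show "(u, v) \<in> conn (insert {Y, z} (fatten (k + 1) d3 \<union> {}))" if "same (fatten (k + 1) d3) u v" for u v
            using conn_same[OF that, of "{}"] by (rule conn_mono) auto
        qed (rule conn_block[of "{Y, z}"], auto)
      qed (use pts zp z in simp_all)
      then show ?thesis by (simp add: components_partition[OF partF])
    qed
    moreover have "closure_comps (k + 1) (fatten (k + 1) d3) = Suc (closure_comps (k + 1) (fatten (k + 1) d))"
      unfolding closure_comps_def
    proof (rule join_partition[where x = Y and y = z and S = "{X, Y}"])
      show "partition_on (points (k + 1) (k + 1)) (fatten (k + 1) d3)" "partition_on (points (k + 1) (k + 1)) (fatten (k + 1) d)"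
        by (rule partF)+
      show "v \<in> {X, Y}" if "same (fatten (k + 1) d3) u v" "u \<in> {X, Y}" for u v
      proof -
        have "u = Y \<and> v = Y \<or> same (fatten (k + 1) d) v u \<and> u \<noteq> Y"
          using that(1) same_sym[of "fatten (k + 1) d" u v] unfolding F by blast
        then show ?thesis using Xs[of v] that(2) by blast
      qed
      show "v \<in> {X, Y}" if "B \<in> id_diagram (k + 1)" "u \<in> B" "v \<in> B" "u \<in> {X, Y}" for B u v
        by (rule flip_closed[OF that]) auto
      show "(u, v) \<in> conn (fatten (k + 1) d \<union> id_diagram (k + 1))" if "same (fatten (k + 1) d3) u v" for u v by (rule sF[OF that])
      show "(Y, z) \<in> conn (fatten (k + 1) d \<union> id_diagram (k + 1))" by (rule conn_same[OF zY])
      show "(u, v) \<in> conn (insert {Y, z} (fatten (k + 1) d3 \<union> id_diagram (k + 1)))" if "same (fatten (k + 1) d) u v" for u v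
      proof (rule conn_isolate[OF partF F _ _ zY z(1) that])
        show "(u, v) \<in> conn (insert {Y, z} (fatten (k + 1) d3 \<union> id_diagram (k + 1)))" if "same (fatten (k + 1) d3) u v" for u v
          using conn_same[OF that, of "id_diagram (k + 1)"] by (rule conn_mono) auto
      qed (rule conn_block[of "{Y, z}"], auto)
    qed (use pts zp z zX Id_sub[of "k + 1"] in simp_all)
    ultimately show ?thesis unfolding euler_def by linarith
  qed
qed

text \<open>The last column is a loop of its own. Removing it drops this loop, the blocks
  \<open>{X}\<close> and \<open>{Y}\<close>, and one component of the closed fattening: 1 + 2 -
  2.\<close>

lemma strip:
  assumes md: "mate d up = ua" "mate d lb = lq"
  obtains d0 where "d0 \<in> NC2 (2 * k) (2 * k)" "euler (k + 1) d = euler k d0 + 1"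
proof -
  note m = NC2_matching[OF d]
  note P = matching_partition[OF m]
  define d0 where "d0 = d - {{up, ua}} - {{lb, lq}}"
  have cl: "{u, mate d u} \<in> d" if "u \<in> points n n" for u
  proof -
    have "{v. same d u v} = {u, mate d u}" using same_mate[OF m that] by auto
    then show ?thesis using block_in[OF P that] by simp
  qed
  have b1: "{up, ua} \<in> d" using cl[OF pts(1)] md(1) by simp
  have b2: "{lb, lq} \<in> d" using cl[OF pts(3)] md(2) by simp
  have b2': "{lb, lq} \<in> d - {{up, ua}}" using b2 by auto
  have A: "points n n - {up, ua} - {lb, lq} = points (2 * k) (2 * k)"
  proof (intro set_eqI)
    fix x show "x \<in> points n n - {up, ua} - {lb, lq} \<longleftrightarrow> x \<in> points (2 * k) (2 * k)" by (cases x) auto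
  qed
  have P0: "partition_on (points (2 * k) (2 * k)) d0"
    using partition_remove[OF partition_remove[OF P b1] b2'] unfolding A d0_def .
  have d0: "d0 \<in> NC2 (2 * k) (2 * k)"
  proof (rule NC2_I[OF NC_I])
    show "d0 \<in> Part (2 * k) (2 * k)" using P0 by (simp add: Part_def)
    show "matching (points (2 * k) (2 * k)) d0" using P0 m by (simp add: matching_def d0_def)
    fix a b c e assume s: "same d0 a c" "same d0 b e" "a < b" "b < c" "c < e"
    have s': "same d u v" if "same d0 u v" for u v using that by (auto simp: same_def d0_def)
    have "same d a b" by (rule nc_same[OF NC2_NC[OF d] s'[OF s(1)] s'[OF s(2)] s(3-5)])
    then obtain B where B: "B \<in> d" "a \<in> B" "b \<in> B" by (auto simp: same_def)
    obtain C where C: "C \<in> d0" "a \<in> C" using s(1) by (auto simp: same_def)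
    then have "C = B" using partition_unique[OF P, of C B a] B by (auto simp: d0_def)
    then show "same d0 a b" using C B by (auto intro: sameI)
  qed
  have d_eq: "d = insert {up, ua} (insert {lb, lq} d0)" using b1 b2 unfolding d0_def by auto
  have sd: "same d u v \<longleftrightarrow> u \<in> {up, ua} \<and> v \<in> {up, ua} \<or> u \<in> {lb, lq} \<and> v \<in> {lb, lq} \<or> same d0 u v" for u v
    unfolding d_eq same_insert by blast
  have ip: "isolate_pair (k + 1) lb lq" and nb: "nb lb = Y" using isolate_lower[of k "k + 1"] by simp_all
  have ip': "isolate_pair (k + 1) up ua" and nb': "nb up = X" using isolate_upper[of k "k + 1"] by simp_all
  have Xs: "w = X" if "same (fatten (k + 1) d) w X" for w
    using fatten_isolate(2)[OF d ip', unfolded nb'] md that by blast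
  have Ys: "w = Y" if "same (fatten (k + 1) d) w Y" for w
    using fatten_isolate(2)[OF d ip, unfolded nb] md that by blast
  \<comment> \<open>The two pairs of the last column pass over no new point of the remaining
    columns, so comparing \<open>kap\<close> there is the same before and after removing
    them.\<close>
  have small: "\<not> cr x up ua" "\<not> cr x lb lq" if x: "x \<in> points k k" for x
  proof -
    show "\<not> cr x up ua" using x unfolding cr_def side_def by (cases x) auto
    show "\<not> cr x lb lq" using x unfolding cr_def side_def by (cases x) auto
  qed
  have pk: "x \<in> points (k + 1) (k + 1) \<longleftrightarrow> x = X \<or> x = Y \<or> x \<in> points k k" for x by (cases x) auto
  have kap0: "kap d x = kap d y \<longleftrightarrow> kap d0 x = kap d0 y" if "x \<in> points k k" "y \<in> points k k" for x y
  proof -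
    have "cr z u v = False" if "z \<in> points k k" "u \<in> {up, ua} \<and> v \<in> {up, ua} \<or> u \<in> {lb, lq} \<and> v \<in> {lb, lq}" for z u v
      using small[OF that(1)] that(2) cr_sym[of z] by auto
    then show ?thesis unfolding kap_eq_iff sd using that by metis
  qed
  have XY: "X \<notin> points k k" "Y \<notin> points k k" by simp_all
  have f_eq: "fatten (k + 1) d = insert {X} (insert {Y} (fatten k d0))"
  proof (rule partition_eqI[OF partF])
    have "points (k + 1) (k + 1) = {X} \<union> ({Y} \<union> points k k)" using pk by blast
    then show "partition_on (points (k + 1) (k + 1)) (insert {X} (insert {Y} (fatten k d0)))"
      using partition_insert[OF partition_insert[OF partF[of k d0], of "{Y}"], of "{X}"] XY by simp
    fix x y assume xy: "x \<in> points (k + 1) (k + 1)" "y \<in> points (k + 1) (k + 1)"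
    have r: "same (fatten (k + 1) d) z z" if "z \<in> points (k + 1) (k + 1)" for z by (rule same_refl[OF partF that])
    show "same (fatten (k + 1) d) x y \<longleftrightarrow> same (insert {X} (insert {Y} (fatten k d0))) x y"
    proof (cases "x \<in> points k k \<and> y \<in> points k k")
      case True
      then have "x \<noteq> X" "x \<noteq> Y" "y \<noteq> X" "y \<noteq> Y" using XY by metis+
      moreover have "same (fatten (k + 1) d) x y \<longleftrightarrow> same (fatten k d0) x y"
        unfolding same_fatten using True xy kap0[of x y] by blast
      ultimately show ?thesis unfolding same_insert by blast
    next
      case False
      then have c: "x = X \<or> x = Y \<or> y = X \<or> y = Y" using xy pk by blast
      have "same (fatten (k + 1) d) x y \<longleftrightarrow> x = y"
        using c Xs[of x] Xs[of y] Ys[of x] Ys[of y] same_sym[of "fatten (k + 1) d" x y] r[OF xy(1)] by metis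
      moreover have "\<not> same (fatten k d0) x y" using False same_in[OF partF[of k d0], of x y] by blast
      ultimately show ?thesis unfolding same_insert using c by auto
    qed
  qed
  have c1: "card (fatten (k + 1) d) = card (fatten k d0) + 2"
  proof -
    have U: "\<Union>(fatten k d0) = points k k" by (rule Part_Union[OF fatten_Part])
    have "finite (fatten k d0)" by (rule finite_elements[OF _ partF]) simp
    moreover have n: "{z} \<notin> fatten k d0" if "z \<notin> points k k" for z
    proof
      assume "{z} \<in> fatten k d0"
      then have "z \<in> \<Union>(fatten k d0)" by blast
      then show False using that unfolding U by blast
    qed
    moreover have "{X} \<notin> insert {Y} (fatten k d0)" using n[OF XY(1)] by simp
    moreover note n[OF XY(2)]
    ultimately show ?thesis unfolding f_eq by (simp only: card_insert_disjoint finite_insert not_False_eq_True)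
  qed
  have c2: "closure_comps (k + 1) (fatten (k + 1) d) = closure_comps k (fatten k d0) + 1"
  proof -
    let ?Q = "{{X}, {Y}, {X, Y}}" and ?H = "fatten k d0 \<union> id_diagram k"
    have i: "id_diagram (k + 1) = insert {X, Y} (id_diagram k)" unfolding strand_id[symmetric] strand_def ..
    have e: "fatten (k + 1) d \<union> id_diagram (k + 1) = ?H \<union> ?Q" unfolding f_eq i by auto
    have U: "\<Union>?H = points k k" using Part_Union[OF fatten_Part] Union_id_diagram by (simp add: Union_Un_distrib)
    have dis: "\<Union>?H \<inter> \<Union>?Q = {}" unfolding U using XY by auto
    have "card (components ?Q) = 1"
    proof (rule components_singleton[of X])
      show "(X, y) \<in> conn ?Q" if "y \<in> \<Union>?Q" for y using that by (intro conn_block[of "{X, Y}"]) auto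
    qed auto
    moreover have "finite (components ?H)" "finite (components ?Q)" using finite_components[of ?H] finite_components[of ?Q]
      unfolding U by simp_all
    ultimately show ?thesis
      unfolding closure_comps_def e components_disjoint_Un(1)[OF dis]
      using card_Un_disjoint[OF _ _ components_disjoint_Un(2)[OF dis]] by simp
  qed
  have c3: "closure_comps n d = closure_comps (2 * k) d0 + 1"
  proof -
    let ?Q = "{{up, ua}, {lb, lq}, {up, lq}, {ua, lb}}" and ?H = "d0 \<union> id_diagram (2 * k)"
    have "id_diagram (2 * k + 1 + 1) = insert {ua, lb} (insert {up, lq} (id_diagram (2 * k)))"
      unfolding strand_id[symmetric] strand_def by simp
    then have i: "id_diagram n = insert {ua, lb} (insert {up, lq} (id_diagram (2 * k)))" by simp
    have e: "d \<union> id_diagram n = ?H \<union> ?Q" unfolding i by (subst d_eq) auto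
    have U: "\<Union>?H = points (2 * k) (2 * k)" using P0 Union_id_diagram by (simp add: Union_Un_distrib partition_on_def)
    have dis: "\<Union>?H \<inter> \<Union>?Q = {}" unfolding U by auto
    have "card (components ?Q) = 1"
    proof (rule components_singleton[of up])
      have q: "(up, ua) \<in> conn ?Q" "(up, lq) \<in> conn ?Q" "(ua, lb) \<in> conn ?Q"
        by (rule conn_block[of "{up, ua}"] conn_block[of "{up, lq}"] conn_block[of "{ua, lb}"]; simp)+
      show "(up, y) \<in> conn ?Q" if "y \<in> \<Union>?Q" for y
      proof -
        have "y = up \<or> y = ua \<or> y = lb \<or> y = lq" using that by auto
        then show ?thesis using q conn_trans[OF q(1) q(3)] by (elim disjE) simp_all
      qed
    qed auto
    moreover have "finite (components ?H)" "finite (components ?Q)" using finite_components[of ?H] finite_components[of ?Q]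
      unfolding U by simp_all
    ultimately show ?thesis
      unfolding closure_comps_def e components_disjoint_Un(1)[OF dis]
      using card_Un_disjoint[OF _ _ components_disjoint_Un(2)[OF dis]] by simp
  qed
  have "euler (k + 1) d = euler k d0 + 1" unfolding euler_def c1 c2 c3 by simp
  then show thesis using d0 that by blast
qed

end

text \<open>Three reconnections detach the last column of any pairing without changing
  \<open>euler\<close>; removing the column then lowers it by 1.\<close>

lemma euler_formula: "d \<in> NC2 (2 * k) (2 * k) \<Longrightarrow> euler k d = int k"
proof (induction k arbitrary: d)
  case 0
  then have "partition_on {} d" by (auto simp: NC2_def NC_def Part_def points_def)
  then have "d = {}" by (auto simp: partition_on_def)
  then show ?case
    by (simp add: euler_def closure_comps_def id_diagram_def components_alt fatten_kerp kerp_def points_def)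
next
  case (Suc k)
  then have d: "d \<in> NC2 (2 * (k + 1)) (2 * (k + 1))" by simp
  define d1 where "d1 = rejoin (Upper (2 * k + 2)) (Lower (2 * k + 2)) d"
  note 1 = close_step[OF d, folded d1_def]
  define d2 where "d2 = rejoin (Upper (2 * k + 1)) (Upper (2 * k + 2)) d1"
  note 2 = split_upper[OF 1(1,2), folded d2_def]
  define d3 where "d3 = rejoin (Lower (2 * k + 2)) (Lower (2 * k + 1)) d2"
  note 3 = split_lower[OF 2(1,2), folded d3_def]
  obtain d0 where "d0 \<in> NC2 (2 * k) (2 * k)" "euler (k + 1) d3 = euler k d0 + 1"
    using strip[OF 3(1-3)] by blast
  then show ?case unfolding Suc_eq_plus1 using 1(4) 2(3) 3(4) Suc.IH[of d0] by simp
qed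

subsection \<open>The fattening map on generators\<close>

text \<open>The ratio of the traces after inserting Euler's formula,
  \<open>s^L / s^(2C) = s^(k - b)\<close>, kept as a quotient because the number \<open>b\<close> of
  blocks may exceed \<open>k\<close>.\<close>

definition weight :: "complex \<Rightarrow> nat \<Rightarrow> diagram \<Rightarrow> complex" where
  "weight s k d = s ^ k / s ^ card (fatten k d)"

lemma fatten_weight:
  assumes s: "s \<noteq> 0" and d: "d \<in> NC2 (2 * k) (2 * k)"
  shows "trace s d / trace (s\<^sup>2) (fatten k d) = weight s k d"
proof -
  let ?L = "closure_comps (2 * k) d" and ?C = "closure_comps k (fatten k d)" and ?b = "card (fatten k d)"
  have "?L + ?b = k + 2 * ?C" using euler_formula[OF d] unfolding euler_def by linarith
  then have "s ^ ?L * s ^ ?b = s ^ k * (s\<^sup>2) ^ ?C" by (metis power_add power_mult)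
  then show ?thesis
    unfolding trace_closure[OF NC_Part[OF NC2_NC[OF d]]] trace_closure[OF fatten_Part] weight_def
    using s by (simp add: divide_simps mult.commute)
qed

lemma fattening_map_simps [simp]:
  "fattening_map s k (x + y) = fattening_map s k x + fattening_map s k y"
  "fattening_map s k (smult c x) = smult c (fattening_map s k x)"
  "fattening_map s k 0 = 0"
  by (simp_all add: fattening_map_def lin_extend_add lin_extend_smult)

lemma fattening_map_basis:
  "s \<noteq> 0 \<Longrightarrow> d \<in> NC2 (2 * k) (2 * k) \<Longrightarrow> fattening_map s k (basis d) = smult (weight s k d) (basis (fatten k d))"
  unfolding fattening_map_def lin_extend_basis by (simp add: fatten_weight)

lemma fattening_map_NC:
  assumes s: "s \<noteq> 0" and x: "x \<in> Hom0 NC2 (2 * k) (2 * k)"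
  shows "fattening_map s k x \<in> Hom0 NC k k"
  using x
  by (induction rule: Hom0_induct) (auto simp: fattening_map_basis[OF s] fatten_NC intro: Hom0_add Hom0_smult)

lemma trace_flipd: "trace s (flipd p) = trace s p"
proof -
  have "case_point id id (flip x) = (case_point id id x :: nat)" for x by (cases x) auto
  then have "(`) (case_point id id) ` flipd p = ((`) (case_point id id) ` p :: nat set set)"
    by (simp add: flipd_def image_image)
  then show ?thesis by (simp add: trace_def)
qed

lemma fattening_map_flip0: "fattening_map s k (flip0 x) = flip0 (fattening_map s k x)"
proof -
  have "x \<in> Hom0 (\<lambda>_ _. UNIV) 0 0" by (simp add: Hom0_def)
  then show ?thesis
    by (induction rule: Hom0_induct)
      (simp_all add: fattening_map_def lin_extend_add lin_extend_smult fatten_flipd trace_flipd)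
qed

lemma card_merge:
  assumes p: "partition_on A p" and q: "partition_on A q" and fin: "finite A" and x: "x \<in> A" "y \<in> A"
    and q_eq: "\<And>u v. same q u v \<longleftrightarrow> u \<in> A \<and> v \<in> A \<and>
       (same p u v \<or> same p u x \<and> same p y v \<or> same p u y \<and> same p x v)"
    and n: "\<not> same p x y"
  shows "card p = Suc (card q)"
proof -
  have "card (components (p \<union> {})) = Suc (card (components (q \<union> {})))"
  proof (rule join_partition[OF p q fin, where x = x and y = y and S = "{v. same p x v}"])
    show "v \<in> {v. same p x v}" if "same p u v" "u \<in> {v. same p x v}" for u v
      using that same_trans[OF p] by blast
    show "(u, v) \<in> conn (q \<union> {})" if "same p u v" for u v
    proof (rule conn_same)
      show "same q u v" using that same_in[OF p that] unfolding q_eq by blast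
    qed
    show "(x, y) \<in> conn (q \<union> {})"
      by (rule conn_same) (use same_refl[OF p] x in \<open>simp add: q_eq\<close>)
    show "(u, v) \<in> conn (insert {x, y} (p \<union> {}))" if "same q u v" for u v
    proof -
      have D: "same p u v \<or> same p u x \<and> same p y v \<or> same p u y \<and> same p x v" using that unfolding q_eq by blast
      have xy: "(x, y) \<in> conn (insert {x, y} (p \<union> {}))" by (rule conn_block[of "{x, y}"]) auto
      have c: "(u, v) \<in> conn (insert {x, y} (p \<union> {}))" if "same p u v" for u v
        using conn_same[OF that, of "{}"] by (rule conn_mono) auto
      show ?thesis by (rule conn_merged[OF c xy D])
    qed
  qed (use x n same_refl[OF p x(1)] in simp_all)
  then show ?thesis by (simp add: components_partition[OF p] components_partition[OF q])
qed

text \<open>Read backwards: \<open>p\<close> arises from \<open>q\<close> by merging the singleton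
  of \<open>x\<close> with the block of \<open>z\<close>.\<close>

lemma card_isolate:
  assumes p: "partition_on A p" and q: "partition_on A q" and fin: "finite A" and x: "x \<in> A"
    and q_eq: "\<And>u v. same q u v \<longleftrightarrow> u \<in> A \<and> v \<in> A \<and> (u = x \<and> v = x \<or> u \<noteq> x \<and> v \<noteq> x \<and> same p u v)"
    and z: "same p z x" "z \<noteq> x"
  shows "card q = Suc (card p)"
proof (rule card_merge[OF q p fin])
  show "x \<in> A" "z \<in> A" using same_in[OF p z(1)] by auto
  show "\<not> same q x z" using z unfolding q_eq by blast
  note st = same_trans[OF p] and ss = same_sym[of p]
  fix u v
  have in_A: "same p u v \<Longrightarrow> u \<in> A \<and> v \<in> A" by (rule same_in[OF p])
  show "same p u v \<longleftrightarrow> u \<in> A \<and> v \<in> A \<and> (same q u v \<or> same q u x \<and> same q z v \<or> same q u z \<and> same q x v)"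
  proof
    assume s: "same p u v"
    show "u \<in> A \<and> v \<in> A \<and> (same q u v \<or> same q u x \<and> same q z v \<or> same q u z \<and> same q x v)"
    proof (cases "u = x \<or> v = x")
      case True
      have "u = x \<Longrightarrow> v \<noteq> x \<Longrightarrow> same p z v" "v = x \<Longrightarrow> u \<noteq> x \<Longrightarrow> same p u z"
        using s st[OF z(1)] st[OF _ ss[OF z(1)]] by blast+
      then show ?thesis using True in_A[OF s] z(2) \<open>x \<in> A\<close> \<open>z \<in> A\<close> unfolding q_eq by metis
    next
      case False
      then show ?thesis using s in_A[OF s] unfolding q_eq by blast
    qed
  next
    assume "u \<in> A \<and> v \<in> A \<and> (same q u v \<or> same q u x \<and> same q z v \<or> same q u z \<and> same q x v)"
    then show "same p u v"
      unfolding q_eq using same_refl[OF p \<open>x \<in> A\<close>] z(1) ss[OF z(1)] st by metis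
  qed
qed

context
  fixes s :: complex and k :: nat
  assumes s: "s \<noteq> 0"
begin

lemma fattening_map_S:
  assumes m: "m < k" and x: "x \<in> Hom0 NC2 (2 * k) (2 * k)"
  shows "comp0 (s\<^sup>2) (basis (sdiag k (m + 1))) (fattening_map s k x) = smult s (fattening_map s k (comp0 s (ulin (2 * k) (2 * m + 1)) x))"
  using x
proof (induction rule: Hom0_induct)
  case (basis d)
  let ?a = "Lower (2 * m + 2)" and ?b = "Lower (2 * m + 1)" and ?X = "Lower (m + 1)"
  let ?f = "fatten k d"
  have i: "1 \<le> 2 * m + 1" "2 * m + 1 < 2 * k" "1 \<le> m + 1" "m + 1 \<le> k" using m by auto
  have l: "?a \<in> points (2 * k) (2 * k)" "?b \<in> points (2 * k) (2 * k)" "?X \<in> points k k" using m by auto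
  note md = NC2_matching[OF basis]
  define d' where "d' = composite (udiag (2 * k) (2 * m + 1)) d"
  have e2: "2 * m + 1 + 1 = 2 * m + 2" by simp
  have d': "d' = rejoin ?a ?b d"
    unfolding d'_def composite_U(1)[OF basis i(1,2)] e2 by (rule rejoin_commute[OF matching_partition[OF md] l(2,1)])
  have d'NC: "d' \<in> NC2 (2 * k) (2 * k)" unfolding d'_def by (rule composite_U_NC2[OF basis i(1,2)])
  note I = fatten_isolate[OF basis isolate_lower(1)[OF m], folded d', unfolded isolate_lower(2)[OF m]]
  have fS: "composite (sdiag k (m + 1)) ?f = fatten k d'"
  proof (rule partition_eqI[OF _ Part_partition[OF fatten_Part]])
    show "partition_on (points k k) (composite (sdiag k (m + 1)) ?f)"
      by (rule Part_partition, rule composite_Part[of 0 1 2, OF _ _ _ fatten_Part NC_Part[OF sdiag_NC]]) auto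
  qed (simp only: same_composite_S[OF fatten_Part i(3,4)] I(1))
  have mb: "mate d ?b = ?a \<longleftrightarrow> mate d ?a = ?b" using mate_eq_iff[OF md l(2,1)] by metis
  have lu: "loops (udiag (2 * k) (2 * m + 1)) d = (if mate d ?a = ?b then 1 else 0)"
    unfolding composite_U(2)[OF basis i(1,2)] e2 mb ..
  have lS: "loops (sdiag k (m + 1)) ?f = (if mate d ?a = ?b then 1 else 0)"
    unfolding loops_S[OF fatten_Part i(3,4)] I(2) by simp
  \<comment> \<open>If the pair is already there, the loop of singletons gives \<open>s^2\<close> on
    the left and the closed strand only \<open>s\<close> on the right, whence the extra factor
    \<open>s\<close>. Otherwise a new block lowers the weight by this factor.\<close>
  have w: "weight s k d * (s\<^sup>2) ^ loops (sdiag k (m + 1)) ?f = s * (s ^ loops (udiag (2 * k) (2 * m + 1)) d * weight s k d')"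
  proof (cases "mate d ?a = ?b")
    case True
    then have "d' = d" unfolding d' by (intro rejoin_id[OF md l(1,2)]) simp_all
    then show ?thesis using True by (simp add: lu lS power2_eq_square)
  next
    case False
    then obtain z where z: "z \<noteq> ?X" "same ?f z ?X" using I(2) by blast
    have "card (fatten k d') = Suc (card ?f)"
      by (rule card_isolate[OF Part_partition[OF fatten_Part] Part_partition[OF fatten_Part] finite_points l(3) I(1) z(2,1)])
    then show ?thesis using False s by (simp add: lu lS weight_def)
  qed
  have "comp0 (s\<^sup>2) (basis (sdiag k (m + 1))) (fattening_map s k (basis d)) =
     smult (weight s k d * (s\<^sup>2) ^ loops (sdiag k (m + 1)) ?f) (basis (fatten k d'))"
    by (simp add: fattening_map_basis[OF s basis] comp0_smult_right comp0_basis fS)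
  moreover have "fattening_map s k (comp0 s (ulin (2 * k) (2 * m + 1)) (basis d)) =
     smult (s ^ loops (udiag (2 * k) (2 * m + 1)) d * weight s k d') (basis (fatten k d'))"
    using fattening_map_basis[OF s d'NC] by (simp add: ulin_def comp0_basis d'_def[symmetric])
  ultimately show ?case using w by simp
qed (simp_all add: comp0_add_right comp0_smult_right lin.scale_right_distrib mult.commute)

lemma fattening_map_M:
  assumes m: "1 \<le> m" "m < k" and x: "x \<in> Hom0 NC2 (2 * k) (2 * k)"
  shows "smult s (comp0 (s\<^sup>2) (basis (mdiag k m)) (fattening_map s k x)) = fattening_map s k (comp0 s (ulin (2 * k) (2 * m)) x)"
  using x
proof (induction rule: Hom0_induct)
  case (basis d)
  let ?a = "Lower (2 * m + 1)" and ?b = "Lower (2 * m)" and ?X = "Lower (m + 1)" and ?Y = "Lower m"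
  let ?f = "fatten k d"
  have i: "1 \<le> 2 * m" "2 * m < 2 * k" using m by auto
  have l: "?a \<in> points (2 * k) (2 * k)" "?b \<in> points (2 * k) (2 * k)" "?X \<in> points k k" "?Y \<in> points k k" using m by auto
  have nb: "nb ?a = ?X" "nb ?b = ?Y" by simp_all
  note md = NC2_matching[OF basis]
  define d' where "d' = composite (udiag (2 * k) (2 * m)) d"
  have d': "d' = rejoin ?a ?b d"
    unfolding d'_def composite_U(1)[OF basis i] by (rule rejoin_commute[OF matching_partition[OF md] l(2,1)])
  have d'NC: "d' \<in> NC2 (2 * k) (2 * k)" unfolding d'_def by (rule composite_U_NC2[OF basis i])
  note I = fatten_merge[OF basis merge_lower[OF m], folded d', unfolded nb]
  have fM: "composite (mdiag k m) ?f = fatten k d'"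
  proof (rule partition_eqI[OF _ Part_partition[OF fatten_Part]])
    show "partition_on (points k k) (composite (mdiag k m) ?f)"
      by (rule Part_partition, rule composite_Part[of 0 1 2, OF _ _ _ fatten_Part NC_Part[OF mdiag_NC]]) auto
    fix x y show "same (composite (mdiag k m) ?f) x y \<longleftrightarrow> same (fatten k d') x y"
      unfolding same_composite_M[OF fatten_Part m] I(1) by blast
  qed
  have mb: "mate d ?b = ?a \<longleftrightarrow> mate d ?a = ?b" using mate_eq_iff[OF md l(2,1)] by metis
  have lu: "loops (udiag (2 * k) (2 * m)) d = (if mate d ?a = ?b then 1 else 0)"
    unfolding composite_U(2)[OF basis i] mb ..
  have lM: "loops (mdiag k m) ?f = 0" by (rule loops_M[OF fatten_Part m])
  \<comment> \<open>Either a loop appears on the right only and gives \<open>s\<close>, or two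
    blocks merge and the weight rises by \<open>s\<close>; in both cases the factor belongs on the
    left.\<close>
  have w: "s * weight s k d = s ^ loops (udiag (2 * k) (2 * m)) d * weight s k d'"
  proof (cases "mate d ?a = ?b")
    case True
    then have "d' = d" unfolding d' by (intro rejoin_id[OF md l(1,2)]) simp_all
    then show ?thesis using True by (simp add: lu)
  next
    case False
    have "card ?f = Suc (card (fatten k d'))"
      by (rule card_merge[OF Part_partition[OF fatten_Part] Part_partition[OF fatten_Part] finite_points l(3,4) I(1)])
        (use I(2) False in simp)
    then show ?thesis using False s by (simp add: lu weight_def)
  qed
  have "smult s (comp0 (s\<^sup>2) (basis (mdiag k m)) (fattening_map s k (basis d))) = smult (s * weight s k d) (basis (fatten k d'))"
    by (simp add: fattening_map_basis[OF s basis] comp0_smult_right comp0_basis fM lM)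
  moreover have "fattening_map s k (comp0 s (ulin (2 * k) (2 * m)) (basis d)) =
     smult (s ^ loops (udiag (2 * k) (2 * m)) d * weight s k d') (basis (fatten k d'))"
    using fattening_map_basis[OF s d'NC] by (simp add: ulin_def comp0_basis d'_def[symmetric])
  ultimately show ?case using w by simp
next
  case (smult c x)
  have "smult s (comp0 (s\<^sup>2) (basis (mdiag k m)) (fattening_map s k (smult c x))) =
     smult c (smult s (comp0 (s\<^sup>2) (basis (mdiag k m)) (fattening_map s k x)))"
    by (simp add: comp0_smult_right mult.commute)
  then show ?case using smult by (simp add: comp0_smult_right)
qed (simp_all add: comp0_add_right lin.scale_right_distrib)

end

subsection \<open>The excluded parameters\<close>

text \<open>The rescaled Chebyshev polynomials of the second kind, \<open>U_n(s/2)\<close>.\<close>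

fun cheb :: "complex \<Rightarrow> nat \<Rightarrow> complex" where
  "cheb s 0 = 1"
| "cheb s (Suc 0) = s"
| "cheb s (Suc (Suc n)) = s * cheb s (Suc n) - cheb s n"

lemma cheb_jw_coeff:
  assumes "\<And>m. cheb s m \<noteq> 0"
  shows "s - jw_coeff s (Suc n) = cheb s (Suc n) / cheb s n"
proof (induction n)
  case (Suc n)
  have "s - jw_coeff s (Suc (Suc n)) = s - inverse (cheb s (Suc n) / cheb s n)" unfolding Suc[symmetric] by simp
  then show ?case using assms[of n] assms[of "Suc n"] by (simp add: field_simps)
qed simp

text \<open>Closed form for \<open>s = z + 1/z\<close>. The factor \<open>z - 1/z\<close> vanishes
  at \<open>z = 1\<close> and \<open>z = -1\<close>; these points are treated by
  \<open>cheb_unit\<close>.\<close>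

lemma cheb_power:
  assumes z: "z \<noteq> 0"
  shows "cheb (z + inverse z) n * (z - inverse z) = z ^ (n + 1) - inverse z ^ (n + 1)"
proof (induction "z + inverse z" n rule: cheb.induct)
  case (3 n)
  have "cheb (z + inverse z) (Suc (Suc n)) * (z - inverse z) =
      (z + inverse z) * (z ^ (n + 2) - inverse z ^ (n + 2)) - (z ^ (n + 1) - inverse z ^ (n + 1))"
    unfolding cheb.simps left_diff_distrib mult.assoc 3 by (simp flip: Suc_eq_plus1)
  also have "\<dots> = z ^ (n + 3) - inverse z ^ (n + 3)"
  proof -
    have 1: "z * inverse z ^ (n + 2) = inverse z ^ (n + 1)" "inverse z * z ^ (n + 2) = z ^ (n + 1)"
      using z by (simp_all add: power_add field_simps)
    have "(z + inverse z) * (z ^ (n + 2) - inverse z ^ (n + 2)) =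
        z * z ^ (n + 2) + inverse z * z ^ (n + 2) - z * inverse z ^ (n + 2) - inverse z * inverse z ^ (n + 2)"
      by (simp only: algebra_simps)
    moreover have "z * z ^ (n + 2) = z ^ (n + 3)" "inverse z * inverse z ^ (n + 2) = inverse z ^ (n + 3)"
      by (simp_all add: power_add numeral_3_eq_3)
    ultimately show ?thesis unfolding 1 by simp
  qed
  finally show ?case by (simp add: numeral_3_eq_3 flip: Suc_eq_plus1)
qed (simp_all add: power2_eq_square algebra_simps)

lemma cheb_unit:
  assumes z: "z * z = 1"
  shows "cheb (2 * z) n = of_nat (n + 1) * z ^ n"
proof (induction "2 * z" n rule: cheb.induct)
  case (3 n)
  have z2: "z * (z * x) = x" for x using z by (simp add: mult.assoc[symmetric])
  from 3 show ?case by (simp add: algebra_simps z2)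
qed simp_all

lemma cheb_zero:
  assumes "cheb s n = 0"
  obtains j l :: nat where "2 \<le> l" "j \<in> {1..l - 1}" "s\<^sup>2 = complex_of_real (4 * (cos (real j * pi / real l))\<^sup>2)"
proof -
  \<comment> \<open>A root of \<open>z^2 - s z + 1 = 0\<close>, so that
    \<open>s = z + 1/z\<close>.\<close>
  define z where "z = (s + csqrt (s\<^sup>2 - 4)) / 2"
  have "2 * z = s + csqrt (s\<^sup>2 - 4)" unfolding z_def by (simp add: field_simps)
  then have "(2 * z - s)\<^sup>2 = s\<^sup>2 - 4" by simp
  then have "4 * (z * (s - z)) = 4" by (simp add: power2_eq_square algebra_simps)
  then have zs: "z * (s - z) = 1" by simp
  then have z: "z \<noteq> 0" "inverse z = s - z" by (auto simp: inverse_unique)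
  then have s: "s = z + inverse z" by simp
  have n: "n \<noteq> 0" using assms by (cases n) auto
  have zz: "z * z \<noteq> 1"
  proof
    assume "z * z = 1"
    then have "inverse z = z" by (rule inverse_unique)
    then have "cheb (2 * z) n = 0" using assms s by simp
    moreover have "complex_of_nat (n + 1) \<noteq> 0" using of_nat_neq_0[of n, where ?'a = complex] unfolding Suc_eq_plus1 .
    moreover have "z ^ n \<noteq> 0" using z(1) by simp
    ultimately show False unfolding cheb_unit[OF \<open>z * z = 1\<close>] by (simp only: mult_eq_0_iff) simp
  qed
  \<comment> \<open>Only \<open>s^2\<close> is wanted, and \<open>s^2 = w + 1/w + 2\<close>. The
    zero of \<open>cheb\<close> makes \<open>w\<close> an \<open>(n + 1)\<close>-st root of unity,
    different from 1 by \<open>zz\<close>; hence \<open>l = n + 1\<close> and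
    \<open>j \<noteq> 0\<close>.\<close>
  define w where "w = z * z"
  have eq: "z ^ (n + 1) = inverse z ^ (n + 1)" using cheb_power[OF z(1), of n] assms unfolding s[symmetric] by simp
  have "w ^ (n + 1) = z ^ (n + 1) * z ^ (n + 1)" unfolding w_def power_mult_distrib ..
  also have "\<dots> = inverse z ^ (n + 1) * z ^ (n + 1)" by (rule arg_cong[OF eq, of "\<lambda>x. x * z ^ (n + 1)"])
  also have "\<dots> = (inverse z * z) ^ (n + 1)" by (simp only: power_mult_distrib)
  finally have w: "w ^ (n + 1) = 1" using z(1) by simp
  have "bij_betw (\<lambda>k. cis (2 * pi * real k / real (n + 1))) {..<n + 1} {w. w ^ (n + 1) = 1}"
    by (rule bij_betw_roots_unity) simp
  then obtain j where j: "j < n + 1" "w = cis (2 * pi * real j / real (n + 1))"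
    using w unfolding bij_betw_def by blast
  have "j \<noteq> 0" using j(2) zz unfolding w_def by (intro notI) simp
  let ?x = "real j * pi / real (n + 1)"
  have w': "w = cis (2 * ?x)" using j(2) by (simp add: mult.commute mult.left_commute)
  have "s\<^sup>2 = w + inverse w + 2" unfolding s w_def using z(1) by (simp add: power2_eq_square field_simps)
  also have "w + inverse w = complex_of_real (2 * cos (2 * ?x))" unfolding w' by (simp add: complex_eq_iff)
  also have "cos (2 * ?x) = 2 * (cos ?x)\<^sup>2 - 1" by (rule cos_double_cos)
  also have "complex_of_real (2 * (2 * c - 1)) + 2 = complex_of_real (4 * c)" for c by (simp add: algebra_simps)
  finally show ?thesis using that[of "n + 1" j] j(1) \<open>j \<noteq> 0\<close> n by simp
qed

subsection \<open>The fattened Jones--Wenzl idempotents\<close>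

lemma id_not_reducible: "\<not> reducible k (id_diagram k)"
  unfolding reducible_def
proof (intro notI, elim disjE exE conjE)
  fix i assume i: "1 \<le> i" "i \<le> k" and a: "\<forall>x. same (id_diagram k) x (Lower i) \<longrightarrow> x = Lower i"
  have "same (id_diagram k) (Upper i) (Lower i)" using i by (simp add: id_diagram_kerp)
  then have "Upper i = Lower i" using a by blast
  then show False by simp
qed (simp add: id_diagram_kerp)

text \<open>A pair of neighbouring lower points \<open>2n + 1\<close>, \<open>2n + 2\<close>
  corresponds to a lower singleton of the fattening, a pair \<open>2n\<close>, \<open>2n + 1\<close>
  to two neighbouring lower points in one block. Pairings have no singletons, so these are all
  cases.\<close>

lemma fatten_reducible:
  assumes d: "d \<in> NC2 (2 * k) (2 * k)"
  shows "reducible k (fatten k d) \<longleftrightarrow> reducible (2 * k) d"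
proof
  note m = NC2_matching[OF d]
  have lower: "same d (Lower i) (Lower (i + 1))" if "1 \<le> i" "i < 2 * k" "mate d (Lower (i + 1)) = Lower i" for i
    using same_mate[OF m, of "Lower (i + 1)" "Lower i"] that by (auto intro: same_sym)
  {
    assume "reducible k (fatten k d)"
    then consider i where "1 \<le> i" "i \<le> k" "\<forall>x. same (fatten k d) x (Lower i) \<longrightarrow> x = Lower i"
      | i where "1 \<le> i" "i < k" "same (fatten k d) (Lower i) (Lower (i + 1))"
      unfolding reducible_def by blast
    then show "reducible (2 * k) d"
    proof cases
      case (1 i)
      define n where "n = i - 1"
      have n: "n < k" "i = n + 1" using 1(1,2) by (auto simp: n_def)
      have "mate d (Lower (2 * n + 2)) = Lower (2 * n + 1)"
        using fatten_isolate(2)[OF d isolate_lower(1)[OF n(1)], unfolded isolate_lower(2)[OF n(1)]] 1(3) n(2) by blast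
      then show ?thesis by (intro reducibleI(2)[OF _ _ lower, of "2 * n + 1"]) (use n in simp_all)
    next
      case (2 i)
      have "same (fatten k d) (Lower (i + 1)) (Lower i)" using 2(3) by (rule same_sym)
      then have "mate d (Lower (2 * i + 1)) = Lower (2 * i)"
        using fatten_merge(2)[OF d merge_lower[OF 2(1,2)]] by (simp flip: Suc_eq_plus1)
      then show ?thesis by (intro reducibleI(2)[OF _ _ lower, of "2 * i"]) (use 2 in simp_all)
    qed
  }
  {
    assume "reducible (2 * k) d"
    then consider i where "1 \<le> i" "i \<le> 2 * k" "\<forall>x. same d x (Lower i) \<longrightarrow> x = Lower i"
      | i where "1 \<le> i" "i < 2 * k" "same d (Lower i) (Lower (i + 1))"
      unfolding reducible_def by blast
    then show "reducible k (fatten k d)"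
    proof cases
      case (1 i)
      then have l: "Lower i \<in> points (2 * k) (2 * k)" by simp
      have "same d (mate d (Lower i)) (Lower i)" using same_mate[OF m l, of "mate d (Lower i)"] same_sym[of d] by blast
      then have "mate d (Lower i) = Lower i" using 1(3) by blast
      then show ?thesis using mate_ne[OF m l] by simp
    next
      case (2 i)
      have l: "Lower (i + 1) \<in> points (2 * k) (2 * k)" using 2 by simp
      have mt: "mate d (Lower (i + 1)) = Lower i" by (rule mate_eqI[OF m same_sym[OF 2(3)]]) simp
      show ?thesis
      proof (cases "even i")
        case True
        then obtain n where n: "i = 2 * n" by (elim evenE)
        have "1 \<le> n" "n < k" using 2 n by auto
        then have "same (fatten k d) (Lower (n + 1)) (Lower n)"
          using fatten_merge(2)[OF d merge_lower[of n k]] mt unfolding n by (simp flip: Suc_eq_plus1)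
        then show ?thesis by (rule reducibleI(2)[OF \<open>1 \<le> n\<close> \<open>n < k\<close> same_sym])
      next
        case False
        then obtain n where n: "i = 2 * n + 1" by (elim oddE)
        have nk: "n < k" using 2 n by auto
        have e: "2 * n + 1 + 1 = 2 * n + 2" by simp
        show ?thesis
        proof (rule reducibleI(1)[of "n + 1"])
          fix x assume "same (fatten k d) x (Lower (n + 1))"
          then show "x = Lower (n + 1)"
            using fatten_isolate(2)[OF d isolate_lower(1)[OF nk], unfolded isolate_lower(2)[OF nk]] mt
            unfolding n e by blast
        qed (use nk in simp_all)
      qed
    qed
  }
qed

text \<open>Irreducibility passes between \<open>d\<close> and its fattening, and on both sides it
  characterises the identity.\<close>

lemma fatten_eq_id:
  assumes d: "d \<in> NC2 (2 * k) (2 * k)"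
  shows "fatten k d = id_diagram k \<longleftrightarrow> d = id_diagram (2 * k)"
proof
  assume "fatten k d = id_diagram k"
  then have "\<not> reducible (2 * k) d" using fatten_reducible[OF d] id_not_reducible by metis
  then show "d = id_diagram (2 * k)" using irreducible_id[OF NC2_NC[OF d]] by simp
next
  assume "d = id_diagram (2 * k)"
  then have "\<not> reducible k (fatten k d)" using fatten_reducible[OF d] id_not_reducible by metis
  then show "fatten k d = id_diagram k" using irreducible_id[OF fatten_NC] by simp
qed

lemma card_id_diagram: "card (id_diagram k) = k"
  unfolding id_diagram_def by (subst card_image) (auto simp: inj_on_def)

text \<open>Only the identity fattens to the identity, and its weight is
  \<open>s^k / s^k = 1\<close>.\<close>

lemma lookup_fattening_map_id:
  assumes s: "s \<noteq> 0" and x: "x \<in> Hom0 NC2 (2 * k) (2 * k)"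
  shows "Poly_Mapping.lookup (fattening_map s k x) (id_diagram k) = Poly_Mapping.lookup x (id_diagram (2 * k))"
  using x
proof (induction rule: Hom0_induct)
  case (basis d)
  show ?case
  proof (cases "d = id_diagram (2 * k)")
    case True
    have "fatten k d = id_diagram k" using fatten_eq_id[OF basis] True by blast
    then show ?thesis
      unfolding fattening_map_basis[OF s basis] using True s by (simp add: lookup_basis weight_def card_id_diagram)
  next
    case False
    then show ?thesis
      unfolding fattening_map_basis[OF s basis] using fatten_eq_id[OF basis] by (simp add: lookup_basis)
  qed
qed (simp_all add: lookup_add)

text \<open>The scalar \<open>t\<close> in the first alternative is the loop formed by two
  singletons facing each other.\<close>

lemma reducible_comp0:
  assumes t: "t \<noteq> 0" and p: "p \<in> NC j k" and r: "reducible k p"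
  obtains i where "1 \<le> i" "i \<le> k" "smult t (basis p) = comp0 t (basis (sdiag k i)) (basis p)"
  | i where "1 \<le> i" "i < k" "basis p = comp0 t (basis (mdiag k i)) (basis p)"
proof -
  consider i where "1 \<le> i" "i \<le> k" "\<forall>x. same p x (Lower i) \<longrightarrow> x = Lower i"
      | i where "1 \<le> i" "i < k" "same p (Lower i) (Lower (i + 1))"
    using r unfolding reducible_def by blast
  then show ?thesis
  proof cases
    case (1 i)
    note a = composite_S_absorb[OF NC_Part[OF p] 1(1,2) 1(3)[rule_format]]
    show ?thesis by (rule that(1)[OF 1(1,2)]) (simp add: comp0_basis a)
  next
    case (2 i)
    show ?thesis
      by (rule that(2)[OF 2(1,2)])
        (simp add: comp0_basis composite_M_absorb[OF NC_Part[OF p] 2] loops_M[OF NC_Part[OF p] 2(1,2)])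
  qed
qed

text \<open>After reflection the diagram absorbs a generator on the side facing the fattened
  element. There the generator is moved inside the fattening map, where it kills
  \<open>x\<close>.\<close>

lemma fattening_map_kill:
  assumes s: "s \<noteq> 0" and x: "x \<in> Hom0 NC2 (2 * k) (2 * k)"
    and u: "\<And>i. 1 \<le> i \<Longrightarrow> i < 2 * k \<Longrightarrow> comp0 s (ulin (2 * k) i) x = 0"
    and p: "p \<in> NC j k" and r: "reducible k p"
  shows "comp0 (s\<^sup>2) (basis (flipd p)) (fattening_map s k x) = 0"
proof -
  have t: "s\<^sup>2 \<noteq> 0" using s by simp
  let ?G = "fattening_map s k x" and ?q = "basis (flipd p)"
  have G: "?G \<in> Hom0 NC k k" by (rule fattening_map_NC[OF s x])
  have P: "basis p \<in> Hom0 NC j k" "?q \<in> Hom0 NC k j" using p flipd_NC[OF p] by simp_all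
  have S: "comp0 (s\<^sup>2) (basis (sdiag k i)) ?G = 0" if i: "1 \<le> i" "i \<le> k" for i
  proof -
    obtain m where m: "i = m + 1" "m < k" using i by (metis Suc_eq_plus1 Suc_le_lessD le_add_diff_inverse2)
    have "comp0 s (ulin (2 * k) (2 * m + 1)) x = 0" using m by (intro u) auto
    then show ?thesis unfolding m(1) fattening_map_S[OF s m(2) x] by simp
  qed
  have M: "comp0 (s\<^sup>2) (basis (mdiag k i)) ?G = 0" if i: "1 \<le> i" "i < k" for i
  proof -
    have "comp0 s (ulin (2 * k) (2 * i)) x = 0" using i by (intro u) auto
    then have "smult s (comp0 (s\<^sup>2) (basis (mdiag k i)) ?G) = 0" unfolding fattening_map_M[OF s i x] by simp
    then show ?thesis using s by simp
  qed
  show ?thesis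
  proof (rule reducible_comp0[OF t p r])
    fix i assume i: "1 \<le> i" "i \<le> k" and e: "smult (s\<^sup>2) (basis p) = comp0 (s\<^sup>2) (basis (sdiag k i)) (basis p)"
    have Si: "basis (sdiag k i) \<in> Hom0 NC k k" by (simp add: sdiag_NC)
    have "smult (s\<^sup>2) ?q = comp0 (s\<^sup>2) ?q (basis (sdiag k i))"
      using arg_cong[OF e, of flip0] flip0_comp0[OF Si P(1)] by simp
    then have "smult (s\<^sup>2) (comp0 (s\<^sup>2) ?q ?G) = comp0 (s\<^sup>2) (comp0 (s\<^sup>2) ?q (basis (sdiag k i))) ?G"
      by (metis comp0_smult_left)
    also have "\<dots> = 0" unfolding comp0_assoc[OF P(2) Si G] S[OF i] by simp
    finally show ?thesis using t by simp
  next
    fix i assume i: "1 \<le> i" "i < k" and e: "basis p = comp0 (s\<^sup>2) (basis (mdiag k i)) (basis p)"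
    have Mi: "basis (mdiag k i) \<in> Hom0 NC k k" by (simp add: mdiag_NC)
    have "?q = comp0 (s\<^sup>2) ?q (basis (mdiag k i))"
      using arg_cong[OF e, of flip0] flip0_comp0[OF Mi P(1)] by simp
    then have "comp0 (s\<^sup>2) ?q ?G = comp0 (s\<^sup>2) (comp0 (s\<^sup>2) ?q (basis (mdiag k i))) ?G" by metis
    also have "\<dots> = 0" unfolding comp0_assoc[OF P(2) Mi G] M[OF i] by simp
    finally show ?thesis .
  qed
qed

definition fat_jw :: "complex \<Rightarrow> nat \<Rightarrow> lin" where
  "fat_jw s k = fattening_map s k (jones_wenzl s (2 * k))"

text \<open>The morphisms from \<open>[k]\<close> to \<open>[l]\<close> that are sums of
  compositions over the \<open>E_j\<close>, for all \<open>j\<close> together. They form an ideal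
  (\<open>through_left\<close>, \<open>through_right\<close>).\<close>

inductive_set through :: "complex \<Rightarrow> nat \<Rightarrow> nat \<Rightarrow> lin set" for s k l where
  base: "a \<in> Hom0 NC j l \<Longrightarrow> b \<in> Hom0 NC k j \<Longrightarrow> comp0 (s\<^sup>2) a (comp0 (s\<^sup>2) (fat_jw s j) b) \<in> through s k l"
| zero: "0 \<in> through s k l"
| add: "x \<in> through s k l \<Longrightarrow> y \<in> through s k l \<Longrightarrow> x + y \<in> through s k l"

context
  fixes s :: complex
  assumes cheb_nz: "\<And>n. cheb s n \<noteq> 0"
begin

lemma s_nz: "s \<noteq> 0" using cheb_nz[of 1] by (simp add: One_nat_def)

lemma jw_coeff_nz: "1 \<le> k \<Longrightarrow> s - jw_coeff s k \<noteq> 0"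
  using cheb_jw_coeff[OF cheb_nz, of "k - 1"] cheb_nz by simp

lemmas JW_NC2 = jones_wenzl_NC2[OF jw_coeff_nz]

lemma fat_jw_NC: "fat_jw s k \<in> Hom0 NC k k"
  unfolding fat_jw_def by (rule fattening_map_NC[OF s_nz JW_NC2])

lemma lookup_fat_jw: "Poly_Mapping.lookup (fat_jw s k) (id_diagram k) = 1"
  using lookup_fattening_map_id[OF s_nz JW_NC2, of k] lookup_jones_wenzl[OF jw_coeff_nz, of "2 * k"]
  by (simp add: fat_jw_def)

lemma fat_jw_nz: "fat_jw s k \<noteq> 0"
proof
  assume "fat_jw s k = 0"
  then show False using lookup_fat_jw[of k] by simp
qed

lemma fat_jw_reducible:
  assumes p: "p \<in> NC j k" and r: "reducible k p"
  shows "comp0 (s\<^sup>2) (basis (flipd p)) (fat_jw s k) = 0" "comp0 (s\<^sup>2) (fat_jw s k) (basis p) = 0"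
proof -
  let ?J = "jones_wenzl s (2 * k)"
  show "comp0 (s\<^sup>2) (basis (flipd p)) (fat_jw s k) = 0"
    unfolding fat_jw_def
    by (rule fattening_map_kill[OF s_nz JW_NC2 jones_wenzl_ulin(1)[OF jw_coeff_nz] p r])
  have "comp0 (s\<^sup>2) (basis (flipd p)) (fattening_map s k (flip0 ?J)) = 0"
  proof (rule fattening_map_kill[OF s_nz flip0_NC2[OF JW_NC2] _ p r])
    fix i assume i: "1 \<le> i" "i < 2 * k"
    have "flip0 (comp0 s ?J (ulin (2 * k) i)) = comp0 s (ulin (2 * k) i) (flip0 ?J)"
      using flip0_comp0[OF NC2_sub[OF JW_NC2] ulin_NC, of s "2 * k" i] by (simp add: ulin_def)
    then show "comp0 s (ulin (2 * k) i) (flip0 ?J) = 0" using jones_wenzl_ulin(2)[OF jw_coeff_nz i] by simp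
  qed
  then have "flip0 (comp0 (s\<^sup>2) (basis (flipd p)) (flip0 (fat_jw s k))) = 0"
    unfolding fattening_map_flip0 fat_jw_def by simp
  then show "comp0 (s\<^sup>2) (fat_jw s k) (basis p) = 0"
    using flip0_comp0[of "basis (flipd p)" k j "flip0 (fat_jw s k)" k "s\<^sup>2"] flip0_NC[OF fat_jw_NC[of k]] flipd_NC[OF p]
    by simp
qed

text \<open>By \<open>irreducible_id\<close> every diagram from at most \<open>k\<close> upper to
  \<open>k\<close> lower points other than the identity is reducible and therefore killed, so only
  the identity coefficient of \<open>x\<close> counts.\<close>

lemma fat_jw_absorb:
  assumes x: "x \<in> Hom0 NC j k" and "j \<le> k"
  shows "comp0 (s\<^sup>2) (fat_jw s k) x = (if j = k then smult (Poly_Mapping.lookup x (id_diagram k)) (fat_jw s k) else 0)"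
  using x
proof (induction rule: Hom0_induct)
  case (basis p)
  show ?case
  proof (cases "reducible k p")
    case True
    then have "p \<noteq> id_diagram k" using id_not_reducible by metis
    then show ?thesis using fat_jw_reducible(2)[OF basis True] by (simp add: lookup_basis)
  next
    case False
    from irreducible_id[OF basis False \<open>j \<le> k\<close>] have "j = k" "p = id_diagram k" by simp_all
    then show ?thesis using comp0_id_right[OF fat_jw_NC] by (simp add: lookup_basis id0_def)
  qed
qed (simp_all add: comp0_add_right comp0_smult_right lookup_add lin.scale_left_distrib)

lemma fat_jw_absorb_right:
  assumes x: "x \<in> Hom0 NC k j" and "j < k"
  shows "comp0 (s\<^sup>2) x (fat_jw s k) = 0"
  using x
proof (induction rule: Hom0_induct)
  case (basis p)
  have f: "flipd p \<in> NC j k" by (rule flipd_NC[OF basis])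
  have "reducible k (flipd p)" using irreducible_id[OF f] \<open>j < k\<close> by force
  then show ?case using fat_jw_reducible(1)[OF f] by simp
qed (simp_all add: comp0_add_left comp0_smult_left)

lemma fat_jw_idem: "comp0 (s\<^sup>2) (fat_jw s k) (fat_jw s k) = fat_jw s k"
  using fat_jw_absorb[OF fat_jw_NC[of k]] by (simp add: lookup_fat_jw)

text \<open>Schur's lemma for the images of the \<open>E_k\<close>: annihilation from one side
  settles \<open>j < k\<close>, from the other side \<open>j > k\<close>.\<close>

lemma fat_jw_sandwich:
  assumes x: "x \<in> Hom0 NC j k"
  shows "j \<noteq> k \<Longrightarrow> comp0 (s\<^sup>2) (fat_jw s k) (comp0 (s\<^sup>2) x (fat_jw s j)) = 0"
    and "j = k \<Longrightarrow> comp0 (s\<^sup>2) (fat_jw s k) (comp0 (s\<^sup>2) x (fat_jw s j)) = smult (Poly_Mapping.lookup x (id_diagram k)) (fat_jw s k)"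
proof -
  note as = comp0_assoc[OF fat_jw_NC x fat_jw_NC]
  show "comp0 (s\<^sup>2) (fat_jw s k) (comp0 (s\<^sup>2) x (fat_jw s j)) = 0" if "j \<noteq> k"
  proof (cases "j < k")
    case True
    then show ?thesis unfolding as[symmetric] using fat_jw_absorb[OF x] by simp
  next
    case False
    then have "k < j" using that by simp
    show ?thesis unfolding fat_jw_absorb_right[OF x \<open>k < j\<close>] by simp
  qed
  show "comp0 (s\<^sup>2) (fat_jw s k) (comp0 (s\<^sup>2) x (fat_jw s j)) = smult (Poly_Mapping.lookup x (id_diagram k)) (fat_jw s k)" if "j = k"
    unfolding as[symmetric] using fat_jw_absorb[OF x] that by (simp add: comp0_smult_left fat_jw_idem)
qed

lemma through_left:
  assumes "x \<in> through s k l" "c \<in> Hom0 NC l m"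
  shows "comp0 (s\<^sup>2) c x \<in> through s k m"
  using assms(1)
proof (induction rule: through.induct)
  case (base a j b)
  have "comp0 (s\<^sup>2) (comp0 (s\<^sup>2) c a) (comp0 (s\<^sup>2) (fat_jw s j) b) \<in> through s k m"
    by (rule through.base[OF comp0_NC[OF assms(2) base(1)] base(2)])
  then show ?case unfolding comp0_assoc[OF assms(2) base(1) comp0_NC[OF fat_jw_NC base(2)]] .
qed (simp_all add: comp0_add_right through.zero through.add)

lemma through_right:
  assumes "x \<in> through s k l" "c \<in> Hom0 NC m k"
  shows "comp0 (s\<^sup>2) x c \<in> through s m l"
  using assms(1)
proof (induction rule: through.induct)
  case (base a j b)
  have "comp0 (s\<^sup>2) a (comp0 (s\<^sup>2) (fat_jw s j) (comp0 (s\<^sup>2) b c)) \<in> through s m l"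
    by (rule through.base[OF base(1) comp0_NC[OF base(2) assms(2)]])
  then show ?case
    unfolding comp0_assoc[OF fat_jw_NC base(2) assms(2), symmetric]
      comp0_assoc[OF base(1) comp0_NC[OF fat_jw_NC base(2)] assms(2), symmetric] .
qed (simp_all add: comp0_add_left through.zero through.add)

lemma through_smult: "x \<in> through s k l \<Longrightarrow> smult c x \<in> through s k l"
proof (induction rule: through.induct)
  case (base a j b)
  show ?case unfolding comp0_smult_left[symmetric] by (rule through.base[OF Hom0_smult[OF base(1)] base(2)])
qed (simp_all add: lin.scale_right_distrib through.zero through.add)

text \<open>The identity of \<open>[n]\<close>, which lies in the ideal, is inserted between the two
  factors of the diagram.\<close>

lemma through_factor:
  assumes g: "g \<in> NC n (n + 1)" "loops g (flipd g) = 0" and x: "x \<in> Hom0 NC k (n + 1)"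
    and i: "id0 n \<in> through s n n"
  shows "comp0 (s\<^sup>2) (basis (composite g (flipd g))) x \<in> through s k (n + 1)"
proof -
  have G: "basis g \<in> Hom0 NC n (n + 1)" "basis (flipd g) \<in> Hom0 NC (n + 1) n" using g flipd_NC[OF g(1)] by simp_all
  have y: "comp0 (s\<^sup>2) (basis (flipd g)) x \<in> Hom0 NC k n" by (rule comp0_NC[OF G(2) x])
  have "comp0 (s\<^sup>2) (id0 n) (comp0 (s\<^sup>2) (basis (flipd g)) x) \<in> through s k n" by (rule through_right[OF i y])
  then have "comp0 (s\<^sup>2) (basis g) (comp0 (s\<^sup>2) (basis (flipd g)) x) \<in> through s k (n + 1)"
    unfolding comp0_id_left[OF y] by (rule through_left[OF _ G(1)])
  then have "comp0 (s\<^sup>2) (comp0 (s\<^sup>2) (basis g) (basis (flipd g))) x \<in> through s k (n + 1)"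
    unfolding comp0_assoc[OF G x] .
  moreover have "comp0 (s\<^sup>2) (basis g) (basis (flipd g)) = basis (composite g (flipd g))"
    by (simp add: comp0_basis g(2))
  ultimately show ?thesis by simp
qed

lemma through_reducible:
  assumes i: "id0 n \<in> through s n n" and p: "p \<in> NC k (n + 1)" and r: "reducible (n + 1) p"
  shows "basis p \<in> through s k (n + 1)"
proof -
  have t: "s\<^sup>2 \<noteq> 0" using s_nz by simp
  have P: "basis p \<in> Hom0 NC k (n + 1)" using p by simp
  show ?thesis
  proof (rule reducible_comp0[OF t p r])
    fix m assume m: "1 \<le> m" "m \<le> n + 1" and e: "smult (s\<^sup>2) (basis p) = comp0 (s\<^sup>2) (basis (sdiag (n + 1) m)) (basis p)"
    have "comp0 (s\<^sup>2) (basis (sdiag (n + 1) m)) (basis p) \<in> through s k (n + 1)"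
      unfolding sdiag_factor(1)[OF m] by (rule through_factor[OF gdiag_NC sdiag_factor(2)[OF m] P i])
    then have "smult (inverse (s\<^sup>2)) (smult (s\<^sup>2) (basis p)) \<in> through s k (n + 1)" unfolding e by (rule through_smult)
    then show ?thesis using t by simp
  next
    fix m assume m: "1 \<le> m" "m < n + 1" and e: "basis p = comp0 (s\<^sup>2) (basis (mdiag (n + 1) m)) (basis p)"
    have m': "1 \<le> m" "m \<le> n" using m by auto
    have "comp0 (s\<^sup>2) (basis (mdiag (n + 1) m)) (basis p) \<in> through s k (n + 1)"
      unfolding mdiag_factor(1)[OF m'] by (rule through_factor[OF hdiag_NC mdiag_factor(2)[OF m'] P i])
    then show ?thesis unfolding e[symmetric] .
  qed
qed

text \<open>The identity has coefficient 1 in \<open>E_k\<close>, so \<open>1 - E_k\<close> is a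
  combination of the diagrams that are in the ideal by assumption.\<close>

lemma through_id_step:
  assumes b: "\<And>p. p \<in> NC k k \<Longrightarrow> p \<noteq> id_diagram k \<Longrightarrow> basis p \<in> through s k k"
  shows "id0 k \<in> through s k k"
proof -
  have F: "fat_jw s k \<in> through s k k"
    using through.base[OF id0_NC id0_NC, of s k] by (simp add: comp0_id_right[OF fat_jw_NC] comp0_id_left[OF fat_jw_NC])
  have S: "(\<Sum>p\<in>S. smult (c p) (basis p)) \<in> through s k k" if "finite S" "\<forall>p\<in>S. p \<in> NC k k \<and> p \<noteq> id_diagram k" for S c
    using that by (induction S rule: finite_induct) (simp_all add: through.zero through.add through_smult b)
  let ?d = "id0 k - fat_jw s k"
  have "?d \<in> Hom0 NC k k" by (intro Hom0_diff fat_jw_NC id0_NC)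
  moreover have "Poly_Mapping.lookup ?d (id_diagram k) = 0" by (simp add: lookup_minus lookup_fat_jw id0_def lookup_basis)
  ultimately have "\<forall>p\<in>Poly_Mapping.keys ?d. p \<in> NC k k \<and> p \<noteq> id_diagram k"
    unfolding Hom0_def by (auto simp: in_keys_iff)
  then have "?d \<in> through s k k"
    using S[of "Poly_Mapping.keys ?d" "Poly_Mapping.lookup ?d"] lin_expand[of ?d] by simp
  from through.add[OF F this] show ?thesis by simp
qed

lemma through_id: "id0 k \<in> through s k k"
proof (induction k)
  case 0
  have b: "basis p \<in> through s 0 0" if p: "p \<in> NC 0 0" "p \<noteq> id_diagram 0" for p
  proof -
    have "\<not> reducible 0 p" by (simp add: reducible_def)
    then show ?thesis using irreducible_id[OF p(1)] p(2) by simp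
  qed
  show ?case by (rule through_id_step[OF b])
next
  case (Suc n)
  have b: "basis p \<in> through s (n + 1) (n + 1)" if p: "p \<in> NC (n + 1) (n + 1)" "p \<noteq> id_diagram (n + 1)" for p
  proof (rule through_reducible[OF Suc p(1)])
    show "reducible (n + 1) p" using irreducible_id[OF p(1)] p(2) by blast
  qed
  show ?case unfolding Suc_eq_plus1 by (rule through_id_step[OF b])
qed

lemma Hom0_through: "x \<in> Hom0 NC k l \<Longrightarrow> x \<in> through s k l"
  using through_right[OF through_id[of l], of x k] by (simp add: comp0_id_left)

end

subsection \<open>Matrices\<close>

definition mat_smult :: "complex \<Rightarrow> mat \<Rightarrow> mat" where
  "mat_smult c M = (\<lambda>a b. smult c (M a b))"

definition mat_diff :: "mat \<Rightarrow> mat \<Rightarrow> mat" where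
  "mat_diff M N = (\<lambda>a b. M a b - N a b)"

definition elem :: "nat \<Rightarrow> nat \<Rightarrow> lin \<Rightarrow> mat" where
  "elem j i x = (\<lambda>a b. if a = j \<and> b = i then x else 0)"

lemma mat_eqI: "(\<And>a b. M a b = N a b) \<Longrightarrow> M = (N :: mat)"
  by (intro ext)

lemma image_obj_elem: "image_obj k x = ([k], elem 0 0 x)"
  by (simp add: image_obj_def elem_def)

lemma mat_comp_add:
  "mat_comp t ls (mat_add N N') M = mat_add (mat_comp t ls N M) (mat_comp t ls N' M)"
  "mat_comp t ls N (mat_add M M') = mat_add (mat_comp t ls N M) (mat_comp t ls N M')"
  by (simp_all add: mat_comp_def mat_add_def comp0_add_left comp0_add_right sum.distrib)

lemma mat_comp_diff:
  "mat_comp t ls (mat_diff N N') M = mat_diff (mat_comp t ls N M) (mat_comp t ls N' M)"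
  "mat_comp t ls N (mat_diff M M') = mat_diff (mat_comp t ls N M) (mat_comp t ls N M')"
  by (simp_all add: mat_comp_def mat_diff_def comp0_diff_left comp0_diff_right sum_subtractf)

lemma mat_comp_smult:
  "mat_comp t ls (mat_smult c N) M = mat_smult c (mat_comp t ls N M)"
  "mat_comp t ls N (mat_smult c M) = mat_smult c (mat_comp t ls N M)"
  by (simp_all add: mat_comp_def mat_smult_def comp0_smult_left comp0_smult_right lin.scale_sum_right)

lemma mat_comp_zero [simp]:
  "mat_comp t ls mat_zero M = mat_zero" "mat_comp t ls N mat_zero = mat_zero"
  by (simp_all add: mat_comp_def mat_zero_def)

lemma mat_add_zero [simp]: "mat_add mat_zero M = M" "mat_add M mat_zero = M"
  by (simp_all add: mat_add_def mat_zero_def)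

lemma mat_diff_self [simp]: "mat_diff M M = mat_zero" "mat_diff M mat_zero = M"
  by (simp_all add: mat_diff_def mat_zero_def)

lemma mat_diff_add [simp]: "mat_add M (mat_diff N M) = N"
  by (simp add: mat_diff_def mat_add_def)

lemma mat_diff_eq_zero: "mat_diff M N = mat_zero \<longleftrightarrow> M = N"
  by (auto simp: mat_diff_def mat_zero_def fun_eq_iff)

lemma mat_smult_simps [simp]:
  "mat_smult c mat_zero = mat_zero" "mat_smult 0 M = mat_zero" "mat_smult 1 M = M"
  "mat_smult c (mat_smult d M) = mat_smult (c * d) M"
  by (simp_all add: mat_smult_def mat_zero_def)

lemma mat_smult_cancel:
  assumes "mat_smult c M = mat_smult d M" "M \<noteq> mat_zero"
  shows "c = d"
proof -
  obtain a b where "M a b \<noteq> 0" using assms(2) by (auto simp: mat_zero_def fun_eq_iff)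
  moreover have "smult c (M a b) = smult d (M a b)" using fun_cong[OF fun_cong[OF assms(1)], of a b] by (simp add: mat_smult_def)
  ultimately show ?thesis by simp
qed

lemma mat_Hom_closed:
  "mat_zero \<in> mat_Hom C ks ls"
  "M \<in> mat_Hom C ks ls \<Longrightarrow> N \<in> mat_Hom C ks ls \<Longrightarrow> mat_add M N \<in> mat_Hom C ks ls"
  "M \<in> mat_Hom C ks ls \<Longrightarrow> N \<in> mat_Hom C ks ls \<Longrightarrow> mat_diff M N \<in> mat_Hom C ks ls"
  "M \<in> mat_Hom C ks ls \<Longrightarrow> mat_smult c M \<in> mat_Hom C ks ls"
  by (auto simp: mat_Hom_def mat_zero_def mat_add_def mat_diff_def mat_smult_def Hom0_add Hom0_diff Hom0_smult)

lemma mat_Hom_entry: "M \<in> mat_Hom C ks ls \<Longrightarrow> j < length ls \<Longrightarrow> i < length ks \<Longrightarrow> M j i \<in> Hom0 C (ks ! i) (ls ! j)"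
  by (auto simp: mat_Hom_def split: if_splits)

lemma mat_Hom_outside: "M \<in> mat_Hom C ks ls \<Longrightarrow> \<not> (j < length ls \<and> i < length ks) \<Longrightarrow> M j i = 0"
  unfolding mat_Hom_def by (drule CollectD, drule spec[of _ j], drule spec[of _ i]) (simp split: if_splits)

lemma mat_comp_Hom:
  assumes N: "N \<in> mat_Hom NC ls ms" and M: "M \<in> mat_Hom NC ks ls"
  shows "mat_comp t ls N M \<in> mat_Hom NC ks ms"
proof -
  have "mat_comp t ls N M j i = 0" if "\<not> (j < length ms \<and> i < length ks)" for j i
    unfolding mat_comp_def
  proof (rule sum.neutral, rule ballI)
    fix b
    have "N j b = 0 \<or> M b i = 0" using that mat_Hom_outside[OF N, of j b] mat_Hom_outside[OF M, of b i] by blast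
    then show "comp0 t (N j b) (M b i) = 0" by auto
  qed
  moreover have "mat_comp t ls N M j i \<in> Hom0 NC (ks ! i) (ms ! j)" if "j < length ms" "i < length ks" for j i
    unfolding mat_comp_def
    by (rule Hom0_sum, rule comp0_NC[OF mat_Hom_entry[OF N that(1)] mat_Hom_entry[OF M _ that(2)]]) simp_all
  ultimately show ?thesis by (simp add: mat_Hom_def)
qed

lemma mat_comp_assoc:
  assumes L: "L \<in> mat_Hom NC ms ns" and N: "N \<in> mat_Hom NC ls ms" and M: "M \<in> mat_Hom NC ks ls"
  shows "mat_comp t ls (mat_comp t ms L N) M = mat_comp t ms L (mat_comp t ls N M)"
proof (rule mat_eqI)
  fix a d
  show "mat_comp t ls (mat_comp t ms L N) M a d = mat_comp t ms L (mat_comp t ls N M) a d"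
  proof (cases "a < length ns \<and> d < length ks")
    case True
    have "mat_comp t ls (mat_comp t ms L N) M a d = (\<Sum>c<length ls. \<Sum>b<length ms. comp0 t (comp0 t (L a b) (N b c)) (M c d))"
      by (simp add: mat_comp_def comp0_sum_left)
    also have "\<dots> = (\<Sum>c<length ls. \<Sum>b<length ms. comp0 t (L a b) (comp0 t (N b c) (M c d)))"
      by (intro sum.cong refl comp0_assoc[OF mat_Hom_entry[OF L] mat_Hom_entry[OF N] mat_Hom_entry[OF M]])
        (use True in simp_all)
    also have "\<dots> = (\<Sum>b<length ms. \<Sum>c<length ls. comp0 t (L a b) (comp0 t (N b c) (M c d)))" by (rule sum.swap)
    finally show ?thesis by (simp add: mat_comp_def comp0_sum_right)
  next
    case False
    then show ?thesis
      using mat_Hom_outside[OF mat_comp_Hom[OF mat_comp_Hom[OF L N] M]]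
        mat_Hom_outside[OF mat_comp_Hom[OF L mat_comp_Hom[OF N M]]] by metis
  qed
qed

lemma elem_Hom: "j < length ls \<Longrightarrow> i < length ks \<Longrightarrow> x \<in> Hom0 C (ks ! i) (ls ! j) \<Longrightarrow> elem j i x \<in> mat_Hom C ks ls"
  by (auto simp: mat_Hom_def elem_def)

lemma elem_comp: "mat_comp t [k] (elem j 0 x) (elem 0 i y) = elem j i (comp0 t x y)"
  by (rule mat_eqI) (simp add: mat_comp_def elem_def)

lemma elem_simps:
  "elem j i 0 = mat_zero" "elem j i (x + y) = mat_add (elem j i x) (elem j i y)" "elem j i (smult c x) = mat_smult c (elem j i x)"
  by (auto simp: elem_def mat_zero_def mat_add_def mat_smult_def fun_eq_iff)

lemma mat_Hom_single:
  assumes "M \<in> mat_Hom C [k] [l]"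
  obtains x where "x \<in> Hom0 C k l" "M = elem 0 0 x"
proof (rule that[of "M 0 0"])
  show "M 0 0 \<in> Hom0 C k l" using mat_Hom_entry[OF assms, of 0 0] by simp
  show "M = elem 0 0 (M 0 0)"
    by (rule mat_eqI) (use mat_Hom_outside[OF assms] in \<open>auto simp: elem_def\<close>)
qed

subsection \<open>The Karoubi envelope\<close>

lemma Obj_iff: "X \<in> Obj C t \<longleftrightarrow> snd X \<in> mat_Hom C (fst X) (fst X) \<and> mat_comp t (fst X) (snd X) (snd X) = snd X"
  by (cases X) (simp add: Obj_def)

lemma Hom_iff:
  assumes X: "X \<in> Obj NC t" and Y: "Y \<in> Obj NC t"
  shows "M \<in> Hom NC t X Y \<longleftrightarrow> M \<in> mat_Hom NC (fst X) (fst Y) \<and> mat_comp t (fst Y) (snd Y) M = M \<and> mat_comp t (fst X) M (snd X) = M"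
proof
  note X' = X[unfolded Obj_iff, THEN conjunct1] and Y' = Y[unfolded Obj_iff, THEN conjunct1]
  note X2 = X[unfolded Obj_iff, THEN conjunct2] and Y2 = Y[unfolded Obj_iff, THEN conjunct2]
  assume "M \<in> Hom NC t X Y"
  then obtain N where N: "N \<in> mat_Hom NC (fst X) (fst Y)"
    and M: "M = mat_comp t (fst Y) (snd Y) (mat_comp t (fst X) N (snd X))" by (auto simp: Hom_def)
  note NX = mat_comp_Hom[OF N X', of t]
  have "mat_comp t (fst Y) (snd Y) M = M"
    unfolding M mat_comp_assoc[OF Y' Y' NX, symmetric] Y2 ..
  moreover have "mat_comp t (fst X) M (snd X) = M"
    unfolding M mat_comp_assoc[OF Y' NX X'] mat_comp_assoc[OF N X' X'] X2 ..
  ultimately show "M \<in> mat_Hom NC (fst X) (fst Y) \<and> mat_comp t (fst Y) (snd Y) M = M \<and> mat_comp t (fst X) M (snd X) = M"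
    using mat_comp_Hom[OF Y' NX, of t] M by simp
next
  assume "M \<in> mat_Hom NC (fst X) (fst Y) \<and> mat_comp t (fst Y) (snd Y) M = M \<and> mat_comp t (fst X) M (snd X) = M"
  then show "M \<in> Hom NC t X Y" unfolding Hom_def by (intro image_eqI[of _ _ M]) simp_all
qed

context
  fixes t :: complex
begin

abbreviation "Ob \<equiv> Obj NC t"
abbreviation "Mor \<equiv> Hom NC t"

lemma ObD: "X \<in> Ob \<Longrightarrow> snd X \<in> mat_Hom NC (fst X) (fst X)" "X \<in> Ob \<Longrightarrow> mat_comp t (fst X) (snd X) (snd X) = snd X"
  by (simp_all add: Obj_iff)

lemma MorD:
  assumes "X \<in> Ob" "Y \<in> Ob" "M \<in> Mor X Y"
  shows "M \<in> mat_Hom NC (fst X) (fst Y)" "mat_comp t (fst Y) (snd Y) M = M" "mat_comp t (fst X) M (snd X) = M"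
  using assms by (simp_all add: Hom_iff)

lemma Mor_closed:
  assumes X: "X \<in> Ob" and Y: "Y \<in> Ob"
  shows "mat_zero \<in> Mor X Y"
    and "M \<in> Mor X Y \<Longrightarrow> N \<in> Mor X Y \<Longrightarrow> mat_diff M N \<in> Mor X Y"
    and "M \<in> Mor X Y \<Longrightarrow> mat_smult c M \<in> Mor X Y"
  by (simp_all add: Hom_iff[OF X Y] mat_Hom_closed mat_comp_diff mat_comp_smult)

lemma ident_Mor: "X \<in> Ob \<Longrightarrow> snd X \<in> Mor X X"
  by (simp add: Hom_iff Obj_iff)

lemma comp_assoc:
  assumes "X \<in> Ob" "Y \<in> Ob" "Z \<in> Ob" "W \<in> Ob" "f \<in> Mor X Y" "g \<in> Mor Y Z" "h \<in> Mor Z W"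
  shows "mat_comp t (fst Y) (mat_comp t (fst Z) h g) f = mat_comp t (fst Z) h (mat_comp t (fst Y) g f)"
  by (rule mat_comp_assoc[OF MorD(1)[OF assms(3,4,7)] MorD(1)[OF assms(2,3,6)] MorD(1)[OF assms(1,2,5)]])

lemma comp_Mor:
  assumes X: "X \<in> Ob" and Y: "Y \<in> Ob" and Z: "Z \<in> Ob" and f: "f \<in> Mor X Y" and g: "g \<in> Mor Y Z"
  shows "mat_comp t (fst Y) g f \<in> Mor X Z"
  unfolding Hom_iff[OF X Z]
proof (intro conjI)
  note as = mat_comp_assoc
  note F = MorD[OF X Y f] and G = MorD[OF Y Z g]
  show "mat_comp t (fst Y) g f \<in> mat_Hom NC (fst X) (fst Z)" by (rule mat_comp_Hom[OF G(1) F(1)])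
  show "mat_comp t (fst Z) (snd Z) (mat_comp t (fst Y) g f) = mat_comp t (fst Y) g f"
    unfolding as[OF ObD(1)[OF Z] G(1) F(1), symmetric] G(2) ..
  show "mat_comp t (fst X) (mat_comp t (fst Y) g f) (snd X) = mat_comp t (fst Y) g f"
    unfolding as[OF G(1) F(1) ObD(1)[OF X]] F(3) ..
qed

lemma zero_object_iff:
  assumes X: "X \<in> Ob" shows "zero_object NC t X \<longleftrightarrow> snd X = mat_zero"
proof
  assume "zero_object NC t X"
  then have "Mor X X = {mat_zero}" using X by (simp add: zero_object_def)
  then show "snd X = mat_zero" using ident_Mor[OF X] by simp
next
  assume z: "snd X = mat_zero"
  have "Mor X Y = {mat_zero}" "Mor Y X = {mat_zero}" if Y: "Y \<in> Ob" for Y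
  proof -
    have "f = mat_zero" if "f \<in> Mor X Y" for f using MorD(3)[OF X Y that] z by simp
    then show "Mor X Y = {mat_zero}" using Mor_closed(1)[OF X Y] by blast
    have "f = mat_zero" if "f \<in> Mor Y X" for f using MorD(2)[OF Y X that] z by simp
    then show "Mor Y X = {mat_zero}" using Mor_closed(1)[OF Y X] by blast
  qed
  then show "zero_object NC t X" using X by (simp add: zero_object_def)
qed

lemma iso_relI:
  assumes "X \<in> Ob" "Y \<in> Ob" "f \<in> Mor X Y" "g \<in> Mor Y X"
    "mat_comp t (fst Y) g f = snd X" "mat_comp t (fst X) f g = snd Y"
  shows "(X, Y) \<in> iso_rel NC t"
  using assms unfolding iso_rel_def comp_mor_def ident_def by blast

lemma iso_relE:
  assumes "(X, Y) \<in> iso_rel NC t"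
  obtains f g where "X \<in> Ob" "Y \<in> Ob" "f \<in> Mor X Y" "g \<in> Mor Y X"
    "mat_comp t (fst Y) g f = snd X" "mat_comp t (fst X) f g = snd Y"
  using assms unfolding iso_rel_def comp_mor_def ident_def by blast

lemma iso_refl: "X \<in> Ob \<Longrightarrow> (X, X) \<in> iso_rel NC t"
  by (rule iso_relI[where f = "snd X" and g = "snd X"]) (simp_all add: ident_Mor ObD(2))

lemma iso_sym: "(X, Y) \<in> iso_rel NC t \<Longrightarrow> (Y, X) \<in> iso_rel NC t"
  by (elim iso_relE, rule iso_relI)

lemma iso_trans:
  assumes "(X, Y) \<in> iso_rel NC t" "(Y, Z) \<in> iso_rel NC t"
  shows "(X, Z) \<in> iso_rel NC t"
proof -
  obtain f g where X: "X \<in> Ob" and Y: "Y \<in> Ob" and f: "f \<in> Mor X Y" and g: "g \<in> Mor Y X"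
    and fg: "mat_comp t (fst Y) g f = snd X" "mat_comp t (fst X) f g = snd Y" by (rule iso_relE[OF assms(1)])
  obtain f' g' where Z: "Z \<in> Ob" and f': "f' \<in> Mor Y Z" and g': "g' \<in> Mor Z Y"
    and fg': "mat_comp t (fst Z) g' f' = snd Y" "mat_comp t (fst Y) f' g' = snd Z" by (rule iso_relE[OF assms(2)])
  show ?thesis
  proof (rule iso_relI[OF X Z comp_Mor[OF X Y Z f f'] comp_Mor[OF Z Y X g' g]])
    show "mat_comp t (fst Z) (mat_comp t (fst Y) g g') (mat_comp t (fst Y) f' f) = snd X"
      unfolding comp_assoc[OF X Z Y X comp_Mor[OF X Y Z f f'] g' g] comp_assoc[OF X Y Z Y f f' g', symmetric]
        fg' MorD(2)[OF X Y f] fg ..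
    show "mat_comp t (fst X) (mat_comp t (fst Y) f' f) (mat_comp t (fst Y) g g') = snd Z"
      unfolding comp_assoc[OF Z X Y Z comp_Mor[OF Z Y X g' g] f f'] comp_assoc[OF Z Y X Y g' g f, symmetric]
        fg MorD(2)[OF Z Y g'] fg' ..
  qed
qed

lemma iso_class_eq:
  assumes "(X, Y) \<in> iso_rel NC t" shows "iso_class NC t X = iso_class NC t Y"
  unfolding iso_class_def using iso_trans[OF assms] iso_trans[OF iso_sym[OF assms]] by blast

text \<open>The idempotents belonging to two complementary summands are scalars, hence 0 or 1. Were
  both 1, the identity would be twice itself and \<open>X\<close> would vanish.\<close>

lemma simple_indecomposable:
  assumes X: "X \<in> Ob" and nz: "snd X \<noteq> mat_zero"
    and e: "\<And>f. f \<in> Mor X X \<Longrightarrow> \<exists>c. f = mat_smult c (snd X)"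
  shows "indecomposable NC t X"
proof -
  have split: "snd Y = mat_zero \<or> mat_comp t (fst Y) i p = snd X"
    if Y: "Y \<in> Ob" and i: "i \<in> Mor Y X" and p: "p \<in> Mor X Y" and pi: "mat_comp t (fst X) p i = snd Y" for Y i p
  proof -
    let ?e = "mat_comp t (fst Y) i p"
    obtain c where c: "?e = mat_smult c (snd X)" using e[OF comp_Mor[OF X Y X p i]] by blast
    have ep: "mat_comp t (fst X) ?e i = i"
      unfolding comp_assoc[OF Y X Y X i p i] pi MorD(3)[OF Y X i] ..
    have "mat_comp t (fst X) ?e ?e = ?e"
      unfolding comp_assoc[OF X Y X X p i comp_Mor[OF X Y X p i], symmetric] ep ..
    then have "mat_smult (c * c) (snd X) = mat_smult c (snd X)"
      unfolding c mat_comp_smult ObD(2)[OF X] by simp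
    then have "c * c = c" using nz by (rule mat_smult_cancel)
    then consider "c = 0" | "c = 1" by auto
    then show ?thesis
    proof cases
      case 1
      then have "i = mat_zero" using ep c by simp
      then show ?thesis using pi by simp
    qed (use c in simp)
  qed
  show ?thesis
    unfolding indecomposable_def
  proof (intro conjI allI impI X)
    fix Y Z assume "direct_sum NC t X Y Z"
    then obtain i j p q where Y: "Y \<in> Ob" and Z: "Z \<in> Ob" and ij: "i \<in> Mor Y X" "j \<in> Mor Z X"
      and pq: "p \<in> Mor X Y" "q \<in> Mor X Z"
      and id: "mat_comp t (fst X) p i = snd Y" "mat_comp t (fst X) q j = snd Z"
      and sm: "mat_add (mat_comp t (fst Y) i p) (mat_comp t (fst Z) j q) = snd X"
      unfolding direct_sum_def comp_mor_def ident_def by blast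
    have "snd Y = mat_zero \<or> snd Z = mat_zero"
    proof (rule ccontr)
      assume "\<not> ?thesis"
      then have "mat_comp t (fst Y) i p = snd X" "mat_comp t (fst Z) j q = snd X"
        using split[OF Y ij(1) pq(1) id(1)] split[OF Z ij(2) pq(2) id(2)] by blast+
      then have "snd X = mat_zero" using sm by (simp add: mat_add_def mat_zero_def fun_eq_iff)
      then show False using nz by simp
    qed
    then show "zero_object NC t Y \<or> zero_object NC t Z" using zero_object_iff Y Z by blast
  qed
qed

text \<open>\<open>f g\<close> is an idempotent whose complement cuts out a second summand.
  Indecomposability makes that summand zero, so \<open>f\<close> and \<open>g\<close> are inverse to
  each other.\<close>

lemma split_iso:
  assumes X: "X \<in> Ob" and Y: "Y \<in> Ob" and ind: "indecomposable NC t X" and nz: "snd Y \<noteq> mat_zero"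
    and f: "f \<in> Mor Y X" and g: "g \<in> Mor X Y" and gf: "mat_comp t (fst X) g f = snd Y"
  shows "(X, Y) \<in> iso_rel NC t"
proof -
  let ?e = "mat_comp t (fst Y) f g"
  define d where "d = mat_diff (snd X) ?e"
  have e: "?e \<in> Mor X X" by (rule comp_Mor[OF X Y X g f])
  note as = comp_assoc
  note I = ident_Mor[OF X]
  have ef: "mat_comp t (fst X) ?e f = f" unfolding as[OF Y X Y X f g f] gf MorD(3)[OF Y X f] ..
  have ge: "mat_comp t (fst X) g ?e = g" unfolding as[OF X Y X Y g f g, symmetric] gf MorD(2)[OF X Y g] ..
  have ee: "mat_comp t (fst X) ?e ?e = ?e" unfolding as[OF X Y X X g f e, symmetric] ef ..
  have dX: "d \<in> Mor X X" unfolding d_def by (rule Mor_closed(2)[OF X X I e])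
  have dd: "mat_comp t (fst X) d d = d"
    unfolding d_def mat_comp_diff ee ObD(2)[OF X] MorD(2,3)[OF X X e] by simp
  have df: "mat_comp t (fst X) d f = mat_zero" and gd: "mat_comp t (fst X) g d = mat_zero"
    unfolding d_def mat_comp_diff ef ge MorD(2)[OF Y X f] MorD(3)[OF X Y g] by simp_all
  \<comment> \<open>Idempotents split in the Karoubi envelope, so the complement \<open>d\<close> is
    itself an object; as a morphism \<open>d\<close> serves both as its inclusion and as its
    projection.\<close>
  define Z where "Z = (fst X, d)"
  have Z: "Z \<in> Ob" using MorD(1)[OF X X dX] dd by (simp add: Obj_iff Z_def)
  have dZ: "d \<in> Mor X Z" "d \<in> Mor Z X"
    using MorD[OF X X dX] dd by (simp_all add: Hom_iff X Z) (simp_all add: Z_def)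
  have "direct_sum NC t X Y Z"
    unfolding direct_sum_def comp_mor_def ident_def
  proof (intro conjI X Y Z, rule bexI[OF _ f], rule bexI[OF _ dZ(2)], rule bexI[OF _ g], rule bexI[OF _ dZ(1)],
      intro conjI gf gd df)
    show "mat_comp t (fst X) d d = snd Z" using dd by (simp add: Z_def)
    show "mat_add ?e (mat_comp t (fst Z) d d) = snd X" using dd by (simp add: Z_def d_def)
  qed
  then have "zero_object NC t Y \<or> zero_object NC t Z" using ind unfolding indecomposable_def by blast
  then have "d = mat_zero" using nz zero_object_iff[OF Y] zero_object_iff[OF Z] by (simp add: Z_def)
  then have "?e = snd X" unfolding d_def mat_diff_eq_zero by simp
  then show ?thesis using gf by (intro iso_relI[OF X Y g f])
qed

end

subsection \<open>The indecomposable objects\<close>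

text \<open>Matrix version of \<open>through\<close>, between formal direct sums and without
  idempotents at the two ends.\<close>

inductive_set mid :: "complex \<Rightarrow> nat list \<Rightarrow> nat list \<Rightarrow> mat set" for s ks ls where
  base: "A \<in> mat_Hom NC [j] ls \<Longrightarrow> B \<in> mat_Hom NC ks [j] \<Longrightarrow>
    mat_comp (s\<^sup>2) [j] A (mat_comp (s\<^sup>2) [j] (elem 0 0 (fat_jw s j)) B) \<in> mid s ks ls"
| zero: "mat_zero \<in> mid s ks ls"
| add: "M \<in> mid s ks ls \<Longrightarrow> N \<in> mid s ks ls \<Longrightarrow> mat_add M N \<in> mid s ks ls"

context
  fixes s :: complex
  assumes nz: "\<And>n. cheb s n \<noteq> 0"
begin

abbreviation "ObS \<equiv> Obj NC (s\<^sup>2)"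
abbreviation "MorS \<equiv> Hom NC (s\<^sup>2)"
abbreviation "cp \<equiv> mat_comp (s\<^sup>2)"
abbreviation "simp_mat k \<equiv> elem 0 0 (fat_jw s k)"
abbreviation "simp_obj k \<equiv> image_obj k (fat_jw s k)"

lemma simp_mat_Hom: "simp_mat k \<in> mat_Hom NC [k] [k]"
  by (rule elem_Hom) (simp_all add: fat_jw_NC[OF nz])

lemma simp_obj_simps [simp]: "fst (simp_obj k) = [k]" "snd (simp_obj k) = simp_mat k"
  by (simp_all add: image_obj_elem)

lemma simp_obj: "simp_obj k \<in> ObS"
  by (simp add: Obj_iff simp_mat_Hom elem_comp fat_jw_idem[OF nz])

lemma simp_mat_nz: "simp_mat k \<noteq> mat_zero"
proof
  assume "simp_mat k = mat_zero"
  then have "simp_mat k 0 0 = mat_zero 0 0" by simp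
  then show False using fat_jw_nz[OF nz] by (simp add: elem_def mat_zero_def)
qed

lemma simp_Hom:
  assumes M: "M \<in> MorS (simp_obj j) (simp_obj k)"
  shows "j \<noteq> k \<Longrightarrow> M = mat_zero" "j = k \<Longrightarrow> \<exists>c. M = mat_smult c (simp_mat k)"
proof -
  note m = MorD[OF simp_obj simp_obj M, simplified]
  obtain x where x: "x \<in> Hom0 NC j k" "M = elem 0 0 x" by (rule mat_Hom_single[OF m(1)])
  have "M = cp [k] (simp_mat k) (cp [j] M (simp_mat j))" unfolding m(2,3) ..
  then have M': "M = elem 0 0 (comp0 (s\<^sup>2) (fat_jw s k) (comp0 (s\<^sup>2) x (fat_jw s j)))" unfolding x(2) elem_comp .
  show "M = mat_zero" if "j \<noteq> k" using M' fat_jw_sandwich(1)[OF nz x(1) that] by (simp add: elem_simps)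
  show "\<exists>c. M = mat_smult c (simp_mat k)" if "j = k"
    using M' fat_jw_sandwich(2)[OF nz x(1) that] by (auto simp: elem_simps)
qed

lemma elem_mid:
  assumes "x \<in> through s k l" and ij: "i < length ks" "j < length ls" "ks ! i = k" "ls ! j = l"
  shows "elem j i x \<in> mid s ks ls"
  using assms(1)
proof (induction rule: through.induct)
  case (base a m b)
  have A: "elem j 0 a \<in> mat_Hom NC [m] ls" using base ij by (intro elem_Hom) simp_all
  have B: "elem 0 i b \<in> mat_Hom NC ks [m]" using base ij by (intro elem_Hom) simp_all
  show ?case using mid.base[OF A B, of s] by (simp add: elem_comp)
qed (simp_all add: elem_simps mid.zero mid.add)

lemma mat_Hom_mid:
  assumes M: "M \<in> mat_Hom NC ks ls"
  shows "M \<in> mid s ks ls"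
proof -
  define R where "R S = (\<lambda>j i. if (j, i) \<in> S then M j i else 0)" for S
  have "R S \<in> mid s ks ls" if "finite S" "S \<subseteq> {..<length ls} \<times> {..<length ks}" for S
    using that
  proof (induction S rule: finite_induct)
    case empty
    have "R {} = mat_zero" by (simp add: R_def mat_zero_def)
    then show ?case by (simp add: mid.zero)
  next
    case (insert p S)
    obtain j i where p: "p = (j, i)" by (cases p)
    have ji: "j < length ls" "i < length ks" using insert.prems p by auto
    have "R (insert p S) = mat_add (elem j i (M j i)) (R S)"
      by (rule mat_eqI) (use insert.hyps(2) p in \<open>auto simp: R_def mat_add_def elem_def\<close>)
    moreover have "elem j i (M j i) \<in> mid s ks ls"
      by (rule elem_mid[OF Hom0_through[OF nz mat_Hom_entry[OF M ji]] ji(2,1) refl refl])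
    ultimately show ?case using insert by (simp add: mid.add)
  qed
  from this[of "{..<length ls} \<times> {..<length ks}"]
  have "R ({..<length ls} \<times> {..<length ks}) \<in> mid s ks ls" by simp
  moreover have "R ({..<length ls} \<times> {..<length ks}) = M"
    by (rule mat_eqI) (use mat_Hom_outside[OF M] in \<open>auto simp: R_def\<close>)
  ultimately show ?thesis by simp
qed

text \<open>If all pairings vanished, writing the identity of \<open>X\<close> as a sum through the
  \<open>E_j\<close> would kill first every morphism from \<open>X\<close> to a
  \<open>simp_obj k\<close> and then the identity itself.\<close>

lemma nonzero_pairing:
  assumes X: "X \<in> ObS" and n: "snd X \<noteq> mat_zero"
  obtains k f g where "f \<in> MorS (simp_obj k) X" "g \<in> MorS X (simp_obj k)" "cp (fst X) g f \<noteq> mat_zero"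
proof (rule ccontr)
  assume c: "\<not> thesis"
  note pairing = that
  have z: "cp (fst X) g f = mat_zero" if "f \<in> MorS (simp_obj k) X" "g \<in> MorS X (simp_obj k)" for k f g
    using pairing[OF that] c by blast
  let ?E = "snd X" and ?ks = "fst X"
  note E = ObD[OF X]
  note as = mat_comp_assoc
  have fin: "cp ?ks ?E (cp [j] A (simp_mat j)) \<in> MorS (simp_obj j) X" if A: "A \<in> mat_Hom NC [j] ?ks" for A j
    unfolding Hom_def using A by simp
  have fout: "cp [j] (simp_mat j) (cp ?ks B ?E) \<in> MorS X (simp_obj j)" if B: "B \<in> mat_Hom NC ?ks [j]" for B j
    unfolding Hom_def using B by simp
  have EM: "?E \<in> mid s ?ks ?ks" by (rule mat_Hom_mid[OF E(1)])
  \<comment> \<open>\<open>g = g E E\<close>, and each summand of one factor \<open>E\<close> runs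
    through some \<open>E_j\<close>. For \<open>j = k\<close> the pairing is zero by assumption, for
    \<open>j \<noteq> k\<close> there is no non-zero morphism.\<close>
  have g0: "g = mat_zero" if g: "g \<in> MorS X (simp_obj k)" for g k
  proof -
    note G = MorD[OF X simp_obj g, simplified]
    have "cp ?ks g (cp ?ks M ?E) = mat_zero" if "M \<in> mid s ?ks ?ks" for M
      using that
    proof (induction rule: mid.induct)
      case (base A j B)
      note A = base(1) and B = base(2) and S = simp_mat_Hom[of j]
      have gA: "cp ?ks g A \<in> mat_Hom NC [j] [k]" by (rule mat_comp_Hom[OF G(1) A])
      have f: "cp ?ks ?E (cp [j] A (simp_mat j)) \<in> MorS (simp_obj j) X" by (rule fin[OF A])
      have "cp ?ks g (cp ?ks ?E (cp [j] A (simp_mat j))) = mat_zero"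
      proof (cases "j = k")
        case True
        show ?thesis by (rule z[of _ k]) (use f g True in simp_all)
      next
        case False
        show ?thesis
          using simp_Hom(1)[OF comp_Mor[OF simp_obj X simp_obj f g] False] by simp
      qed
      then have gAS: "cp ?ks g (cp [j] A (simp_mat j)) = mat_zero"
        unfolding as[OF G(1) E(1) mat_comp_Hom[OF A S], symmetric] G(3) .
      have "cp ?ks g (cp ?ks (cp [j] A (cp [j] (simp_mat j) B)) ?E) =
          cp ?ks (cp ?ks g (cp [j] (cp [j] A (simp_mat j)) B)) ?E"
        unfolding as[OF A S B] as[OF G(1) mat_comp_Hom[OF A mat_comp_Hom[OF S B]] E(1)] ..
      also have "\<dots> = mat_zero"
        unfolding as[OF G(1) mat_comp_Hom[OF A S] B, symmetric] gAS by simp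
      finally show ?case .
    qed (simp_all add: mat_comp_add)
    from this[OF EM] show "g = mat_zero" unfolding E(2) G(3) .
  qed
  have "cp ?ks M ?E = mat_zero" if "M \<in> mid s ?ks ?ks" for M
    using that
  proof (induction rule: mid.induct)
    case (base A j B)
    note A = base(1) and B = base(2) and S = simp_mat_Hom[of j]
    have "cp ?ks (cp [j] A (cp [j] (simp_mat j) B)) ?E = cp [j] A (cp [j] (simp_mat j) (cp ?ks B ?E))"
      unfolding as[OF A mat_comp_Hom[OF S B] E(1)] as[OF S B E(1)] ..
    then show ?case unfolding g0[OF fout[OF B]] by simp
  qed (simp_all add: mat_comp_add)
  from this[OF EM] show False using n unfolding E(2) by simp
qed

text \<open>The pairing is a non-zero multiple of the identity of \<open>simp_obj k\<close>;
  rescaling \<open>g\<close> makes it a retraction of \<open>f\<close>, and \<open>split_iso\<close>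
  applies.\<close>

lemma indecomposable_iso:
  assumes X: "X \<in> ObS" and ind: "indecomposable NC (s\<^sup>2) X" and n: "\<not> zero_object NC (s\<^sup>2) X"
  obtains k where "(X, simp_obj k) \<in> iso_rel NC (s\<^sup>2)"
proof -
  have "snd X \<noteq> mat_zero" using n zero_object_iff[OF X] by simp
  then obtain k f g where f: "f \<in> MorS (simp_obj k) X" and g: "g \<in> MorS X (simp_obj k)" and gf: "cp (fst X) g f \<noteq> mat_zero"
    using nonzero_pairing[OF X] by blast
  obtain c where c: "cp (fst X) g f = mat_smult c (simp_mat k)"
    using simp_Hom(2)[OF comp_Mor[OF simp_obj X simp_obj f g] refl] by blast
  have c0: "c \<noteq> 0" using gf c by auto
  have "(X, simp_obj k) \<in> iso_rel NC (s\<^sup>2)"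
  proof (rule split_iso[OF X simp_obj ind _ f Mor_closed(3)[OF X simp_obj g]])
    show "cp (fst X) (mat_smult (inverse c) g) f = snd (simp_obj k)"
      using c0 by (simp add: mat_comp_smult c)
  qed (simp add: simp_mat_nz)
  then show ?thesis by (rule that)
qed

lemma bij_simp_obj: "bij_betw (\<lambda>k. iso_class NC (s\<^sup>2) (simp_obj k)) UNIV (indec_classes NC (s\<^sup>2))"
  unfolding bij_betw_def
proof (intro conjI)
  show "inj (\<lambda>k. iso_class NC (s\<^sup>2) (simp_obj k))"
  proof (rule injI, rule ccontr)
    fix j k assume "iso_class NC (s\<^sup>2) (simp_obj j) = iso_class NC (s\<^sup>2) (simp_obj k)" and ne: "j \<noteq> k"
    then have "(simp_obj j, simp_obj k) \<in> iso_rel NC (s\<^sup>2)"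
      using iso_refl[OF simp_obj[of k]] unfolding iso_class_def by blast
    then obtain f g where f: "f \<in> MorS (simp_obj j) (simp_obj k)" and gf: "cp (fst (simp_obj k)) g f = snd (simp_obj j)"
      by (rule iso_relE)
    have "simp_mat j = mat_zero" using gf unfolding simp_Hom(1)[OF f ne] by simp
    then show False using simp_mat_nz by simp
  qed
  show "range (\<lambda>k. iso_class NC (s\<^sup>2) (simp_obj k)) = indec_classes NC (s\<^sup>2)"
  proof (intro equalityI subsetI)
    fix c assume "c \<in> range (\<lambda>k. iso_class NC (s\<^sup>2) (simp_obj k))"
    then obtain k where c: "c = iso_class NC (s\<^sup>2) (simp_obj k)" by blast
    have "indecomposable NC (s\<^sup>2) (simp_obj k)"
      by (rule simple_indecomposable[OF simp_obj]) (use simp_mat_nz simp_Hom(2)[OF _ refl] in simp_all)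
    moreover have "\<not> zero_object NC (s\<^sup>2) (simp_obj k)"
      unfolding zero_object_iff[OF simp_obj] by (simp add: simp_mat_nz)
    ultimately show "c \<in> indec_classes NC (s\<^sup>2)" unfolding indec_classes_def c using simp_obj by blast
  next
    fix c assume "c \<in> indec_classes NC (s\<^sup>2)"
    then obtain X where X: "X \<in> ObS" "\<not> zero_object NC (s\<^sup>2) X" "indecomposable NC (s\<^sup>2) X" and c: "c = iso_class NC (s\<^sup>2) X"
      unfolding indec_classes_def by blast
    obtain k where "(X, simp_obj k) \<in> iso_rel NC (s\<^sup>2)" by (rule indecomposable_iso[OF X(1,3,2)])
    from iso_class_eq[OF this] show "c \<in> range (\<lambda>k. iso_class NC (s\<^sup>2) (simp_obj k))" unfolding c by blast
  qed
qed

end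

theorem proposition5p23:
  fixes s t :: complex
  assumes "t \<notin> {complex_of_real (4 * (cos (real j * pi / real l))\<^sup>2) | j l :: nat.
                   2 \<le> l \<and> j \<in> {1..l - 1}}"
    and "s\<^sup>2 = t"
  shows "bij_betw
           (\<lambda>k. iso_class NC t (image_obj k (fattening_map s k (jones_wenzl s (2 * k)))))
           (UNIV :: nat set) (indec_classes NC t)"
proof -
  have "cheb s n \<noteq> 0" for n
  proof
    assume "cheb s n = 0"
    then obtain j l :: nat where "2 \<le> l" "j \<in> {1..l - 1}" "s\<^sup>2 = complex_of_real (4 * (cos (real j * pi / real l))\<^sup>2)"
      by (rule cheb_zero)
    then show False using assms by blast
  qed
  from bij_simp_obj[OF this] show ?thesis unfolding fat_jw_def assms(2) .
qed

end
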